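(* Let $(R,\mathfrak m,k)$ be a noetherian local ring (or a standard graded $k$-algebra). Let $M\neq 0$ be a finitely generated $R$-module with linear quotients with respect to a minimal system of generators $m_1,\ldots,m_t$; that is, setting $I_i=(m_1,\ldots,m_{i-1}):_R m_i$, each cyclic module $R/I_i$ ($i=1,\dots,t$) is a Koszul module. Then for each $1\le i\le t$ the submodule $(m_1,\ldots,m_i)$ of $M$ is a Koszul module. In particular, $M$ is a Koszul module. Moreover, $$\beta_s(M)=\sum_{i=1}^t\beta_s(R/I_i)\quad\text{for all } s\ge 0,\qquad \operatorname{pd}_R M=\max_{1\le i\le t}\{\operatorname{pd}_R(R/I_i)\}.$$ If $R$ is a (standard) graded algebra, $M$ is a graded module and $m_i$ is homogeneous with $\deg m_i=d_i$ for $1\le i\le t$, then also $$\beta_{s,j}(M)=\sum_{i=1}^t\beta_{s,j-d_i}(R/I_i)\quad\text{for all } s,j\ge 0,\qquad \operatorname{reg}_R M=\max_{1\le i\le t}\{\operatorname{reg}_R(R/I_i)+d_i\}.$$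
   Context: $(R,\mathfrak m,k)$ denotes a commutative noetherian local ring with maximal ideal $\mathfrak m$ and residue field $k=R/\mathfrak m$; statements are also meant to cover, with the obvious changes, the graded situation where $R$ is a standard graded $k$-algebra with graded maximal ideal $\mathfrak m$ and modules are graded. Linearity defect: for a finitely generated $R$-module $M$ with minimal free resolution $F$, filter $F$ by the subcomplexes $\mathcal G^nF$ with $(\mathcal G^nF)_i=\mathfrak m^{n-i}F_i$ (where $\mathfrak m^j=R$ for $j\le 0$), with differential induced by that of $F$. The associated graded complex of this filtration is the linear part $\operatorname{lin}^R F$. The linearity defect is $\operatorname{ld}_R M=\sup\{i: H_i(\operatorname{lin}^R F)\ne 0\}\in\{0,1,\dots\}\cup\{\infty\}$ for $M\neq 0$, and $\operatorname{ld}_R 0=0$. $M$ is a Koszul module if $\operatorname{ld}_R M=0$. Here $(m_1,\dots,m_{i-1}):_R m_i=\{r\in R: rm_i\in (m_1,\dots,m_{i-1})\}$ (so $I_1=0:_R m_1$). $\operatorname{pd}$ is projective dimension; $\beta_s(M)=\dim_k\operatorname{Tor}^R_s(k,M)$ and, in the graded case, $\beta_{s,j}(M)=\dim_k\operatorname{Tor}^R_s(k,M)_j$. In the graded case the Castelnuovo–Mumford regularity is $\operatorname{reg}_R M=\sup\{j-i:\operatorname{Tor}^R_i(k,M)_j\ne 0\}$. *)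

theory Defs
  imports
    "HOL-Algebra.QuotRing"
    "HOL-Algebra.Ideal_Product"
    "HOL-Algebra.Ring_Divisibility"
    "HOL-Algebra.Generated_Rings"
    "HOL-Algebra.Subrings"
    "HOL-Library.Extended_Nat"
    "HOL-Library.Extended_Real"
    "Jordan_Normal_Form.Missing_VectorSpace"
begin

section \<open>Rings\<close>

locale noetherian_local_ring = cring R + noetherian_ring R for R (structure) +
  fixes \<mm> :: "'a set"
  assumes maximal: "maximalideal \<mm> R"
    and unique_maximal: "maximalideal J R \<Longrightarrow> J = \<mm>"

text \<open>The additive group of \<open>G\<close> is the internal direct sum of the subgroups \<open>A j\<close>.\<close>

definition grading :: "('x, 'e) ring_scheme \<Rightarrow> (int \<Rightarrow> 'x set) \<Rightarrow> bool" where
  "grading G A \<longleftrightarrow>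
     (\<forall>j. subgroup (A j) (add_monoid G)) \<and>
     (\<forall>x\<in>carrier G. \<exists>!f. (\<forall>j. f j \<in> A j) \<and> finite {j. f j \<noteq> \<zero>\<^bsub>G\<^esub>} \<and>
        x = (\<Oplus>\<^bsub>G\<^esub>j\<in>{j. f j \<noteq> \<zero>\<^bsub>G\<^esub>}. f j))"

text \<open>Gradings of rings are indexed by \<open>int\<close> as well, with zero components in negative
  degrees; the ground field \<open>k\<close> is the component of degree \<open>0\<close>.\<close>

locale standard_graded_algebra = cring R for R (structure) +
  fixes Rg :: "int \<Rightarrow> 'a set"
  assumes grading: "grading R Rg"
    and mult_degree: "\<lbrakk>x \<in> Rg i; y \<in> Rg j\<rbrakk> \<Longrightarrow> x \<otimes> y \<in> Rg (i + j)"
    and negative_degree: "j < 0 \<Longrightarrow> Rg j = {\<zero>}"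
    and degree_zero: "subfield (Rg 0) R"
    and standard: "\<exists>S. finite S \<and> S \<subseteq> Rg 1 \<and> generate_ring R (Rg 0 \<union> S) = carrier R"

definition irrelevant_ideal :: "('a, 'm) ring_scheme \<Rightarrow> (int \<Rightarrow> 'a set) \<Rightarrow> 'a set" where
  "irrelevant_ideal R Rg = genideal R (\<Union>j\<in>{1..}. Rg j)"

primrec ideal_power :: "('a, 'm) ring_scheme \<Rightarrow> 'a set \<Rightarrow> nat \<Rightarrow> 'a set" where
  "ideal_power R I 0 = carrier R"
| "ideal_power R I (Suc n) = ideal_prod R I (ideal_power R I n)"


section \<open>Modules\<close>

definition graded_module ::
  "('a, 'm) ring_scheme \<Rightarrow> (int \<Rightarrow> 'a set) \<Rightarrow> ('a, 'b, 'n) module_scheme \<Rightarrow> (int \<Rightarrow> 'b set) \<Rightarrow> bool"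
  where
  "graded_module R Rg M Mg \<longleftrightarrow> module R M \<and> grading M Mg \<and>
     (\<forall>i j. \<forall>r\<in>Rg i. \<forall>x\<in>Mg j. r \<odot>\<^bsub>M\<^esub> x \<in> Mg (i + j))"

definition nontrivial :: "('a, 'b, 'n) module_scheme \<Rightarrow> bool" where
  "nontrivial M \<longleftrightarrow> carrier M \<noteq> {\<zero>\<^bsub>M\<^esub>}"

text \<open>In the records below the ring multiplication and unit of a module are irrelevant.\<close>

definition self_module :: "('a, 'm) ring_scheme \<Rightarrow> ('a, 'a) module" where
  "self_module R = \<lparr>carrier = carrier R, monoid.mult = (\<otimes>\<^bsub>R\<^esub>), one = \<one>\<^bsub>R\<^esub>, zero = \<zero>\<^bsub>R\<^esub>,
     add = (\<oplus>\<^bsub>R\<^esub>), smult = (\<otimes>\<^bsub>R\<^esub>)\<rparr>"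

text \<open>\<open>R\<^sup>n\<close>, as the functions on \<open>nat\<close> that vanish outside \<open>{..<n}\<close>.\<close>

definition free_module :: "('a, 'm) ring_scheme \<Rightarrow> nat \<Rightarrow> ('a, nat \<Rightarrow> 'a) module" where
  "free_module R n =
     \<lparr>carrier = {f. (\<forall>c<n. f c \<in> carrier R) \<and> (\<forall>c\<ge>n. f c = \<zero>\<^bsub>R\<^esub>)},
      monoid.mult = \<lambda>f g c. \<zero>\<^bsub>R\<^esub>, one = \<lambda>c. \<zero>\<^bsub>R\<^esub>, zero = \<lambda>c. \<zero>\<^bsub>R\<^esub>,
      add = \<lambda>f g c. f c \<oplus>\<^bsub>R\<^esub> g c, smult = \<lambda>r f c. r \<otimes>\<^bsub>R\<^esub> f c\<rparr>"

definition quotient_module :: "('a, 'b, 'n) module_scheme \<Rightarrow> 'b set \<Rightarrow> ('a, 'b set) module" where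
  "quotient_module M N =
     \<lparr>carrier = a_rcosets\<^bsub>M\<^esub> N, monoid.mult = \<lambda>X Y. N, one = N, zero = N, add = set_add M,
      smult = \<lambda>r X. N <+>\<^bsub>M\<^esub> ((\<lambda>x. r \<odot>\<^bsub>M\<^esub> x) ` X)\<rparr>"

abbreviation cyclic_module :: "('a, 'm) ring_scheme \<Rightarrow> 'a set \<Rightarrow> ('a, 'a set) module" where
  "cyclic_module R I \<equiv> quotient_module (self_module R) I"

text \<open>The grading of \<open>R/I\<close> by the images of the components of \<open>R\<close>.\<close>

definition cyclic_grading ::
  "('a, 'm) ring_scheme \<Rightarrow> (int \<Rightarrow> 'a set) \<Rightarrow> 'a set \<Rightarrow> int \<Rightarrow> 'a set set" where
  "cyclic_grading R Rg I j = (\<lambda>r. I +>\<^bsub>R\<^esub> r) ` Rg j"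

definition ideal_smult ::
  "('a, 'm) ring_scheme \<Rightarrow> 'a set \<Rightarrow> ('a, 'b, 'n) module_scheme \<Rightarrow> 'b set" where
  "ideal_smult R I M = module.span R M {r \<odot>\<^bsub>M\<^esub> x | r x. r \<in> I \<and> x \<in> carrier M}"

definition colon_ideal ::
  "('a, 'm) ring_scheme \<Rightarrow> ('a, 'b, 'n) module_scheme \<Rightarrow> 'b set \<Rightarrow> 'b \<Rightarrow> 'a set" where
  "colon_ideal R M N x = {r \<in> carrier R. r \<odot>\<^bsub>M\<^esub> x \<in> N}"

text \<open>A finitely generated module is projective iff it is a direct summand of some \<open>R\<^sup>n\<close>.\<close>

definition fg_projective :: "('a, 'm) ring_scheme \<Rightarrow> ('a, 'b, 'n) module_scheme \<Rightarrow> bool" where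
  "fg_projective R P \<longleftrightarrow> module R P \<and>
     (\<exists>n. \<exists>p\<in>module_hom R (free_module R n) P. \<exists>q\<in>module_hom R P (free_module R n).
        \<forall>x\<in>carrier P. p (q x) = x)"

text \<open>The \<open>R/\<mm>\<close>-vector space structure on an \<open>R\<close>-module annihilated by \<open>\<mm>\<close>.\<close>

definition residue_space :: "('a, 'b, 'n) module_scheme \<Rightarrow> ('a set, 'b) module" where
  "residue_space V =
     \<lparr>carrier = carrier V, monoid.mult = (\<otimes>\<^bsub>V\<^esub>), one = \<one>\<^bsub>V\<^esub>, zero = \<zero>\<^bsub>V\<^esub>, add = (\<oplus>\<^bsub>V\<^esub>),
      smult = \<lambda>X v. the_elem ((\<lambda>r. r \<odot>\<^bsub>V\<^esub> v) ` X)\<rparr>"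

definition residue_dim ::
  "('a, 'm) ring_scheme \<Rightarrow> 'a set \<Rightarrow> ('a, 'b, 'n) module_scheme \<Rightarrow> nat" where
  "residue_dim R \<mm> V = vectorspace.dim (R Quot \<mm>) (residue_space V)"


section \<open>Complexes and resolutions\<close>

text \<open>\<open>diff C i\<close> is the differential from \<open>obj C (Suc i)\<close> to \<open>obj C i\<close>.\<close>

record ('a, 'c) chain =
  obj :: "nat \<Rightarrow> ('a, 'c) module"
  diff :: "nat \<Rightarrow> 'c \<Rightarrow> 'c"

fun cycles :: "('a, 'c) chain \<Rightarrow> nat \<Rightarrow> 'c set" where
  "cycles C 0 = carrier (obj C 0)"
| "cycles C (Suc i) = {x \<in> carrier (obj C (Suc i)). diff C i x = \<zero>\<^bsub>obj C i\<^esub>}"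

definition boundaries :: "('a, 'c) chain \<Rightarrow> nat \<Rightarrow> 'c set" where
  "boundaries C i = diff C i ` carrier (obj C (Suc i))"

definition homology :: "('a, 'c) chain \<Rightarrow> nat \<Rightarrow> ('a, 'c set) module" where
  "homology C i = quotient_module ((obj C i)\<lparr>carrier := cycles C i\<rparr>) (boundaries C i)"

text \<open>The complex \<open>A/B\<close> for subcomplexes \<open>B \<subseteq> A\<close> of \<open>C\<close>, with the induced differential.\<close>

definition subquotient ::
  "('a, 'c) chain \<Rightarrow> (nat \<Rightarrow> 'c set) \<Rightarrow> (nat \<Rightarrow> 'c set) \<Rightarrow> ('a, 'c set) chain" where
  "subquotient C A B =
     \<lparr>obj = \<lambda>i. quotient_module ((obj C i)\<lparr>carrier := A i\<rparr>) (B i),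
      diff = \<lambda>i X. B i <+>\<^bsub>obj C i\<^esub> (diff C i ` X)\<rparr>"

definition resolution ::
  "('a, 'm) ring_scheme \<Rightarrow> ('a, 'c) chain \<Rightarrow> ('c \<Rightarrow> 'b) \<Rightarrow> ('a, 'b, 'n) module_scheme \<Rightarrow> bool"
  where
  "resolution R C \<epsilon> M \<longleftrightarrow>
     (\<forall>i. module R (obj C i)) \<and>
     (\<forall>i. diff C i \<in> module_hom R (obj C (Suc i)) (obj C i)) \<and>
     \<epsilon> \<in> module_hom R (obj C 0) M \<and>
     \<epsilon> ` carrier (obj C 0) = carrier M \<and>
     {x \<in> carrier (obj C 0). \<epsilon> x = \<zero>\<^bsub>M\<^esub>} = boundaries C 0 \<and>
     (\<forall>i. cycles C (Suc i) = boundaries C (Suc i))"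

definition free_resolution ::
  "('a, 'm) ring_scheme \<Rightarrow> ('a, nat \<Rightarrow> 'a) chain \<Rightarrow> ((nat \<Rightarrow> 'a) \<Rightarrow> 'b)
     \<Rightarrow> ('a, 'b, 'n) module_scheme \<Rightarrow> bool" where
  "free_resolution R F \<epsilon> M \<longleftrightarrow>
     resolution R F \<epsilon> M \<and> (\<forall>i. \<exists>n. obj F i = free_module R n)"

definition minimal_complex ::
  "('a, 'm) ring_scheme \<Rightarrow> 'a set \<Rightarrow> ('a, 'c) chain \<Rightarrow> bool" where
  "minimal_complex R \<mm> F \<longleftrightarrow> (\<forall>i. boundaries F i \<subseteq> ideal_smult R \<mm> (obj F i))"

text \<open>In a graded free resolution, the basis element \<open>c\<close> of \<open>obj F i\<close> has degree \<open>a i c\<close>, that is,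
  \<open>obj F i\<close> is the direct sum of the \<open>R(- a i c)\<close>; this is its component of degree \<open>j\<close>.\<close>

definition free_component ::
  "(int \<Rightarrow> 'a set) \<Rightarrow> ('a, nat \<Rightarrow> 'a) chain \<Rightarrow> (nat \<Rightarrow> nat \<Rightarrow> int) \<Rightarrow> nat \<Rightarrow> int \<Rightarrow> (nat \<Rightarrow> 'a) set"
  where
  "free_component Rg F a i j = {f \<in> carrier (obj F i). \<forall>c. f c \<in> Rg (j - a i c)}"

definition graded_free_resolution ::
  "('a, 'm) ring_scheme \<Rightarrow> (int \<Rightarrow> 'a set) \<Rightarrow> ('a, nat \<Rightarrow> 'a) chain \<Rightarrow> (nat \<Rightarrow> nat \<Rightarrow> int)
     \<Rightarrow> ((nat \<Rightarrow> 'a) \<Rightarrow> 'b) \<Rightarrow> ('a, 'b, 'n) module_scheme \<Rightarrow> (int \<Rightarrow> 'b set) \<Rightarrow> bool" where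
  "graded_free_resolution R Rg F a \<epsilon> M Mg \<longleftrightarrow>
     free_resolution R F \<epsilon> M \<and>
     (\<forall>i j. diff F i ` free_component Rg F a (Suc i) j \<subseteq> free_component Rg F a i j) \<and>
     (\<forall>j. \<epsilon> ` free_component Rg F a 0 j \<subseteq> Mg j)"

text \<open>For finitely generated modules over noetherian rings, projective dimension may be computed
  with finitely generated projectives, and these all have copies on the type \<open>nat \<Rightarrow> 'a\<close>.\<close>

definition projective_dimension ::
  "('a, 'm) ring_scheme \<Rightarrow> ('a, 'b, 'n) module_scheme \<Rightarrow> enat" where
  "projective_dimension R M =
     Inf {enat n | n. \<exists>(P :: ('a, nat \<Rightarrow> 'a) chain) \<epsilon>. resolution R P \<epsilon> M \<and>
        (\<forall>i. fg_projective R (obj P i)) \<and> (\<forall>i>n. \<not> nontrivial (obj P i))}"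


section \<open>Linearity defect\<close>

text \<open>\<open>(\<G>\<^sup>n F)\<^sub>i = \<mm>\<^bsup>n-i\<^esup> F\<^sub>i\<close>; truncated subtraction implements \<open>\<mm>\<^sup>j = R\<close> for \<open>j \<le> 0\<close>, and
  \<open>\<G>\<^sup>n F = F\<close> for all \<open>n \<le> 0\<close>.\<close>

definition madic_filtration ::
  "('a, 'm) ring_scheme \<Rightarrow> 'a set \<Rightarrow> ('a, 'c) chain \<Rightarrow> nat \<Rightarrow> nat \<Rightarrow> 'c set" where
  "madic_filtration R \<mm> F n i = ideal_smult R (ideal_power R \<mm> (n - i)) (obj F i)"

text \<open>The linear part is the direct sum over \<open>n\<close> of these complexes.\<close>

definition linear_part ::
  "('a, 'm) ring_scheme \<Rightarrow> 'a set \<Rightarrow> ('a, 'c) chain \<Rightarrow> nat \<Rightarrow> ('a, 'c set) chain" where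
  "linear_part R \<mm> F n =
     subquotient F (madic_filtration R \<mm> F n) (madic_filtration R \<mm> F (Suc n))"

definition linear_part_sup :: "('a, 'm) ring_scheme \<Rightarrow> 'a set \<Rightarrow> ('a, 'c) chain \<Rightarrow> enat" where
  "linear_part_sup R \<mm> F = Sup {enat i | i. \<exists>n. nontrivial (homology (linear_part R \<mm> F n) i)}"

definition linearity_defect ::
  "('a, 'm) ring_scheme \<Rightarrow> 'a set \<Rightarrow> ('a, 'b, 'n) module_scheme \<Rightarrow> enat" where
  "linearity_defect R \<mm> M = (if nontrivial M
     then linear_part_sup R \<mm> (SOME F. \<exists>\<epsilon>. free_resolution R F \<epsilon> M \<and> minimal_complex R \<mm> F)
     else 0)"

definition graded_linearity_defect ::
  "('a, 'm) ring_scheme \<Rightarrow> (int \<Rightarrow> 'a set) \<Rightarrow> ('a, 'b, 'n) module_scheme \<Rightarrow> (int \<Rightarrow> 'b set) \<Rightarrow> enat"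
  where
  "graded_linearity_defect R Rg M Mg = (if nontrivial M
     then linear_part_sup R (irrelevant_ideal R Rg)
       (SOME F. \<exists>a \<epsilon>. graded_free_resolution R Rg F a \<epsilon> M Mg \<and>
          minimal_complex R (irrelevant_ideal R Rg) F)
     else 0)"

definition koszul_module ::
  "('a, 'm) ring_scheme \<Rightarrow> 'a set \<Rightarrow> ('a, 'b, 'n) module_scheme \<Rightarrow> bool" where
  "koszul_module R \<mm> M \<longleftrightarrow> linearity_defect R \<mm> M = 0"

definition graded_koszul_module ::
  "('a, 'm) ring_scheme \<Rightarrow> (int \<Rightarrow> 'a set) \<Rightarrow> ('a, 'b, 'n) module_scheme \<Rightarrow> (int \<Rightarrow> 'b set) \<Rightarrow> bool"
  where
  "graded_koszul_module R Rg M Mg \<longleftrightarrow> graded_linearity_defect R Rg M Mg = 0"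


section \<open>Tor, Betti numbers and regularity\<close>

text \<open>\<open>R/\<mm> \<otimes> F\<close> is the complex \<open>F/\<mm>F\<close>.\<close>

definition residue_tensor ::
  "('a, 'm) ring_scheme \<Rightarrow> 'a set \<Rightarrow> ('a, 'c) chain \<Rightarrow> ('a, 'c set) chain" where
  "residue_tensor R \<mm> F =
     subquotient F (\<lambda>i. carrier (obj F i)) (\<lambda>i. ideal_smult R \<mm> (obj F i))"

definition residue_tor ::
  "('a, 'm) ring_scheme \<Rightarrow> 'a set \<Rightarrow> ('a, 'b, 'n) module_scheme \<Rightarrow> nat
     \<Rightarrow> ('a, (nat \<Rightarrow> 'a) set set) module" where
  "residue_tor R \<mm> M s =
     homology (residue_tensor R \<mm> (SOME F. \<exists>\<epsilon>. free_resolution R F \<epsilon> M)) s"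

definition betti ::
  "('a, 'm) ring_scheme \<Rightarrow> 'a set \<Rightarrow> ('a, 'b, 'n) module_scheme \<Rightarrow> nat \<Rightarrow> nat" where
  "betti R \<mm> M s = residue_dim R \<mm> (residue_tor R \<mm> M s)"

text \<open>The degree \<open>j\<close> strand of \<open>F/\<mm>F\<close>, consisting of the images of the degree \<open>j\<close> elements
  of \<open>F\<close>.\<close>

definition residue_tensor_strand ::
  "('a, 'm) ring_scheme \<Rightarrow> (int \<Rightarrow> 'a set) \<Rightarrow> ('a, nat \<Rightarrow> 'a) chain \<Rightarrow> (nat \<Rightarrow> nat \<Rightarrow> int) \<Rightarrow> int
     \<Rightarrow> ('a, (nat \<Rightarrow> 'a) set) chain" where
  "residue_tensor_strand R Rg F a j =
     (let mF = (\<lambda>i. ideal_smult R (irrelevant_ideal R Rg) (obj F i))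
      in subquotient F (\<lambda>i. free_component Rg F a i j <+>\<^bsub>obj F i\<^esub> mF i) mF)"

definition graded_residue_tor ::
  "('a, 'm) ring_scheme \<Rightarrow> (int \<Rightarrow> 'a set) \<Rightarrow> ('a, 'b, 'n) module_scheme \<Rightarrow> (int \<Rightarrow> 'b set)
     \<Rightarrow> nat \<Rightarrow> int \<Rightarrow> ('a, (nat \<Rightarrow> 'a) set set) module" where
  "graded_residue_tor R Rg M Mg s j =
     (let (F, a) = (SOME (F, a). \<exists>\<epsilon>. graded_free_resolution R Rg F a \<epsilon> M Mg)
      in homology (residue_tensor_strand R Rg F a j) s)"

definition graded_betti ::
  "('a, 'm) ring_scheme \<Rightarrow> (int \<Rightarrow> 'a set) \<Rightarrow> ('a, 'b, 'n) module_scheme \<Rightarrow> (int \<Rightarrow> 'b set)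
     \<Rightarrow> nat \<Rightarrow> int \<Rightarrow> nat" where
  "graded_betti R Rg M Mg s j =
     residue_dim R (irrelevant_ideal R Rg) (graded_residue_tor R Rg M Mg s j)"

definition regularity ::
  "('a, 'm) ring_scheme \<Rightarrow> (int \<Rightarrow> 'a set) \<Rightarrow> ('a, 'b, 'n) module_scheme \<Rightarrow> (int \<Rightarrow> 'b set) \<Rightarrow> ereal"
  where
  "regularity R Rg M Mg =
     Sup {ereal (real_of_int (j - int i)) | i j. nontrivial (graded_residue_tor R Rg M Mg i j)}"


section \<open>Linear quotients\<close>

definition minimal_generators ::
  "('a, 'm) ring_scheme \<Rightarrow> ('a, 'b, 'n) module_scheme \<Rightarrow> (nat \<Rightarrow> 'b) \<Rightarrow> nat \<Rightarrow> bool" where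
  "minimal_generators R M g t \<longleftrightarrow>
     g \<in> {1..t} \<rightarrow> carrier M \<and> module.span R M (g ` {1..t}) = carrier M \<and>
     (\<forall>i\<in>{1..t}. module.span R M (g ` ({1..t} - {i})) \<noteq> carrier M)"

definition initial_submodule ::
  "('a, 'm) ring_scheme \<Rightarrow> ('a, 'b, 'n) module_scheme \<Rightarrow> (nat \<Rightarrow> 'b) \<Rightarrow> nat \<Rightarrow> 'b set" where
  "initial_submodule R M g i = module.span R M (g ` {1..i})"

definition quotient_ideal ::
  "('a, 'm) ring_scheme \<Rightarrow> ('a, 'b, 'n) module_scheme \<Rightarrow> (nat \<Rightarrow> 'b) \<Rightarrow> nat \<Rightarrow> 'a set" where
  "quotient_ideal R M g i = colon_ideal R M (initial_submodule R M g (i - 1)) (g i)"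

definition linear_quotients ::
  "('a, 'm) ring_scheme \<Rightarrow> 'a set \<Rightarrow> ('a, 'b, 'n) module_scheme \<Rightarrow> (nat \<Rightarrow> 'b) \<Rightarrow> nat \<Rightarrow> bool"
  where
  "linear_quotients R \<mm> M g t \<longleftrightarrow> minimal_generators R M g t \<and>
     (\<forall>i\<in>{1..t}. koszul_module R \<mm> (cyclic_module R (quotient_ideal R M g i)))"

definition graded_linear_quotients ::
  "('a, 'm) ring_scheme \<Rightarrow> (int \<Rightarrow> 'a set) \<Rightarrow> ('a, 'b, 'n) module_scheme \<Rightarrow> (nat \<Rightarrow> 'b) \<Rightarrow> nat \<Rightarrow> bool"
  where
  "graded_linear_quotients R Rg M g t \<longleftrightarrow> minimal_generators R M g t \<and>
     (\<forall>i\<in>{1..t}. graded_koszul_module R Rg (cyclic_module R (quotient_ideal R M g i))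
        (cyclic_grading R Rg (quotient_ideal R M g i)))"

end

theory Submission imports Defs begin

text \<open>
  The submodules \<open>M\<^sub>i = (m\<^sub>1,\<dots>,m\<^sub>i)\<close> filter \<open>M\<close> with quotients \<open>M\<^sub>i/M\<^sub>i\<^sub>-\<^sub>1 \<cong> R/I\<^sub>i\<close>. Let \<open>F\<close> and \<open>G\<close> be the minimal
  free resolutions of \<open>M\<^sub>i\<^sub>-\<^sub>1\<close> and \<open>R/I\<^sub>i\<close>. The horseshoe lemma resolves \<open>M\<^sub>i\<close> by \<open>F \<oplus> G\<close> with the
  differential \<open>(f,g) \<mapsto> (df + hg, dg)\<close>, where the maps \<open>h\<^sub>j : G\<^sub>j\<^sub>+\<^sub>1 \<rightarrow> F\<^sub>j\<close> connect the two summands. The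
  theorem follows once this resolution is known to be minimal and to have an acyclic linear part: then
  \<open>M\<^sub>i\<close> is Koszul, and the ranks and degrees of the minimal resolution of \<open>M\<close> are those of the
  resolutions of all the \<open>R/I\<^sub>i\<close> together. These ranks and degrees are the (graded) Betti numbers and
  determine the projective dimension and the regularity.

  Everything rests on a reformulation of acyclicity of the linear part (\<open>linear_part_exact\<close>): every
  \<open>x \<in> \<mm>\<^sup>pF\<^sub>i\<close>, \<open>i \<ge> 1\<close>, with \<open>dx \<in> \<mm>\<^sup>p\<^sup>+\<^sup>2F\<^sub>i\<^sub>-\<^sub>1\<close> lies in \<open>d(\<mm>\<^sup>p\<^sup>-\<^sup>1F\<^sub>i\<^sub>+\<^sub>1) + \<mm>\<^sup>p\<^sup>+\<^sup>1F\<^sub>i\<close>. With it, minimality of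
  \<open>F \<oplus> G\<close>, that is, \<open>h G \<subseteq> \<mm>F\<close>, is an induction on \<open>j\<close> (\<open>h_minimal\<close>). The start \<open>j = 0\<close> holds because
  \<open>m\<^sub>1,\<dots>,m\<^sub>t\<close> are minimal generators: two expressions of an element of \<open>\<mm>M\<^sub>i \<inter> M\<^sub>i\<^sub>-\<^sub>1\<close> in the \<open>m\<^sub>j\<close> agree
  modulo \<open>\<mm>\<close>, so that \<open>\<mm>M\<^sub>i \<inter> M\<^sub>i\<^sub>-\<^sub>1 = \<mm>M\<^sub>i\<^sub>-\<^sub>1\<close> (\<open>init_max_intersection\<close>). In the step, \<open>d h\<^sub>j\<^sub>+\<^sub>1 = - h\<^sub>j d\<close>
  has values in \<open>\<mm>\<^sup>2F\<close>, and the criterion for \<open>F\<close> with \<open>p = 0\<close> yields \<open>h\<^sub>j\<^sub>+\<^sub>1 G \<subseteq> dF + \<mm>F = \<mm>F\<close>. Since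
  \<open>h\<close> raises the \<open>\<mm>\<close>-adic filtration like \<open>d\<close> does, the criterion for \<open>F \<oplus> G\<close> reduces to those for \<open>F\<close>
  and \<open>G\<close> (\<open>total_linear_part_exact\<close>).

  The invariants in the theorem are defined from arbitrarily chosen resolutions. Any two of them are
  homotopy equivalent (\<open>homotopy_equivalence\<close>), and homotopies preserve the criterion
  (\<open>linear_part_exact_transfer\<close>) and Tor (\<open>strand_homology_basis\<close>), so a single minimal resolution
  computes all of them.

  The local and the graded case are treated together. A local ring is graded by putting everything
  into degree \<open>0\<close> (\<open>trivial_grading\<close>), and both situations are instances of the locale \<open>star_local\<close>:
  a noetherian graded ring with a maximal ideal \<open>\<mm>\<close> that contains all components of nonzero degree and
  all elements of degree \<open>0\<close> that are not units. This is what the existence of minimal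
  resolutions requires (\<open>minimal_resolution_exists\<close>). That a standard graded algebra is noetherian is
  Hilbert's basis theorem.\<close>

section \<open>Homomorphisms and submodules\<close>

lemma submodule_carrier: "module R X \<Longrightarrow> submodule R (carrier X) X"
  by (auto simp: submodule_def module.smult_closed module_def
      abelian_monoid.a_closed abelian_monoid.zero_closed abelian_group_def)

lemma submoduleD:
  assumes "submodule R N X"
  shows "x \<in> N \<Longrightarrow> x \<in> carrier X" "x \<in> N \<Longrightarrow> y \<in> N \<Longrightarrow> x \<oplus>\<^bsub>X\<^esub> y \<in> N" "\<zero>\<^bsub>X\<^esub> \<in> N"
    "r \<in> carrier R \<Longrightarrow> x \<in> N \<Longrightarrow> r \<odot>\<^bsub>X\<^esub> x \<in> N"
  using assms by (auto simp: submodule_def)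

lemma smult_left_commute:
  assumes "module R X" "r \<in> carrier R" "s \<in> carrier R" "x \<in> carrier X"
  shows "r \<odot>\<^bsub>X\<^esub> (s \<odot>\<^bsub>X\<^esub> x) = s \<odot>\<^bsub>X\<^esub> (r \<odot>\<^bsub>X\<^esub> x)"
proof -
  interpret X: module R X by fact
  have "r \<otimes>\<^bsub>R\<^esub> s = s \<otimes>\<^bsub>R\<^esub> r" using assms by (intro X.R.m_comm)
  with assms show ?thesis by (metis X.smult_assoc1)
qed

lemma submodule_finsum_closed:
  assumes "submodule R N X" "f \<in> A \<rightarrow> N"
  shows "finsum X f A \<in> N"
proof -
  interpret X: module R X using assms(1) by (simp add: submodule_def)
  interpret N: submodule R N X by fact
  show ?thesis using assms(2)
  proof (induction A rule: infinite_finite_induct)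
    case (insert a A)
    then show ?case using N.subset by (subst X.finsum_insert) (auto simp: Pi_def)
  qed auto
qed

lemma submodule_minus_closed:
  assumes "submodule R N X" "x \<in> N"
  shows "\<ominus>\<^bsub>X\<^esub> x \<in> N"
proof -
  interpret X: module R X using assms(1) by (simp add: submodule_def)
  interpret N: submodule R N X by fact
  have "(\<ominus>\<^bsub>R\<^esub> \<one>\<^bsub>R\<^esub>) \<odot>\<^bsub>X\<^esub> x \<in> N" using assms by auto
  moreover have "x \<in> carrier X" using assms N.subset by auto
  ultimately show ?thesis by (simp add: X.smult_l_minus)
qed

lemma module_submodule: "submodule R N X \<Longrightarrow> module R (X\<lparr>carrier := N\<rparr>)"
  by (simp add: module.submodule_is_module submodule_def)

lemma submodule_submodule:
  assumes "submodule R N X" "submodule R L X" "L \<subseteq> N"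
  shows "submodule R L (X\<lparr>carrier := N\<rparr>)"
  using assms module_submodule[OF assms(1)] by (auto simp: submodule_def)

lemma finsum_submodule:
  assumes "submodule R N X" "f \<in> A \<rightarrow> N"
  shows "finsum (X\<lparr>carrier := N\<rparr>) f A = finsum X f A"
proof -
  interpret X: module R X using assms(1) by (simp add: submodule_def)
  interpret N: module R "X\<lparr>carrier := N\<rparr>" by (rule module_submodule) fact
  show ?thesis using assms(2)
  proof (induction A rule: infinite_finite_induct)
    case (insert a A)
    moreover have "N \<subseteq> carrier X" using assms(1) by (simp add: submodule_def)
    ultimately show ?case
      by (subst X.finsum_insert) (auto simp: Pi_def subset_iff)
  qed auto
qed

lemma minus_submodule:
  assumes "submodule R N X" "x \<in> N"
  shows "\<ominus>\<^bsub>X\<lparr>carrier := N\<rparr>\<^esub> x = \<ominus>\<^bsub>X\<^esub> x"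
proof -
  interpret X: module R X using assms(1) by (simp add: submodule_def)
  interpret N: module R "X\<lparr>carrier := N\<rparr>" by (rule module_submodule) fact
  have 1: "\<ominus>\<^bsub>X\<^esub> x \<in> N" by (rule submodule_minus_closed[OF assms])
  have N: "N \<subseteq> carrier X" using assms(1) by (simp add: submodule_def)
  show ?thesis
    by (rule N.minus_equality) (use 1 assms N in \<open>auto simp: X.l_neg\<close>)
qed

lemma
  assumes "module R X" "module R Y" "f \<in> module_hom R X Y"
  shows hom_zero: "f \<zero>\<^bsub>X\<^esub> = \<zero>\<^bsub>Y\<^esub>"
    and hom_neg: "x \<in> carrier X \<Longrightarrow> f (\<ominus>\<^bsub>X\<^esub> x) = \<ominus>\<^bsub>Y\<^esub> f x"
    and hom_minus: "x \<in> carrier X \<Longrightarrow> y \<in> carrier X \<Longrightarrow> f (x \<ominus>\<^bsub>X\<^esub> y) = f x \<ominus>\<^bsub>Y\<^esub> f y"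
    and hom_finsum: "g \<in> A \<rightarrow> carrier X \<Longrightarrow> f (finsum X g A) = finsum Y (\<lambda>a. f (g a)) A"
    and hom_image_submodule: "submodule R (f ` carrier X) Y"
    and hom_kernel_submodule: "submodule R {x \<in> carrier X. f x = \<zero>\<^bsub>Y\<^esub>} X"
proof -
  interpret mod_hom R X Y f using assms by (simp add: mod_hom_def mod_hom_axioms_def)
  show "f \<zero>\<^bsub>X\<^esub> = \<zero>\<^bsub>Y\<^esub>" by simp
  show "x \<in> carrier X \<Longrightarrow> f (\<ominus>\<^bsub>X\<^esub> x) = \<ominus>\<^bsub>Y\<^esub> f x" by simp
  show "x \<in> carrier X \<Longrightarrow> y \<in> carrier X \<Longrightarrow> f (x \<ominus>\<^bsub>X\<^esub> y) = f x \<ominus>\<^bsub>Y\<^esub> f y" by simp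
  show "submodule R (f ` carrier X) Y" using im_is_submodule by (simp add: im_def)
  show "submodule R {x \<in> carrier X. f x = \<zero>\<^bsub>Y\<^esub>} X" using ker_is_submodule by (simp add: ker_def)
  show "f (finsum X g A) = finsum Y (\<lambda>a. f (g a)) A" if "g \<in> A \<rightarrow> carrier X" using that
  proof (induction A rule: infinite_finite_induct)
    case (insert a A)
    then have "(\<lambda>a. f (g a)) \<in> A \<rightarrow> carrier Y" "g \<in> A \<rightarrow> carrier X" by auto
    with insert show ?case
      by (simp add: Pi_def)
  qed auto
qed

lemma module_homI:
  assumes "\<And>x. x \<in> carrier X \<Longrightarrow> f x \<in> carrier Y"
    and "\<And>x y. x \<in> carrier X \<Longrightarrow> y \<in> carrier X \<Longrightarrow> f (x \<oplus>\<^bsub>X\<^esub> y) = f x \<oplus>\<^bsub>Y\<^esub> f y"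
    and "\<And>r x. r \<in> carrier R \<Longrightarrow> x \<in> carrier X \<Longrightarrow> f (r \<odot>\<^bsub>X\<^esub> x) = r \<odot>\<^bsub>Y\<^esub> f x"
  shows "f \<in> module_hom R X Y"
  using assms by (auto simp: module_hom_def)

lemma hom_closed: "f \<in> module_hom R X Y \<Longrightarrow> x \<in> carrier X \<Longrightarrow> f x \<in> carrier Y"
  by (auto simp: module_hom_def)

lemma hom_comp:
  "f \<in> module_hom R X Y \<Longrightarrow> g \<in> module_hom R Y Z \<Longrightarrow> (\<lambda>x. g (f x)) \<in> module_hom R X Z"
  by (auto simp: module_hom_def Pi_def)

lemma hom_add:
  assumes "module R Y" "f \<in> module_hom R X Y" "g \<in> module_hom R X Y"
  shows "(\<lambda>x. f x \<oplus>\<^bsub>Y\<^esub> g x) \<in> module_hom R X Y"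
proof -
  interpret Y: module R Y by fact
  note cl = hom_closed[OF assms(2)] hom_closed[OF assms(3)]
  show ?thesis
    by (rule module_homI) (auto simp: cl module_hom_add[OF assms(2)] module_hom_add[OF assms(3)]
        module_hom_smult[OF assms(2)] module_hom_smult[OF assms(3)] Y.smult_r_distr Y.a_ac)
qed

lemma hom_minus_fun:
  assumes "module R Y" "f \<in> module_hom R X Y"
  shows "(\<lambda>x. \<ominus>\<^bsub>Y\<^esub> f x) \<in> module_hom R X Y"
proof -
  interpret Y: module R Y by fact
  note cl = hom_closed[OF assms(2)]
  show ?thesis
    by (rule module_homI) (auto simp: cl module_hom_add[OF assms(2)]
        module_hom_smult[OF assms(2)] Y.smult_r_minus Y.minus_add)
qed

lemma hom_restrict:
  "f \<in> module_hom R X Y \<Longrightarrow> f ` carrier X \<subseteq> N \<Longrightarrow> f \<in> module_hom R X (Y\<lparr>carrier := N\<rparr>)"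
  by (auto simp: module_hom_def)

lemma hom_vimage_submodule:
  assumes "module R X" "module R Y" "f \<in> module_hom R X Y" "submodule R N Y"
  shows "submodule R {x \<in> carrier X. f x \<in> N} X"
proof -
  interpret X: module R X by fact
  interpret N: submodule R N Y by fact
  show ?thesis
    using assms(1) by (auto simp: submodule_def hom_zero[OF assms(1,2,3)] module_hom_add[OF assms(3)]
        module_hom_smult[OF assms(3)])
qed

lemma submodule_Int:
  "submodule R N X \<Longrightarrow> submodule R L X \<Longrightarrow> submodule R (N \<inter> L) X"
  by (auto simp: submodule_def)

section \<open>Multiples of a module by an ideal\<close>

lemma ideal_smult_submodule:
  assumes "module R X" "I \<subseteq> carrier R"
  shows "submodule R (ideal_smult R I X) X"
proof -
  interpret X: module R X by fact
  show ?thesis unfolding ideal_smult_def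
    by (rule X.span_is_submodule) (use assms in auto)
qed

lemma ideal_smult_subset:
  assumes "module R X" "submodule R N X" "I \<subseteq> carrier R"
    "\<And>r x. r \<in> I \<Longrightarrow> x \<in> carrier X \<Longrightarrow> r \<odot>\<^bsub>X\<^esub> x \<in> N"
  shows "ideal_smult R I X \<subseteq> N"
proof -
  interpret X: module R X by fact
  show ?thesis unfolding ideal_smult_def
    by (rule X.span_is_subset) (use assms in auto)
qed

lemma ideal_smult_incl:
  assumes "module R X" "I \<subseteq> carrier R" "r \<in> I" "x \<in> carrier X"
  shows "r \<odot>\<^bsub>X\<^esub> x \<in> ideal_smult R I X"
proof -
  interpret X: module R X by fact
  have "{r \<odot>\<^bsub>X\<^esub> x |r x. r \<in> I \<and> x \<in> carrier X} \<subseteq> carrier X" using assms by auto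
  from X.in_own_span[OF this] show ?thesis unfolding ideal_smult_def using assms by auto
qed

lemma ideal_smult_mono:
  assumes "module R X" "I \<subseteq> J" "J \<subseteq> carrier R"
  shows "ideal_smult R I X \<subseteq> ideal_smult R J X"
  by (rule ideal_smult_subset) (use assms ideal_smult_incl[OF assms(1,3)] ideal_smult_submodule[OF assms(1,3)] in auto)

lemma hom_ideal_smult:
  assumes "module R X" "module R Y" "f \<in> module_hom R X Y" "I \<subseteq> carrier R"
    "x \<in> ideal_smult R I X"
  shows "f x \<in> ideal_smult R I Y"
proof -
  have "ideal_smult R I X \<subseteq> {x \<in> carrier X. f x \<in> ideal_smult R I Y}"
    by (rule ideal_smult_subset[OF assms(1) hom_vimage_submodule[OF assms(1,2,3) ideal_smult_submodule[OF assms(2,4)]] assms(4)])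
      (use assms ideal_smult_incl[OF assms(2,4)] in \<open>auto simp: module_hom_smult hom_closed module.smult_closed subset_iff\<close>)
  then show ?thesis using assms(5) by auto
qed

lemma hom_ideal_smult_surj:
  assumes "module R X" "module R Y" "f \<in> module_hom R X Y" "I \<subseteq> carrier R"
    "f ` carrier X = carrier Y"
  shows "f ` ideal_smult R I X = ideal_smult R I Y"
proof
  show "f ` ideal_smult R I X \<subseteq> ideal_smult R I Y" using hom_ideal_smult[OF assms(1-4)] by auto
  let ?S = "ideal_smult R I X"
  have sub: "submodule R ?S X" by (rule ideal_smult_submodule[OF assms(1,4)])
  have "f \<in> module_hom R (X\<lparr>carrier := ?S\<rparr>) Y"
    using assms(3) sub unfolding module_hom_def submodule_def by (auto simp: subset_iff)
  from hom_image_submodule[OF module_submodule[OF sub] assms(2) this]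
  have "submodule R (f ` ?S) Y" by simp
  then show "ideal_smult R I Y \<subseteq> f ` ?S"
  proof (rule ideal_smult_subset[OF assms(2) _ assms(4)])
    fix r y assume r: "r \<in> I" and "y \<in> carrier Y"
    then obtain x where x: "x \<in> carrier X" "y = f x" using assms(5) by auto
    then have "r \<odot>\<^bsub>Y\<^esub> y = f (r \<odot>\<^bsub>X\<^esub> x)" using r assms(3,4) by (auto simp: module_hom_smult)
    then show "r \<odot>\<^bsub>Y\<^esub> y \<in> f ` ?S" using ideal_smult_incl[OF assms(1,4) r x(1)] by auto
  qed
qed

lemma ideal_smult_carrier:
  assumes "module R X"
  shows "ideal_smult R (carrier R) X = carrier X"
proof -
  interpret X: module R X by fact
  have "x \<in> ideal_smult R (carrier R) X" if "x \<in> carrier X" for x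
    using ideal_smult_incl[OF assms, of "carrier R" "\<one>\<^bsub>R\<^esub>" x] that by auto
  then show ?thesis using ideal_smult_submodule[OF assms, of "carrier R"] by (auto simp: submodule_def)
qed

lemma (in cring) ideal_power_ideal:
  "ideal I R \<Longrightarrow> ideal (ideal_power R I n) R"
  by (induction n) (auto simp: ideal_prod_is_ideal oneideal)

lemma (in cring) ideal_power_subset: "ideal I R \<Longrightarrow> ideal_power R I n \<subseteq> carrier R"
  by (rule subsetI) (erule ideal.Icarr[OF ideal_power_ideal])

lemma (in cring) ideal_power_Suc: "ideal I R \<Longrightarrow> ideal_power R I (Suc n) \<subseteq> ideal_power R I n"
  using ideal_prod_inter[of I "ideal_power R I n"] ideal_power_ideal[of I n] by auto

lemma (in cring) ideal_power_one: "ideal I R \<Longrightarrow> ideal_power R I (Suc 0) = I"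
  using ideal_prod_one[of I] by auto

text \<open>A map whose values lie in \<open>\<mm>Y\<close> raises the \<open>\<mm>\<close>-adic filtration by one step.\<close>

lemma (in cring) hom_raises_madic:
  assumes "ideal I R" "module R X" "module R Y" "f \<in> module_hom R X Y"
    "f ` carrier X \<subseteq> ideal_smult R I Y" "x \<in> ideal_smult R (ideal_power R I p) X"
  shows "f x \<in> ideal_smult R (ideal_power R I (Suc p)) Y"
proof -
  interpret Y: module R Y by fact
  note sub = ideal_power_subset[OF assms(1)]
  let ?N = "ideal_smult R (ideal_power R I (Suc p)) Y"
  have N: "submodule R ?N Y" by (rule ideal_smult_submodule[OF assms(3) sub])
  have I: "I \<subseteq> carrier R" by (rule subsetI) (rule ideal.Icarr[OF assms(1)])
  have *: "r \<odot>\<^bsub>Y\<^esub> y \<in> ?N" if r: "r \<in> ideal_power R I p" and y: "y \<in> ideal_smult R I Y" for r y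
  proof -
    have r': "r \<in> carrier R" using r sub[of p] by auto
    have "(\<lambda>y. r \<odot>\<^bsub>Y\<^esub> y) \<in> module_hom R Y Y"
      using r' by (intro module_homI) (auto simp: Y.smult_r_distr smult_left_commute[OF assms(3)])
    then have vs: "submodule R {y \<in> carrier Y. r \<odot>\<^bsub>Y\<^esub> y \<in> ?N} Y"
      by (rule hom_vimage_submodule[OF assms(3,3) _ N])
    have "ideal_smult R I Y \<subseteq> {y \<in> carrier Y. r \<odot>\<^bsub>Y\<^esub> y \<in> ?N}"
    proof (rule ideal_smult_subset[OF assms(3) vs I])
      fix s y assume s: "s \<in> I" and y: "y \<in> carrier Y"
      have "r \<odot>\<^bsub>Y\<^esub> (s \<odot>\<^bsub>Y\<^esub> y) = (s \<otimes> r) \<odot>\<^bsub>Y\<^esub> y"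
        using s r' y I smult_left_commute[OF assms(3), of r s y] by (auto simp: Y.smult_assoc1 subset_iff)
      moreover have "s \<otimes> r \<in> ideal_power R I (Suc p)"
        using s r by (auto intro: ideal_prod.prod)
      ultimately show "s \<odot>\<^bsub>Y\<^esub> y \<in> {y \<in> carrier Y. r \<odot>\<^bsub>Y\<^esub> y \<in> ?N}"
        using ideal_smult_incl[OF assms(3) sub _ y] I s y by (auto simp del: ideal_power.simps)
    qed
    then show ?thesis using y by blast
  qed
  have "ideal_smult R (ideal_power R I p) X \<subseteq> {x \<in> carrier X. f x \<in> ?N}"
  proof (rule ideal_smult_subset[OF assms(2) hom_vimage_submodule[OF assms(2,3,4) N] sub])
    fix r x assume r: "r \<in> ideal_power R I p" and x: "x \<in> carrier X"
    have "f x \<in> ideal_smult R I Y" using x assms(5) by blast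
    then have "r \<odot>\<^bsub>Y\<^esub> f x \<in> ?N" by (rule *[OF r])
    moreover have "r \<in> carrier R" using r sub[of p] by blast
    ultimately show "r \<odot>\<^bsub>X\<^esub> x \<in> {x \<in> carrier X. f x \<in> ?N}"
      using module_hom_smult[OF assms(4) _ x] module.smult_closed[OF assms(2) _ x]
      by (metis (no_types, lifting) mem_Collect_eq)
  qed
  then show ?thesis using assms(6) by blast
qed

section \<open>Free modules\<close>

lemma free_carrier_iff:
  "f \<in> carrier (free_module R n) \<longleftrightarrow> (\<forall>c<n. f c \<in> carrier R) \<and> (\<forall>c\<ge>n. f c = \<zero>\<^bsub>R\<^esub>)"
  by (simp add: free_module_def)

lemma free_module_simps:
  "\<zero>\<^bsub>free_module R n\<^esub> = (\<lambda>c. \<zero>\<^bsub>R\<^esub>)"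
  "f \<oplus>\<^bsub>free_module R n\<^esub> g = (\<lambda>c. f c \<oplus>\<^bsub>R\<^esub> g c)"
  "r \<odot>\<^bsub>free_module R n\<^esub> f = (\<lambda>c. r \<otimes>\<^bsub>R\<^esub> f c)"
  by (simp_all add: free_module_def)

definition unit_vector :: "('a, 'm) ring_scheme \<Rightarrow> nat \<Rightarrow> nat \<Rightarrow> 'a" where
  "unit_vector R c = (\<lambda>b. if b = c then \<one>\<^bsub>R\<^esub> else \<zero>\<^bsub>R\<^esub>)"

definition basis_map ::
  "('a, 'b, 'n) module_scheme \<Rightarrow> (nat \<Rightarrow> 'b) \<Rightarrow> nat \<Rightarrow> (nat \<Rightarrow> 'a) \<Rightarrow> 'b" where
  "basis_map X x n r = (\<Oplus>\<^bsub>X\<^esub>c\<in>{..<n}. r c \<odot>\<^bsub>X\<^esub> x c)"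

context cring
begin

lemma free_carrier_in: "f \<in> carrier (free_module R n) \<Longrightarrow> f c \<in> carrier R"
  by (cases "c < n") (auto simp: free_carrier_iff)

lemma free_add_closed:
  "f \<in> carrier (free_module R n) \<Longrightarrow> g \<in> carrier (free_module R n)
    \<Longrightarrow> (\<lambda>c. f c \<oplus> g c) \<in> carrier (free_module R n)"
  and free_smult_closed:
  "s \<in> carrier R \<Longrightarrow> f \<in> carrier (free_module R n) \<Longrightarrow> (\<lambda>c. s \<otimes> f c) \<in> carrier (free_module R n)"
  and free_zero_closed: "(\<lambda>c. \<zero>) \<in> carrier (free_module R n)"
  by (auto simp: free_carrier_iff)

lemma free_module_module: "module R (free_module R n)"
proof (rule module_criteria)
  show "cring R" by (rule cring_axioms)
  show "\<forall>v\<in>carrier (free_module R n). \<exists>w\<in>carrier (free_module R n).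
      v \<oplus>\<^bsub>free_module R n\<^esub> w = \<zero>\<^bsub>free_module R n\<^esub>"
  proof
    fix v assume v: "v \<in> carrier (free_module R n)"
    show "\<exists>w\<in>carrier (free_module R n). v \<oplus>\<^bsub>free_module R n\<^esub> w = \<zero>\<^bsub>free_module R n\<^esub>"
      by (rule bexI[of _ "\<lambda>c. \<ominus> v c"]) (use v free_carrier_in[OF v] in \<open>auto simp: r_neg free_carrier_iff free_module_simps\<close>)
  qed
qed (auto simp: free_add_closed free_smult_closed free_zero_closed fun_eq_iff free_carrier_in free_module_simps
    m_assoc l_distr r_distr a_ac)

lemma free_finsum:
  assumes "f \<in> A \<rightarrow> carrier (free_module R n)"
  shows "finsum (free_module R n) f A c = (\<Oplus>a\<in>A. f a c)"
proof -
  interpret F: module R "free_module R n" by (rule free_module_module)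
  show ?thesis using assms
  proof (induction A rule: infinite_finite_induct)
    case (insert a A)
    then have f: "f \<in> A \<rightarrow> carrier (free_module R n)" "f a \<in> carrier (free_module R n)" by auto
    have "finsum (free_module R n) f (insert a A) = f a \<oplus>\<^bsub>free_module R n\<^esub> finsum (free_module R n) f A"
      by (rule F.finsum_insert) (use insert f in auto)
    moreover have "(\<Oplus>b\<in>insert a A. f b c) = f a c \<oplus> (\<Oplus>b\<in>A. f b c)"
      by (rule finsum_insert) (use insert f free_carrier_in in \<open>auto simp: Pi_def\<close>)
    ultimately show ?case using insert.IH[OF f(1)] by (simp add: free_module_simps)
  qed (auto simp: free_module_simps)
qed

lemma unit_vector_carrier: "c < n \<Longrightarrow> unit_vector R c \<in> carrier (free_module R n)"
  by (auto simp: unit_vector_def free_carrier_iff free_module_simps)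

lemma smult_unit_vector_carrier:
  "c < n \<Longrightarrow> s \<in> carrier R \<Longrightarrow> s \<odot>\<^bsub>free_module R n\<^esub> unit_vector R c \<in> carrier (free_module R n)"
  by (auto simp: unit_vector_def free_carrier_iff free_module_simps)

lemma free_expansion:
  assumes r: "r \<in> carrier (free_module R n)"
  shows "r = (\<Oplus>\<^bsub>free_module R n\<^esub>c\<in>{..<n}. r c \<odot>\<^bsub>free_module R n\<^esub> unit_vector R c)"
proof
  fix b
  have "(\<Oplus>\<^bsub>free_module R n\<^esub>c\<in>{..<n}. r c \<odot>\<^bsub>free_module R n\<^esub> unit_vector R c) b
      = (\<Oplus>c\<in>{..<n}. r c \<otimes> unit_vector R c b)"
    using smult_unit_vector_carrier free_carrier_in[OF r] by (subst free_finsum) (auto simp: free_module_simps)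
  also have "\<dots> = (\<Oplus>c\<in>{..<n}. if b = c then r c else \<zero>)"
    by (rule finsum_cong') (use free_carrier_in[OF r] in \<open>auto simp: unit_vector_def\<close>)
  also have "\<dots> = r b"
  proof (cases "b < n")
    case True
    then show ?thesis by (subst finsum_singleton) (use free_carrier_in[OF r] in auto)
  next
    case False
    have "(\<Oplus>c\<in>{..<n}. if b = c then r c else \<zero>) = (\<Oplus>c\<in>{..<n}. \<zero>)"
      by (rule finsum_cong') (use False in auto)
    with False r show ?thesis by (auto simp: free_carrier_iff)
  qed
  finally show "r b = (\<Oplus>\<^bsub>free_module R n\<^esub>c\<in>{..<n}. r c \<odot>\<^bsub>free_module R n\<^esub> unit_vector R c) b" by simp
qed

lemma basis_map_hom:
  assumes "module R X" "\<And>c. c < n \<Longrightarrow> x c \<in> carrier X"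
  shows "basis_map X x n \<in> module_hom R (free_module R n) X"
proof -
  interpret X: module R X by fact
  show ?thesis
  proof (rule module_homI)
    fix r assume r: "r \<in> carrier (free_module R n)"
    show "basis_map X x n r \<in> carrier X" unfolding basis_map_def
      using free_carrier_in[OF r] assms(2) by (intro X.finsum_closed) auto
    show "basis_map X x n (s \<odot>\<^bsub>free_module R n\<^esub> r) = s \<odot>\<^bsub>X\<^esub> basis_map X x n r" if "s \<in> carrier R" for s
      unfolding basis_map_def
      using free_carrier_in[OF r] assms(2) that
      by (subst X.finsum_smult_ldistr) (auto simp: X.smult_assoc1 Pi_def free_module_simps intro!: X.finsum_cong')
    fix q assume q: "q \<in> carrier (free_module R n)"
    have "basis_map X x n (r \<oplus>\<^bsub>free_module R n\<^esub> q)
        = (\<Oplus>\<^bsub>X\<^esub>c\<in>{..<n}. r c \<odot>\<^bsub>X\<^esub> x c \<oplus>\<^bsub>X\<^esub> q c \<odot>\<^bsub>X\<^esub> x c)"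
      unfolding basis_map_def
      using free_carrier_in[OF r] free_carrier_in[OF q] assms(2)
      by (intro X.finsum_cong') (auto simp: X.smult_l_distr free_module_simps)
    also have "\<dots> = basis_map X x n r \<oplus>\<^bsub>X\<^esub> basis_map X x n q"
      unfolding basis_map_def
      using free_carrier_in[OF r] free_carrier_in[OF q] assms(2)
      by (intro X.finsum_addf) auto
    finally show "basis_map X x n (r \<oplus>\<^bsub>free_module R n\<^esub> q) = basis_map X x n r \<oplus>\<^bsub>X\<^esub> basis_map X x n q" .
  qed
qed

lemma basis_map_unit_vector:
  assumes "module R X" "\<And>c. c < n \<Longrightarrow> x c \<in> carrier X" "b < n"
  shows "basis_map X x n (unit_vector R b) = x b"
proof -
  interpret X: module R X by fact
  have "basis_map X x n (unit_vector R b) = (\<Oplus>\<^bsub>X\<^esub>c\<in>{..<n}. if b = c then x c else \<zero>\<^bsub>X\<^esub>)"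
    unfolding basis_map_def using assms(2)
    by (intro X.finsum_cong') (auto simp: unit_vector_def)
  also have "\<dots> = x b" by (rule X.finsum_singleton) (use assms in auto)
  finally show ?thesis .
qed

lemma hom_free_expansion:
  assumes "module R X" "f \<in> module_hom R (free_module R n) X" "r \<in> carrier (free_module R n)"
  shows "f r = basis_map X (\<lambda>c. f (unit_vector R c)) n r"
proof -
  have s: "(\<lambda>c. r c \<odot>\<^bsub>free_module R n\<^esub> unit_vector R c) \<in> {..<n} \<rightarrow> carrier (free_module R n)"
    using smult_unit_vector_carrier free_carrier_in[OF assms(3)] by blast
  have "f r = f (\<Oplus>\<^bsub>free_module R n\<^esub>c\<in>{..<n}. r c \<odot>\<^bsub>free_module R n\<^esub> unit_vector R c)"
    using free_expansion[OF assms(3)] by simp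
  also have "\<dots> = (\<Oplus>\<^bsub>X\<^esub>c\<in>{..<n}. f (r c \<odot>\<^bsub>free_module R n\<^esub> unit_vector R c))"
    by (rule hom_finsum[OF free_module_module assms(1,2) s])
  also have "\<dots> = basis_map X (\<lambda>c. f (unit_vector R c)) n r"
  proof -
    interpret X: module R X by fact
    show ?thesis unfolding basis_map_def
    proof (rule X.finsum_cong')
      show "(\<lambda>c. r c \<odot>\<^bsub>X\<^esub> f (unit_vector R c)) \<in> {..<n} \<rightarrow> carrier X"
        using free_carrier_in[OF assms(3)] unit_vector_carrier hom_closed[OF assms(2)] by blast
      fix c assume "c \<in> {..<n}"
      then show "f (r c \<odot>\<^bsub>free_module R n\<^esub> unit_vector R c) = r c \<odot>\<^bsub>X\<^esub> f (unit_vector R c)"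
        by (intro module_hom_smult[OF assms(2)] free_carrier_in[OF assms(3)] unit_vector_carrier) auto
    qed simp
  qed
  finally show ?thesis .
qed

lemma basis_map_in_submodule:
  assumes "submodule R N X" "\<And>c. c < n \<Longrightarrow> r c \<odot>\<^bsub>X\<^esub> x c \<in> N"
  shows "basis_map X x n r \<in> N"
  unfolding basis_map_def by (rule submodule_finsum_closed[OF assms(1)]) (use assms(2) in auto)

lemma basis_map_image:
  assumes "module R X" "\<And>c. c < n \<Longrightarrow> x c \<in> carrier X"
  shows "basis_map X x n ` carrier (free_module R n) = module.span R X (x ` {..<n})"
proof -
  interpret X: module R X by fact
  have x: "x ` {..<n} \<subseteq> carrier X" using assms(2) by auto
  note sub = X.span_is_submodule[OF x]
  show ?thesis
  proof
    show "basis_map X x n ` carrier (free_module R n) \<subseteq> X.span (x ` {..<n})"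
    proof (rule image_subsetI)
      fix r assume r: "r \<in> carrier (free_module R n)"
      show "basis_map X x n r \<in> X.span (x ` {..<n})"
        using X.in_own_span[OF x] free_carrier_in[OF r] sub
        by (intro basis_map_in_submodule[OF sub]) (auto simp: submodule_def)
    qed
    show "X.span (x ` {..<n}) \<subseteq> basis_map X x n ` carrier (free_module R n)"
    proof (rule X.span_is_subset)
      show "submodule R (basis_map X x n ` carrier (free_module R n)) X"
        by (rule hom_image_submodule[OF free_module_module assms(1) basis_map_hom[OF assms]])
      show "x ` {..<n} \<subseteq> basis_map X x n ` carrier (free_module R n)"
      proof (rule image_subsetI)
        fix c assume c: "c \<in> {..<n}"
        show "x c \<in> basis_map X x n ` carrier (free_module R n)"
          by (rule image_eqI[of _ _ "unit_vector R c"])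
            (use c in \<open>auto simp: basis_map_unit_vector[where x = x, OF assms] unit_vector_carrier\<close>)
      qed
    qed
  qed
qed

lemma ideal_smult_free:
  assumes "ideal I R"
  shows "ideal_smult R I (free_module R n) = {r \<in> carrier (free_module R n). \<forall>c. r c \<in> I}"
    (is "_ = ?N")
proof
  interpret I: ideal I R by fact
  interpret F: module R "free_module R n" by (rule free_module_module)
  have sub: "submodule R ?N (free_module R n)"
    using F.module_axioms I.I_l_closed
    by (auto simp: submodule_def free_module_simps I.zero_closed I.a_closed free_add_closed free_smult_closed free_zero_closed)
  have I: "I \<subseteq> carrier R" using I.a_subset .
  show "ideal_smult R I (free_module R n) \<subseteq> ?N"
    by (rule ideal_smult_subset[OF F.module_axioms sub I])
      (use free_carrier_in I.I_r_closed I in \<open>auto simp: subset_iff free_module_simps intro!: free_smult_closed\<close>)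
  show "?N \<subseteq> ideal_smult R I (free_module R n)"
  proof
    fix r assume r: "r \<in> ?N"
    have "(\<Oplus>\<^bsub>free_module R n\<^esub>c\<in>{..<n}. r c \<odot>\<^bsub>free_module R n\<^esub> unit_vector R c) \<in> ideal_smult R I (free_module R n)"
      by (rule submodule_finsum_closed[OF ideal_smult_submodule[OF F.module_axioms I]])
        (use r in \<open>auto intro!: ideal_smult_incl[OF F.module_axioms I] unit_vector_carrier\<close>)
    then show "r \<in> ideal_smult R I (free_module R n)" using free_expansion[of r n] r by simp
  qed
qed

end

section \<open>Degrees and lifting\<close>

text \<open>Modules with homogeneous pieces \<open>Xg j\<close>, weaker than graded modules: a decomposition into homogeneous
  components enters the comparison of resolutions only through \<open>degree_strict\<close>, which allows
  homogeneous elements to be lifted to homogeneous ones.\<close>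

definition degree_module ::
  "('a, 'm) ring_scheme \<Rightarrow> (int \<Rightarrow> 'a set) \<Rightarrow> ('a, 'b, 'n) module_scheme \<Rightarrow> (int \<Rightarrow> 'b set) \<Rightarrow> bool" where
  "degree_module R Rg X Xg \<longleftrightarrow> module R X \<and>
     (\<forall>j. Xg j \<subseteq> carrier X \<and> \<zero>\<^bsub>X\<^esub> \<in> Xg j \<and> (\<forall>x\<in>Xg j. \<forall>y\<in>Xg j. x \<oplus>\<^bsub>X\<^esub> y \<in> Xg j)) \<and>
     (\<forall>i j. \<forall>r\<in>Rg i. \<forall>x\<in>Xg j. r \<odot>\<^bsub>X\<^esub> x \<in> Xg (i + j))"

definition graded_hom ::
  "('a, 'm) ring_scheme \<Rightarrow> ('a, 'b, 'n) module_scheme \<Rightarrow> (int \<Rightarrow> 'b set)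
     \<Rightarrow> ('a, 'c, 'k) module_scheme \<Rightarrow> (int \<Rightarrow> 'c set) \<Rightarrow> ('b \<Rightarrow> 'c) set" where
  "graded_hom R X Xg Y Yg = {h \<in> module_hom R X Y. \<forall>j. h ` Xg j \<subseteq> Yg j}"

definition degree_strict ::
  "('a, 'b, 'n) module_scheme \<Rightarrow> (int \<Rightarrow> 'b set) \<Rightarrow> (int \<Rightarrow> 'c set) \<Rightarrow> ('b \<Rightarrow> 'c) \<Rightarrow> bool" where
  "degree_strict X Xg Yg h \<longleftrightarrow> (\<forall>j. Yg j \<inter> h ` carrier X \<subseteq> h ` Xg j)"

text \<open>The grading of \<open>\<Oplus>\<^sub>c R(- a c)\<close>: the basis vector \<open>c\<close> has degree \<open>a c\<close>.\<close>

definition free_degree ::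
  "('a, 'm) ring_scheme \<Rightarrow> (int \<Rightarrow> 'a set) \<Rightarrow> nat \<Rightarrow> (nat \<Rightarrow> int) \<Rightarrow> int \<Rightarrow> (nat \<Rightarrow> 'a) set" where
  "free_degree R Rg n a j = {f \<in> carrier (free_module R n). \<forall>c. f c \<in> Rg (j - a c)}"

definition graded_projective ::
  "('a, 'm) ring_scheme \<Rightarrow> (int \<Rightarrow> 'a set) \<Rightarrow> ('a, 'b, 'n) module_scheme \<Rightarrow> (int \<Rightarrow> 'b set) \<Rightarrow> bool" where
  "graded_projective R Rg X Xg \<longleftrightarrow>
     (\<exists>n a. \<exists>p\<in>graded_hom R (free_module R n) (free_degree R Rg n a) X Xg.
        \<exists>q\<in>graded_hom R X Xg (free_module R n) (free_degree R Rg n a). \<forall>x\<in>carrier X. p (q x) = x)"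

lemma graded_homI:
  "h \<in> module_hom R X Y \<Longrightarrow> (\<And>j x. x \<in> Xg j \<Longrightarrow> h x \<in> Yg j) \<Longrightarrow> h \<in> graded_hom R X Xg Y Yg"
  by (auto simp: graded_hom_def)

lemma graded_homD:
  assumes "h \<in> graded_hom R X Xg Y Yg"
  shows "h \<in> module_hom R X Y" "x \<in> Xg j \<Longrightarrow> h x \<in> Yg j" "x \<in> carrier X \<Longrightarrow> h x \<in> carrier Y"
  using assms by (auto simp: graded_hom_def hom_closed)

lemma degree_moduleD:
  assumes "degree_module R Rg X Xg"
  shows "module R X" "x \<in> Xg j \<Longrightarrow> x \<in> carrier X" "\<zero>\<^bsub>X\<^esub> \<in> Xg j"
    "x \<in> Xg j \<Longrightarrow> y \<in> Xg j \<Longrightarrow> x \<oplus>\<^bsub>X\<^esub> y \<in> Xg j"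
    "r \<in> Rg i \<Longrightarrow> x \<in> Xg j \<Longrightarrow> r \<odot>\<^bsub>X\<^esub> x \<in> Xg (i + j)"
  using assms by (auto simp: degree_module_def)

lemma graded_hom_comp:
  "f \<in> graded_hom R X Xg Y Yg \<Longrightarrow> g \<in> graded_hom R Y Yg Z Zg \<Longrightarrow> (\<lambda>x. g (f x)) \<in> graded_hom R X Xg Z Zg"
  by (auto simp: graded_hom_def hom_comp image_subset_iff)

lemma graded_hom_id: "(\<lambda>x. x) \<in> graded_hom R X Xg X Xg"
  by (auto simp: graded_hom_def module_hom_def)

lemma degree_finsum:
  assumes "degree_module R Rg X Xg" "\<And>a. a \<in> A \<Longrightarrow> f a \<in> Xg j"
  shows "finsum X f A \<in> Xg j"
proof -
  interpret X: module R X by (rule degree_moduleD(1)[OF assms(1)])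
  show ?thesis using assms(2)
  proof (induction A rule: infinite_finite_induct)
    case (insert a A)
    then show ?case using degree_moduleD[OF assms(1)]
      by (subst X.finsum_insert) (auto simp: Pi_def)
  qed (auto simp: degree_moduleD(3)[OF assms(1)])
qed

locale degree_ring = cring R for R (structure) +
  fixes Rg :: "int \<Rightarrow> 'a set"
  assumes degree_subgroup: "subgroup (Rg j) (add_monoid R)"
    and mult_degree: "x \<in> Rg i \<Longrightarrow> y \<in> Rg j \<Longrightarrow> x \<otimes> y \<in> Rg (i + j)"
    and one_degree: "\<one> \<in> Rg 0"
begin

lemma Rg_carrier: "x \<in> Rg j \<Longrightarrow> x \<in> carrier R"
  using subgroup.subset[OF degree_subgroup] by auto

lemma Rg_zero: "\<zero> \<in> Rg j"
  using subgroup.one_closed[OF degree_subgroup] by simp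

lemma Rg_add: "x \<in> Rg j \<Longrightarrow> y \<in> Rg j \<Longrightarrow> x \<oplus> y \<in> Rg j"
  using subgroup.m_closed[OF degree_subgroup] by simp

lemma Rg_neg: "x \<in> Rg j \<Longrightarrow> \<ominus> x \<in> Rg j"
  using subgroup.m_inv_closed[OF degree_subgroup] by (simp add: a_inv_def)

lemma degree_neg:
  assumes "degree_module R Rg X Xg" "x \<in> Xg j"
  shows "\<ominus>\<^bsub>X\<^esub> x \<in> Xg j"
proof -
  interpret X: module R X by (rule degree_moduleD(1)[OF assms(1)])
  have "(\<ominus> \<one>) \<odot>\<^bsub>X\<^esub> x \<in> Xg (0 + j)"
    by (rule degree_moduleD(5)[OF assms(1) Rg_neg[OF one_degree] assms(2)])
  then show ?thesis using degree_moduleD(2)[OF assms] by (simp add: X.smult_l_minus)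
qed

lemma graded_hom_add:
  assumes "degree_module R Rg Y Yg" "f \<in> graded_hom R X Xg Y Yg" "g \<in> graded_hom R X Xg Y Yg"
  shows "(\<lambda>x. f x \<oplus>\<^bsub>Y\<^esub> g x) \<in> graded_hom R X Xg Y Yg"
  using assms hom_add[of R Y f X g] by (intro graded_homI) (auto simp: graded_homD degree_moduleD)

lemma graded_hom_neg:
  assumes "degree_module R Rg Y Yg" "f \<in> graded_hom R X Xg Y Yg"
  shows "(\<lambda>x. \<ominus>\<^bsub>Y\<^esub> f x) \<in> graded_hom R X Xg Y Yg"
  using assms hom_minus_fun[of R Y f X] degree_neg[OF assms(1)]
  by (intro graded_homI) (auto simp: graded_homD degree_moduleD)

lemma graded_hom_diff:
  assumes "degree_module R Rg Y Yg" "f \<in> graded_hom R X Xg Y Yg" "g \<in> graded_hom R X Xg Y Yg"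
  shows "(\<lambda>x. f x \<ominus>\<^bsub>Y\<^esub> g x) \<in> graded_hom R X Xg Y Yg"
  using graded_hom_add[OF assms(1,2) graded_hom_neg[OF assms(1,3)]] by (simp add: a_minus_def)

lemma free_degree_module: "degree_module R Rg (free_module R n) (free_degree R Rg n a)"
proof -
  have "r \<otimes> x c \<in> Rg (i + j - a c)" if "r \<in> Rg i" "x c \<in> Rg (j - a c)" for r x c i j
    using mult_degree[OF that] by (simp add: algebra_simps)
  then show ?thesis
    by (auto simp: degree_module_def free_degree_def free_module_module free_module_simps
        free_add_closed free_smult_closed free_zero_closed Rg_zero Rg_add Rg_carrier)
qed

lemma basis_map_graded:
  assumes "degree_module R Rg X Xg" "\<And>c. c < n \<Longrightarrow> x c \<in> Xg (a c)"
  shows "basis_map X x n \<in> graded_hom R (free_module R n) (free_degree R Rg n a) X Xg"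
proof (rule graded_homI)
  note X = degree_moduleD[OF assms(1)]
  show "basis_map X x n \<in> module_hom R (free_module R n) X"
    by (rule basis_map_hom[OF X(1)]) (use assms X in auto)
  fix j r assume r: "r \<in> free_degree R Rg n a j"
  show "basis_map X x n r \<in> Xg j" unfolding basis_map_def
  proof (rule degree_finsum[OF assms(1)])
    fix c assume "c \<in> {..<n}"
    then have "r c \<in> Rg (j - a c)" "x c \<in> Xg (a c)" using r assms(2) by (auto simp: free_degree_def)
    from X(5)[OF this] show "r c \<odot>\<^bsub>X\<^esub> x c \<in> Xg j" by simp
  qed
qed

lemma unit_vector_degree: "c < n \<Longrightarrow> unit_vector R c \<in> free_degree R Rg n a (a c)"
  by (auto simp: free_degree_def unit_vector_carrier) (auto simp: unit_vector_def one_degree Rg_zero)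

text \<open>Homogeneous preimages of the images of the basis elements exist because \<open>p\<close> is strict.\<close>

lemma free_lift:
  assumes Y: "degree_module R Rg Y Yg" and Z: "degree_module R Rg Z Zg"
    and f: "f \<in> graded_hom R (free_module R n) (free_degree R Rg n a) Y Yg"
    and p: "p \<in> graded_hom R Z Zg Y Yg" and strict: "degree_strict Z Zg Yg p"
    and im: "f ` carrier (free_module R n) \<subseteq> p ` carrier Z"
  shows "\<exists>h\<in>graded_hom R (free_module R n) (free_degree R Rg n a) Z Zg.
    \<forall>x\<in>carrier (free_module R n). p (h x) = f x"
proof -
  have "\<exists>z. z \<in> Zg (a c) \<and> p z = f (unit_vector R c)" if "c < n" for c
  proof -
    have "f (unit_vector R c) \<in> p ` carrier Z" using im unit_vector_carrier[OF that] by blast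
    moreover have "f (unit_vector R c) \<in> Yg (a c)" by (rule graded_homD(2)[OF f unit_vector_degree[OF that]])
    ultimately have "f (unit_vector R c) \<in> p ` Zg (a c)" using strict unfolding degree_strict_def by blast
    then show ?thesis by auto
  qed
  then obtain z where z: "\<And>c. c < n \<Longrightarrow> z c \<in> Zg (a c)" "\<And>c. c < n \<Longrightarrow> p (z c) = f (unit_vector R c)"
    by metis
  let ?h = "basis_map Z z n"
  have h: "?h \<in> graded_hom R (free_module R n) (free_degree R Rg n a) Z Zg"
    by (rule basis_map_graded[OF Z z(1)])
  note Zm = degree_moduleD(1)[OF Z] and Ym = degree_moduleD(1)[OF Y]
  interpret Y: module R Y by (rule Ym)
  have zc: "\<And>c. c < n \<Longrightarrow> z c \<in> carrier Z" using z(1) degree_moduleD(2)[OF Z] by blast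
  show ?thesis
  proof (rule bexI[OF _ h], rule ballI)
    fix x assume x: "x \<in> carrier (free_module R n)"
    have ph: "(\<lambda>x. p (?h x)) \<in> module_hom R (free_module R n) Y"
      by (rule hom_comp[OF graded_homD(1)[OF h] graded_homD(1)[OF p]])
    have "p (?h x) = basis_map Y (\<lambda>c. p (?h (unit_vector R c))) n x"
      by (rule hom_free_expansion[OF Ym ph x])
    also have "\<dots> = basis_map Y (\<lambda>c. f (unit_vector R c)) n x"
      unfolding basis_map_def
    proof (rule Y.finsum_cong')
      show "(\<lambda>c. x c \<odot>\<^bsub>Y\<^esub> f (unit_vector R c)) \<in> {..<n} \<rightarrow> carrier Y"
        using free_carrier_in[OF x] graded_homD(3)[OF f unit_vector_carrier] by auto
    next
      fix c assume "c \<in> {..<n}"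
      then have "basis_map Z z n (unit_vector R c) = z c" "p (z c) = f (unit_vector R c)"
        using z(2) by (auto intro!: basis_map_unit_vector[OF Zm] zc)
      then show "x c \<odot>\<^bsub>Y\<^esub> p (\<Oplus>\<^bsub>Z\<^esub>b\<in>{..<n}. unit_vector R c b \<odot>\<^bsub>Z\<^esub> z b) = x c \<odot>\<^bsub>Y\<^esub> f (unit_vector R c)"
        by (simp add: basis_map_def)
    qed simp
    also have "\<dots> = f x" by (rule hom_free_expansion[OF Ym graded_homD(1)[OF f] x, symmetric])
    finally show "p (?h x) = f x" .
  qed
qed

text \<open>A graded projective is a summand of a free module with a degree preserving projection, so a lift
  for the free module restricts to one for the summand.\<close>

lemma projective_lift:
  assumes X: "graded_projective R Rg X Xg" and Y: "degree_module R Rg Y Yg" and Z: "degree_module R Rg Z Zg"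
    and f: "f \<in> graded_hom R X Xg Y Yg"
    and p: "p \<in> graded_hom R Z Zg Y Yg" and strict: "degree_strict Z Zg Yg p"
    and im: "f ` carrier X \<subseteq> p ` carrier Z"
  shows "\<exists>h\<in>graded_hom R X Xg Z Zg. \<forall>x\<in>carrier X. p (h x) = f x"
proof -
  obtain n a e q where e: "e \<in> graded_hom R (free_module R n) (free_degree R Rg n a) X Xg"
    and q: "q \<in> graded_hom R X Xg (free_module R n) (free_degree R Rg n a)"
    and eq: "\<And>x. x \<in> carrier X \<Longrightarrow> e (q x) = x"
    using X unfolding graded_projective_def by blast
  have "(\<lambda>x. f (e x)) ` carrier (free_module R n) \<subseteq> p ` carrier Z"
    using im graded_homD(3)[OF e] by blast
  from free_lift[OF Y Z graded_hom_comp[OF e f] p strict this]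
  obtain h where h: "h \<in> graded_hom R (free_module R n) (free_degree R Rg n a) Z Zg"
    and ph: "\<And>x. x \<in> carrier (free_module R n) \<Longrightarrow> p (h x) = f (e x)" by blast
  show ?thesis
    by (rule bexI[of _ "\<lambda>x. h (q x)"])
      (auto simp: graded_homD(3)[OF q] ph eq intro: graded_hom_comp[OF q h])
qed

lemma free_projective: "graded_projective R Rg (free_module R n) (free_degree R Rg n a)"
  unfolding graded_projective_def
  by (intro exI[of _ n] exI[of _ a] bexI[of _ "\<lambda>x. x"] graded_hom_id) auto

end

section \<open>Comparison of resolutions\<close>

definition graded_complex ::
  "('a, 'm) ring_scheme \<Rightarrow> (int \<Rightarrow> 'a set) \<Rightarrow> ('a, 'c) chain \<Rightarrow> (nat \<Rightarrow> int \<Rightarrow> 'c set) \<Rightarrow> bool" where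
  "graded_complex R Rg C Cg \<longleftrightarrow>
     (\<forall>i. degree_module R Rg (obj C i) (Cg i)) \<and>
     (\<forall>i. diff C i \<in> graded_hom R (obj C (Suc i)) (Cg (Suc i)) (obj C i) (Cg i)) \<and>
     (\<forall>i. \<forall>x\<in>carrier (obj C (Suc (Suc i))). diff C i (diff C (Suc i) x) = \<zero>\<^bsub>obj C i\<^esub>)"

text \<open>Strictness of the maps means that a boundary of degree \<open>j\<close> bounds an element of degree \<open>j\<close>; it
  makes the degree \<open>j\<close> pieces of the resolution exact as well.\<close>

definition strict_resolution ::
  "('a, 'm) ring_scheme \<Rightarrow> (int \<Rightarrow> 'a set) \<Rightarrow> ('a, 'c) chain \<Rightarrow> (nat \<Rightarrow> int \<Rightarrow> 'c set)
     \<Rightarrow> ('c \<Rightarrow> 'b) \<Rightarrow> ('a, 'b, 'n) module_scheme \<Rightarrow> (int \<Rightarrow> 'b set) \<Rightarrow> bool" where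
  "strict_resolution R Rg C Cg \<epsilon> M Mg \<longleftrightarrow>
     resolution R C \<epsilon> M \<and> graded_complex R Rg C Cg \<and> degree_module R Rg M Mg \<and>
     \<epsilon> \<in> graded_hom R (obj C 0) (Cg 0) M Mg \<and> degree_strict (obj C 0) (Cg 0) Mg \<epsilon> \<and>
     (\<forall>i. degree_strict (obj C (Suc i)) (Cg (Suc i)) (Cg i) (diff C i))"

lemma resolution_exact:
  assumes "resolution R C \<epsilon> M"
  shows "x \<in> carrier (obj C 0) \<Longrightarrow> \<epsilon> x = \<zero>\<^bsub>M\<^esub> \<Longrightarrow> \<exists>y\<in>carrier (obj C 1). diff C 0 y = x"
    and "x \<in> carrier (obj C (Suc i)) \<Longrightarrow> diff C i x = \<zero>\<^bsub>obj C i\<^esub>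
      \<Longrightarrow> \<exists>y\<in>carrier (obj C (Suc (Suc i))). diff C (Suc i) y = x"
    and "y \<in> carrier (obj C 1) \<Longrightarrow> \<epsilon> (diff C 0 y) = \<zero>\<^bsub>M\<^esub>"
    and "y \<in> carrier (obj C (Suc (Suc i))) \<Longrightarrow> diff C i (diff C (Suc i) y) = \<zero>\<^bsub>obj C i\<^esub>"
proof -
  from assms have 0: "{x \<in> carrier (obj C 0). \<epsilon> x = \<zero>\<^bsub>M\<^esub>} = boundaries C 0"
    and S: "\<And>i. cycles C (Suc i) = boundaries C (Suc i)" by (auto simp: resolution_def)
  show "\<exists>y\<in>carrier (obj C 1). diff C 0 y = x" if "x \<in> carrier (obj C 0)" "\<epsilon> x = \<zero>\<^bsub>M\<^esub>"
  proof -
    have "x \<in> boundaries C 0" unfolding 0[symmetric] using that by simp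
    then show ?thesis by (auto simp: boundaries_def)
  qed
  show "\<exists>y\<in>carrier (obj C (Suc (Suc i))). diff C (Suc i) y = x"
    if "x \<in> carrier (obj C (Suc i))" "diff C i x = \<zero>\<^bsub>obj C i\<^esub>"
  proof -
    have "x \<in> boundaries C (Suc i)" unfolding S[symmetric] using that by simp
    then show ?thesis by (auto simp: boundaries_def)
  qed
  show "\<epsilon> (diff C 0 y) = \<zero>\<^bsub>M\<^esub>" if "y \<in> carrier (obj C 1)"
  proof -
    have "diff C 0 y \<in> boundaries C 0" using that by (simp add: boundaries_def)
    then show ?thesis unfolding 0[symmetric] by simp
  qed
  show "diff C i (diff C (Suc i) y) = \<zero>\<^bsub>obj C i\<^esub>" if "y \<in> carrier (obj C (Suc (Suc i)))"
  proof -
    have "diff C (Suc i) y \<in> boundaries C (Suc i)" using that by (simp add: boundaries_def)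
    then show ?thesis unfolding S[symmetric] by simp
  qed
qed

context degree_ring
begin

text \<open>Stated for complexes \<open>C\<close> of projectives, because the connecting maps of the horseshoe construction arise
  from a \<open>C\<close> that is the part of a resolution in degrees \<open>\<ge> 1\<close>.\<close>

lemma chain_map_lift:
  assumes C: "graded_complex R Rg C Cg" and proj: "\<And>i. graded_projective R Rg (obj C i) (Cg i)"
    and D: "strict_resolution R Rg D Dg \<epsilon> M Mg"
    and f: "f \<in> graded_hom R (obj C 0) (Cg 0) M Mg"
    and f0: "\<And>x. x \<in> carrier (obj C 1) \<Longrightarrow> f (diff C 0 x) = \<zero>\<^bsub>M\<^esub>"
  shows "\<exists>\<phi>. (\<forall>i. \<phi> i \<in> graded_hom R (obj C i) (Cg i) (obj D i) (Dg i)) \<and>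
    (\<forall>x\<in>carrier (obj C 0). \<epsilon> (\<phi> 0 x) = f x) \<and>
    (\<forall>i. \<forall>x\<in>carrier (obj C (Suc i)). diff D i (\<phi> (Suc i) x) = \<phi> i (diff C i x))"
proof -
  have Cm: "\<And>i. degree_module R Rg (obj C i) (Cg i)"
    and Cd: "\<And>i. diff C i \<in> graded_hom R (obj C (Suc i)) (Cg (Suc i)) (obj C i) (Cg i)"
    and Cdd: "\<And>i x. x \<in> carrier (obj C (Suc (Suc i))) \<Longrightarrow> diff C i (diff C (Suc i) x) = \<zero>\<^bsub>obj C i\<^esub>"
    using C by (auto simp: graded_complex_def)
  have res: "resolution R D \<epsilon> M" and Dm: "\<And>i. degree_module R Rg (obj D i) (Dg i)"
    and Dd: "\<And>i. diff D i \<in> graded_hom R (obj D (Suc i)) (Dg (Suc i)) (obj D i) (Dg i)"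
    and Mm: "degree_module R Rg M Mg" and e: "\<epsilon> \<in> graded_hom R (obj D 0) (Dg 0) M Mg"
    and es: "degree_strict (obj D 0) (Dg 0) Mg \<epsilon>"
    and ds: "\<And>i. degree_strict (obj D (Suc i)) (Dg (Suc i)) (Dg i) (diff D i)"
    using D by (auto simp: strict_resolution_def graded_complex_def)
  note ex = resolution_exact[OF res]
  let ?P = "\<lambda>i h. h \<in> graded_hom R (obj C i) (Cg i) (obj D i) (Dg i) \<and>
     (i = 0 \<longrightarrow> (\<forall>x\<in>carrier (obj C 0). \<epsilon> (h x) = f x)) \<and>
     (\<forall>x\<in>carrier (obj C (Suc i)). h (diff C i x) \<in> diff D i ` carrier (obj D (Suc i)))"
  let ?Q = "\<lambda>i h h'. \<forall>x\<in>carrier (obj C (Suc i)). diff D i (h' x) = h (diff C i x)"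
  have "\<exists>\<phi>. \<forall>i. ?P i (\<phi> i) \<and> ?Q i (\<phi> i) (\<phi> (Suc i))"
  proof (rule dependent_nat_choice)
    have "f ` carrier (obj C 0) \<subseteq> \<epsilon> ` carrier (obj D 0)"
      using graded_homD(3)[OF f] res by (auto simp: resolution_def)
    from projective_lift[OF proj Mm Dm f e es this]
    obtain h where h: "h \<in> graded_hom R (obj C 0) (Cg 0) (obj D 0) (Dg 0)"
      and eh: "\<And>x. x \<in> carrier (obj C 0) \<Longrightarrow> \<epsilon> (h x) = f x" by blast
    have "h (diff C 0 x) \<in> diff D 0 ` carrier (obj D (Suc 0))" if "x \<in> carrier (obj C (Suc 0))" for x
    proof -
      have dx: "diff C 0 x \<in> carrier (obj C 0)" by (rule graded_homD(3)[OF Cd that])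
      have "\<epsilon> (h (diff C 0 x)) = \<zero>\<^bsub>M\<^esub>" using eh[OF dx] f0 that by simp
      with ex(1)[OF graded_homD(3)[OF h dx]] show ?thesis by force
    qed
    with h eh show "\<exists>h. ?P 0 h" by blast
  next
    fix h i assume P: "?P i h"
    then have h: "h \<in> graded_hom R (obj C i) (Cg i) (obj D i) (Dg i)"
      and hb: "\<And>x. x \<in> carrier (obj C (Suc i)) \<Longrightarrow> h (diff C i x) \<in> diff D i ` carrier (obj D (Suc i))" by auto
    have "(\<lambda>x. h (diff C i x)) ` carrier (obj C (Suc i)) \<subseteq> diff D i ` carrier (obj D (Suc i))"
      using hb by blast
    from projective_lift[OF proj Dm Dm graded_hom_comp[OF Cd h] Dd ds this]
    obtain h' where h': "h' \<in> graded_hom R (obj C (Suc i)) (Cg (Suc i)) (obj D (Suc i)) (Dg (Suc i))"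
      and eq: "\<And>x. x \<in> carrier (obj C (Suc i)) \<Longrightarrow> diff D i (h' x) = h (diff C i x)" by blast
    have "h' (diff C (Suc i) x) \<in> diff D (Suc i) ` carrier (obj D (Suc (Suc i)))"
      if "x \<in> carrier (obj C (Suc (Suc i)))" for x
    proof -
      have dx: "diff C (Suc i) x \<in> carrier (obj C (Suc i))" by (rule graded_homD(3)[OF Cd that])
      have "diff D i (h' (diff C (Suc i) x)) = \<zero>\<^bsub>obj D i\<^esub>"
        using eq[OF dx] Cdd[OF that]
          hom_zero[OF degree_moduleD(1)[OF Cm] degree_moduleD(1)[OF Dm] graded_homD(1)[OF h]] by simp
      with ex(2)[OF graded_homD(3)[OF h' dx]] show ?thesis by force
    qed
    with h' eq show "\<exists>h'. ?P (Suc i) h' \<and> ?Q i h h'" by blast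
  qed
  then obtain \<phi> where "\<And>i. ?P i (\<phi> i) \<and> ?Q i (\<phi> i) (\<phi> (Suc i))" by blast
  then show ?thesis by (intro exI[of _ \<phi>]) auto
qed

text \<open>The homotopy is built degree by degree: \<open>u - s d\<close> is a cycle in the exact complex \<open>D\<close>, hence lifts
  along the next differential.\<close>

lemma null_homotopy:
  assumes C: "graded_complex R Rg C Cg" and proj: "\<And>i. graded_projective R Rg (obj C i) (Cg i)"
    and D: "strict_resolution R Rg D Dg \<epsilon> M Mg"
    and u: "\<And>i. u i \<in> graded_hom R (obj C i) (Cg i) (obj D i) (Dg i)"
    and u0: "\<And>x. x \<in> carrier (obj C 0) \<Longrightarrow> \<epsilon> (u 0 x) = \<zero>\<^bsub>M\<^esub>"
    and ud: "\<And>i x. x \<in> carrier (obj C (Suc i)) \<Longrightarrow> diff D i (u (Suc i) x) = u i (diff C i x)"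
  shows "\<exists>s. (\<forall>i. s i \<in> graded_hom R (obj C i) (Cg i) (obj D (Suc i)) (Dg (Suc i))) \<and>
    (\<forall>x\<in>carrier (obj C 0). u 0 x = diff D 0 (s 0 x)) \<and>
    (\<forall>i. \<forall>x\<in>carrier (obj C (Suc i)). u (Suc i) x = diff D (Suc i) (s (Suc i) x) \<oplus>\<^bsub>obj D (Suc i)\<^esub> s i (diff C i x))"
proof -
  have Cm: "\<And>i. degree_module R Rg (obj C i) (Cg i)"
    and Cd: "\<And>i. diff C i \<in> graded_hom R (obj C (Suc i)) (Cg (Suc i)) (obj C i) (Cg i)"
    and Cdd: "\<And>i x. x \<in> carrier (obj C (Suc (Suc i))) \<Longrightarrow> diff C i (diff C (Suc i) x) = \<zero>\<^bsub>obj C i\<^esub>"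
    using C by (auto simp: graded_complex_def)
  have res: "resolution R D \<epsilon> M" and Dm: "\<And>i. degree_module R Rg (obj D i) (Dg i)"
    and Dd: "\<And>i. diff D i \<in> graded_hom R (obj D (Suc i)) (Dg (Suc i)) (obj D i) (Dg i)"
    and ds: "\<And>i. degree_strict (obj D (Suc i)) (Dg (Suc i)) (Dg i) (diff D i)"
    using D by (auto simp: strict_resolution_def graded_complex_def)
  note ex = resolution_exact[OF res]
  note Cmod = degree_moduleD(1)[OF Cm] and Dmod = degree_moduleD(1)[OF Dm]
  let ?P = "\<lambda>i s. s \<in> graded_hom R (obj C i) (Cg i) (obj D (Suc i)) (Dg (Suc i)) \<and>
     (i = 0 \<longrightarrow> (\<forall>x\<in>carrier (obj C 0). u 0 x = diff D 0 (s x))) \<and>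
     (\<forall>x\<in>carrier (obj C (Suc i)). diff D i (u (Suc i) x) = diff D i (s (diff C i x)))"
  let ?Q = "\<lambda>i s s'. \<forall>x\<in>carrier (obj C (Suc i)).
     u (Suc i) x = diff D (Suc i) (s' x) \<oplus>\<^bsub>obj D (Suc i)\<^esub> s (diff C i x)"
  have "\<exists>s. \<forall>i. ?P i (s i) \<and> ?Q i (s i) (s (Suc i))"
  proof (rule dependent_nat_choice)
    have "u 0 ` carrier (obj C 0) \<subseteq> diff D 0 ` carrier (obj D (Suc 0))"
      using ex(1)[OF graded_homD(3)[OF u] u0] by force
    from projective_lift[OF proj Dm Dm u Dd ds this]
    obtain s where s: "s \<in> graded_hom R (obj C 0) (Cg 0) (obj D (Suc 0)) (Dg (Suc 0))"
      and eq: "\<And>x. x \<in> carrier (obj C 0) \<Longrightarrow> diff D 0 (s x) = u 0 x" by blast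
    have "diff D 0 (u (Suc 0) x) = diff D 0 (s (diff C 0 x))" if "x \<in> carrier (obj C (Suc 0))" for x
      using ud[OF that] eq[OF graded_homD(3)[OF Cd that]] by simp
    with s eq show "\<exists>s. ?P 0 s" by (intro exI[of _ s]) auto
  next
    fix s i assume "?P i s"
    then have s: "s \<in> graded_hom R (obj C i) (Cg i) (obj D (Suc i)) (Dg (Suc i))"
      and eq: "\<And>x. x \<in> carrier (obj C (Suc i)) \<Longrightarrow> diff D i (u (Suc i) x) = diff D i (s (diff C i x))" by auto
    let ?w = "\<lambda>x. u (Suc i) x \<ominus>\<^bsub>obj D (Suc i)\<^esub> s (diff C i x)"
    have w: "?w \<in> graded_hom R (obj C (Suc i)) (Cg (Suc i)) (obj D (Suc i)) (Dg (Suc i))"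
      by (rule graded_hom_diff[OF Dm u graded_hom_comp[OF Cd s]])
    interpret D1: module R "obj D (Suc i)" by (rule Dmod)
    interpret D0: module R "obj D i" by (rule Dmod)
    have "?w ` carrier (obj C (Suc i)) \<subseteq> diff D (Suc i) ` carrier (obj D (Suc (Suc i)))"
    proof (rule image_subsetI)
      fix x assume x: "x \<in> carrier (obj C (Suc i))"
      have 1: "u (Suc i) x \<in> carrier (obj D (Suc i))" by (rule graded_homD(3)[OF u x])
      have 2: "s (diff C i x) \<in> carrier (obj D (Suc i))" by (rule graded_homD(3)[OF s graded_homD(3)[OF Cd x]])
      have "diff D i (?w x) = \<zero>\<^bsub>obj D i\<^esub>"
        using hom_minus[OF Dmod Dmod graded_homD(1)[OF Dd] 1 2] eq[OF x] graded_homD(3)[OF Dd 2]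
        by (simp add: a_minus_def D0.r_neg)
      from ex(2)[OF graded_homD(3)[OF w x] this]
      show "?w x \<in> diff D (Suc i) ` carrier (obj D (Suc (Suc i)))" by force
    qed
    from projective_lift[OF proj Dm Dm w Dd ds this]
    obtain s' where s': "s' \<in> graded_hom R (obj C (Suc i)) (Cg (Suc i)) (obj D (Suc (Suc i))) (Dg (Suc (Suc i)))"
      and eq': "\<And>x. x \<in> carrier (obj C (Suc i)) \<Longrightarrow> diff D (Suc i) (s' x) = ?w x" by blast
    have Q: "?Q i s s'"
    proof
      fix x assume x: "x \<in> carrier (obj C (Suc i))"
      have 1: "u (Suc i) x \<in> carrier (obj D (Suc i))" by (rule graded_homD(3)[OF u x])
      have 2: "s (diff C i x) \<in> carrier (obj D (Suc i))" by (rule graded_homD(3)[OF s graded_homD(3)[OF Cd x]])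
      show "u (Suc i) x = diff D (Suc i) (s' x) \<oplus>\<^bsub>obj D (Suc i)\<^esub> s (diff C i x)"
        using eq'[OF x] 1 2 by (simp add: a_minus_def D1.a_assoc D1.l_neg)
    qed
    have "diff D (Suc i) (u (Suc (Suc i)) x) = diff D (Suc i) (s' (diff C (Suc i) x))"
      if x: "x \<in> carrier (obj C (Suc (Suc i)))" for x
    proof -
      have dx: "diff C (Suc i) x \<in> carrier (obj C (Suc i))" by (rule graded_homD(3)[OF Cd x])
      have "s (diff C i (diff C (Suc i) x)) = \<zero>\<^bsub>obj D (Suc i)\<^esub>"
        using Cdd[OF x] hom_zero[OF Cmod Dmod graded_homD(1)[OF s]] by simp
      with Q dx ud[OF x] graded_homD(3)[OF Dd graded_homD(3)[OF s' dx]] show ?thesis by simp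
    qed
    with s' Q show "\<exists>s'. ?P (Suc i) s' \<and> ?Q i s s'" by blast
  qed
  then obtain s where "\<And>i. ?P i (s i) \<and> ?Q i (s i) (s (Suc i))" by blast
  then show ?thesis by (intro exI[of _ s]) auto
qed

lemma homotopic_to_identity:
  assumes C: "strict_resolution R Rg C Cg \<epsilon> M Mg" and proj: "\<And>i. graded_projective R Rg (obj C i) (Cg i)"
    and f: "\<And>i. f i \<in> graded_hom R (obj C i) (Cg i) (obj C i) (Cg i)"
    and f0: "\<And>x. x \<in> carrier (obj C 0) \<Longrightarrow> \<epsilon> (f 0 x) = \<epsilon> x"
    and fd: "\<And>i x. x \<in> carrier (obj C (Suc i)) \<Longrightarrow> diff C i (f (Suc i) x) = f i (diff C i x)"
  shows "\<exists>s. (\<forall>i. s i \<in> graded_hom R (obj C i) (Cg i) (obj C (Suc i)) (Cg (Suc i))) \<and>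
    (\<forall>x\<in>carrier (obj C 0). x = f 0 x \<oplus>\<^bsub>obj C 0\<^esub> diff C 0 (s 0 x)) \<and>
    (\<forall>i. \<forall>x\<in>carrier (obj C (Suc i)). x = f (Suc i) x \<oplus>\<^bsub>obj C (Suc i)\<^esub>
        (diff C (Suc i) (s (Suc i) x) \<oplus>\<^bsub>obj C (Suc i)\<^esub> s i (diff C i x)))"
proof -
  have Cc: "graded_complex R Rg C Cg" and Ce: "\<epsilon> \<in> graded_hom R (obj C 0) (Cg 0) M Mg"
    and Cr: "resolution R C \<epsilon> M" and Mm: "module R M"
    using C by (auto simp: strict_resolution_def degree_module_def)
  have Cm: "\<And>i. degree_module R Rg (obj C i) (Cg i)"
    and Cd: "\<And>i. diff C i \<in> graded_hom R (obj C (Suc i)) (Cg (Suc i)) (obj C i) (Cg i)"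
    using Cc by (auto simp: graded_complex_def)
  interpret M: module R M by (rule Mm)
  let ?u = "\<lambda>i x. x \<ominus>\<^bsub>obj C i\<^esub> f i x"
  have u: "?u i \<in> graded_hom R (obj C i) (Cg i) (obj C i) (Cg i)" for i
    by (rule graded_hom_diff[OF Cm graded_hom_id f])
  have u0: "\<epsilon> (?u 0 x) = \<zero>\<^bsub>M\<^esub>" if x: "x \<in> carrier (obj C 0)" for x
    using hom_minus[OF degree_moduleD(1)[OF Cm] Mm graded_homD(1)[OF Ce] x graded_homD(3)[OF f x]]
      f0[OF x] graded_homD(3)[OF Ce x]
    by (simp add: a_minus_def M.r_neg)
  have ud: "diff C i (?u (Suc i) x) = ?u i (diff C i x)" if x: "x \<in> carrier (obj C (Suc i))" for i x
    using hom_minus[OF degree_moduleD(1)[OF Cm] degree_moduleD(1)[OF Cm] graded_homD(1)[OF Cd] x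
        graded_homD(3)[OF f x]] fd[OF x] by simp
  obtain s where s: "\<And>i. s i \<in> graded_hom R (obj C i) (Cg i) (obj C (Suc i)) (Cg (Suc i))"
    "\<And>x. x \<in> carrier (obj C 0) \<Longrightarrow> ?u 0 x = diff C 0 (s 0 x)"
    "\<And>i x. x \<in> carrier (obj C (Suc i)) \<Longrightarrow> ?u (Suc i) x = diff C (Suc i) (s (Suc i) x) \<oplus>\<^bsub>obj C (Suc i)\<^esub> s i (diff C i x)"
    using null_homotopy[OF Cc proj C u u0 ud] by blast
  have split: "x = f i x \<oplus>\<^bsub>obj C i\<^esub> ?u i x" if x: "x \<in> carrier (obj C i)" for i x
  proof -
    interpret C: module R "obj C i" by (rule degree_moduleD(1)[OF Cm])
    have "f i x \<in> carrier (obj C i)" by (rule graded_homD(3)[OF f x])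
    then show ?thesis using x by (simp add: a_minus_def C.a_ac C.r_neg2 C.r_neg)
  qed
  have "x = f 0 x \<oplus>\<^bsub>obj C 0\<^esub> diff C 0 (s 0 x)" if x: "x \<in> carrier (obj C 0)" for x
    using split[OF x] s(2)[OF x] by simp
  moreover have "x = f (Suc i) x \<oplus>\<^bsub>obj C (Suc i)\<^esub>
        (diff C (Suc i) (s (Suc i) x) \<oplus>\<^bsub>obj C (Suc i)\<^esub> s i (diff C i x))"
    if x: "x \<in> carrier (obj C (Suc i))" for i x
    using split[OF x] s(3)[OF x] by simp
  ultimately show ?thesis using s(1) by blast
qed

text \<open>Lift the identity of \<open>M\<close> in both directions; the two composites lift the identity, like the
  identity maps do, and are therefore homotopic to them.\<close>

lemma homotopy_equivalence:
  assumes C: "strict_resolution R Rg C Cg \<epsilon> M Mg" and projC: "\<And>i. graded_projective R Rg (obj C i) (Cg i)"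
    and D: "strict_resolution R Rg D Dg \<delta> M Mg" and projD: "\<And>i. graded_projective R Rg (obj D i) (Dg i)"
  obtains \<phi> \<psi> s u where
    "\<And>i. \<phi> i \<in> graded_hom R (obj C i) (Cg i) (obj D i) (Dg i)"
    "\<And>i. \<psi> i \<in> graded_hom R (obj D i) (Dg i) (obj C i) (Cg i)"
    "\<And>i x. x \<in> carrier (obj C (Suc i)) \<Longrightarrow> diff D i (\<phi> (Suc i) x) = \<phi> i (diff C i x)"
    "\<And>i x. x \<in> carrier (obj D (Suc i)) \<Longrightarrow> diff C i (\<psi> (Suc i) x) = \<psi> i (diff D i x)"
    "\<And>i. s i \<in> graded_hom R (obj C i) (Cg i) (obj C (Suc i)) (Cg (Suc i))"
    "\<And>x. x \<in> carrier (obj C 0) \<Longrightarrow> x = \<psi> 0 (\<phi> 0 x) \<oplus>\<^bsub>obj C 0\<^esub> diff C 0 (s 0 x)"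
    "\<And>i x. x \<in> carrier (obj C (Suc i)) \<Longrightarrow> x = \<psi> (Suc i) (\<phi> (Suc i) x) \<oplus>\<^bsub>obj C (Suc i)\<^esub>
        (diff C (Suc i) (s (Suc i) x) \<oplus>\<^bsub>obj C (Suc i)\<^esub> s i (diff C i x))"
    "\<And>i. u i \<in> graded_hom R (obj D i) (Dg i) (obj D (Suc i)) (Dg (Suc i))"
    "\<And>x. x \<in> carrier (obj D 0) \<Longrightarrow> x = \<phi> 0 (\<psi> 0 x) \<oplus>\<^bsub>obj D 0\<^esub> diff D 0 (u 0 x)"
    "\<And>i x. x \<in> carrier (obj D (Suc i)) \<Longrightarrow> x = \<phi> (Suc i) (\<psi> (Suc i) x) \<oplus>\<^bsub>obj D (Suc i)\<^esub>
        (diff D (Suc i) (u (Suc i) x) \<oplus>\<^bsub>obj D (Suc i)\<^esub> u i (diff D i x))"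
proof -
  have Cc: "graded_complex R Rg C Cg" and Ce: "\<epsilon> \<in> graded_hom R (obj C 0) (Cg 0) M Mg"
    and Cr: "resolution R C \<epsilon> M"
    using C by (auto simp: strict_resolution_def)
  have Dc: "graded_complex R Rg D Dg" and De: "\<delta> \<in> graded_hom R (obj D 0) (Dg 0) M Mg"
    and Dr: "resolution R D \<delta> M"
    using D by (auto simp: strict_resolution_def)
  obtain \<phi> where \<phi>: "\<And>i. \<phi> i \<in> graded_hom R (obj C i) (Cg i) (obj D i) (Dg i)"
      "\<And>x. x \<in> carrier (obj C 0) \<Longrightarrow> \<delta> (\<phi> 0 x) = \<epsilon> x"
      "\<And>i x. x \<in> carrier (obj C (Suc i)) \<Longrightarrow> diff D i (\<phi> (Suc i) x) = \<phi> i (diff C i x)"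
    using chain_map_lift[OF Cc projC D Ce resolution_exact(3)[OF Cr]] by blast
  obtain \<psi> where \<psi>: "\<And>i. \<psi> i \<in> graded_hom R (obj D i) (Dg i) (obj C i) (Cg i)"
      "\<And>x. x \<in> carrier (obj D 0) \<Longrightarrow> \<epsilon> (\<psi> 0 x) = \<delta> x"
      "\<And>i x. x \<in> carrier (obj D (Suc i)) \<Longrightarrow> diff C i (\<psi> (Suc i) x) = \<psi> i (diff D i x)"
    using chain_map_lift[OF Dc projD C De resolution_exact(3)[OF Dr]] by blast
  have "\<exists>s. (\<forall>i. s i \<in> graded_hom R (obj C i) (Cg i) (obj C (Suc i)) (Cg (Suc i))) \<and>
    (\<forall>x\<in>carrier (obj C 0). x = \<psi> 0 (\<phi> 0 x) \<oplus>\<^bsub>obj C 0\<^esub> diff C 0 (s 0 x)) \<and>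
    (\<forall>i. \<forall>x\<in>carrier (obj C (Suc i)). x = \<psi> (Suc i) (\<phi> (Suc i) x) \<oplus>\<^bsub>obj C (Suc i)\<^esub>
        (diff C (Suc i) (s (Suc i) x) \<oplus>\<^bsub>obj C (Suc i)\<^esub> s i (diff C i x)))"
    by (rule homotopic_to_identity[OF C projC graded_hom_comp[OF \<phi>(1) \<psi>(1)]])
      (simp_all add: \<phi>(2,3) \<psi>(2,3) graded_homD(3)[OF \<phi>(1)])
  moreover have "\<exists>u. (\<forall>i. u i \<in> graded_hom R (obj D i) (Dg i) (obj D (Suc i)) (Dg (Suc i))) \<and>
    (\<forall>x\<in>carrier (obj D 0). x = \<phi> 0 (\<psi> 0 x) \<oplus>\<^bsub>obj D 0\<^esub> diff D 0 (u 0 x)) \<and>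
    (\<forall>i. \<forall>x\<in>carrier (obj D (Suc i)). x = \<phi> (Suc i) (\<psi> (Suc i) x) \<oplus>\<^bsub>obj D (Suc i)\<^esub>
        (diff D (Suc i) (u (Suc i) x) \<oplus>\<^bsub>obj D (Suc i)\<^esub> u i (diff D i x)))"
    by (rule homotopic_to_identity[OF D projD graded_hom_comp[OF \<psi>(1) \<phi>(1)]])
      (simp_all add: \<phi>(2,3) \<psi>(2,3) graded_homD(3)[OF \<psi>(1)])
  ultimately obtain s u where
    s: "\<And>i. s i \<in> graded_hom R (obj C i) (Cg i) (obj C (Suc i)) (Cg (Suc i))"
    "\<And>x. x \<in> carrier (obj C 0) \<Longrightarrow> x = \<psi> 0 (\<phi> 0 x) \<oplus>\<^bsub>obj C 0\<^esub> diff C 0 (s 0 x)"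
    "\<And>i x. x \<in> carrier (obj C (Suc i)) \<Longrightarrow> x = \<psi> (Suc i) (\<phi> (Suc i) x) \<oplus>\<^bsub>obj C (Suc i)\<^esub>
        (diff C (Suc i) (s (Suc i) x) \<oplus>\<^bsub>obj C (Suc i)\<^esub> s i (diff C i x))"
    and u: "\<And>i. u i \<in> graded_hom R (obj D i) (Dg i) (obj D (Suc i)) (Dg (Suc i))"
    "\<And>x. x \<in> carrier (obj D 0) \<Longrightarrow> x = \<phi> 0 (\<psi> 0 x) \<oplus>\<^bsub>obj D 0\<^esub> diff D 0 (u 0 x)"
    "\<And>i x. x \<in> carrier (obj D (Suc i)) \<Longrightarrow> x = \<phi> (Suc i) (\<psi> (Suc i) x) \<oplus>\<^bsub>obj D (Suc i)\<^esub>
        (diff D (Suc i) (u (Suc i) x) \<oplus>\<^bsub>obj D (Suc i)\<^esub> u i (diff D i x))"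
    by blast
  show thesis by (rule that) (fact \<phi>(1) \<psi>(1) \<phi>(3) \<psi>(3) s u)+
qed

end

section \<open>Quotients and homology\<close>

lemma submodule_abelian_subgroup:
  assumes "submodule R N X"
  shows "abelian_subgroup N X" "subgroup N (add_monoid X)"
proof -
  interpret X: module R X using assms by (simp add: submodule_def)
  have N: "N \<subseteq> carrier X" "\<zero>\<^bsub>X\<^esub> \<in> N" using assms by (auto simp: submodule_def)
  show "subgroup N (add_monoid X)"
    by (rule X.add.subgroupI)
      (use N assms submodule_minus_closed[OF assms] in \<open>auto simp: submodule_def a_inv_def[symmetric]\<close>)
  then show "abelian_subgroup N X"
    by (intro abelian_subgroupI3 X.abelian_group_axioms) (simp add: additive_subgroup_def)
qed

lemma coset_submodule_record: "N +>\<^bsub>X\<lparr>carrier := A\<rparr>\<^esub> x = N +>\<^bsub>X\<^esub> x"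
  by (simp add: a_r_coset_def r_coset_def)

lemma coset_eq_iff:
  assumes "submodule R N X" "x \<in> carrier X" "y \<in> carrier X"
  shows "N +>\<^bsub>X\<^esub> x = N +>\<^bsub>X\<^esub> y \<longleftrightarrow> (\<exists>b\<in>N. x = y \<oplus>\<^bsub>X\<^esub> b)"
proof -
  interpret X: module R X using assms by (simp add: submodule_def)
  interpret N: abelian_subgroup N X by (rule submodule_abelian_subgroup[OF assms(1)])
  have N: "N \<subseteq> carrier X" by (rule N.a_subset)
  show ?thesis
  proof
    assume eq: "N +>\<^bsub>X\<^esub> x = N +>\<^bsub>X\<^esub> y"
    have "\<zero>\<^bsub>X\<^esub> \<oplus>\<^bsub>X\<^esub> x \<in> N +>\<^bsub>X\<^esub> x" by (rule X.a_rcosI) (use N assms in auto)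
    then have "x \<in> N +>\<^bsub>X\<^esub> y" using eq assms by simp
    then obtain b where "b \<in> N" "x = b \<oplus>\<^bsub>X\<^esub> y" by (auto simp: a_r_coset_def')
    then show "\<exists>b\<in>N. x = y \<oplus>\<^bsub>X\<^esub> b" using N assms by (auto simp: X.a_comm subset_iff)
  next
    assume "\<exists>b\<in>N. x = y \<oplus>\<^bsub>X\<^esub> b"
    then obtain b where "b \<in> N" "x = b \<oplus>\<^bsub>X\<^esub> y" using N assms by (auto simp: X.a_comm subset_iff)
    then have "x \<in> N +>\<^bsub>X\<^esub> y" using N assms by (auto intro: X.a_rcosI)
    from X.a_repr_independence[OF this assms(3) submodule_abelian_subgroup(2)[OF assms(1)]]
    show "N +>\<^bsub>X\<^esub> x = N +>\<^bsub>X\<^esub> y" by simp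
  qed
qed

lemma coset_eq_self_iff:
  assumes "submodule R N X" "x \<in> carrier X"
  shows "N +>\<^bsub>X\<^esub> x = N \<longleftrightarrow> x \<in> N"
proof -
  interpret X: module R X using assms by (simp add: submodule_def)
  have N: "N \<subseteq> carrier X" using assms by (simp add: submodule_def)
  have "N = N +>\<^bsub>X\<^esub> \<zero>\<^bsub>X\<^esub>" using N by simp
  then have "N +>\<^bsub>X\<^esub> x = N \<longleftrightarrow> N +>\<^bsub>X\<^esub> x = N +>\<^bsub>X\<^esub> \<zero>\<^bsub>X\<^esub>" by simp
  also have "\<dots> \<longleftrightarrow> (\<exists>b\<in>N. x = \<zero>\<^bsub>X\<^esub> \<oplus>\<^bsub>X\<^esub> b)" by (rule coset_eq_iff[OF assms]) simp
  also have "\<dots> \<longleftrightarrow> x \<in> N" using N by (auto simp: subset_iff)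
  finally show ?thesis .
qed

text \<open>The differential and the scalar multiplication of a quotient are given by images of cosets, filled
  up to cosets again; this identifies them with the maps induced on representatives.\<close>

lemma coset_image_add:
  assumes "submodule R N Y" "f \<in> carrier X \<rightarrow> carrier Y" "submodule R L X" "x \<in> carrier X"
    and add: "\<And>x y. x \<in> carrier X \<Longrightarrow> y \<in> carrier X \<Longrightarrow> f (x \<oplus>\<^bsub>X\<^esub> y) = f x \<oplus>\<^bsub>Y\<^esub> f y"
    and L: "f ` L \<subseteq> N"
  shows "N <+>\<^bsub>Y\<^esub> (f ` (L +>\<^bsub>X\<^esub> x)) = N +>\<^bsub>Y\<^esub> f x"
proof -
  interpret Y: module R Y using assms by (simp add: submodule_def)
  interpret X: module R X using assms by (simp add: submodule_def)
  have N: "N \<subseteq> carrier Y" using assms by (simp add: submodule_def)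
  have L': "L \<subseteq> carrier X" "\<zero>\<^bsub>X\<^esub> \<in> L" using assms by (auto simp: submodule_def)
  have fx: "f x \<in> carrier Y" using assms by auto
  have ff: "\<And>l. l \<in> L \<Longrightarrow> f (l \<oplus>\<^bsub>X\<^esub> x) = f l \<oplus>\<^bsub>Y\<^esub> f x" using add L' assms(4) by auto
  have "f \<zero>\<^bsub>X\<^esub> \<oplus>\<^bsub>Y\<^esub> f x = f x" using ff[OF L'(2)] assms(4) by simp
  show ?thesis
  proof (intro equalityI subsetI)
    fix y assume "y \<in> N <+>\<^bsub>Y\<^esub> (f ` (L +>\<^bsub>X\<^esub> x))"
    then obtain b l where bl: "b \<in> N" "l \<in> L" "y = b \<oplus>\<^bsub>Y\<^esub> (f l \<oplus>\<^bsub>Y\<^esub> f x)"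
      using ff by (auto simp: set_add_def' a_r_coset_def')
    then have "f l \<in> N" using L by auto
    with bl fx N have "y = (b \<oplus>\<^bsub>Y\<^esub> f l) \<oplus>\<^bsub>Y\<^esub> f x" by (simp add: Y.a_assoc subset_iff)
    moreover have "b \<oplus>\<^bsub>Y\<^esub> f l \<in> N" using \<open>f l \<in> N\<close> bl assms(1) by (simp add: submodule_def)
    ultimately show "y \<in> N +>\<^bsub>Y\<^esub> f x" by (auto simp: a_r_coset_def')
  next
    fix y assume "y \<in> N +>\<^bsub>Y\<^esub> f x"
    then obtain b where b: "b \<in> N" "y = b \<oplus>\<^bsub>Y\<^esub> f x" by (auto simp: a_r_coset_def')
    have "\<zero>\<^bsub>X\<^esub> \<oplus>\<^bsub>X\<^esub> x \<in> L +>\<^bsub>X\<^esub> x" using L' by (auto simp: a_r_coset_def')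
    then have "f x \<in> f ` (L +>\<^bsub>X\<^esub> x)" using assms(4) by simp
    with b show "y \<in> N <+>\<^bsub>Y\<^esub> (f ` (L +>\<^bsub>X\<^esub> x))" unfolding set_add_def' by blast
  qed
qed

lemma surj_hom_module:
  assumes X: "module R X" and f: "f \<in> module_hom R X Y" and surj: "f ` carrier X = carrier Y"
    and zero: "f \<zero>\<^bsub>X\<^esub> = \<zero>\<^bsub>Y\<^esub>"
  shows "module R Y"
proof -
  interpret X: module R X by fact
  have cl: "\<And>x. x \<in> carrier X \<Longrightarrow> f x \<in> carrier Y" using surj by auto
  note add = module_hom_add[OF f, symmetric] and sm = module_hom_smult[OF f, symmetric]
  have all: "(\<forall>y\<in>carrier Y. P y) \<longleftrightarrow> (\<forall>x\<in>carrier X. P (f x))" for P unfolding surj[symmetric] by blast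
  show ?thesis
  proof (rule module_criteria)
    show "cring R" by (rule X.R.cring_axioms)
    show "\<zero>\<^bsub>Y\<^esub> \<in> carrier Y" using cl[of "\<zero>\<^bsub>X\<^esub>"] zero by simp
    show "\<forall>v\<in>carrier Y. \<exists>w\<in>carrier Y. v \<oplus>\<^bsub>Y\<^esub> w = \<zero>\<^bsub>Y\<^esub>"
      unfolding all
    proof
      fix x assume x: "x \<in> carrier X"
      show "\<exists>w\<in>carrier Y. f x \<oplus>\<^bsub>Y\<^esub> w = \<zero>\<^bsub>Y\<^esub>"
        by (rule bexI[of _ "f (\<ominus>\<^bsub>X\<^esub> x)"]) (use x in \<open>auto simp: add zero X.r_neg intro: cl\<close>)
    qed
    show "\<forall>v w. v \<in> carrier Y \<and> w \<in> carrier Y \<longrightarrow> v \<oplus>\<^bsub>Y\<^esub> w \<in> carrier Y"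
      using cl unfolding surj[symmetric] by (auto simp: add)
    show "\<forall>v w. v \<in> carrier Y \<and> w \<in> carrier Y \<longrightarrow> v \<oplus>\<^bsub>Y\<^esub> w = w \<oplus>\<^bsub>Y\<^esub> v"
      unfolding surj[symmetric] by (auto simp: add X.a_comm)
    show "\<forall>v w x. v \<in> carrier Y \<and> w \<in> carrier Y \<and> x \<in> carrier Y \<longrightarrow>
        v \<oplus>\<^bsub>Y\<^esub> w \<oplus>\<^bsub>Y\<^esub> x = v \<oplus>\<^bsub>Y\<^esub> (w \<oplus>\<^bsub>Y\<^esub> x)"
      unfolding surj[symmetric] by (auto simp: add X.a_assoc)
    show "\<forall>c v. c \<in> carrier R \<and> v \<in> carrier Y \<longrightarrow> c \<odot>\<^bsub>Y\<^esub> v \<in> carrier Y"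
      unfolding surj[symmetric] by (auto simp: sm)
    show "\<forall>v\<in>carrier Y. v \<oplus>\<^bsub>Y\<^esub> \<zero>\<^bsub>Y\<^esub> = v"
      unfolding surj[symmetric] zero[symmetric] by (auto simp: add)
    show "\<forall>a b v. a \<in> carrier R \<and> b \<in> carrier R \<and> v \<in> carrier Y \<longrightarrow>
        (a \<otimes>\<^bsub>R\<^esub> b) \<odot>\<^bsub>Y\<^esub> v = a \<odot>\<^bsub>Y\<^esub> (b \<odot>\<^bsub>Y\<^esub> v)"
      unfolding surj[symmetric] by (auto simp: sm X.smult_assoc1)
    show "\<forall>v\<in>carrier Y. \<one>\<^bsub>R\<^esub> \<odot>\<^bsub>Y\<^esub> v = v" unfolding surj[symmetric] by (auto simp: sm)
    show "\<forall>a b v. a \<in> carrier R \<and> b \<in> carrier R \<and> v \<in> carrier Y \<longrightarrow>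
        (a \<oplus>\<^bsub>R\<^esub> b) \<odot>\<^bsub>Y\<^esub> v = a \<odot>\<^bsub>Y\<^esub> v \<oplus>\<^bsub>Y\<^esub> b \<odot>\<^bsub>Y\<^esub> v"
      unfolding surj[symmetric] by (auto simp: sm add X.smult_l_distr)
    show "\<forall>a v w. a \<in> carrier R \<and> v \<in> carrier Y \<and> w \<in> carrier Y \<longrightarrow>
        a \<odot>\<^bsub>Y\<^esub> (v \<oplus>\<^bsub>Y\<^esub> w) = a \<odot>\<^bsub>Y\<^esub> v \<oplus>\<^bsub>Y\<^esub> a \<odot>\<^bsub>Y\<^esub> w"
      unfolding surj[symmetric] by (auto simp: sm add X.smult_r_distr)
  qed
qed

lemma
  assumes "submodule R N X"
  shows quotient_module_hom: "(\<lambda>x. N +>\<^bsub>X\<^esub> x) \<in> module_hom R X (quotient_module X N)"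
    and quotient_module_carrier: "carrier (quotient_module X N) = (\<lambda>x. N +>\<^bsub>X\<^esub> x) ` carrier X"
    and quotient_module_module: "module R (quotient_module X N)"
    and quotient_module_zero: "\<zero>\<^bsub>quotient_module X N\<^esub> = N"
proof -
  interpret X: module R X using assms by (simp add: submodule_def)
  interpret N: abelian_subgroup N X by (rule submodule_abelian_subgroup[OF assms(1)])
  show c: "carrier (quotient_module X N) = (\<lambda>x. N +>\<^bsub>X\<^esub> x) ` carrier X"
    by (auto simp: quotient_module_def A_RCOSETS_def')
  show z: "\<zero>\<^bsub>quotient_module X N\<^esub> = N" by (simp add: quotient_module_def)
  show h: "(\<lambda>x. N +>\<^bsub>X\<^esub> x) \<in> module_hom R X (quotient_module X N)"
  proof (rule module_homI)
    fix x assume x: "x \<in> carrier X"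
    show "N +>\<^bsub>X\<^esub> x \<in> carrier (quotient_module X N)" using x c by auto
    show "N +>\<^bsub>X\<^esub> (x \<oplus>\<^bsub>X\<^esub> y) = (N +>\<^bsub>X\<^esub> x) \<oplus>\<^bsub>quotient_module X N\<^esub> (N +>\<^bsub>X\<^esub> y)"
      if "y \<in> carrier X" for y
      using N.a_rcos_sum[OF x that] by (simp add: quotient_module_def)
    fix r assume r: "r \<in> carrier R"
    have "N <+>\<^bsub>X\<^esub> ((\<lambda>x. r \<odot>\<^bsub>X\<^esub> x) ` (N +>\<^bsub>X\<^esub> x)) = N +>\<^bsub>X\<^esub> (r \<odot>\<^bsub>X\<^esub> x)"
      by (rule coset_image_add[OF assms _ assms x])
        (use r assms in \<open>auto simp: X.smult_r_distr submodule_def\<close>)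
    then show "N +>\<^bsub>X\<^esub> (r \<odot>\<^bsub>X\<^esub> x) = r \<odot>\<^bsub>quotient_module X N\<^esub> (N +>\<^bsub>X\<^esub> x)"
      by (simp add: quotient_module_def)
  qed
  have "N +>\<^bsub>X\<^esub> \<zero>\<^bsub>X\<^esub> = N" using N.a_subset by simp
  with surj_hom_module[OF X.module_axioms h c[symmetric]] z
  show "module R (quotient_module X N)" by simp
qed

text \<open>The homology of \<open>A/B\<close> is a quotient of quotients, whose elements are cosets of cosets. The relative
  cycles and boundaries describe it by elements of \<open>C\<close>.\<close>

locale complex_pair = cring R for R (structure) +
  fixes C :: "('a, 'c) chain" and A B :: "nat \<Rightarrow> 'c set"
  assumes A_submodule: "submodule R (A i) (obj C i)"
    and B_submodule: "submodule R (B i) (obj C i)"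
    and B_subset: "B i \<subseteq> A i"
    and diff_hom: "diff C i \<in> module_hom R (obj C (Suc i)) (obj C i)"
    and diff_A: "diff C i ` A (Suc i) \<subseteq> A i"
    and diff_B: "diff C i ` B (Suc i) \<subseteq> B i"
    and diff_diff: "x \<in> carrier (obj C (Suc (Suc i))) \<Longrightarrow> diff C i (diff C (Suc i) x) = \<zero>\<^bsub>obj C i\<^esub>"
begin

definition relative_cycles :: "nat \<Rightarrow> 'c set" where
  "relative_cycles i = {x \<in> A i. \<forall>k. i = Suc k \<longrightarrow> diff C k x \<in> B k}"

definition relative_boundaries :: "nat \<Rightarrow> 'c set" where
  "relative_boundaries i = {x. \<exists>y\<in>A (Suc i). \<exists>b\<in>B i. x = diff C i y \<oplus>\<^bsub>obj C i\<^esub> b}"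

definition homology_class :: "nat \<Rightarrow> 'c \<Rightarrow> 'c set set" where
  "homology_class i x = boundaries (subquotient C A B) i
     +>\<^bsub>(obj (subquotient C A B) i)\<lparr>carrier := cycles (subquotient C A B) i\<rparr>\<^esub> (B i +>\<^bsub>obj C i\<^esub> x)"

lemma obj_module: "module R (obj C i)"
  using A_submodule by (simp add: submodule_def)

lemma A_carrier: "x \<in> A i \<Longrightarrow> x \<in> carrier (obj C i)"
  using A_submodule[of i] by (auto simp: submodule_def)

lemma B_in_A: "submodule R (B i) ((obj C i)\<lparr>carrier := A i\<rparr>)"
  by (rule submodule_submodule[OF A_submodule B_submodule B_subset])

lemma
  shows class_hom: "(\<lambda>x. B i +>\<^bsub>obj C i\<^esub> x) \<in> module_hom R ((obj C i)\<lparr>carrier := A i\<rparr>) (obj (subquotient C A B) i)"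
    and subquotient_carrier: "carrier (obj (subquotient C A B) i) = (\<lambda>x. B i +>\<^bsub>obj C i\<^esub> x) ` A i"
    and subquotient_module: "module R (obj (subquotient C A B) i)"
    and subquotient_zero: "\<zero>\<^bsub>obj (subquotient C A B) i\<^esub> = B i"
  using quotient_module_hom[OF B_in_A] quotient_module_carrier[OF B_in_A] quotient_module_module[OF B_in_A]
    quotient_module_zero[OF B_in_A]
  by (simp_all add: subquotient_def coset_submodule_record)

lemma subquotient_diff:
  assumes x: "x \<in> A (Suc i)"
  shows "diff (subquotient C A B) i (B (Suc i) +>\<^bsub>obj C (Suc i)\<^esub> x) = B i +>\<^bsub>obj C i\<^esub> diff C i x"
proof -
  have "B i <+>\<^bsub>obj C i\<^esub> (diff C i ` (B (Suc i) +>\<^bsub>obj C (Suc i)\<^esub> x)) = B i +>\<^bsub>obj C i\<^esub> diff C i x"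
    by (rule coset_image_add[OF B_submodule module_hom_closed[OF diff_hom] B_submodule A_carrier[OF x]])
      (use diff_B module_hom_add[OF diff_hom] in auto)
  then show ?thesis by (simp add: subquotient_def)
qed

lemma subquotient_boundaries:
  "boundaries (subquotient C A B) i = (\<lambda>y. B i +>\<^bsub>obj C i\<^esub> diff C i y) ` A (Suc i)"
  unfolding boundaries_def subquotient_carrier image_image
  by (rule image_cong) (auto simp: subquotient_diff)

lemma subquotient_cycles:
  "cycles (subquotient C A B) i = (\<lambda>x. B i +>\<^bsub>obj C i\<^esub> x) ` relative_cycles i"
proof (cases i)
  case 0
  then show ?thesis by (simp add: subquotient_carrier relative_cycles_def)
next
  case (Suc k)
  have "B k +>\<^bsub>obj C k\<^esub> diff C k x = B k \<longleftrightarrow> diff C k x \<in> B k" if "x \<in> A (Suc k)" for x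
    by (rule coset_eq_self_iff[OF B_submodule]) (use that diff_A A_carrier in auto)
  then have iff: "{x \<in> A (Suc k). diff (subquotient C A B) k (B (Suc k) +>\<^bsub>obj C (Suc k)\<^esub> x) = B k}
      = relative_cycles (Suc k)"
    unfolding relative_cycles_def by (intro Collect_cong) (simp add: subquotient_diff cong: conj_cong)
  have "cycles (subquotient C A B) (Suc k) = {X \<in> (\<lambda>x. B (Suc k) +>\<^bsub>obj C (Suc k)\<^esub> x) ` A (Suc k).
      diff (subquotient C A B) k X = B k}"
    by (simp add: subquotient_carrier subquotient_zero)
  also have "\<dots> = (\<lambda>x. B (Suc k) +>\<^bsub>obj C (Suc k)\<^esub> x) ` {x \<in> A (Suc k).
      diff (subquotient C A B) k (B (Suc k) +>\<^bsub>obj C (Suc k)\<^esub> x) = B k}"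
    by blast
  finally show ?thesis unfolding iff Suc .
qed

lemma relative_cycles_submodule: "submodule R (relative_cycles i) (obj C i)"
proof (cases i)
  case 0
  then show ?thesis using A_submodule by (simp add: relative_cycles_def)
next
  case (Suc k)
  have "submodule R (A i \<inter> {x \<in> carrier (obj C (Suc k)). diff C k x \<in> B k}) (obj C i)"
    unfolding Suc by (intro submodule_Int A_submodule hom_vimage_submodule[OF obj_module obj_module diff_hom B_submodule])
  moreover have "relative_cycles i = A i \<inter> {x \<in> carrier (obj C (Suc k)). diff C k x \<in> B k}"
    using Suc A_carrier by (auto simp: relative_cycles_def)
  ultimately show ?thesis by simp
qed

lemma relative_cycles_A: "relative_cycles i \<subseteq> A i"
  by (auto simp: relative_cycles_def)

lemma diff_relative_cycles: "y \<in> A (Suc i) \<Longrightarrow> diff C i y \<in> relative_cycles i"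
  using diff_A[of i] diff_diff B_submodule A_carrier by (auto simp: relative_cycles_def submodule_def)

lemma
  shows homology_class_hom: "homology_class i \<in>
      module_hom R ((obj C i)\<lparr>carrier := relative_cycles i\<rparr>) (homology (subquotient C A B) i)"
    and homology_class_surj: "homology_class i ` relative_cycles i = carrier (homology (subquotient C A B) i)"
    and homology_class_zero_iff: "x \<in> relative_cycles i \<Longrightarrow>
      homology_class i x = \<zero>\<^bsub>homology (subquotient C A B) i\<^esub> \<longleftrightarrow> x \<in> relative_boundaries i"
    and homology_module: "module R (homology (subquotient C A B) i)"
proof -
  let ?S = "subquotient C A B" and ?cl = "\<lambda>x. B i +>\<^bsub>obj C i\<^esub> x"
  let ?X = "(obj C i)\<lparr>carrier := A i\<rparr>"
  let ?Zm = "(obj C i)\<lparr>carrier := relative_cycles i\<rparr>"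
  let ?Q = "(obj ?S i)\<lparr>carrier := cycles ?S i\<rparr>"
  have Zm: "module R ?Zm" by (rule module_submodule[OF relative_cycles_submodule])
  have sub_image: "submodule R (?cl ` L) (obj ?S i)" if L: "submodule R L (obj C i)" "L \<subseteq> A i" for L
  proof -
    have "?cl \<in> module_hom R ((obj C i)\<lparr>carrier := L\<rparr>) (obj ?S i)"
      using class_hom[of i] that by (auto simp: module_hom_def subset_iff)
    from hom_image_submodule[OF module_submodule[OF L(1)] subquotient_module this] show ?thesis by simp
  qed
  have cyc: "submodule R (cycles ?S i) (obj ?S i)"
    unfolding subquotient_cycles by (rule sub_image[OF relative_cycles_submodule relative_cycles_A])
  have Qm: "module R ?Q" by (rule module_submodule[OF cyc])
  have dA: "submodule R (diff C i ` A (Suc i)) (obj C i)"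
  proof -
    have "diff C i \<in> module_hom R ((obj C (Suc i))\<lparr>carrier := A (Suc i)\<rparr>) (obj C i)"
      using diff_hom[of i] A_carrier[of _ "Suc i"] by (auto simp: module_hom_def)
    from hom_image_submodule[OF module_submodule[OF A_submodule] obj_module this] show ?thesis by simp
  qed
  have bd: "submodule R (boundaries ?S i) (obj ?S i)"
    using sub_image[OF dA diff_A] by (simp add: subquotient_boundaries image_image)
  have bc: "boundaries ?S i \<subseteq> cycles ?S i"
    unfolding subquotient_boundaries subquotient_cycles using diff_relative_cycles by auto
  have bQ: "submodule R (boundaries ?S i) ?Q"
    by (rule submodule_submodule[OF cyc bd bc])
  have Zcl: "?cl \<in> module_hom R ?Zm ?Q"
    using class_hom[of i] relative_cycles_A[of i] by (auto simp: module_hom_def subset_iff subquotient_cycles)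
  show hh: "homology_class i \<in> module_hom R ?Zm (homology ?S i)"
    using hom_comp[OF Zcl quotient_module_hom[OF bQ]]
    by (simp add: homology_class_def[abs_def] homology_def)
  show "homology_class i ` relative_cycles i = carrier (homology ?S i)"
    by (simp add: homology_def quotient_module_carrier[OF bQ])
      (simp add: subquotient_cycles image_image homology_class_def)
  show hm: "module R (homology ?S i)"
    unfolding homology_def by (rule quotient_module_module[OF bQ])
  show "homology_class i x = \<zero>\<^bsub>homology ?S i\<^esub> \<longleftrightarrow> x \<in> relative_boundaries i" if x: "x \<in> relative_cycles i"
  proof -
    have xA: "x \<in> carrier (obj C i)" using x relative_cycles_A A_carrier by blast
    have "homology_class i x = \<zero>\<^bsub>homology ?S i\<^esub> \<longleftrightarrow> ?cl x \<in> boundaries ?S i"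
      unfolding homology_def quotient_module_zero[OF bQ] homology_class_def
      by (rule coset_eq_self_iff[OF bQ]) (use x in \<open>simp add: subquotient_cycles\<close>)
    also have "\<dots> \<longleftrightarrow> (\<exists>y\<in>A (Suc i). ?cl x = ?cl (diff C i y))"
      by (auto simp: subquotient_boundaries)
    also have "\<dots> \<longleftrightarrow> (\<exists>y\<in>A (Suc i). \<exists>b\<in>B i. x = diff C i y \<oplus>\<^bsub>obj C i\<^esub> b)"
    proof -
      have "?cl x = ?cl (diff C i y) \<longleftrightarrow> (\<exists>b\<in>B i. x = diff C i y \<oplus>\<^bsub>obj C i\<^esub> b)" if "y \<in> A (Suc i)" for y
        by (rule coset_eq_iff[OF B_submodule xA hom_closed[OF diff_hom A_carrier[OF that]]])
      then show ?thesis by blast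
    qed
    finally show ?thesis by (simp add: relative_boundaries_def)
  qed
qed

lemma homology_nontrivial_iff:
  "nontrivial (homology (subquotient C A B) i) \<longleftrightarrow> \<not> relative_cycles i \<subseteq> relative_boundaries i"
proof -
  have "\<zero>\<^bsub>homology (subquotient C A B) i\<^esub> \<in> carrier (homology (subquotient C A B) i)"
  proof -
    interpret H: module R "homology (subquotient C A B) i" by (rule homology_module)
    show ?thesis by (rule H.zero_closed)
  qed
  then have "nontrivial (homology (subquotient C A B) i) \<longleftrightarrow>
      (\<exists>h\<in>carrier (homology (subquotient C A B) i). h \<noteq> \<zero>\<^bsub>homology (subquotient C A B) i\<^esub>)"
    by (auto simp: nontrivial_def)
  also have "\<dots> \<longleftrightarrow> \<not> relative_cycles i \<subseteq> relative_boundaries i"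
    unfolding homology_class_surj[symmetric] using homology_class_zero_iff by auto
  finally show ?thesis .
qed

end

section \<open>Dimension over the residue field\<close>

text \<open>A basis of \<open>V\<close> over \<open>R/\<mm>\<close>, in terms of coefficients in \<open>R\<close>: independence means that relations
  have coefficients in \<open>\<mm>\<close>.\<close>

lemma residue_dim_eqI:
  fixes R (structure)
  assumes m: "maximalideal \<mm> R" and cr: "cring R" and V: "module R V"
    and ann: "\<And>r v. r \<in> \<mm> \<Longrightarrow> v \<in> carrier V \<Longrightarrow> r \<odot>\<^bsub>V\<^esub> v = \<zero>\<^bsub>V\<^esub>"
    and J: "finite J" and e: "\<And>c. c \<in> J \<Longrightarrow> e c \<in> carrier V"
    and gen: "\<And>v. v \<in> carrier V \<Longrightarrow> \<exists>r\<in>J \<rightarrow> carrier R. v = (\<Oplus>\<^bsub>V\<^esub>c\<in>J. r c \<odot>\<^bsub>V\<^esub> e c)"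
    and indep: "\<And>r. r \<in> J \<rightarrow> carrier R \<Longrightarrow> (\<Oplus>\<^bsub>V\<^esub>c\<in>J. r c \<odot>\<^bsub>V\<^esub> e c) = \<zero>\<^bsub>V\<^esub> \<Longrightarrow> \<forall>c\<in>J. r c \<in> \<mm>"
  shows "residue_dim R \<mm> V = card J"
proof -
  interpret m: maximalideal \<mm> R by fact
  interpret cring R by fact
  interpret V: module R V by fact
  let ?K = "R Quot \<mm>" and ?W = "residue_space V"
  interpret K: field ?K by (rule m.quotient_is_field[OF cr])
  have W: "carrier ?W = carrier V" "\<zero>\<^bsub>?W\<^esub> = \<zero>\<^bsub>V\<^esub>" "add ?W = add V"
    by (simp_all add: residue_space_def)
  have Kc: "carrier ?K = (\<lambda>r. \<mm> +>\<^bsub>R\<^esub> r) ` carrier R"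
    by (auto simp: FactRing_def A_RCOSETS_def')
  have sm: "(\<mm> +>\<^bsub>R\<^esub> r) \<odot>\<^bsub>?W\<^esub> v = r \<odot>\<^bsub>V\<^esub> v" if "r \<in> carrier R" "v \<in> carrier V" for r v
  proof -
    have "s \<odot>\<^bsub>V\<^esub> v = r \<odot>\<^bsub>V\<^esub> v" if "s \<in> \<mm> +>\<^bsub>R\<^esub> r" for s
    proof -
      obtain h where h: "h \<in> \<mm>" "s = h \<oplus> r" using \<open>s \<in> \<mm> +>\<^bsub>R\<^esub> r\<close> by (auto simp: a_r_coset_def')
      then show ?thesis using m.Icarr[OF h(1)] ann[OF h(1)] \<open>r \<in> carrier R\<close> \<open>v \<in> carrier V\<close>
        by (simp add: V.smult_l_distr)
    qed
    moreover have "\<zero> \<oplus> r \<in> \<mm> +>\<^bsub>R\<^esub> r" using m.zero_closed by (auto simp: a_r_coset_def')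
    moreover have "(\<lambda>s. s \<odot>\<^bsub>V\<^esub> v) ` (\<mm> +>\<^bsub>R\<^esub> r) = (\<lambda>s. r \<odot>\<^bsub>V\<^esub> v) ` (\<mm> +>\<^bsub>R\<^esub> r)"
      by (rule image_cong) (use calculation in auto)
    ultimately have "(\<lambda>s. s \<odot>\<^bsub>V\<^esub> v) ` (\<mm> +>\<^bsub>R\<^esub> r) = {r \<odot>\<^bsub>V\<^esub> v}"
      by (auto simp only: image_constant_conv split: if_splits)
    then show ?thesis by (simp add: residue_space_def)
  qed
  have Kmult: "(\<mm> +>\<^bsub>R\<^esub> r) \<otimes>\<^bsub>?K\<^esub> (\<mm> +>\<^bsub>R\<^esub> s) = \<mm> +>\<^bsub>R\<^esub> (r \<otimes> s)" if "r \<in> carrier R" "s \<in> carrier R" for r s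
    using m.rcoset_mult_add[OF that] by (simp add: FactRing_def)
  have Kadd: "(\<mm> +>\<^bsub>R\<^esub> r) \<oplus>\<^bsub>?K\<^esub> (\<mm> +>\<^bsub>R\<^esub> s) = \<mm> +>\<^bsub>R\<^esub> (r \<oplus> s)" if "r \<in> carrier R" "s \<in> carrier R" for r s
    using m.a_rcos_sum[OF that] by (simp add: FactRing_def)
  have Kone: "\<one>\<^bsub>?K\<^esub> = \<mm> +>\<^bsub>R\<^esub> \<one>" by (simp add: FactRing_def)
  have Kzero: "\<zero>\<^bsub>?K\<^esub> = \<mm>" by (simp add: FactRing_def)
  have mod: "module ?K ?W"
  proof (rule module_criteria)
    show "cring ?K" by (rule K.cring_axioms)
    show "\<forall>v\<in>carrier ?W. \<exists>w\<in>carrier ?W. v \<oplus>\<^bsub>?W\<^esub> w = \<zero>\<^bsub>?W\<^esub>"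
      unfolding W using V.r_neg V.a_inv_closed by blast
  qed (auto simp: W Kc sm Kmult Kadd Kone V.a_ac V.smult_assoc1 V.smult_l_distr V.smult_r_distr)
  interpret W: module ?K ?W by (rule mod)
  interpret vs: vectorspace ?K ?W by (simp add: vectorspace_def mod K.field_axioms)
  have finsum: "finsum ?W f A = finsum V f A" for f :: "'d \<Rightarrow> _" and A
    by (simp add: finsum_def finprod_def W)
  have finsum': "finsum ?W f A = finsum V f A" for f :: "_ \<Rightarrow> _" and A
    by (simp add: finsum_def finprod_def W)
  have inj: "inj_on e J"
  proof (rule inj_onI, rule ccontr)
    fix b c assume bc: "b \<in> J" "c \<in> J" "e b = e c" "b \<noteq> c"
    let ?r = "\<lambda>x. if x = b then \<one> else if x = c then \<ominus> \<one> else \<zero>"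
    have "(\<Oplus>\<^bsub>V\<^esub>x\<in>J. ?r x \<odot>\<^bsub>V\<^esub> e x) =
        (\<Oplus>\<^bsub>V\<^esub>x\<in>J. (if b = x then e x else \<zero>\<^bsub>V\<^esub>) \<oplus>\<^bsub>V\<^esub> (if c = x then \<ominus>\<^bsub>V\<^esub> e x else \<zero>\<^bsub>V\<^esub>))"
      by (rule V.finsum_cong') (use bc e in \<open>auto simp: V.smult_l_minus\<close>)
    also have "\<dots> = (\<Oplus>\<^bsub>V\<^esub>x\<in>J. if b = x then e x else \<zero>\<^bsub>V\<^esub>) \<oplus>\<^bsub>V\<^esub> (\<Oplus>\<^bsub>V\<^esub>x\<in>J. if c = x then \<ominus>\<^bsub>V\<^esub> e x else \<zero>\<^bsub>V\<^esub>)"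
      by (rule V.finsum_addf) (use e in auto)
    also have "(\<Oplus>\<^bsub>V\<^esub>x\<in>J. if b = x then e x else \<zero>\<^bsub>V\<^esub>) = e b"
      by (rule V.finsum_singleton) (use bc e J in auto)
    also have "(\<Oplus>\<^bsub>V\<^esub>x\<in>J. if c = x then \<ominus>\<^bsub>V\<^esub> e x else \<zero>\<^bsub>V\<^esub>) = \<ominus>\<^bsub>V\<^esub> e c"
      by (rule V.finsum_singleton) (use bc e J in auto)
    also have "e b \<oplus>\<^bsub>V\<^esub> \<ominus>\<^bsub>V\<^esub> e c = \<zero>\<^bsub>V\<^esub>" using bc e by (simp add: V.r_neg)
    finally have "\<forall>x\<in>J. ?r x \<in> \<mm>" by (intro indep) auto
    then have "\<one> \<in> \<mm>" using bc by auto
    then show False using m.one_imp_carrier m.I_notcarr by blast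
  qed
  have lc: "W.lincomb a (e ` J) = (\<Oplus>\<^bsub>V\<^esub>c\<in>J. s c \<odot>\<^bsub>V\<^esub> e c)"
    if "\<And>c. c \<in> J \<Longrightarrow> a (e c) = \<mm> +>\<^bsub>R\<^esub> s c" "\<And>c. c \<in> J \<Longrightarrow> s c \<in> carrier R" for a s
  proof -
    have a: "\<And>c. c \<in> J \<Longrightarrow> a (e c) \<odot>\<^bsub>?W\<^esub> e c = s c \<odot>\<^bsub>V\<^esub> e c" using that sm e by simp
    have "W.lincomb a (e ` J) = (\<Oplus>\<^bsub>V\<^esub>v\<in>e ` J. a v \<odot>\<^bsub>?W\<^esub> v)"
      by (simp add: W.lincomb_def finsum')
    also have "\<dots> = (\<Oplus>\<^bsub>V\<^esub>c\<in>J. a (e c) \<odot>\<^bsub>?W\<^esub> e c)"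
      by (rule V.finsum_reindex[OF _ inj]) (use a e that in auto)
    also have "\<dots> = (\<Oplus>\<^bsub>V\<^esub>c\<in>J. s c \<odot>\<^bsub>V\<^esub> e c)"
      by (rule V.finsum_cong') (use a e that in auto)
    finally show ?thesis .
  qed
  have eJ: "e ` J \<subseteq> carrier ?W" "finite (e ` J)" using e J by (auto simp: W)
  have "W.span (e ` J) = carrier ?W"
  proof
    show "W.span (e ` J) \<subseteq> carrier ?W" by (rule W.span_is_subset2[OF eJ(1)])
    show "carrier ?W \<subseteq> W.span (e ` J)"
    proof
      fix v assume "v \<in> carrier ?W"
      then obtain r where r: "r \<in> J \<rightarrow> carrier R" "v = (\<Oplus>\<^bsub>V\<^esub>c\<in>J. r c \<odot>\<^bsub>V\<^esub> e c)" using gen W by auto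
      let ?a = "\<lambda>w. \<mm> +>\<^bsub>R\<^esub> r (inv_into J e w)"
      have "W.lincomb ?a (e ` J) = v" unfolding r(2) by (rule lc) (use r inj in auto)
      moreover have "?a \<in> e ` J \<rightarrow> carrier ?K" using r inj by (auto simp: Kc)
      ultimately show "v \<in> W.span (e ` J)" unfolding W.finite_span[OF eJ(2,1)] by blast
    qed
  qed
  moreover have "W.lin_indpt (e ` J)"
  proof (rule W.finite_lin_indpt2[OF eJ(2,1)])
    fix a assume a: "a \<in> e ` J \<rightarrow> carrier ?K" and z: "W.lincomb a (e ` J) = \<zero>\<^bsub>?W\<^esub>"
    then have "\<forall>c\<in>J. \<exists>s\<in>carrier R. a (e c) = \<mm> +>\<^bsub>R\<^esub> s" by (auto simp: Kc Pi_def image_iff)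
    then obtain s where s: "\<And>c. c \<in> J \<Longrightarrow> s c \<in> carrier R" "\<And>c. c \<in> J \<Longrightarrow> a (e c) = \<mm> +>\<^bsub>R\<^esub> s c" by metis
    then have "(\<Oplus>\<^bsub>V\<^esub>c\<in>J. s c \<odot>\<^bsub>V\<^esub> e c) = \<zero>\<^bsub>V\<^esub>" using lc[of a s] s z W by simp
    then have "\<forall>c\<in>J. s c \<in> \<mm>" using s(1) by (intro indep) auto
    then show "\<forall>v\<in>e ` J. a v = \<zero>\<^bsub>?K\<^esub>" using s m.a_rcos_const by (auto simp: Kzero)
  qed
  ultimately have "vs.basis (e ` J)" using eJ by (simp add: vs.basis_def)
  from vs.dim_basis[OF eJ(2) this] show ?thesis
    unfolding residue_dim_def using card_image[OF inj] by simp
qed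

section \<open>The linear part\<close>

text \<open>Acyclicity of the linear part of a minimal complex in positive homological degrees. A cycle of
  degree \<open>i+1\<close> in \<open>\<G>\<^sup>n/\<G>\<^sup>n\<^sup>+\<^sup>1\<close> is represented by \<open>x \<in> \<mm>\<^sup>pF\<^sub>i\<^sub>+\<^sub>1\<close> with \<open>p = n-i-1\<close> and \<open>dx \<in> \<mm>\<^sup>p\<^sup>+\<^sup>2F\<^sub>i\<close>. For
  \<open>p = 0\<close> the truncated subtraction makes \<open>\<mm>\<^sup>p\<^sup>-\<^sup>1\<close> the unit ideal, as in the filtration itself.\<close>

definition linear_part_exact :: "('a, 'm) ring_scheme \<Rightarrow> 'a set \<Rightarrow> ('a, 'c) chain \<Rightarrow> bool" where
  "linear_part_exact R \<mm> F \<longleftrightarrow>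
     (\<forall>i p. \<forall>x\<in>ideal_smult R (ideal_power R \<mm> p) (obj F (Suc i)).
        diff F i x \<in> ideal_smult R (ideal_power R \<mm> (Suc (Suc p))) (obj F i) \<longrightarrow>
        (\<exists>y\<in>ideal_smult R (ideal_power R \<mm> (p - 1)) (obj F (Suc (Suc i))).
           \<exists>b\<in>ideal_smult R (ideal_power R \<mm> (Suc p)) (obj F (Suc i)).
             x = diff F (Suc i) y \<oplus>\<^bsub>obj F (Suc i)\<^esub> b))"

lemma enat_Sup_eq_0_iff: "Sup S = (0::enat) \<longleftrightarrow> (\<forall>x\<in>S. x = 0)"
  using Sup_le_iff[of S "0::enat"] by (simp only: le_zero_eq)

lemma minimal_complexD:
  "minimal_complex R I F \<Longrightarrow> x \<in> carrier (obj F (Suc i)) \<Longrightarrow> diff F i x \<in> ideal_smult R I (obj F i)"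
  by (auto simp: minimal_complex_def boundaries_def)

context cring
begin

lemma ideal_power_antimono:
  assumes "ideal I R" "p \<le> q"
  shows "ideal_power R I q \<subseteq> ideal_power R I p"
  using assms(2)
proof (induction rule: dec_induct)
  case (step n)
  then show ?case using ideal_power_Suc[OF assms(1), of n] by blast
qed simp

lemma ideal_smult_power_antimono:
  assumes "ideal I R" "p \<le> q" "module R X"
  shows "ideal_smult R (ideal_power R I q) X \<subseteq> ideal_smult R (ideal_power R I p) X"
  by (rule ideal_smult_mono[OF assms(3) ideal_power_antimono[OF assms(1,2)] ideal_power_subset[OF assms(1)]])

lemma ideal_smult_power_zero: "module R X \<Longrightarrow> ideal_smult R (ideal_power R I 0) X = carrier X"
  by (simp add: ideal_smult_carrier)

lemma minimal_diff_raises: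
  assumes "ideal I R" "module R (obj F i)" "module R (obj F (Suc i))"
    "diff F i \<in> module_hom R (obj F (Suc i)) (obj F i)" "minimal_complex R I F"
    "x \<in> ideal_smult R (ideal_power R I p) (obj F (Suc i))"
  shows "diff F i x \<in> ideal_smult R (ideal_power R I (Suc p)) (obj F i)"
  by (rule hom_raises_madic[OF assms(1,3,2,4) _ assms(6)])
    (use assms(5) in \<open>auto simp: minimal_complex_def boundaries_def\<close>)

text \<open>By minimality, differentials raise the \<open>\<mm>\<close>-adic filtration, so \<open>\<G>\<^sup>nF\<close> is a subcomplex.\<close>

lemma linear_part_pair:
  assumes I: "ideal I R" and F: "\<And>i. module R (obj F i)"
    "\<And>i. diff F i \<in> module_hom R (obj F (Suc i)) (obj F i)"
    "\<And>i x. x \<in> carrier (obj F (Suc (Suc i))) \<Longrightarrow> diff F i (diff F (Suc i) x) = \<zero>\<^bsub>obj F i\<^esub>"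
    and min: "minimal_complex R I F"
  shows "complex_pair R F (madic_filtration R I F n) (madic_filtration R I F (Suc n))"
proof -
  have d: "diff F i ` madic_filtration R I F n (Suc i) \<subseteq> madic_filtration R I F n i" for n i
  proof (cases "i < n")
    case True
    then have "Suc (n - Suc i) = n - i" by simp
    then show ?thesis using minimal_diff_raises[OF I F(1,1,2) min, of _ "n - Suc i" i]
      by (auto simp: madic_filtration_def simp del: ideal_power.simps)
  next
    case False
    then show ?thesis
      using hom_closed[OF F(2)[of i]] ideal_smult_submodule[OF F(1)[of "Suc i"], of "carrier R"] F(1)
      by (auto simp: madic_filtration_def ideal_smult_power_zero ideal_smult_carrier submodule_def)
  qed
  show ?thesis
  proof (intro complex_pair.intro complex_pair_axioms.intro cring_axioms)
    fix i
    show "submodule R (madic_filtration R I F n i) (obj F i)"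
      "submodule R (madic_filtration R I F (Suc n) i) (obj F i)"
      unfolding madic_filtration_def by (rule ideal_smult_submodule[OF F(1) ideal_power_subset[OF I]])+
    show "madic_filtration R I F (Suc n) i \<subseteq> madic_filtration R I F n i"
      unfolding madic_filtration_def by (rule ideal_smult_power_antimono[OF I _ F(1)]) simp
  qed (use d F in auto)
qed

text \<open>For \<open>n \<le> i\<close> the complex \<open>\<G>\<^sup>n/\<G>\<^sup>n\<^sup>+\<^sup>1\<close> vanishes in degree \<open>i+1\<close>; the other \<open>n\<close> are those of the form
  \<open>p + i + 1\<close>.\<close>

lemma linear_part_sup_eq_0_iff:
  assumes I: "ideal I R" and F: "\<And>i. module R (obj F i)"
    "\<And>i. diff F i \<in> module_hom R (obj F (Suc i)) (obj F i)"
    "\<And>i x. x \<in> carrier (obj F (Suc (Suc i))) \<Longrightarrow> diff F i (diff F (Suc i) x) = \<zero>\<^bsub>obj F i\<^esub>"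
    and min: "minimal_complex R I F"
  shows "linear_part_sup R I F = 0 \<longleftrightarrow> linear_part_exact R I F"
proof -
  let ?G = "madic_filtration R I F"
  have G: "?G n i = ideal_smult R (ideal_power R I (n - i)) (obj F i)" for n i
    by (simp add: madic_filtration_def)
  have nontriv: "nontrivial (homology (linear_part R I F n) (Suc i)) \<longleftrightarrow>
     \<not> (\<forall>x\<in>?G n (Suc i). diff F i x \<in> ?G (Suc n) i \<longrightarrow>
         (\<exists>y\<in>?G n (Suc (Suc i)). \<exists>b\<in>?G (Suc n) (Suc i). x = diff F (Suc i) y \<oplus>\<^bsub>obj F (Suc i)\<^esub> b))" for n i
  proof -
    interpret complex_pair R F "?G n" "?G (Suc n)" by (rule linear_part_pair[OF I F min])
    show ?thesis unfolding linear_part_def homology_nontrivial_iff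
      by (auto simp: relative_cycles_def relative_boundaries_def subset_eq)
  qed
  have "linear_part_sup R I F = 0 \<longleftrightarrow> (\<forall>i n. \<not> nontrivial (homology (linear_part R I F n) (Suc i)))"
  proof -
    have "linear_part_sup R I F = 0 \<longleftrightarrow> (\<forall>i n. nontrivial (homology (linear_part R I F n) i) \<longrightarrow> enat i = 0)"
      unfolding linear_part_sup_def enat_Sup_eq_0_iff by blast
    also have "\<dots> \<longleftrightarrow> (\<forall>i n. \<not> nontrivial (homology (linear_part R I F n) (Suc i)))"
      unfolding zero_enat_def enat.inject by (metis not0_implies_Suc nat.distinct(1))
    finally show ?thesis .
  qed
  also have "\<dots> \<longleftrightarrow> linear_part_exact R I F"
  proof
    assume *: "\<forall>i n. \<not> nontrivial (homology (linear_part R I F n) (Suc i))"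
    show "linear_part_exact R I F" unfolding linear_part_exact_def
    proof (intro allI ballI impI)
      fix i p x assume x: "x \<in> ideal_smult R (ideal_power R I p) (obj F (Suc i))"
        "diff F i x \<in> ideal_smult R (ideal_power R I (Suc (Suc p))) (obj F i)"
      have p: "p + Suc i - Suc i = p" "Suc (p + Suc i) - i = Suc (Suc p)"
        "p + Suc i - Suc (Suc i) = p - 1" "Suc (p + Suc i) - Suc i = Suc p" by auto
      from *[rule_format, of "p + Suc i" i] x
      show "\<exists>y\<in>ideal_smult R (ideal_power R I (p - 1)) (obj F (Suc (Suc i))).
           \<exists>b\<in>ideal_smult R (ideal_power R I (Suc p)) (obj F (Suc i)).
             x = diff F (Suc i) y \<oplus>\<^bsub>obj F (Suc i)\<^esub> b"
        unfolding nontriv G p by blast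
    qed
  next
    assume ex: "linear_part_exact R I F"
    show "\<forall>i n. \<not> nontrivial (homology (linear_part R I F n) (Suc i))"
    proof (intro allI, unfold nontriv not_not, intro ballI impI)
      fix i n x assume x: "x \<in> ?G n (Suc i)" "diff F i x \<in> ?G (Suc n) i"
      show "\<exists>y\<in>?G n (Suc (Suc i)). \<exists>b\<in>?G (Suc n) (Suc i). x = diff F (Suc i) y \<oplus>\<^bsub>obj F (Suc i)\<^esub> b"
      proof (cases "i < n")
        case True
        define p where "p = n - Suc i"
        have p: "n - Suc i = p" "Suc n - i = Suc (Suc p)" "n - Suc (Suc i) = p - 1" "Suc n - Suc i = Suc p"
          using True by (auto simp: p_def)
        show ?thesis using ex x unfolding linear_part_exact_def G p by blast
      next
        case False
        interpret F1: module R "obj F (Suc i)" by (rule F(1))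
        interpret F2: module R "obj F (Suc (Suc i))" by (rule F(1))
        have "x \<in> carrier (obj F (Suc i))" "?G (Suc n) (Suc i) = carrier (obj F (Suc i))"
          using False x F(1) by (auto simp: G ideal_smult_carrier)
        moreover have "\<zero>\<^bsub>obj F (Suc (Suc i))\<^esub> \<in> ?G n (Suc (Suc i))"
          using False F(1) by (auto simp: G ideal_smult_carrier)
        moreover have "x = diff F (Suc i) \<zero>\<^bsub>obj F (Suc (Suc i))\<^esub> \<oplus>\<^bsub>obj F (Suc i)\<^esub> x"
          using calculation(1) hom_zero[OF F(1) F(1) F(2)] by simp
        ultimately show ?thesis by blast
      qed
    qed
  qed
  finally show ?thesis .
qed

end

context degree_ring
begin

text \<open>Linearity of a minimal resolution only depends on the resolved module: a homotopy shifts the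
  homological degree without lowering the \<open>\<mm>\<close>-adic degree, so homotopic chain maps agree on the
  linear part.\<close>

lemma linear_part_exact_transfer:
  assumes I: "ideal I R"
    and C: "strict_resolution R Rg C Cg \<epsilon> M Mg" and projC: "\<And>i. graded_projective R Rg (obj C i) (Cg i)"
    and D: "strict_resolution R Rg D Dg \<delta> M Mg" and projD: "\<And>i. graded_projective R Rg (obj D i) (Dg i)"
    and minC: "minimal_complex R I C" and ex: "linear_part_exact R I D"
  shows "linear_part_exact R I C"
  unfolding linear_part_exact_def
proof (intro allI ballI impI)
  fix i p x
  let ?m = "\<lambda>p X. ideal_smult R (ideal_power R I p) X"
  assume x: "x \<in> ?m p (obj C (Suc i))" and dx: "diff C i x \<in> ?m (Suc (Suc p)) (obj C i)"
  obtain \<phi> \<psi> s u where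
    \<phi>: "\<And>i. \<phi> i \<in> graded_hom R (obj C i) (Cg i) (obj D i) (Dg i)"
    and \<psi>: "\<And>i. \<psi> i \<in> graded_hom R (obj D i) (Dg i) (obj C i) (Cg i)"
    and \<phi>d: "\<And>i x. x \<in> carrier (obj C (Suc i)) \<Longrightarrow> diff D i (\<phi> (Suc i) x) = \<phi> i (diff C i x)"
    and \<psi>d: "\<And>i x. x \<in> carrier (obj D (Suc i)) \<Longrightarrow> diff C i (\<psi> (Suc i) x) = \<psi> i (diff D i x)"
    and s: "\<And>i. s i \<in> graded_hom R (obj C i) (Cg i) (obj C (Suc i)) (Cg (Suc i))"
    and hty: "\<And>i x. x \<in> carrier (obj C (Suc i)) \<Longrightarrow> x = \<psi> (Suc i) (\<phi> (Suc i) x) \<oplus>\<^bsub>obj C (Suc i)\<^esub>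
        (diff C (Suc i) (s (Suc i) x) \<oplus>\<^bsub>obj C (Suc i)\<^esub> s i (diff C i x))"
    by (rule homotopy_equivalence[OF C projC D projD]) (rule that, assumption+)
  have Cm: "\<And>i. module R (obj C i)" and Cd: "\<And>i. diff C i \<in> module_hom R (obj C (Suc i)) (obj C i)"
    and Dm: "\<And>i. module R (obj D i)" and Dd: "\<And>i. diff D i \<in> module_hom R (obj D (Suc i)) (obj D i)"
    using C D by (auto simp: strict_resolution_def resolution_def)
  note sub = ideal_power_subset[OF I]
  have mC: "submodule R (?m q (obj C k)) (obj C k)" for q k by (rule ideal_smult_submodule[OF Cm sub])
  have mD: "submodule R (?m q (obj D k)) (obj D k)" for q k by (rule ideal_smult_submodule[OF Dm sub])
  have cC: "y \<in> ?m q (obj C k) \<Longrightarrow> y \<in> carrier (obj C k)" for y q k by (rule submoduleD(1)[OF mC])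
  have cD: "y \<in> ?m q (obj D k) \<Longrightarrow> y \<in> carrier (obj D k)" for y q k by (rule submoduleD(1)[OF mD])
  have \<phi>m: "y \<in> ?m q (obj C k) \<Longrightarrow> \<phi> k y \<in> ?m q (obj D k)" for y q k
    by (rule hom_ideal_smult[OF Cm Dm graded_homD(1)[OF \<phi>] sub])
  have \<psi>m: "y \<in> ?m q (obj D k) \<Longrightarrow> \<psi> k y \<in> ?m q (obj C k)" for y q k
    by (rule hom_ideal_smult[OF Dm Cm graded_homD(1)[OF \<psi>] sub])
  have sm: "y \<in> ?m q (obj C k) \<Longrightarrow> s k y \<in> ?m q (obj C (Suc k))" for y q k
    by (rule hom_ideal_smult[OF Cm Cm graded_homD(1)[OF s] sub])
  have "diff D i (\<phi> (Suc i) x) \<in> ?m (Suc (Suc p)) (obj D i)"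
    unfolding \<phi>d[OF cC[OF x]] by (rule \<phi>m[OF dx])
  with ex \<phi>m[OF x] obtain y b where y: "y \<in> ?m (p - 1) (obj D (Suc (Suc i)))"
    and b: "b \<in> ?m (Suc p) (obj D (Suc i))"
    and eq: "\<phi> (Suc i) x = diff D (Suc i) y \<oplus>\<^bsub>obj D (Suc i)\<^esub> b"
    unfolding linear_part_exact_def by blast
  let ?b = "\<psi> (Suc i) b \<oplus>\<^bsub>obj C (Suc i)\<^esub> (diff C (Suc i) (s (Suc i) x) \<oplus>\<^bsub>obj C (Suc i)\<^esub> s i (diff C i x))"
  \<comment> \<open>three error terms in \<open>\<mm>\<^sup>p\<^sup>+\<^sup>1\<close>: a transported one, \<open>ds\<close> because \<open>C\<close> is minimal, \<open>sd\<close> because \<open>dx \<in> \<mm>\<^sup>p\<^sup>+\<^sup>2\<close>\<close>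
  have 1: "\<psi> (Suc i) b \<in> ?m (Suc p) (obj C (Suc i))" by (rule \<psi>m[OF b])
  have 2: "diff C (Suc i) (s (Suc i) x) \<in> ?m (Suc p) (obj C (Suc i))"
    by (rule minimal_diff_raises[OF I Cm Cm Cd minC sm[OF x]])
  have 3: "s i (diff C i x) \<in> ?m (Suc p) (obj C (Suc i))"
    by (rule subsetD[OF ideal_smult_power_antimono[OF I _ Cm] sm[OF dx]]) simp
  have "?b \<in> ?m (Suc p) (obj C (Suc i))"
    using 1 2 3 submodule.m_closed[OF mC] by blast
  moreover have "x = diff C (Suc i) (\<psi> (Suc (Suc i)) y) \<oplus>\<^bsub>obj C (Suc i)\<^esub> ?b"
  proof -
    interpret C1: module R "obj C (Suc i)" by (rule Cm)
    have dy: "diff D (Suc i) y \<in> carrier (obj D (Suc i))" by (rule hom_closed[OF Dd cD[OF y]])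
    have "\<psi> (Suc i) (\<phi> (Suc i) x) = diff C (Suc i) (\<psi> (Suc (Suc i)) y) \<oplus>\<^bsub>obj C (Suc i)\<^esub> \<psi> (Suc i) b"
      unfolding eq \<psi>d[OF cD[OF y]] by (rule module_hom_add[OF graded_homD(1)[OF \<psi>] dy cD[OF b]])
    moreover have "diff C (Suc i) (\<psi> (Suc (Suc i)) y) \<in> carrier (obj C (Suc i))"
      by (rule hom_closed[OF Cd cC[OF \<psi>m[OF y]]])
    ultimately show ?thesis using hty[OF cC[OF x]] cC[OF 1] cC[OF 2] cC[OF 3] by (simp add: C1.a_assoc)
  qed
  ultimately show "\<exists>y\<in>?m (p - 1) (obj C (Suc (Suc i))). \<exists>b\<in>?m (Suc p) (obj C (Suc i)).
      x = diff C (Suc i) y \<oplus>\<^bsub>obj C (Suc i)\<^esub> b"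
    using \<psi>m[OF y] by blast
qed

end

section \<open>Tor and minimal resolutions\<close>

lemma submodule_residue_sum:
  assumes A: "\<And>r y. r \<in> carrier R \<Longrightarrow> y \<in> L \<Longrightarrow> \<exists>l\<in>L. \<exists>b\<in>N. r \<odot>\<^bsub>X\<^esub> y = l \<oplus>\<^bsub>X\<^esub> b"
    and N: "submodule R N X" and L: "L \<subseteq> carrier X" "\<zero>\<^bsub>X\<^esub> \<in> L"
      "\<And>x y. x \<in> L \<Longrightarrow> y \<in> L \<Longrightarrow> x \<oplus>\<^bsub>X\<^esub> y \<in> L"
  shows "submodule R (L <+>\<^bsub>X\<^esub> N) X"
proof -
  interpret X: module R X using N by (simp add: submodule_def)
  note Nd = submoduleD[OF N]
  have Lc: "l \<in> carrier X" if "l \<in> L" for l using that L(1) by blast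
  have mem: "x \<in> L <+>\<^bsub>X\<^esub> N \<longleftrightarrow> (\<exists>l\<in>L. \<exists>b\<in>N. x = l \<oplus>\<^bsub>X\<^esub> b)" for x
    by (auto simp: set_add_def')
  show ?thesis
    unfolding submodule_def
  proof (intro conjI allI impI X.module_axioms subsetI)
    fix x assume "x \<in> L <+>\<^bsub>X\<^esub> N"
    then obtain l b where "l \<in> L" "b \<in> N" "x = l \<oplus>\<^bsub>X\<^esub> b" by (auto simp: mem)
    then show "x \<in> carrier X" using Lc Nd(1) by simp
  next
    fix x y assume "x \<in> L <+>\<^bsub>X\<^esub> N" "y \<in> L <+>\<^bsub>X\<^esub> N"
    then obtain l b k c where *: "l \<in> L" "b \<in> N" "x = l \<oplus>\<^bsub>X\<^esub> b" "k \<in> L" "c \<in> N" "y = k \<oplus>\<^bsub>X\<^esub> c"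
      by (auto simp: mem)
    then have "x \<oplus>\<^bsub>X\<^esub> y = (l \<oplus>\<^bsub>X\<^esub> k) \<oplus>\<^bsub>X\<^esub> (b \<oplus>\<^bsub>X\<^esub> c)" using Lc Nd(1) by (simp add: X.a_ac)
    moreover have "l \<oplus>\<^bsub>X\<^esub> k \<in> L" "b \<oplus>\<^bsub>X\<^esub> c \<in> N" using * L(3) Nd(2) by auto
    ultimately show "x \<oplus>\<^bsub>X\<^esub> y \<in> L <+>\<^bsub>X\<^esub> N" by (auto simp: mem)
  next
    show "\<zero>\<^bsub>X\<^esub> \<in> L <+>\<^bsub>X\<^esub> N" unfolding mem
      by (rule bexI[OF _ L(2)], rule bexI[OF _ Nd(3)]) simp
  next
    fix r x assume r: "r \<in> carrier R" and "x \<in> L <+>\<^bsub>X\<^esub> N"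
    then obtain l b where *: "l \<in> L" "b \<in> N" "x = l \<oplus>\<^bsub>X\<^esub> b" by (auto simp: mem)
    obtain k c where **: "k \<in> L" "c \<in> N" "r \<odot>\<^bsub>X\<^esub> l = k \<oplus>\<^bsub>X\<^esub> c" using A[OF r *(1)] by blast
    have rb: "r \<odot>\<^bsub>X\<^esub> b \<in> N" by (rule Nd(4)[OF r *(2)])
    have "r \<odot>\<^bsub>X\<^esub> x = k \<oplus>\<^bsub>X\<^esub> (c \<oplus>\<^bsub>X\<^esub> r \<odot>\<^bsub>X\<^esub> b)"
      using r * ** Lc Nd(1) rb by (simp add: X.smult_r_distr X.a_assoc)
    moreover have "c \<oplus>\<^bsub>X\<^esub> r \<odot>\<^bsub>X\<^esub> b \<in> N" by (rule Nd(2)[OF **(2) rb])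
    ultimately show "r \<odot>\<^bsub>X\<^esub> x \<in> L <+>\<^bsub>X\<^esub> N" using **(1) by (auto simp: mem)
  qed
qed

lemma (in cring) free_expansion_support:
  assumes q: "q \<in> carrier (free_module R n)" and J: "J \<subseteq> {..<n}" and z: "\<And>c. c \<notin> J \<Longrightarrow> q c = \<zero>"
  shows "q = (\<Oplus>\<^bsub>free_module R n\<^esub>c\<in>J. q c \<odot>\<^bsub>free_module R n\<^esub> unit_vector R c)"
proof -
  interpret F: module R "free_module R n" by (rule free_module_module)
  have e: "c < n \<Longrightarrow> unit_vector R c \<in> carrier (free_module R n)" for c by (rule unit_vector_carrier)
  have "q = (\<Oplus>\<^bsub>free_module R n\<^esub>c\<in>{..<n}. q c \<odot>\<^bsub>free_module R n\<^esub> unit_vector R c)"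
    by (rule free_expansion[OF q])
  also have "\<dots> = (\<Oplus>\<^bsub>free_module R n\<^esub>c\<in>J. q c \<odot>\<^bsub>free_module R n\<^esub> unit_vector R c)"
    by (rule F.add.finprod_mono_neutral_cong_right) (use J e z free_carrier_in[OF q] in auto)
  finally show ?thesis .
qed

text \<open>The residue field is concentrated in degree \<open>0\<close>. Hence every homogeneous strand of \<open>D/\<mm>D\<close> is a
  complex of vector spaces over the residue field of \<open>R\<close>.\<close>

locale graded_residue = degree_ring +
  fixes \<mm>
  assumes maximal: "maximalideal \<mm> R"
    and degree_in_max: "j \<noteq> 0 \<Longrightarrow> Rg j \<subseteq> \<mm>"
    and residue_degree_0: "r \<in> carrier R \<Longrightarrow> \<exists>s\<in>Rg 0. \<exists>q\<in>\<mm>. r = s \<oplus> q"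
begin

lemma max_ideal: "ideal \<mm> R"
  using maximal by (simp add: maximalideal_def)

lemma max_carrier: "\<mm> \<subseteq> carrier R"
  by (rule additive_subgroup.a_subset) (use max_ideal in \<open>simp add: ideal_def\<close>)

lemma max_zero: "\<zero> \<in> \<mm>"
  by (rule additive_subgroup.zero_closed) (use max_ideal in \<open>simp add: ideal_def\<close>)

lemma one_notin_max: "\<one> \<notin> \<mm>"
  using ideal.one_imp_carrier[OF max_ideal] maximal by (auto simp: maximalideal_def maximalideal_axioms_def)

text \<open>The degree \<open>j\<close> part of \<open>R/\<mm> \<otimes> D\<close>.\<close>

definition strand :: "('a, 'c) chain \<Rightarrow> (nat \<Rightarrow> int \<Rightarrow> 'c set) \<Rightarrow> int \<Rightarrow> ('a, 'c set) chain" where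
  "strand D Dg j = subquotient D (\<lambda>i. Dg i j <+>\<^bsub>obj D i\<^esub> ideal_smult R \<mm> (obj D i)) (\<lambda>i. ideal_smult R \<mm> (obj D i))"

lemma strand_pair:
  assumes "graded_complex R Rg D Dg"
  shows "complex_pair R D (\<lambda>i. Dg i j <+>\<^bsub>obj D i\<^esub> ideal_smult R \<mm> (obj D i)) (\<lambda>i. ideal_smult R \<mm> (obj D i))"
proof (intro complex_pair.intro complex_pair_axioms.intro cring_axioms)
  have Dm: "\<And>i. degree_module R Rg (obj D i) (Dg i)"
    and Dd: "\<And>i. diff D i \<in> graded_hom R (obj D (Suc i)) (Dg (Suc i)) (obj D i) (Dg i)"
    and Ddd: "\<And>i x. x \<in> carrier (obj D (Suc (Suc i))) \<Longrightarrow> diff D i (diff D (Suc i) x) = \<zero>\<^bsub>obj D i\<^esub>"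
    using assms by (auto simp: graded_complex_def)
  note Dmod = degree_moduleD(1)[OF Dm]
  fix i
  let ?m = "ideal_smult R \<mm> (obj D i)" and ?A = "Dg i j <+>\<^bsub>obj D i\<^esub> ideal_smult R \<mm> (obj D i)"
  interpret X: module R "obj D i" by (rule Dmod)
  show m: "submodule R ?m (obj D i)" by (rule ideal_smult_submodule[OF Dmod max_carrier])
  show "submodule R ?A (obj D i)"
  proof (rule submodule_residue_sum[OF _ m])
    show "Dg i j \<subseteq> carrier (obj D i)" using degree_moduleD(2)[OF Dm] by blast
    show "\<zero>\<^bsub>obj D i\<^esub> \<in> Dg i j" by (rule degree_moduleD(3)[OF Dm])
    show "\<And>x y. x \<in> Dg i j \<Longrightarrow> y \<in> Dg i j \<Longrightarrow> x \<oplus>\<^bsub>obj D i\<^esub> y \<in> Dg i j" by (rule degree_moduleD(4)[OF Dm])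
    fix r y assume r: "r \<in> carrier R" and y: "y \<in> Dg i j"
    obtain s q where sq: "s \<in> Rg 0" "q \<in> \<mm>" "r = s \<oplus> q" using residue_degree_0[OF r] by blast
    have yc: "y \<in> carrier (obj D i)" by (rule degree_moduleD(2)[OF Dm y])
    have "s \<odot>\<^bsub>obj D i\<^esub> y \<in> Dg i (0 + j)" by (rule degree_moduleD(5)[OF Dm sq(1) y])
    moreover have "q \<odot>\<^bsub>obj D i\<^esub> y \<in> ?m" by (rule ideal_smult_incl[OF Dmod max_carrier sq(2) yc])
    moreover have "r \<odot>\<^bsub>obj D i\<^esub> y = s \<odot>\<^bsub>obj D i\<^esub> y \<oplus>\<^bsub>obj D i\<^esub> q \<odot>\<^bsub>obj D i\<^esub> y"
      unfolding sq(3) using Rg_carrier[OF sq(1)] sq(2) max_carrier yc by (auto intro!: X.smult_l_distr)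
    ultimately show "\<exists>l\<in>Dg i j. \<exists>b\<in>?m. r \<odot>\<^bsub>obj D i\<^esub> y = l \<oplus>\<^bsub>obj D i\<^esub> b" by auto
  qed
  show "?m \<subseteq> ?A"
  proof
    fix x assume x: "x \<in> ?m"
    have "x = \<zero>\<^bsub>obj D i\<^esub> \<oplus>\<^bsub>obj D i\<^esub> x" using submoduleD(1)[OF m x] by simp
    then show "x \<in> ?A" using degree_moduleD(3)[OF Dm, of i j] x unfolding set_add_def' by blast
  qed
  show "diff D i \<in> module_hom R (obj D (Suc i)) (obj D i)" by (rule graded_homD(1)[OF Dd])
  show mm: "diff D i ` ideal_smult R \<mm> (obj D (Suc i)) \<subseteq> ?m"
    using hom_ideal_smult[OF Dmod Dmod graded_homD(1)[OF Dd] max_carrier] by blast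
  show "diff D i ` (Dg (Suc i) j <+>\<^bsub>obj D (Suc i)\<^esub> ideal_smult R \<mm> (obj D (Suc i))) \<subseteq> ?A"
  proof (rule image_subsetI)
    fix x assume "x \<in> Dg (Suc i) j <+>\<^bsub>obj D (Suc i)\<^esub> ideal_smult R \<mm> (obj D (Suc i))"
    then obtain l b where *: "l \<in> Dg (Suc i) j" "b \<in> ideal_smult R \<mm> (obj D (Suc i))" "x = l \<oplus>\<^bsub>obj D (Suc i)\<^esub> b"
      by (auto simp: set_add_def')
    have "diff D i x = diff D i l \<oplus>\<^bsub>obj D i\<^esub> diff D i b"
      unfolding *(3) by (rule module_hom_add[OF graded_homD(1)[OF Dd] degree_moduleD(2)[OF Dm *(1)]
            submoduleD(1)[OF ideal_smult_submodule[OF Dmod max_carrier] *(2)]])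
    then show "diff D i x \<in> ?A" using graded_homD(2)[OF Dd *(1)] mm *(2) unfolding set_add_def' by blast
  qed
  show "\<And>x. x \<in> carrier (obj D (Suc (Suc i))) \<Longrightarrow> diff D i (diff D (Suc i) x) = \<zero>\<^bsub>obj D i\<^esub>" by (rule Ddd)
qed

text \<open>A minimal resolution \<open>F\<close> computes Tor: modulo \<open>\<mm>\<close>, its homotopy equivalence with \<open>D\<close> identifies
  the homology of \<open>D/\<mm>D\<close> in degree \<open>j\<close> with the span of the basis elements of \<open>F\<close> of degree \<open>j\<close>.\<close>

lemma strand_homology_basis:
  fixes F :: "('a, nat \<Rightarrow> 'a) chain" and D :: "('a, 'c) chain" and j :: int and k :: nat
  assumes F: "strict_resolution R Rg F (\<lambda>i. free_degree R Rg (n i) (a i)) \<epsilon> M Mg"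
    and free: "\<And>i. obj F i = free_module R (n i)" and minF: "minimal_complex R \<mm> F"
    and D: "strict_resolution R Rg D Dg \<delta> M Mg" and projD: "\<And>i. graded_projective R Rg (obj D i) (Dg i)"
  defines "V \<equiv> homology (strand D Dg j) k" and "J \<equiv> {c. c < n k \<and> a k c = j}"
  obtains e where "module R V" "\<And>r v. r \<in> \<mm> \<Longrightarrow> v \<in> carrier V \<Longrightarrow> r \<odot>\<^bsub>V\<^esub> v = \<zero>\<^bsub>V\<^esub>"
    "\<And>c. c \<in> J \<Longrightarrow> e c \<in> carrier V"
    "\<And>v. v \<in> carrier V \<Longrightarrow> \<exists>r\<in>J \<rightarrow> carrier R. v = (\<Oplus>\<^bsub>V\<^esub>c\<in>J. r c \<odot>\<^bsub>V\<^esub> e c)"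
    "\<And>r. r \<in> J \<rightarrow> carrier R \<Longrightarrow> (\<Oplus>\<^bsub>V\<^esub>c\<in>J. r c \<odot>\<^bsub>V\<^esub> e c) = \<zero>\<^bsub>V\<^esub> \<Longrightarrow> \<forall>c\<in>J. r c \<in> \<mm>"
proof -
  have projF: "graded_projective R Rg (obj F i) (free_degree R Rg (n i) (a i))" for i
    unfolding free by (rule free_projective)
  have Dc: "graded_complex R Rg D Dg" using D by (simp add: strict_resolution_def)
  define A where "A i = Dg i j <+>\<^bsub>obj D i\<^esub> ideal_smult R \<mm> (obj D i)" for i
  define B where "B i = ideal_smult R \<mm> (obj D i)" for i
  interpret P: complex_pair R D A B
    unfolding A_def[abs_def] B_def[abs_def] by (rule strand_pair[OF Dc])
  have V: "V = homology (subquotient D A B) k"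
    unfolding V_def strand_def A_def[abs_def] B_def[abs_def] ..
  let ?Z = "P.relative_cycles k" and ?cl = "P.homology_class k"
  obtain \<phi> \<psi> s u where
    \<phi>: "\<And>i. \<phi> i \<in> graded_hom R (obj D i) (Dg i) (obj F i) (free_degree R Rg (n i) (a i))"
    and \<psi>: "\<And>i. \<psi> i \<in> graded_hom R (obj F i) (free_degree R Rg (n i) (a i)) (obj D i) (Dg i)"
    and \<phi>d: "\<And>i x. x \<in> carrier (obj D (Suc i)) \<Longrightarrow> diff F i (\<phi> (Suc i) x) = \<phi> i (diff D i x)"
    and \<psi>d: "\<And>i x. x \<in> carrier (obj F (Suc i)) \<Longrightarrow> diff D i (\<psi> (Suc i) x) = \<psi> i (diff F i x)"
    and s: "\<And>i. s i \<in> graded_hom R (obj D i) (Dg i) (obj D (Suc i)) (Dg (Suc i))"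
    and s0: "\<And>x. x \<in> carrier (obj D 0) \<Longrightarrow> x = \<psi> 0 (\<phi> 0 x) \<oplus>\<^bsub>obj D 0\<^esub> diff D 0 (s 0 x)"
    and sS: "\<And>i x. x \<in> carrier (obj D (Suc i)) \<Longrightarrow> x = \<psi> (Suc i) (\<phi> (Suc i) x) \<oplus>\<^bsub>obj D (Suc i)\<^esub>
        (diff D (Suc i) (s (Suc i) x) \<oplus>\<^bsub>obj D (Suc i)\<^esub> s i (diff D i x))"
    and u: "\<And>i. u i \<in> graded_hom R (obj F i) (free_degree R Rg (n i) (a i)) (obj F (Suc i)) (free_degree R Rg (n (Suc i)) (a (Suc i)))"
    and u0: "\<And>x. x \<in> carrier (obj F 0) \<Longrightarrow> x = \<phi> 0 (\<psi> 0 x) \<oplus>\<^bsub>obj F 0\<^esub> diff F 0 (u 0 x)"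
    and uS: "\<And>i x. x \<in> carrier (obj F (Suc i)) \<Longrightarrow> x = \<phi> (Suc i) (\<psi> (Suc i) x) \<oplus>\<^bsub>obj F (Suc i)\<^esub>
        (diff F (Suc i) (u (Suc i) x) \<oplus>\<^bsub>obj F (Suc i)\<^esub> u i (diff F i x))"
    by (rule homotopy_equivalence[OF D projD F projF]) (rule that, assumption+)
  have Fm: "\<And>i. module R (obj F i)" and Fd: "\<And>i. diff F i \<in> module_hom R (obj F (Suc i)) (obj F i)"
    and Dd: "\<And>i. diff D i \<in> module_hom R (obj D (Suc i)) (obj D i)"
    using F D by (auto simp: strict_resolution_def resolution_def)
  note Dm = P.obj_module
  note Dg = degree_moduleD[of R Rg "obj D i" "Dg i" for i]
  have Dgm: "\<And>i. degree_module R Rg (obj D i) (Dg i)" using Dc by (simp add: graded_complex_def)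
  let ?mF = "\<lambda>i. ideal_smult R \<mm> (obj F i)"
  have mF: "submodule R (?mF i) (obj F i)" for i by (rule ideal_smult_submodule[OF Fm max_carrier])
  have mD: "submodule R (B i) (obj D i)" for i unfolding B_def by (rule ideal_smult_submodule[OF Dm max_carrier])
  have dF: "diff F i y \<in> ?mF i" if "y \<in> carrier (obj F (Suc i))" for i y
    using minF that by (auto simp: minimal_complex_def boundaries_def)
  have \<psi>m: "x \<in> ?mF i \<Longrightarrow> \<psi> i x \<in> B i" for i x
    unfolding B_def by (rule hom_ideal_smult[OF Fm Dm graded_homD(1)[OF \<psi>] max_carrier])
  have \<phi>m: "x \<in> B i \<Longrightarrow> \<phi> i x \<in> ?mF i" for i x
    unfolding B_def by (rule hom_ideal_smult[OF Dm Fm graded_homD(1)[OF \<phi>] max_carrier])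
  have sm: "x \<in> B i \<Longrightarrow> s i x \<in> B (Suc i)" for i x
    unfolding B_def by (rule hom_ideal_smult[OF Dm Dm graded_homD(1)[OF s] max_carrier])
  have um: "x \<in> ?mF i \<Longrightarrow> u i x \<in> ?mF (Suc i)" for i x
    by (rule hom_ideal_smult[OF Fm Fm graded_homD(1)[OF u] max_carrier])
  have A: "x \<in> A i \<longleftrightarrow> (\<exists>y\<in>Dg i j. \<exists>z\<in>B i. x = y \<oplus>\<^bsub>obj D i\<^esub> z)" for x i
    by (auto simp: A_def B_def set_add_def')
  have sA: "s i x \<in> A (Suc i)" if xA: "x \<in> A i" for i x
  proof -
    obtain y z where yz: "y \<in> Dg i j" "z \<in> B i" "x = y \<oplus>\<^bsub>obj D i\<^esub> z" using xA unfolding A by blast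
    have "s i x = s i y \<oplus>\<^bsub>obj D (Suc i)\<^esub> s i z" unfolding yz(3)
      by (rule module_hom_add[OF graded_homD(1)[OF s] degree_moduleD(2)[OF Dgm yz(1)] submoduleD(1)[OF mD yz(2)]])
    then show ?thesis unfolding A using graded_homD(2)[OF s yz(1)] sm[OF yz(2)] by blast
  qed
  interpret F: module R "obj F k" by (rule Fm)
  interpret Dk: module R "obj D k" by (rule Dm)
  interpret V: module R V unfolding V by (rule P.homology_module)
  interpret Z: module R "(obj D k)\<lparr>carrier := ?Z\<rparr>" by (rule module_submodule[OF P.relative_cycles_submodule])
  \<comment> \<open>a cycle is homologous to its image under the round trip through \<open>F\<close>\<close>
  have round_D: "\<exists>b\<in>B k. x = (\<psi> k (\<phi> k x) \<oplus>\<^bsub>obj D k\<^esub> b) \<oplus>\<^bsub>obj D k\<^esub> diff D k (s k x)" if x: "x \<in> ?Z" for x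
  proof -
    have xc: "x \<in> carrier (obj D k)" using x P.relative_cycles_A P.A_carrier by blast
    have 1: "\<psi> k (\<phi> k x) \<in> carrier (obj D k)" by (rule graded_homD(3)[OF \<psi> graded_homD(3)[OF \<phi> xc]])
    have 2: "diff D k (s k x) \<in> carrier (obj D k)" by (rule hom_closed[OF Dd graded_homD(3)[OF s xc]])
    show ?thesis
    proof (cases k)
      case 0
      have "x = \<psi> k (\<phi> k x) \<oplus>\<^bsub>obj D k\<^esub> diff D k (s k x)"
        using s0[OF xc[unfolded 0]] unfolding 0 .
      then have "x = (\<psi> k (\<phi> k x) \<oplus>\<^bsub>obj D k\<^esub> \<zero>\<^bsub>obj D k\<^esub>) \<oplus>\<^bsub>obj D k\<^esub> diff D k (s k x)"
        using Dk.r_zero[OF 1] by argo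
      then show ?thesis using submoduleD(3)[OF mD] by blast
    next
      case (Suc i)
      have 3: "s i (diff D i x) \<in> B k"
        using x Suc sm[of "diff D i x" i] by (simp add: P.relative_cycles_def)
      have "x = \<psi> k (\<phi> k x) \<oplus>\<^bsub>obj D k\<^esub> (diff D k (s k x) \<oplus>\<^bsub>obj D k\<^esub> s i (diff D i x))"
        using sS[OF xc[unfolded Suc]] unfolding Suc .
      also have "\<dots> = (\<psi> k (\<phi> k x) \<oplus>\<^bsub>obj D k\<^esub> s i (diff D i x)) \<oplus>\<^bsub>obj D k\<^esub> diff D k (s k x)"
        using 1 2 submoduleD(1)[OF mD 3] by (simp only: Dk.a_ac Dk.a_closed)
      finally have "x = (\<psi> k (\<phi> k x) \<oplus>\<^bsub>obj D k\<^esub> s i (diff D i x)) \<oplus>\<^bsub>obj D k\<^esub> diff D k (s k x)" .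
      with 3 show ?thesis by blast
    qed
  qed
  have round_F: "q \<in> ?mF k" if q: "q \<in> carrier (obj F k)" and m: "\<phi> k (\<psi> k q) \<in> ?mF k" for q
  proof (cases k)
    case 0
    have "q = \<phi> k (\<psi> k q) \<oplus>\<^bsub>obj F k\<^esub> diff F k (u k q)" using u0[OF q[unfolded 0]] unfolding 0 .
    moreover have "diff F k (u k q) \<in> ?mF k" by (rule dF[OF graded_homD(3)[OF u q]])
    ultimately show ?thesis using submoduleD(2)[OF mF m] by metis
  next
    case (Suc i)
    have "q = \<phi> k (\<psi> k q) \<oplus>\<^bsub>obj F k\<^esub> (diff F k (u k q) \<oplus>\<^bsub>obj F k\<^esub> u i (diff F i q))"
      using uS[OF q[unfolded Suc]] unfolding Suc .
    moreover have "diff F k (u k q) \<in> ?mF k" by (rule dF[OF graded_homD(3)[OF u q]])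
    moreover have "u i (diff F i q) \<in> ?mF k" using um[OF dF[OF q[unfolded Suc]]] unfolding Suc .
    ultimately show ?thesis using submoduleD(2)[OF mF] m by metis
  qed
  have \<psi>e: "\<psi> k (unit_vector R c) \<in> ?Z" if c: "c \<in> J" for c
  proof -
    have c': "c < n k" "a k c = j" using c by (auto simp: J_def)
    have ed: "unit_vector R c \<in> free_degree R Rg (n k) (a k) j" using unit_vector_degree[OF c'(1), of "a k"] c'(2) by simp
    have "\<psi> k (unit_vector R c) = \<psi> k (unit_vector R c) \<oplus>\<^bsub>obj D k\<^esub> \<zero>\<^bsub>obj D k\<^esub>"
      using graded_homD(2)[OF \<psi> ed] degree_moduleD(2)[OF Dgm] by simp
    then have "\<psi> k (unit_vector R c) \<in> A k" unfolding A using graded_homD(2)[OF \<psi> ed] submoduleD(3)[OF mD] by blast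
    moreover have "diff D i (\<psi> k (unit_vector R c)) \<in> B i" if "k = Suc i" for i
    proof -
      have e: "unit_vector R c \<in> carrier (obj F (Suc i))" using unit_vector_carrier[OF c'(1)] that by (simp add: free)
      then show ?thesis using \<psi>d[OF e] \<psi>m[OF dF[OF e]] that by simp
    qed
    ultimately show ?thesis by (simp add: P.relative_cycles_def)
  qed
  let ?e = "\<lambda>c. ?cl (\<psi> k (unit_vector R c))"
  have clh: "?cl \<in> module_hom R ((obj D k)\<lparr>carrier := ?Z\<rparr>) V" unfolding V by (rule P.homology_class_hom)
  have J: "J \<subseteq> {..<n k}" by (auto simp: J_def)
  have expand: "\<psi> k q \<in> ?Z \<and> ?cl (\<psi> k q) = (\<Oplus>\<^bsub>V\<^esub>c\<in>J. q c \<odot>\<^bsub>V\<^esub> ?e c)"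
    if q: "q \<in> carrier (obj F k)" "\<And>c. c \<notin> J \<Longrightarrow> q c = \<zero>" for q
  proof -
    have qR: "q c \<in> carrier R" for c using free_carrier_in[of q "n k" c] q(1) by (simp add: free)
    have e: "unit_vector R c \<in> carrier (obj F k)" if "c \<in> J" for c
      using unit_vector_carrier[of c "n k"] that J by (auto simp: free)
    have "\<psi> k q = \<psi> k (\<Oplus>\<^bsub>obj F k\<^esub>c\<in>J. q c \<odot>\<^bsub>obj F k\<^esub> unit_vector R c)"
      using free_expansion_support[of q "n k" J] q J by (simp add: free)
    also have "\<dots> = (\<Oplus>\<^bsub>obj D k\<^esub>c\<in>J. \<psi> k (q c \<odot>\<^bsub>obj F k\<^esub> unit_vector R c))"
      by (rule hom_finsum[OF Fm Dm graded_homD(1)[OF \<psi>]]) (use e qR in auto)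
    also have "\<dots> = (\<Oplus>\<^bsub>obj D k\<^esub>c\<in>J. q c \<odot>\<^bsub>obj D k\<^esub> \<psi> k (unit_vector R c))"
      by (rule Dk.finsum_cong') (use e qR graded_homD(3)[OF \<psi>] in \<open>auto simp: module_hom_smult[OF graded_homD(1)[OF \<psi>]]\<close>)
    also have "\<dots> = (\<Oplus>\<^bsub>(obj D k)\<lparr>carrier := ?Z\<rparr>\<^esub>c\<in>J. q c \<odot>\<^bsub>obj D k\<^esub> \<psi> k (unit_vector R c))"
      by (rule finsum_submodule[OF P.relative_cycles_submodule, symmetric])
        (use \<psi>e qR submoduleD(4)[OF P.relative_cycles_submodule] in blast)
    finally have eq: "\<psi> k q = (\<Oplus>\<^bsub>(obj D k)\<lparr>carrier := ?Z\<rparr>\<^esub>c\<in>J. q c \<odot>\<^bsub>obj D k\<^esub> \<psi> k (unit_vector R c))" .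
    have in_Z: "(\<lambda>c. q c \<odot>\<^bsub>obj D k\<^esub> \<psi> k (unit_vector R c)) \<in> J \<rightarrow> carrier ((obj D k)\<lparr>carrier := ?Z\<rparr>)"
      using \<psi>e qR submoduleD(4)[OF P.relative_cycles_submodule] by auto
    have "\<psi> k q \<in> ?Z" using Z.finsum_closed[OF in_Z] eq by simp
    moreover have "?cl (\<psi> k q) = (\<Oplus>\<^bsub>V\<^esub>c\<in>J. ?cl (q c \<odot>\<^bsub>obj D k\<^esub> \<psi> k (unit_vector R c)))"
      unfolding eq by (rule hom_finsum[OF Z.module_axioms V.module_axioms clh in_Z])
    moreover have "\<dots> = (\<Oplus>\<^bsub>V\<^esub>c\<in>J. q c \<odot>\<^bsub>V\<^esub> ?e c)"
    proof (rule V.finsum_cong')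
      show "(\<lambda>c. q c \<odot>\<^bsub>V\<^esub> ?e c) \<in> J \<rightarrow> carrier V"
        using \<psi>e qR hom_closed[OF clh] by auto
      fix c assume "c \<in> J"
      then show "?cl (q c \<odot>\<^bsub>obj D k\<^esub> \<psi> k (unit_vector R c)) = q c \<odot>\<^bsub>V\<^esub> ?e c"
        using module_hom_smult[OF clh qR, of "\<psi> k (unit_vector R c)" c] \<psi>e by simp
    qed simp
    ultimately show ?thesis by simp
  qed
  show thesis
  proof (rule that)
    show "module R V" by (rule V.module_axioms)
    show "?e c \<in> carrier V" if "c \<in> J" for c
      using hom_closed[OF clh] \<psi>e[OF that] by simp
    show "r \<odot>\<^bsub>V\<^esub> v = \<zero>\<^bsub>V\<^esub>" if r: "r \<in> \<mm>" and v: "v \<in> carrier V" for r v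
    proof -
      have "v \<in> ?cl ` ?Z" using v unfolding V P.homology_class_surj .
      then obtain x where x: "x \<in> ?Z" "v = ?cl x" by blast
      have rR: "r \<in> carrier R" using r max_carrier by blast
      have xc: "x \<in> carrier (obj D k)" using x P.relative_cycles_A P.A_carrier by blast
      have rx: "r \<odot>\<^bsub>obj D k\<^esub> x \<in> B k" unfolding B_def by (rule ideal_smult_incl[OF Dm max_carrier r xc])
      have "r \<odot>\<^bsub>obj D k\<^esub> x = diff D k \<zero>\<^bsub>obj D (Suc k)\<^esub> \<oplus>\<^bsub>obj D k\<^esub> r \<odot>\<^bsub>obj D k\<^esub> x"
        using hom_zero[OF Dm Dm Dd] submoduleD(1)[OF mD rx] by simp
      then have "r \<odot>\<^bsub>obj D k\<^esub> x \<in> P.relative_boundaries k"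
        unfolding P.relative_boundaries_def using rx submoduleD(3)[OF P.A_submodule] by blast
      then have "?cl (r \<odot>\<^bsub>obj D k\<^esub> x) = \<zero>\<^bsub>V\<^esub>"
        unfolding V using P.homology_class_zero_iff submoduleD(4)[OF P.relative_cycles_submodule rR x(1)] by blast
      then show ?thesis using module_hom_smult[OF clh rR, of x] x by simp
    qed
    show "\<exists>r\<in>J \<rightarrow> carrier R. v = (\<Oplus>\<^bsub>V\<^esub>c\<in>J. r c \<odot>\<^bsub>V\<^esub> ?e c)" if v: "v \<in> carrier V" for v
    proof -
      have "v \<in> ?cl ` ?Z" using v unfolding V P.homology_class_surj .
      then obtain x where x: "x \<in> ?Z" "v = ?cl x" by blast
      have xA: "x \<in> A k" using x P.relative_cycles_A by blast
      have xc: "x \<in> carrier (obj D k)" by (rule P.A_carrier[OF xA])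
      obtain y z where yz: "y \<in> Dg k j" "z \<in> B k" "x = y \<oplus>\<^bsub>obj D k\<^esub> z" using xA unfolding A by blast
      have yc: "y \<in> carrier (obj D k)" by (rule degree_moduleD(2)[OF Dgm yz(1)])
      let ?f = "\<phi> k y"
      let ?q = "\<lambda>c. if c \<in> J then ?f c else \<zero>" and ?w = "\<lambda>c. if c \<in> J then \<zero> else ?f c"
      have f: "?f \<in> free_degree R Rg (n k) (a k) j" by (rule graded_homD(2)[OF \<phi> yz(1)])
      then have fc: "?f \<in> carrier (free_module R (n k))" "\<And>c. ?f c \<in> Rg (j - a k c)" by (auto simp: free_degree_def)
      have fR: "?f c \<in> carrier R" for c using free_carrier_in[OF fc(1)] .
      have q: "?q \<in> carrier (obj F k)" unfolding free using fc(1) by (auto simp: free_carrier_iff)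
      have w: "?w \<in> ?mF k"
      proof -
        have "?w c \<in> \<mm>" for c
        proof (cases "c < n k \<and> c \<notin> J")
          case True
          then have "j - a k c \<noteq> 0" by (auto simp: J_def)
          then have "?f c \<in> \<mm>" by (rule subsetD[OF degree_in_max fc(2)])
          then show ?thesis using True by simp
        next
          case False
          then show ?thesis using fc(1) max_zero by (auto simp: free_carrier_iff)
        qed
        moreover have "?w \<in> carrier (free_module R (n k))" using fc(1) by (auto simp: free_carrier_iff)
        ultimately show ?thesis by (simp add: free ideal_smult_free[OF max_ideal])
      qed
      have "?f = ?q \<oplus>\<^bsub>obj F k\<^esub> ?w" using fR by (auto simp: free free_module_simps)
      then have "\<psi> k ?f = \<psi> k ?q \<oplus>\<^bsub>obj D k\<^esub> \<psi> k ?w"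
        using module_hom_add[OF graded_homD(1)[OF \<psi>] q submoduleD(1)[OF mF w]] by simp
      moreover have "\<phi> k x = ?f \<oplus>\<^bsub>obj F k\<^esub> \<phi> k z" unfolding yz(3)
        by (rule module_hom_add[OF graded_homD(1)[OF \<phi>] yc submoduleD(1)[OF mD yz(2)]])
      moreover have "\<psi> k (?f \<oplus>\<^bsub>obj F k\<^esub> \<phi> k z) = \<psi> k ?f \<oplus>\<^bsub>obj D k\<^esub> \<psi> k (\<phi> k z)"
        by (rule module_hom_add[OF graded_homD(1)[OF \<psi>] graded_homD(3)[OF \<phi> yc] submoduleD(1)[OF mF \<phi>m[OF yz(2)]]])
      ultimately have px: "\<psi> k (\<phi> k x) = (\<psi> k ?q \<oplus>\<^bsub>obj D k\<^esub> \<psi> k ?w) \<oplus>\<^bsub>obj D k\<^esub> \<psi> k (\<phi> k z)" by simp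
      obtain b where b: "b \<in> B k" "x = (\<psi> k (\<phi> k x) \<oplus>\<^bsub>obj D k\<^esub> b) \<oplus>\<^bsub>obj D k\<^esub> diff D k (s k x)"
        using round_D[OF x(1)] by blast
      let ?d = "diff D k (s k x)" and ?b = "\<psi> k ?w \<oplus>\<^bsub>obj D k\<^esub> (\<psi> k (\<phi> k z) \<oplus>\<^bsub>obj D k\<^esub> b)"
      have bb: "?b \<in> B k" by (intro submoduleD(2)[OF mD] \<psi>m w \<phi>m yz(2) b(1))
      have ex: "\<psi> k ?q \<in> ?Z" "?cl (\<psi> k ?q) = (\<Oplus>\<^bsub>V\<^esub>c\<in>J. ?q c \<odot>\<^bsub>V\<^esub> ?e c)" using expand[OF q] by auto
      have cs: "\<psi> k ?q \<in> carrier (obj D k)" "\<psi> k ?w \<in> carrier (obj D k)" "\<psi> k (\<phi> k z) \<in> carrier (obj D k)"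
        "b \<in> carrier (obj D k)" "?d \<in> carrier (obj D k)"
        using submoduleD(1)[OF P.relative_cycles_submodule ex(1)] submoduleD(1)[OF mD \<psi>m[OF w]]
          submoduleD(1)[OF mD \<psi>m[OF \<phi>m[OF yz(2)]]] submoduleD(1)[OF mD b(1)] hom_closed[OF Dd graded_homD(3)[OF s xc]] by auto
      have eq: "x = \<psi> k ?q \<oplus>\<^bsub>obj D k\<^esub> (?d \<oplus>\<^bsub>obj D k\<^esub> ?b)"
      proof -
        have "x = ((\<psi> k ?q \<oplus>\<^bsub>obj D k\<^esub> \<psi> k ?w) \<oplus>\<^bsub>obj D k\<^esub> \<psi> k (\<phi> k z) \<oplus>\<^bsub>obj D k\<^esub> b) \<oplus>\<^bsub>obj D k\<^esub> ?d"
          using b(2) unfolding px .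
        also have "\<dots> = \<psi> k ?q \<oplus>\<^bsub>obj D k\<^esub> (?d \<oplus>\<^bsub>obj D k\<^esub> ?b)"
          using cs by (simp add: Dk.a_ac)
        finally show ?thesis .
      qed
      have rb: "?d \<oplus>\<^bsub>obj D k\<^esub> ?b \<in> P.relative_boundaries k"
        unfolding P.relative_boundaries_def using bb sA[OF xA] by blast
      have rz: "?d \<oplus>\<^bsub>obj D k\<^esub> ?b \<in> ?Z"
      proof (rule submoduleD(2)[OF P.relative_cycles_submodule])
        show "?d \<in> ?Z" by (rule P.diff_relative_cycles[OF sA[OF xA]])
        have "?b \<in> A k" using bb P.B_subset by blast
        moreover have "diff D i ?b \<in> B i" if "k = Suc i" for i
          using P.diff_B[of i] bb that by blast
        ultimately show "?b \<in> ?Z" by (simp add: P.relative_cycles_def)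
      qed
      have "v = ?cl (\<psi> k ?q) \<oplus>\<^bsub>V\<^esub> ?cl (?d \<oplus>\<^bsub>obj D k\<^esub> ?b)"
        unfolding x(2) by (subst eq) (use module_hom_add[OF clh, of "\<psi> k ?q" "?d \<oplus>\<^bsub>obj D k\<^esub> ?b"] ex(1) rz in simp)
      also have "?cl (?d \<oplus>\<^bsub>obj D k\<^esub> ?b) = \<zero>\<^bsub>V\<^esub>" unfolding V using P.homology_class_zero_iff[OF rz] rb by simp
      finally have "v = ?cl (\<psi> k ?q)" using hom_closed[OF clh, of "\<psi> k ?q"] ex(1) by simp
      then show ?thesis unfolding ex(2) using fR by (intro bexI[of _ ?q]) auto
    qed
    show "\<forall>c\<in>J. r c \<in> \<mm>" if r: "r \<in> J \<rightarrow> carrier R" and z: "(\<Oplus>\<^bsub>V\<^esub>c\<in>J. r c \<odot>\<^bsub>V\<^esub> ?e c) = \<zero>\<^bsub>V\<^esub>" for r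
    proof -
      let ?q = "\<lambda>c. if c \<in> J then r c else \<zero>"
      have q: "?q \<in> carrier (obj F k)" unfolding free using r J by (auto simp: free_carrier_iff)
      have ex: "\<psi> k ?q \<in> ?Z" "?cl (\<psi> k ?q) = (\<Oplus>\<^bsub>V\<^esub>c\<in>J. ?q c \<odot>\<^bsub>V\<^esub> ?e c)" using expand[OF q] by auto
      have "(\<Oplus>\<^bsub>V\<^esub>c\<in>J. ?q c \<odot>\<^bsub>V\<^esub> ?e c) = (\<Oplus>\<^bsub>V\<^esub>c\<in>J. r c \<odot>\<^bsub>V\<^esub> ?e c)"
        by (rule V.finsum_cong') (use r \<psi>e hom_closed[OF clh] in auto)
      then have "\<psi> k ?q \<in> P.relative_boundaries k"
        using P.homology_class_zero_iff[OF ex(1)] ex(2) z unfolding V by simp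
      then obtain y b where yb: "y \<in> A (Suc k)" "b \<in> B k" "\<psi> k ?q = diff D k y \<oplus>\<^bsub>obj D k\<^esub> b"
        by (auto simp: P.relative_boundaries_def)
      have yc: "y \<in> carrier (obj D (Suc k))" by (rule P.A_carrier[OF yb(1)])
      have "\<phi> k (\<psi> k ?q) = diff F k (\<phi> (Suc k) y) \<oplus>\<^bsub>obj F k\<^esub> \<phi> k b"
        unfolding yb(3) \<phi>d[OF yc]
        by (rule module_hom_add[OF graded_homD(1)[OF \<phi>] hom_closed[OF Dd yc] submoduleD(1)[OF mD yb(2)]])
      moreover have "diff F k (\<phi> (Suc k) y) \<oplus>\<^bsub>obj F k\<^esub> \<phi> k b \<in> ?mF k"
        by (rule submoduleD(2)[OF mF dF[OF graded_homD(3)[OF \<phi> yc]] \<phi>m[OF yb(2)]])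
      ultimately have "?q \<in> ?mF k" using round_F[OF q] by simp
      then have qm: "?q c \<in> \<mm>" for c by (simp add: free ideal_smult_free[OF max_ideal])
      show ?thesis
      proof
        fix c assume "c \<in> J"
        then show "r c \<in> \<mm>" using qm[of c] by simp
      qed
    qed
  qed
qed

lemma strand_homology_dim:
  fixes F :: "('a, nat \<Rightarrow> 'a) chain" and D :: "('a, 'c) chain"
  assumes F: "strict_resolution R Rg F (\<lambda>i. free_degree R Rg (n i) (a i)) \<epsilon> M Mg"
    and free: "\<And>i. obj F i = free_module R (n i)" and minF: "minimal_complex R \<mm> F"
    and D: "strict_resolution R Rg D Dg \<delta> M Mg" and projD: "\<And>i. graded_projective R Rg (obj D i) (Dg i)"
  shows "residue_dim R \<mm> (homology (strand D Dg j) k) = card {c. c < n k \<and> a k c = j}"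
    and "nontrivial (homology (strand D Dg j) k) \<longleftrightarrow> (\<exists>c<n k. a k c = j)"
proof -
  let ?V = "homology (strand D Dg j) k" and ?J = "{c. c < n k \<and> a k c = j}"
  obtain e where V: "module R ?V" "\<And>r v. r \<in> \<mm> \<Longrightarrow> v \<in> carrier ?V \<Longrightarrow> r \<odot>\<^bsub>?V\<^esub> v = \<zero>\<^bsub>?V\<^esub>"
    and e: "\<And>c. c \<in> ?J \<Longrightarrow> e c \<in> carrier ?V"
    and gen: "\<And>v. v \<in> carrier ?V \<Longrightarrow> \<exists>r\<in>?J \<rightarrow> carrier R. v = (\<Oplus>\<^bsub>?V\<^esub>c\<in>?J. r c \<odot>\<^bsub>?V\<^esub> e c)"
    and ind: "\<And>r. r \<in> ?J \<rightarrow> carrier R \<Longrightarrow> (\<Oplus>\<^bsub>?V\<^esub>c\<in>?J. r c \<odot>\<^bsub>?V\<^esub> e c) = \<zero>\<^bsub>?V\<^esub> \<Longrightarrow> \<forall>c\<in>?J. r c \<in> \<mm>"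
    by (rule strand_homology_basis[OF F free minF D projD]) (rule that, assumption+)
  show "residue_dim R \<mm> ?V = card ?J"
    by (rule residue_dim_eqI[OF maximal cring_axioms V _ e gen ind]) auto
  interpret V: module R ?V by (rule V(1))
  show "nontrivial ?V \<longleftrightarrow> (\<exists>c<n k. a k c = j)"
  proof
    assume "nontrivial ?V"
    moreover have "carrier ?V = {\<zero>\<^bsub>?V\<^esub>}" if "?J = {}"
      using gen V.zero_closed unfolding that by auto
    ultimately show "\<exists>c<n k. a k c = j" unfolding nontrivial_def by blast
  next
    assume "\<exists>c<n k. a k c = j"
    then obtain c where c: "c \<in> ?J" by blast
    have "carrier ?V \<noteq> {\<zero>\<^bsub>?V\<^esub>}"
    proof
      assume triv: "carrier ?V = {\<zero>\<^bsub>?V\<^esub>}"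
      have "(\<Oplus>\<^bsub>?V\<^esub>c\<in>?J. \<one> \<odot>\<^bsub>?V\<^esub> e c) = \<zero>\<^bsub>?V\<^esub>"
        using V.finsum_closed[of "\<lambda>c. \<one> \<odot>\<^bsub>?V\<^esub> e c" ?J] e triv by auto
      then have "\<one> \<in> \<mm>" using ind[of "\<lambda>c. \<one>"] c by blast
      then show False using one_notin_max by blast
    qed
    then show "nontrivial ?V" by (simp add: nontrivial_def)
  qed
qed

end

section \<open>Direct sums of free modules\<close>

text \<open>\<open>R\<^sup>n \<oplus> R\<^sup>k\<close> is realised as \<open>R\<^sup>n\<^sup>+\<^sup>k\<close>.\<close>

definition join :: "nat \<Rightarrow> (nat \<Rightarrow> 'x) \<Rightarrow> (nat \<Rightarrow> 'x) \<Rightarrow> nat \<Rightarrow> 'x" where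
  "join n f g = (\<lambda>c. if c < n then f c else g (c - n))"

definition left_part :: "('a, 'm) ring_scheme \<Rightarrow> nat \<Rightarrow> (nat \<Rightarrow> 'a) \<Rightarrow> nat \<Rightarrow> 'a" where
  "left_part R n x = (\<lambda>c. if c < n then x c else \<zero>\<^bsub>R\<^esub>)"

definition right_part :: "nat \<Rightarrow> (nat \<Rightarrow> 'x) \<Rightarrow> nat \<Rightarrow> 'x" where
  "right_part n x = (\<lambda>c. x (c + n))"

context cring
begin

lemma left_part_join [simp]: "f \<in> carrier (free_module R n) \<Longrightarrow> left_part R n (join n f g) = f"
  by (auto simp: left_part_def join_def free_carrier_iff)

lemma right_part_join [simp]: "right_part n (join n f g) = g"
  by (auto simp: right_part_def join_def)

lemma join_parts: "join n (left_part R n x) (right_part n x) = x"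
  by (auto simp: left_part_def right_part_def join_def)

lemma join_closed:
  "f \<in> carrier (free_module R n) \<Longrightarrow> g \<in> carrier (free_module R k) \<Longrightarrow> join n f g \<in> carrier (free_module R (n + k))"
  by (auto simp: free_carrier_iff join_def)

lemma join_add:
  "join n f g \<oplus>\<^bsub>free_module R (n + k)\<^esub> join n f' g'
     = join n (f \<oplus>\<^bsub>free_module R n\<^esub> f') (g \<oplus>\<^bsub>free_module R k\<^esub> g')"
  by (auto simp: free_module_simps join_def)

lemma join_hom:
  assumes "u \<in> module_hom R X (free_module R n)" "v \<in> module_hom R X (free_module R k)"
  shows "(\<lambda>x. join n (u x) (v x)) \<in> module_hom R X (free_module R (n + k))"
proof (rule module_homI)
  fix x assume x: "x \<in> carrier X"
  show "join n (u x) (v x) \<in> carrier (free_module R (n + k))"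
    by (rule join_closed[OF hom_closed[OF assms(1) x] hom_closed[OF assms(2) x]])
  show "join n (u (x \<oplus>\<^bsub>X\<^esub> y)) (v (x \<oplus>\<^bsub>X\<^esub> y)) = join n (u x) (v x) \<oplus>\<^bsub>free_module R (n + k)\<^esub> join n (u y) (v y)"
    if y: "y \<in> carrier X" for y
    unfolding join_add module_hom_add[OF assms(1) x y] module_hom_add[OF assms(2) x y] ..
  show "join n (u (r \<odot>\<^bsub>X\<^esub> x)) (v (r \<odot>\<^bsub>X\<^esub> x)) = r \<odot>\<^bsub>free_module R (n + k)\<^esub> join n (u x) (v x)"
    if r: "r \<in> carrier R" for r
    unfolding module_hom_smult[OF assms(1) r x] module_hom_smult[OF assms(2) r x]
    by (auto simp: free_module_simps join_def)
qed

lemma left_part_hom: "left_part R n \<in> module_hom R (free_module R (n + k)) (free_module R n)"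
  by (rule module_homI) (auto simp: free_module_simps left_part_def free_carrier_iff)

lemma right_part_hom: "right_part n \<in> module_hom R (free_module R (n + k)) (free_module R k)"
  by (rule module_homI) (auto simp: free_module_simps right_part_def free_carrier_iff)

lemma zero_hom: "module R Y \<Longrightarrow> (\<lambda>x. \<zero>\<^bsub>Y\<^esub>) \<in> module_hom R X Y"
proof -
  assume "module R Y"
  then interpret Y: module R Y .
  show ?thesis by (rule module_homI) auto
qed

lemma join_ideal_smult:
  assumes I: "I \<subseteq> carrier R" and f: "f \<in> ideal_smult R I (free_module R n)"
    and g: "g \<in> ideal_smult R I (free_module R k)"
  shows "join n f g \<in> ideal_smult R I (free_module R (n + k))"
proof -
  note fm = free_module_module
  interpret Fn: module R "free_module R n" by (rule fm)
  interpret Fk: module R "free_module R k" by (rule fm)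
  have fc: "f \<in> carrier (free_module R n)" and gc: "g \<in> carrier (free_module R k)"
    using submoduleD(1)[OF ideal_smult_submodule[OF fm I]] f g by auto
  have 1: "(\<lambda>f. join n f \<zero>\<^bsub>free_module R k\<^esub>) \<in> module_hom R (free_module R n) (free_module R (n + k))"
    by (rule join_hom[OF _ zero_hom[OF fm]]) (simp add: module_hom_def)
  have 2: "(\<lambda>g. join n \<zero>\<^bsub>free_module R n\<^esub> g) \<in> module_hom R (free_module R k) (free_module R (n + k))"
    by (rule join_hom[OF zero_hom[OF fm]]) (simp add: module_hom_def)
  have "join n f g = join n f \<zero>\<^bsub>free_module R k\<^esub> \<oplus>\<^bsub>free_module R (n + k)\<^esub> join n \<zero>\<^bsub>free_module R n\<^esub> g"
    unfolding join_add using fc gc by simp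
  then show ?thesis
    using submoduleD(2)[OF ideal_smult_submodule[OF fm I] hom_ideal_smult[OF fm fm 1 I f] hom_ideal_smult[OF fm fm 2 I g]]
    by simp
qed

lemma
  assumes I: "I \<subseteq> carrier R" and x: "x \<in> ideal_smult R I (free_module R (n + k))"
  shows left_part_ideal_smult: "left_part R n x \<in> ideal_smult R I (free_module R n)"
    and right_part_ideal_smult: "right_part n x \<in> ideal_smult R I (free_module R k)"
  by (rule hom_ideal_smult[OF free_module_module free_module_module left_part_hom I x])
    (rule hom_ideal_smult[OF free_module_module free_module_module right_part_hom I x])

end

section \<open>The horseshoe construction\<close>

text \<open>For a short exact sequence \<open>0 \<rightarrow> P \<rightarrow> N \<rightarrow> Q \<rightarrow> 0\<close> and free resolutions \<open>F\<close> of \<open>P\<close> and \<open>G\<close> of \<open>Q\<close>: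
  \<open>l\<close> lifts the augmentation of \<open>G\<close> to \<open>N\<close>, and \<open>h\<close> is the connecting part of the differential on
  \<open>F \<oplus> G\<close>.\<close>

locale horseshoe = degree_ring +
  fixes F G :: "('a, nat \<Rightarrow> 'a) chain" and nF nG :: "nat \<Rightarrow> nat" and aF aG :: "nat \<Rightarrow> nat \<Rightarrow> int"
    and eF :: "(nat \<Rightarrow> 'a) \<Rightarrow> 'x" and eG :: "(nat \<Rightarrow> 'a) \<Rightarrow> 'd"
    and N :: "('a, 'x, 'n) module_scheme" and Ng :: "int \<Rightarrow> 'x set" and P :: "'x set" and Pg :: "int \<Rightarrow> 'x set"
    and Q :: "('a, 'd, 'k) module_scheme" and Qg :: "int \<Rightarrow> 'd set"
    and \<pi> :: "'x \<Rightarrow> 'd" and l :: "(nat \<Rightarrow> 'a) \<Rightarrow> 'x" and h :: "nat \<Rightarrow> (nat \<Rightarrow> 'a) \<Rightarrow> nat \<Rightarrow> 'a"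
  assumes F: "strict_resolution R Rg F (\<lambda>i. free_degree R Rg (nF i) (aF i)) eF (N\<lparr>carrier := P\<rparr>) Pg"
    and Ffree: "obj F i = free_module R (nF i)"
    and G: "strict_resolution R Rg G (\<lambda>i. free_degree R Rg (nG i) (aG i)) eG Q Qg"
    and Gfree: "obj G i = free_module R (nG i)"
    and N: "degree_module R Rg N Ng" and P: "submodule R P N" and Pg: "Pg j \<subseteq> Ng j"
    and \<pi>: "\<pi> \<in> module_hom R N Q" and ker: "y \<in> carrier N \<Longrightarrow> \<pi> y = \<zero>\<^bsub>Q\<^esub> \<longleftrightarrow> y \<in> P"
    and l: "l \<in> graded_hom R (obj G 0) (free_degree R Rg (nG 0) (aG 0)) N Ng"
    and \<pi>l: "x \<in> carrier (obj G 0) \<Longrightarrow> \<pi> (l x) = eG x"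
    and h: "h i \<in> graded_hom R (obj G (Suc i)) (free_degree R Rg (nG (Suc i)) (aG (Suc i)))
        (obj F i) (free_degree R Rg (nF i) (aF i))"
    and h0: "x \<in> carrier (obj G 1) \<Longrightarrow> eF (h 0 x) = \<ominus>\<^bsub>N\<^esub> l (diff G 0 x)"
    and hS: "x \<in> carrier (obj G (Suc (Suc i))) \<Longrightarrow>
        diff F i (h (Suc i) x) = \<ominus>\<^bsub>obj F i\<^esub> h i (diff G (Suc i) x)"
begin

lemma Fm: "module R (obj F i)" and Gm: "module R (obj G i)" and Nm: "module R N" and Qm: "module R Q"
  and Fd: "diff F i \<in> graded_hom R (obj F (Suc i)) (free_degree R Rg (nF (Suc i)) (aF (Suc i)))
      (obj F i) (free_degree R Rg (nF i) (aF i))"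
  and Gd: "diff G i \<in> graded_hom R (obj G (Suc i)) (free_degree R Rg (nG (Suc i)) (aG (Suc i)))
      (obj G i) (free_degree R Rg (nG i) (aG i))"
  and eF: "eF \<in> graded_hom R (obj F 0) (free_degree R Rg (nF 0) (aF 0)) (N\<lparr>carrier := P\<rparr>) Pg"
  and eG: "eG \<in> graded_hom R (obj G 0) (free_degree R Rg (nG 0) (aG 0)) Q Qg"
  and Fres: "resolution R F eF (N\<lparr>carrier := P\<rparr>)" and Gres: "resolution R G eG Q"
  using F G N by (auto simp: strict_resolution_def resolution_def graded_complex_def degree_module_def)

lemmas Fex = resolution_exact[OF Fres, simplified] and Gex = resolution_exact[OF Gres, simplified]

lemma eF_N: "eF \<in> module_hom R (obj F 0) N"
  using graded_homD(1)[OF eF] submoduleD(1)[OF P] by (auto simp: module_hom_def)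

lemma eF_P: "x \<in> carrier (obj F 0) \<Longrightarrow> eF x \<in> P"
  using graded_homD(3)[OF eF] by simp

definition total :: "('a, nat \<Rightarrow> 'a) chain" where
  "total = \<lparr>obj = \<lambda>i. free_module R (nF i + nG i),
     diff = \<lambda>i x. join (nF i)
       (diff F i (left_part R (nF (Suc i)) x) \<oplus>\<^bsub>obj F i\<^esub> h i (right_part (nF (Suc i)) x))
       (diff G i (right_part (nF (Suc i)) x))\<rparr>"

definition total_degree :: "nat \<Rightarrow> nat \<Rightarrow> int" where
  "total_degree i = join (nF i) (aF i) (aG i)"

definition augmentation :: "(nat \<Rightarrow> 'a) \<Rightarrow> 'x" where
  "augmentation x = eF (left_part R (nF 0) x) \<oplus>\<^bsub>N\<^esub> l (right_part (nF 0) x)"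

lemma total_obj [simp]: "obj total i = free_module R (nF i + nG i)"
  by (simp add: total_def)

lemma total_diff: "diff total i (join (nF (Suc i)) f g) =
    join (nF i) (diff F i f \<oplus>\<^bsub>obj F i\<^esub> h i g) (diff G i g)" if "f \<in> carrier (obj F (Suc i))"
  using that by (simp add: total_def Ffree)

lemma total_carrier:
  assumes "x \<in> carrier (obj total i)"
  shows "left_part R (nF i) x \<in> carrier (obj F i)" "right_part (nF i) x \<in> carrier (obj G i)"
  using hom_closed[OF left_part_hom] hom_closed[OF right_part_hom] assms by (simp_all add: Ffree Gfree)

lemma total_cases:
  assumes "x \<in> carrier (obj total i)"
  obtains f g where "f \<in> carrier (obj F i)" "g \<in> carrier (obj G i)" "x = join (nF i) f g"
  using total_carrier[OF assms] join_parts[of "nF i" x] by metis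

lemma join_total: "f \<in> carrier (obj F i) \<Longrightarrow> g \<in> carrier (obj G i) \<Longrightarrow> join (nF i) f g \<in> carrier (obj total i)"
  using join_closed[of f "nF i" g "nG i"] by (simp add: Ffree Gfree)

lemma join_eq_zero_iff:
  assumes "f \<in> carrier (obj F i)" "g \<in> carrier (obj G i)"
  shows "join (nF i) f g = \<zero>\<^bsub>obj total i\<^esub> \<longleftrightarrow> f = \<zero>\<^bsub>obj F i\<^esub> \<and> g = \<zero>\<^bsub>obj G i\<^esub>"
proof
  assume eq: "join (nF i) f g = \<zero>\<^bsub>obj total i\<^esub>"
  have "f = left_part R (nF i) (join (nF i) f g)" "g = right_part (nF i) (join (nF i) f g)"
    using assms by (simp_all add: Ffree)
  then show "f = \<zero>\<^bsub>obj F i\<^esub> \<and> g = \<zero>\<^bsub>obj G i\<^esub>"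
    unfolding eq by (auto simp: free_module_simps Ffree Gfree left_part_def right_part_def)
qed (auto simp: free_module_simps Ffree Gfree join_def)

lemma total_diff_hom: "diff total i \<in> module_hom R (obj total (Suc i)) (obj total i)"
proof -
  have L: "(\<lambda>x. diff F i (left_part R (nF (Suc i)) x)) \<in> module_hom R (obj total (Suc i)) (free_module R (nF i))"
    using hom_comp[OF left_part_hom[of "nF (Suc i)" "nG (Suc i)"], of "diff F i" "obj F i"] graded_homD(1)[OF Fd, of i]
    by (simp add: Ffree)
  have H: "(\<lambda>x. h i (right_part (nF (Suc i)) x)) \<in> module_hom R (obj total (Suc i)) (free_module R (nF i))"
    using hom_comp[OF right_part_hom[of "nF (Suc i)" "nG (Suc i)"], of "h i" "obj F i"] graded_homD(1)[OF h, of i]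
    by (simp add: Ffree Gfree)
  have D: "(\<lambda>x. diff G i (right_part (nF (Suc i)) x)) \<in> module_hom R (obj total (Suc i)) (free_module R (nG i))"
    using hom_comp[OF right_part_hom[of "nF (Suc i)" "nG (Suc i)"], of "diff G i" "obj G i"] graded_homD(1)[OF Gd, of i]
    by (simp add: Gfree)
  from join_hom[OF hom_add[OF free_module_module L H] D] show ?thesis
    by (simp add: total_def[abs_def] Ffree)
qed

lemma augmentation_join: "f \<in> carrier (obj F 0) \<Longrightarrow> augmentation (join (nF 0) f g) = eF f \<oplus>\<^bsub>N\<^esub> l g"
  by (simp add: augmentation_def Ffree)

lemma augmentation_hom: "augmentation \<in> module_hom R (obj total 0) N"
proof -
  have "(\<lambda>x. eF (left_part R (nF 0) x)) \<in> module_hom R (obj total 0) N"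
    using hom_comp[OF left_part_hom[of "nF 0" "nG 0"], of eF N] eF_N by (simp add: Ffree)
  moreover have "(\<lambda>x. l (right_part (nF 0) x)) \<in> module_hom R (obj total 0) N"
    using hom_comp[OF right_part_hom[of "nF 0" "nG 0"], of l N] graded_homD(1)[OF l] by (simp add: Gfree)
  ultimately show ?thesis unfolding augmentation_def[abs_def] by (rule hom_add[OF Nm])
qed

text \<open>The usual diagram chase: an element of \<open>F \<oplus> G\<close> is corrected first in its \<open>G\<close> component, using
  exactness of \<open>G\<close>, and then in its \<open>F\<close> component, using exactness of \<open>F\<close>.\<close>

lemma total_resolution: "resolution R total augmentation N"
proof -
  interpret N: module R N by (rule Nm)
  interpret Q: module R Q by (rule Qm)
  note hh = graded_homD(1)[OF h] and Fdh = graded_homD(1)[OF Fd] and Gdh = graded_homD(1)[OF Gd]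
  note lh = graded_homD(1)[OF l]
  note Pc = submoduleD(1)[OF P]
  have surj: "augmentation ` carrier (obj total 0) = carrier N"
  proof
    show "augmentation ` carrier (obj total 0) \<subseteq> carrier N" using hom_closed[OF augmentation_hom] by blast
    show "carrier N \<subseteq> augmentation ` carrier (obj total 0)"
    proof
      fix y assume y: "y \<in> carrier N"
      have "\<pi> y \<in> eG ` carrier (obj G 0)" using Gres hom_closed[OF \<pi> y] by (simp add: resolution_def)
      then obtain g where g: "g \<in> carrier (obj G 0)" "\<pi> y = eG g" by blast
      have lg: "l g \<in> carrier N" by (rule hom_closed[OF lh g(1)])
      have "\<pi> (y \<ominus>\<^bsub>N\<^esub> l g) = \<zero>\<^bsub>Q\<^esub>"
        using hom_minus[OF Nm Qm \<pi> y lg] \<pi>l[OF g(1)] g(2) hom_closed[OF \<pi> y] by (simp add: a_minus_def Q.r_neg)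
      then have "y \<ominus>\<^bsub>N\<^esub> l g \<in> P" using ker y lg by simp
      then have "y \<ominus>\<^bsub>N\<^esub> l g \<in> eF ` carrier (obj F 0)" using Fres by (simp add: resolution_def)
      then obtain f where f: "f \<in> carrier (obj F 0)" "y \<ominus>\<^bsub>N\<^esub> l g = eF f" by blast
      have "y = (y \<ominus>\<^bsub>N\<^esub> l g) \<oplus>\<^bsub>N\<^esub> l g" using y lg by (simp add: a_minus_def N.a_assoc N.l_neg)
      then have "y = augmentation (join (nF 0) f g)" using augmentation_join[OF f(1)] f(2) by simp
      then show "y \<in> augmentation ` carrier (obj total 0)" using join_total[OF f(1) g(1)] by blast
    qed
  qed
  have exact0: "{x \<in> carrier (obj total 0). augmentation x = \<zero>\<^bsub>N\<^esub>} = boundaries total 0"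
  proof (intro equalityI subsetI)
    fix x assume "x \<in> {x \<in> carrier (obj total 0). augmentation x = \<zero>\<^bsub>N\<^esub>}"
    then have x: "x \<in> carrier (obj total 0)" "augmentation x = \<zero>\<^bsub>N\<^esub>" by auto
    obtain f g where fg: "f \<in> carrier (obj F 0)" "g \<in> carrier (obj G 0)" "x = join (nF 0) f g"
      by (rule total_cases[OF x(1)])
    have ef: "eF f \<in> P" "eF f \<in> carrier N" using eF_P[OF fg(1)] Pc by auto
    have lg: "l g \<in> carrier N" by (rule hom_closed[OF lh fg(2)])
    have z: "eF f \<oplus>\<^bsub>N\<^esub> l g = \<zero>\<^bsub>N\<^esub>" using x(2) augmentation_join[OF fg(1)] fg(3) by simp
    have "\<pi> (eF f) \<oplus>\<^bsub>Q\<^esub> \<pi> (l g) = \<zero>\<^bsub>Q\<^esub>"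
      using module_hom_add[OF \<pi> ef(2) lg] z hom_zero[OF Nm Qm \<pi>] by simp
    moreover have "\<pi> (eF f) = \<zero>\<^bsub>Q\<^esub>" using ker ef by simp
    ultimately have "eG g = \<zero>\<^bsub>Q\<^esub>" using \<pi>l[OF fg(2)] hom_closed[OF \<pi> lg] by simp
    then obtain q where q: "q \<in> carrier (obj G 1)" "diff G 0 q = g" using Gex(1)[OF fg(2)] by auto
    have hq: "h 0 q \<in> carrier (obj F 0)" using hom_closed[OF hh, of q 0] q by simp
    interpret F0: module R "obj F 0" by (rule Fm)
    have "eF (f \<ominus>\<^bsub>obj F 0\<^esub> h 0 q) = eF f \<ominus>\<^bsub>N\<^esub> eF (h 0 q)"
      by (rule hom_minus[OF Fm Nm eF_N fg(1) hq])
    also have "\<dots> = eF f \<oplus>\<^bsub>N\<^esub> l g" using h0[OF q(1)] q(2) lg by (simp add: a_minus_def)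
    finally have "eF (f \<ominus>\<^bsub>obj F 0\<^esub> h 0 q) = \<zero>\<^bsub>N\<^esub>" using z by simp
    then obtain w where w: "w \<in> carrier (obj F 1)" "diff F 0 w = f \<ominus>\<^bsub>obj F 0\<^esub> h 0 q"
      using Fex(1)[of "f \<ominus>\<^bsub>obj F 0\<^esub> h 0 q"] fg(1) hq by auto
    have "diff F 0 w \<oplus>\<^bsub>obj F 0\<^esub> h 0 q = f" using w(2) fg(1) hq by (simp add: a_minus_def F0.a_assoc F0.l_neg)
    then have "x = diff total 0 (join (nF 1) w q)" using total_diff[of w 0 q] w(1) q(2) fg(3) by simp
    moreover have "join (nF 1) w q \<in> carrier (obj total 1)" by (rule join_total[OF w(1) q(1)])
    ultimately show "x \<in> boundaries total 0" by (simp add: boundaries_def del: total_obj)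
  next
    fix x assume "x \<in> boundaries total 0"
    then obtain y where y: "y \<in> carrier (obj total (Suc 0))" "x = diff total 0 y" by (auto simp: boundaries_def)
    obtain f g where fg: "f \<in> carrier (obj F (Suc 0))" "g \<in> carrier (obj G (Suc 0))" "y = join (nF (Suc 0)) f g"
      by (rule total_cases[OF y(1)])
    have x: "x = join (nF 0) (diff F 0 f \<oplus>\<^bsub>obj F 0\<^esub> h 0 g) (diff G 0 g)" using total_diff[OF fg(1)] y(2) fg(3) by simp
    have c: "diff F 0 f \<in> carrier (obj F 0)" "h 0 g \<in> carrier (obj F 0)" "diff G 0 g \<in> carrier (obj G 0)"
      using hom_closed[OF Fdh fg(1)] hom_closed[OF hh fg(2)] hom_closed[OF Gdh fg(2)] by auto
    interpret F0: module R "obj F 0" by (rule Fm)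
    have "augmentation x = eF (diff F 0 f \<oplus>\<^bsub>obj F 0\<^esub> h 0 g) \<oplus>\<^bsub>N\<^esub> l (diff G 0 g)"
      unfolding x by (rule augmentation_join) (use c in simp)
    also have "\<dots> = (\<zero>\<^bsub>N\<^esub> \<oplus>\<^bsub>N\<^esub> \<ominus>\<^bsub>N\<^esub> l (diff G 0 g)) \<oplus>\<^bsub>N\<^esub> l (diff G 0 g)"
      using module_hom_add[OF eF_N c(1,2)] Fex(3)[of f] fg h0[of g] by simp
    also have "\<dots> = \<zero>\<^bsub>N\<^esub>" using hom_closed[OF lh c(3)] by (simp add: N.l_neg)
    finally show "x \<in> {x \<in> carrier (obj total 0). augmentation x = \<zero>\<^bsub>N\<^esub>}"
      using hom_closed[OF total_diff_hom y(1)] y(2) by simp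
  qed
  have exactS: "cycles total (Suc i) = boundaries total (Suc i)" for i
  proof (intro equalityI subsetI)
    fix x assume "x \<in> cycles total (Suc i)"
    then have x: "x \<in> carrier (obj total (Suc i))" "diff total i x = \<zero>\<^bsub>obj total i\<^esub>" by auto
    obtain f g where fg: "f \<in> carrier (obj F (Suc i))" "g \<in> carrier (obj G (Suc i))" "x = join (nF (Suc i)) f g"
      by (rule total_cases[OF x(1)])
    have c: "diff F i f \<in> carrier (obj F i)" "h i g \<in> carrier (obj F i)" "diff G i g \<in> carrier (obj G i)"
      using hom_closed[OF Fdh fg(1)] hom_closed[OF hh fg(2)] hom_closed[OF Gdh fg(2)] by auto
    interpret F0: module R "obj F i" by (rule Fm)
    interpret F1: module R "obj F (Suc i)" by (rule Fm)
    have z: "diff F i f \<oplus>\<^bsub>obj F i\<^esub> h i g = \<zero>\<^bsub>obj F i\<^esub>" "diff G i g = \<zero>\<^bsub>obj G i\<^esub>"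
      using x(2) total_diff[OF fg(1), of g] fg(3) join_eq_zero_iff[of "diff F i f \<oplus>\<^bsub>obj F i\<^esub> h i g" i "diff G i g"] c
      by auto
    obtain q where q: "q \<in> carrier (obj G (Suc (Suc i)))" "diff G (Suc i) q = g" using Gex(2)[OF fg(2) z(2)] by auto
    have hq: "h (Suc i) q \<in> carrier (obj F (Suc i))" by (rule hom_closed[OF hh q(1)])
    have "diff F i (f \<ominus>\<^bsub>obj F (Suc i)\<^esub> h (Suc i) q) = diff F i f \<ominus>\<^bsub>obj F i\<^esub> diff F i (h (Suc i) q)"
      by (rule hom_minus[OF Fm Fm Fdh fg(1) hq])
    also have "\<dots> = diff F i f \<oplus>\<^bsub>obj F i\<^esub> h i g" using hS[OF q(1)] q(2) c by (simp add: a_minus_def)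
    finally have "diff F i (f \<ominus>\<^bsub>obj F (Suc i)\<^esub> h (Suc i) q) = \<zero>\<^bsub>obj F i\<^esub>" using z by simp
    then obtain w where w: "w \<in> carrier (obj F (Suc (Suc i)))" "diff F (Suc i) w = f \<ominus>\<^bsub>obj F (Suc i)\<^esub> h (Suc i) q"
      using Fex(2)[of "f \<ominus>\<^bsub>obj F (Suc i)\<^esub> h (Suc i) q" i] fg(1) hq by auto
    have "diff F (Suc i) w \<oplus>\<^bsub>obj F (Suc i)\<^esub> h (Suc i) q = f"
      using w(2) fg(1) hq by (simp add: a_minus_def F1.a_assoc F1.l_neg)
    then have "x = diff total (Suc i) (join (nF (Suc (Suc i))) w q)" using total_diff[OF w(1), of q] q(2) fg(3) by simp
    then show "x \<in> boundaries total (Suc i)" using join_total[OF w(1) q(1)] by (simp add: boundaries_def del: total_obj)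
  next
    fix x assume "x \<in> boundaries total (Suc i)"
    then obtain y where y: "y \<in> carrier (obj total (Suc (Suc i)))" "x = diff total (Suc i) y" by (auto simp: boundaries_def)
    obtain f g where fg: "f \<in> carrier (obj F (Suc (Suc i)))" "g \<in> carrier (obj G (Suc (Suc i)))" "y = join (nF (Suc (Suc i))) f g"
      by (rule total_cases[OF y(1)])
    interpret F0: module R "obj F i" by (rule Fm)
    interpret F1: module R "obj F (Suc i)" by (rule Fm)
    interpret G0: module R "obj G i" by (rule Gm)
    have c: "diff F (Suc i) f \<in> carrier (obj F (Suc i))" "h (Suc i) g \<in> carrier (obj F (Suc i))"
      "diff G (Suc i) g \<in> carrier (obj G (Suc i))"
      using hom_closed[OF Fdh fg(1)] hom_closed[OF hh fg(2)] hom_closed[OF Gdh fg(2)] by auto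
    have hc: "h i (diff G (Suc i) g) \<in> carrier (obj F i)" by (rule hom_closed[OF hh c(3)])
    have x: "x = join (nF (Suc i)) (diff F (Suc i) f \<oplus>\<^bsub>obj F (Suc i)\<^esub> h (Suc i) g) (diff G (Suc i) g)"
      using total_diff[OF fg(1)] y(2) fg(3) by simp
    have "diff total i x = join (nF i) (diff F i (diff F (Suc i) f \<oplus>\<^bsub>obj F (Suc i)\<^esub> h (Suc i) g)
        \<oplus>\<^bsub>obj F i\<^esub> h i (diff G (Suc i) g)) (diff G i (diff G (Suc i) g))"
      unfolding x by (rule total_diff) (use c in simp)
    also have "diff G i (diff G (Suc i) g) = \<zero>\<^bsub>obj G i\<^esub>" by (rule Gex(4)[OF fg(2)])
    also have "diff F i (diff F (Suc i) f \<oplus>\<^bsub>obj F (Suc i)\<^esub> h (Suc i) g) \<oplus>\<^bsub>obj F i\<^esub> h i (diff G (Suc i) g) = \<zero>\<^bsub>obj F i\<^esub>"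
      using module_hom_add[OF Fdh c(1,2)] Fex(4)[OF fg(1)] hS[OF fg(2)] hc by (simp add: F0.l_neg)
    also have "join (nF i) \<zero>\<^bsub>obj F i\<^esub> \<zero>\<^bsub>obj G i\<^esub> = \<zero>\<^bsub>obj total i\<^esub>" by (subst join_eq_zero_iff) auto
    finally show "x \<in> cycles total (Suc i)" using hom_closed[OF total_diff_hom y(1)] y(2) by simp
  qed
  show ?thesis
    unfolding resolution_def
    using surj exact0 exactS total_diff_hom augmentation_hom free_module_module by simp
qed

lemma total_degree_iff:
  assumes "f \<in> carrier (obj F i)" "g \<in> carrier (obj G i)"
  shows "join (nF i) f g \<in> free_degree R Rg (nF i + nG i) (total_degree i) j \<longleftrightarrow>
    f \<in> free_degree R Rg (nF i) (aF i) j \<and> g \<in> free_degree R Rg (nG i) (aG i) j"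
proof -
  have "(\<forall>c. join (nF i) f g c \<in> Rg (j - join (nF i) (aF i) (aG i) c)) \<longleftrightarrow>
      (\<forall>c<nF i. f c \<in> Rg (j - aF i c)) \<and> (\<forall>c. g c \<in> Rg (j - aG i c))"
    by (auto simp: join_def) (metis add_diff_cancel_left' not_add_less1)
  also have "(\<forall>c<nF i. f c \<in> Rg (j - aF i c)) \<longleftrightarrow> (\<forall>c. f c \<in> Rg (j - aF i c))"
    using assms(1) Rg_zero by (auto simp: Ffree free_carrier_iff) (metis not_le_imp_less)
  finally show ?thesis using assms join_total[OF assms]
    by (auto simp: free_degree_def total_degree_def Ffree Gfree)
qed

lemma total_diff_degree:
  assumes "x \<in> free_degree R Rg (nF (Suc i) + nG (Suc i)) (total_degree (Suc i)) j"
  shows "diff total i x \<in> free_degree R Rg (nF i + nG i) (total_degree i) j"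
proof -
  have xc: "x \<in> carrier (obj total (Suc i))" using assms by (simp add: free_degree_def)
  obtain f g where fg: "f \<in> carrier (obj F (Suc i))" "g \<in> carrier (obj G (Suc i))" "x = join (nF (Suc i)) f g"
    by (rule total_cases[OF xc])
  have d: "f \<in> free_degree R Rg (nF (Suc i)) (aF (Suc i)) j" "g \<in> free_degree R Rg (nG (Suc i)) (aG (Suc i)) j"
    using total_degree_iff[OF fg(1,2)] assms fg(3) by auto
  interpret F0: module R "obj F i" by (rule Fm)
  have c: "diff F i f \<oplus>\<^bsub>obj F i\<^esub> h i g \<in> carrier (obj F i)" "diff G i g \<in> carrier (obj G i)"
    using graded_homD(3)[OF Fd fg(1)] graded_homD(3)[OF h fg(2)] graded_homD(3)[OF Gd fg(2)] by auto
  have "diff F i f \<oplus>\<^bsub>obj F i\<^esub> h i g \<in> free_degree R Rg (nF i) (aF i) j"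
    unfolding Ffree
    by (rule degree_moduleD(4)[OF free_degree_module]) (use graded_homD(2)[OF Fd d(1)] graded_homD(2)[OF h d(2)] in auto)
  then show ?thesis
    unfolding fg(3) total_diff[OF fg(1)] total_degree_iff[OF c] using graded_homD(2)[OF Gd d(2)] by blast
qed

lemma augmentation_degree:
  assumes "x \<in> free_degree R Rg (nF 0 + nG 0) (total_degree 0) j"
  shows "augmentation x \<in> Ng j"
proof -
  have xc: "x \<in> carrier (obj total 0)" using assms by (simp add: free_degree_def)
  obtain f g where fg: "f \<in> carrier (obj F 0)" "g \<in> carrier (obj G 0)" "x = join (nF 0) f g"
    by (rule total_cases[OF xc])
  have d: "f \<in> free_degree R Rg (nF 0) (aF 0) j" "g \<in> free_degree R Rg (nG 0) (aG 0) j"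
    using total_degree_iff[OF fg(1,2)] assms fg(3) by auto
  show ?thesis unfolding fg(3) augmentation_join[OF fg(1)]
    by (rule degree_moduleD(4)[OF N]) (use graded_homD(2)[OF eF d(1)] Pg graded_homD(2)[OF l d(2)] in auto)
qed

context
  fixes I
  assumes I: "ideal I R" and minF: "minimal_complex R I F" and minG: "minimal_complex R I G"
    and exF: "linear_part_exact R I F" and exG: "linear_part_exact R I G"
    and IN: "ideal_smult R I N \<inter> P \<subseteq> ideal_smult R I (N\<lparr>carrier := P\<rparr>)"
begin

lemma I_subset: "I \<subseteq> carrier R"
  by (rule additive_subgroup.a_subset) (use I in \<open>simp add: ideal_def\<close>)

text \<open>For \<open>i = 0\<close>, \<open>h\<^sub>0\<close> lifts \<open>- l d\<close>, whose values lie in \<open>IN \<inter> P = IP\<close>. In the step, \<open>d h\<^sub>i\<^sub>+\<^sub>1 = - h\<^sub>i d\<close>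
  has values in \<open>I\<^sup>2F\<close>, and linearity of \<open>F\<close> turns this into \<open>h\<^sub>i\<^sub>+\<^sub>1 \<in> dF + IF = IF\<close>.\<close>

lemma h_minimal: "h i ` carrier (obj G (Suc i)) \<subseteq> ideal_smult R I (obj F i)"
proof (induction i)
  case 0
  show ?case
  proof (rule image_subsetI)
    fix x assume x: "x \<in> carrier (obj G (Suc 0))"
    interpret F0: module R "obj F 0" by (rule Fm)
    interpret N: module R N by (rule Nm)
    note Pm = module_submodule[OF P]
    have hx: "h 0 x \<in> carrier (obj F 0)" by (rule graded_homD(3)[OF h x])
    have "diff G 0 x \<in> ideal_smult R I (obj G 0)"
      by (rule minimal_complexD[OF minG x])
    then have "l (diff G 0 x) \<in> ideal_smult R I N" by (rule hom_ideal_smult[OF Gm Nm graded_homD(1)[OF l] I_subset])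
    then have "\<ominus>\<^bsub>N\<^esub> l (diff G 0 x) \<in> ideal_smult R I N"
      by (rule submodule_minus_closed[OF ideal_smult_submodule[OF Nm I_subset]])
    then have "eF (h 0 x) \<in> ideal_smult R I (N\<lparr>carrier := P\<rparr>)" using IN eF_P[OF hx] h0[of x] x by auto
    also have "\<dots> = eF ` ideal_smult R I (obj F 0)"
      by (rule hom_ideal_smult_surj[OF Fm Pm graded_homD(1)[OF eF] I_subset, symmetric])
        (use Fres in \<open>simp add: resolution_def\<close>)
    finally obtain f where f: "f \<in> ideal_smult R I (obj F 0)" "eF (h 0 x) = eF f" by auto
    note sub = ideal_smult_submodule[OF Fm I_subset]
    have fc: "f \<in> carrier (obj F 0)" by (rule submoduleD(1)[OF sub f(1)])
    have "eF (h 0 x \<ominus>\<^bsub>obj F 0\<^esub> f) = \<zero>\<^bsub>N\<^esub>"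
      using hom_minus[OF Fm Nm eF_N hx fc] f(2) hom_closed[OF eF_N fc] by (simp add: a_minus_def N.r_neg)
    then obtain w where w: "w \<in> carrier (obj F 1)" "diff F 0 w = h 0 x \<ominus>\<^bsub>obj F 0\<^esub> f"
      using Fex(1)[of "h 0 x \<ominus>\<^bsub>obj F 0\<^esub> f"] hx fc by auto
    have "diff F 0 w \<in> ideal_smult R I (obj F 0)"
      using minimal_complexD[OF minF, of w 0] w(1) by simp
    from submoduleD(2)[OF sub this f(1)]
    show "h 0 x \<in> ideal_smult R I (obj F 0)"
      using w(2) hx fc by (simp add: a_minus_def F0.a_assoc F0.l_neg)
  qed
next
  case (Suc i)
  show ?case
  proof (rule image_subsetI)
    fix x assume x: "x \<in> carrier (obj G (Suc (Suc i)))"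
    note sub = ideal_smult_submodule[OF Fm I_subset]
    have one: "ideal_smult R (ideal_power R I (Suc 0)) X = ideal_smult R I X" for X :: "('a, nat \<Rightarrow> 'a) module"
      by (simp add: ideal_power_one[OF I] del: ideal_power.simps)
    have hx: "h (Suc i) x \<in> carrier (obj F (Suc i))" by (rule graded_homD(3)[OF h x])
    have "diff G (Suc i) x \<in> ideal_smult R (ideal_power R I (Suc 0)) (obj G (Suc i))"
      unfolding one by (rule minimal_complexD[OF minG x])
    from hom_raises_madic[OF I Gm Fm graded_homD(1)[OF h] Suc.IH this]
    have "\<ominus>\<^bsub>obj F i\<^esub> h i (diff G (Suc i) x) \<in> ideal_smult R (ideal_power R I (Suc (Suc 0))) (obj F i)"
      by (rule submodule_minus_closed[OF ideal_smult_submodule[OF Fm ideal_power_subset[OF I]]])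
    then have "diff F i (h (Suc i) x) \<in> ideal_smult R (ideal_power R I (Suc (Suc 0))) (obj F i)"
      using hS[OF x] by (simp del: ideal_power.simps)
    moreover have "h (Suc i) x \<in> ideal_smult R (ideal_power R I 0) (obj F (Suc i))"
      unfolding ideal_smult_power_zero[OF Fm] by (rule hx)
    ultimately obtain y b where y: "y \<in> ideal_smult R (ideal_power R I (0 - 1)) (obj F (Suc (Suc i)))"
      and b: "b \<in> ideal_smult R I (obj F (Suc i))"
      and eq: "h (Suc i) x = diff F (Suc i) y \<oplus>\<^bsub>obj F (Suc i)\<^esub> b"
      using exF unfolding linear_part_exact_def one[symmetric] by blast
    have "y \<in> carrier (obj F (Suc (Suc i)))"
      by (rule submoduleD(1)[OF ideal_smult_submodule[OF Fm ideal_power_subset[OF I]] y])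
    then have "diff F (Suc i) y \<in> ideal_smult R I (obj F (Suc i))"
      by (rule minimal_complexD[OF minF])
    then show "h (Suc i) x \<in> ideal_smult R I (obj F (Suc i))" unfolding eq by (rule submoduleD(2)[OF sub _ b])
  qed
qed

lemma total_minimal: "minimal_complex R I total"
  unfolding minimal_complex_def
proof (intro allI subsetI)
  fix i x assume "x \<in> boundaries total i"
  then obtain y where y: "y \<in> carrier (obj total (Suc i))" "x = diff total i y" by (auto simp: boundaries_def)
  obtain f g where fg: "f \<in> carrier (obj F (Suc i))" "g \<in> carrier (obj G (Suc i))" "y = join (nF (Suc i)) f g"
    by (rule total_cases[OF y(1)])
  have "diff F i f \<in> ideal_smult R I (obj F i)" "diff G i g \<in> ideal_smult R I (obj G i)"
    by (rule minimal_complexD[OF minF fg(1)], rule minimal_complexD[OF minG fg(2)])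
  moreover have "h i g \<in> ideal_smult R I (obj F i)" using h_minimal[of i] fg(2) by blast
  ultimately show "x \<in> ideal_smult R I (obj total i)"
    unfolding y(2) fg(3) total_diff[OF fg(1)] total_obj
    using submoduleD(2)[OF ideal_smult_submodule[OF Fm I_subset]]
    by (intro join_ideal_smult[OF I_subset]) (simp_all add: Ffree Gfree)
qed

text \<open>Let \<open>(f,g)\<close> have order \<open>p\<close> and a differential of order \<open>p+2\<close>. Linearity of \<open>G\<close> gives \<open>g = dz + g'\<close>.
  Subtracting the boundary of \<open>(0,z)\<close> replaces \<open>f\<close> by \<open>f - hz\<close>, whose differential is
  \<open>(df + hg) - hg'\<close>. The last term has order \<open>p+2\<close> because \<open>h\<close> is minimal, so linearity of \<open>F\<close> applies
  to \<open>f - hz\<close>.\<close>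

lemma total_linear_part_exact: "linear_part_exact R I total"
  unfolding linear_part_exact_def
proof (intro allI ballI impI)
  fix i p x
  let ?m = "\<lambda>p X. ideal_smult R (ideal_power R I p) X"
  assume x: "x \<in> ?m p (obj total (Suc i))" and dx: "diff total i x \<in> ?m (Suc (Suc p)) (obj total i)"
  note sub = ideal_power_subset[OF I]
  have Fs: "submodule R (?m q (obj F k)) (obj F k)" for q k by (rule ideal_smult_submodule[OF Fm sub])
  have Gs: "submodule R (?m q (obj G k)) (obj G k)" for q k by (rule ideal_smult_submodule[OF Gm sub])
  define f g where "f = left_part R (nF (Suc i)) x" and "g = right_part (nF (Suc i)) x"
  have f: "f \<in> ?m p (obj F (Suc i))" and g: "g \<in> ?m p (obj G (Suc i))"
    using left_part_ideal_smult[OF sub] right_part_ideal_smult[OF sub] x by (auto simp: f_def g_def Ffree Gfree)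
  have xfg: "x = join (nF (Suc i)) f g" by (simp add: f_def g_def join_parts)
  note fc = submoduleD(1)[OF Fs f] and gc = submoduleD(1)[OF Gs g]
  interpret F0: module R "obj F i" by (rule Fm)
  interpret F1: module R "obj F (Suc i)" by (rule Fm)
  interpret G1: module R "obj G (Suc i)" by (rule Gm)
  have c: "diff F i f \<in> carrier (obj F i)" "h i g \<in> carrier (obj F i)" "diff G i g \<in> carrier (obj G i)"
    using graded_homD(3)[OF Fd fc] graded_homD(3)[OF h gc] graded_homD(3)[OF Gd gc] by auto
  have s: "diff F i f \<oplus>\<^bsub>obj F i\<^esub> h i g \<in> carrier (obj F i)" using c by simp
  have dfg: "diff F i f \<oplus>\<^bsub>obj F i\<^esub> h i g \<in> ?m (Suc (Suc p)) (obj F i)"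
    and dg: "diff G i g \<in> ?m (Suc (Suc p)) (obj G i)"
  proof -
    have e: "diff total i x = join (nF i) (diff F i f \<oplus>\<^bsub>obj F i\<^esub> h i g) (diff G i g)"
      unfolding xfg by (rule total_diff[OF fc])
    have "left_part R (nF i) (diff total i x) = diff F i f \<oplus>\<^bsub>obj F i\<^esub> h i g"
      unfolding e by (rule left_part_join) (use s in \<open>simp add: Ffree\<close>)
    then show "diff F i f \<oplus>\<^bsub>obj F i\<^esub> h i g \<in> ?m (Suc (Suc p)) (obj F i)"
      using left_part_ideal_smult[OF sub, of "diff total i x" "Suc (Suc p)" "nF i" "nG i"] dx
      by (simp add: Ffree del: ideal_power.simps)
    have "right_part (nF i) (diff total i x) = diff G i g"
      unfolding e by simp
    then show "diff G i g \<in> ?m (Suc (Suc p)) (obj G i)"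
      using right_part_ideal_smult[OF sub, of "diff total i x" "Suc (Suc p)" "nF i" "nG i"] dx
      by (simp add: Gfree del: ideal_power.simps)
  qed
  obtain z g' where z: "z \<in> ?m (p - 1) (obj G (Suc (Suc i)))" and g': "g' \<in> ?m (Suc p) (obj G (Suc i))"
    and geq: "g = diff G (Suc i) z \<oplus>\<^bsub>obj G (Suc i)\<^esub> g'"
    using exG g dg unfolding linear_part_exact_def by blast
  note zc = submoduleD(1)[OF Gs z] and g'c = submoduleD(1)[OF Gs g']
  let ?hz = "h (Suc i) z" and ?dz = "diff G (Suc i) z"
  have hz: "?hz \<in> ?m p (obj F (Suc i))"
    using subsetD[OF ideal_smult_power_antimono[OF I _ Fm] hom_raises_madic[OF I Gm Fm graded_homD(1)[OF h] h_minimal z], of p]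
    by simp
  note hzc = submoduleD(1)[OF Fs hz]
  have dzc: "?dz \<in> carrier (obj G (Suc i))" by (rule graded_homD(3)[OF Gd zc])
  let ?f = "f \<ominus>\<^bsub>obj F (Suc i)\<^esub> ?hz"
  have f1: "?f \<in> ?m p (obj F (Suc i))"
    unfolding a_minus_def by (rule submoduleD(2)[OF Fs f submodule_minus_closed[OF Fs hz]])
  note f1c = submoduleD(1)[OF Fs f1]
  have hg': "h i g' \<in> ?m (Suc (Suc p)) (obj F i)"
    by (rule hom_raises_madic[OF I Gm Fm graded_homD(1)[OF h] h_minimal g'])
  note hg'c = submoduleD(1)[OF Fs hg']
  have "diff F i ?f = (diff F i f \<oplus>\<^bsub>obj F i\<^esub> h i g) \<oplus>\<^bsub>obj F i\<^esub> \<ominus>\<^bsub>obj F i\<^esub> h i g'"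
  proof -
    have hd: "h i ?dz \<in> carrier (obj F i)" by (rule graded_homD(3)[OF h dzc])
    have "diff F i ?f = diff F i f \<ominus>\<^bsub>obj F i\<^esub> diff F i ?hz"
      by (rule hom_minus[OF Fm Fm graded_homD(1)[OF Fd] fc hzc])
    also have "\<dots> = diff F i f \<oplus>\<^bsub>obj F i\<^esub> h i ?dz" using hS[OF zc] hd by (simp add: a_minus_def)
    also have "\<dots> = diff F i f \<oplus>\<^bsub>obj F i\<^esub> ((h i ?dz \<oplus>\<^bsub>obj F i\<^esub> h i g') \<oplus>\<^bsub>obj F i\<^esub> \<ominus>\<^bsub>obj F i\<^esub> h i g')"
      using hd hg'c by (simp add: F0.a_assoc F0.r_neg)
    also have "h i ?dz \<oplus>\<^bsub>obj F i\<^esub> h i g' = h i g"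
      unfolding geq by (rule module_hom_add[OF graded_homD(1)[OF h] dzc g'c, symmetric])
    finally show ?thesis using c hg'c by (simp add: F0.a_assoc)
  qed
  then have "diff F i ?f \<in> ?m (Suc (Suc p)) (obj F i)"
    using submoduleD(2)[OF Fs dfg submodule_minus_closed[OF Fs hg']] by metis
  with f1 exF obtain w f' where w: "w \<in> ?m (p - 1) (obj F (Suc (Suc i)))" and f': "f' \<in> ?m (Suc p) (obj F (Suc i))"
    and feq: "?f = diff F (Suc i) w \<oplus>\<^bsub>obj F (Suc i)\<^esub> f'"
    unfolding linear_part_exact_def by blast
  note wc = submoduleD(1)[OF Fs w] and f'c = submoduleD(1)[OF Fs f']
  have dwc: "diff F (Suc i) w \<in> carrier (obj F (Suc i))" by (rule graded_homD(3)[OF Fd wc])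
  have "f = ?f \<oplus>\<^bsub>obj F (Suc i)\<^esub> ?hz" using fc hzc by (simp add: a_minus_def F1.a_assoc F1.l_neg)
  also have "\<dots> = (diff F (Suc i) w \<oplus>\<^bsub>obj F (Suc i)\<^esub> ?hz) \<oplus>\<^bsub>obj F (Suc i)\<^esub> f'"
    unfolding feq using dwc f'c hzc by (simp add: F1.a_ac)
  finally have feq': "f = (diff F (Suc i) w \<oplus>\<^bsub>obj F (Suc i)\<^esub> ?hz) \<oplus>\<^bsub>obj F (Suc i)\<^esub> f'" .
  show "\<exists>y\<in>?m (p - 1) (obj total (Suc (Suc i))). \<exists>b\<in>?m (Suc p) (obj total (Suc i)).
      x = diff total (Suc i) y \<oplus>\<^bsub>obj total (Suc i)\<^esub> b"
  proof (intro bexI)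
    show "x = diff total (Suc i) (join (nF (Suc (Suc i))) w z) \<oplus>\<^bsub>obj total (Suc i)\<^esub> join (nF (Suc i)) f' g'"
      unfolding total_diff[OF wc] total_obj join_add xfg using feq' geq by (simp add: Ffree Gfree)
    show "join (nF (Suc (Suc i))) w z \<in> ?m (p - 1) (obj total (Suc (Suc i)))"
      unfolding total_obj by (rule join_ideal_smult[OF sub]) (use w z in \<open>simp_all add: Ffree Gfree\<close>)
    show "join (nF (Suc i)) f' g' \<in> ?m (Suc p) (obj total (Suc i))"
      unfolding total_obj by (rule join_ideal_smult[OF sub]) (use f' g' in \<open>simp_all add: Ffree Gfree del: ideal_power.simps\<close>)
  qed
qed

end

end

section \<open>Homogeneous components\<close>

definition component :: "('x, 'e) ring_scheme \<Rightarrow> (int \<Rightarrow> 'x set) \<Rightarrow> 'x \<Rightarrow> int \<Rightarrow> 'x" where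
  "component G A x = (THE f. (\<forall>j. f j \<in> A j) \<and> finite {j. f j \<noteq> \<zero>\<^bsub>G\<^esub>} \<and>
     x = (\<Oplus>\<^bsub>G\<^esub>j\<in>{j. f j \<noteq> \<zero>\<^bsub>G\<^esub>}. f j))"

lemma finsum_support:
  assumes "abelian_group G" "finite S" "\<And>j. j \<in> S \<Longrightarrow> f j \<in> carrier G" "\<And>j. j \<notin> S \<Longrightarrow> f j = \<zero>\<^bsub>G\<^esub>"
  shows "(\<Oplus>\<^bsub>G\<^esub>j\<in>{j. f j \<noteq> \<zero>\<^bsub>G\<^esub>}. f j) = (\<Oplus>\<^bsub>G\<^esub>j\<in>S. f j)"
proof -
  interpret G: abelian_group G by fact
  show ?thesis
    by (rule G.add.finprod_mono_neutral_cong_left) (use assms in auto)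
qed

context
  fixes G :: "('x, 'e) ring_scheme" and A
  assumes G: "abelian_group G" and A: "grading G A"
begin

interpretation G: abelian_group G by (rule G)

lemma grading_carrier: "x \<in> A j \<Longrightarrow> x \<in> carrier G"
  using A subgroup.subset[of "A j" "add_monoid G"] by (auto simp: grading_def)

lemma grading_zero: "\<zero>\<^bsub>G\<^esub> \<in> A j"
  using A subgroup.one_closed[of "A j" "add_monoid G"] by (auto simp: grading_def)

lemma grading_add: "x \<in> A j \<Longrightarrow> y \<in> A j \<Longrightarrow> x \<oplus>\<^bsub>G\<^esub> y \<in> A j"
  using A subgroup.m_closed[of "A j" "add_monoid G"] by (auto simp: grading_def)

lemma grading_minus: "x \<in> A j \<Longrightarrow> \<ominus>\<^bsub>G\<^esub> x \<in> A j"
  using A subgroup.m_inv_closed[of "A j" "add_monoid G"] by (auto simp: grading_def a_inv_def)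

lemma component_unique:
  assumes "x \<in> carrier G"
  shows "\<exists>!f. (\<forall>j. f j \<in> A j) \<and> finite {j. f j \<noteq> \<zero>\<^bsub>G\<^esub>} \<and> x = (\<Oplus>\<^bsub>G\<^esub>j\<in>{j. f j \<noteq> \<zero>\<^bsub>G\<^esub>}. f j)"
  using A assms by (auto simp: grading_def)

lemma
  assumes "x \<in> carrier G"
  shows component_in: "component G A x j \<in> A j"
    and component_finite: "finite {j. component G A x j \<noteq> \<zero>\<^bsub>G\<^esub>}"
    and component_sum: "x = (\<Oplus>\<^bsub>G\<^esub>j\<in>{j. component G A x j \<noteq> \<zero>\<^bsub>G\<^esub>}. component G A x j)"
proof -
  let ?f = "component G A x"
  from theI'[OF component_unique[OF assms]]
  have *: "(\<forall>j. ?f j \<in> A j) \<and> finite {j. ?f j \<noteq> \<zero>\<^bsub>G\<^esub>} \<and> x = (\<Oplus>\<^bsub>G\<^esub>j\<in>{j. ?f j \<noteq> \<zero>\<^bsub>G\<^esub>}. ?f j)"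
    unfolding component_def[symmetric] .
  from * show "component G A x j \<in> A j" by blast
  from * show "finite {j. component G A x j \<noteq> \<zero>\<^bsub>G\<^esub>}" by blast
  from * show "x = (\<Oplus>\<^bsub>G\<^esub>j\<in>{j. component G A x j \<noteq> \<zero>\<^bsub>G\<^esub>}. component G A x j)" by blast
qed

lemma component_carrier: "x \<in> carrier G \<Longrightarrow> component G A x j \<in> carrier G"
  using component_in grading_carrier by blast

lemma component_eqI:
  assumes f: "\<And>j. f j \<in> A j" and S: "finite S" "\<And>j. j \<notin> S \<Longrightarrow> f j = \<zero>\<^bsub>G\<^esub>" and x: "x = (\<Oplus>\<^bsub>G\<^esub>j\<in>S. f j)"
  shows "component G A x = f"
proof -
  have fc: "f j \<in> carrier G" for j using f grading_carrier by blast
  have xc: "x \<in> carrier G" unfolding x by (rule G.finsum_closed) (use fc in auto)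
  have "{j. f j \<noteq> \<zero>\<^bsub>G\<^esub>} \<subseteq> S" using S(2) by blast
  then have fin: "finite {j. f j \<noteq> \<zero>\<^bsub>G\<^esub>}" using S(1) finite_subset by blast
  have "x = (\<Oplus>\<^bsub>G\<^esub>j\<in>{j. f j \<noteq> \<zero>\<^bsub>G\<^esub>}. f j)"
    unfolding x by (rule finsum_support[OF G S(1) fc S(2), symmetric])
  then show ?thesis
    unfolding component_def using the1_equality[OF component_unique[OF xc], of f] f fin by blast
qed

lemma component_homogeneous:
  assumes "x \<in> A j"
  shows "component G A x = (\<lambda>i. if i = j then x else \<zero>\<^bsub>G\<^esub>)"
  by (rule component_eqI[of _ "{j}"]) (use assms grading_zero grading_carrier in auto)

lemma component_sum':
  assumes "x \<in> carrier G" "finite S" "\<And>j. j \<notin> S \<Longrightarrow> component G A x j = \<zero>\<^bsub>G\<^esub>"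
  shows "x = (\<Oplus>\<^bsub>G\<^esub>j\<in>S. component G A x j)"
proof -
  have "x = (\<Oplus>\<^bsub>G\<^esub>j\<in>{j. component G A x j \<noteq> \<zero>\<^bsub>G\<^esub>}. component G A x j)"
    by (rule component_sum[OF assms(1)])
  also have "\<dots> = (\<Oplus>\<^bsub>G\<^esub>j\<in>S. component G A x j)"
    by (rule finsum_support[OF G assms(2) component_carrier[OF assms(1)] assms(3)])
  finally show ?thesis .
qed

lemma component_add:
  assumes "x \<in> carrier G" "y \<in> carrier G"
  shows "component G A (x \<oplus>\<^bsub>G\<^esub> y) = (\<lambda>j. component G A x j \<oplus>\<^bsub>G\<^esub> component G A y j)"
proof (rule component_eqI)
  let ?S = "{j. component G A x j \<noteq> \<zero>\<^bsub>G\<^esub>} \<union> {j. component G A y j \<noteq> \<zero>\<^bsub>G\<^esub>}"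
  show S: "finite ?S" using component_finite assms by auto
  show "component G A x j \<oplus>\<^bsub>G\<^esub> component G A y j \<in> A j" for j
    by (intro grading_add component_in assms)
  show "component G A x j \<oplus>\<^bsub>G\<^esub> component G A y j = \<zero>\<^bsub>G\<^esub>" if "j \<notin> ?S" for j using that by auto
  have "x = (\<Oplus>\<^bsub>G\<^esub>j\<in>?S. component G A x j)" "y = (\<Oplus>\<^bsub>G\<^esub>j\<in>?S. component G A y j)"
    by (rule component_sum'[OF _ S]; use assms in auto)+
  moreover have "(\<Oplus>\<^bsub>G\<^esub>j\<in>?S. component G A x j \<oplus>\<^bsub>G\<^esub> component G A y j)
      = (\<Oplus>\<^bsub>G\<^esub>j\<in>?S. component G A x j) \<oplus>\<^bsub>G\<^esub> (\<Oplus>\<^bsub>G\<^esub>j\<in>?S. component G A y j)"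
    by (rule G.finsum_addf) (use component_carrier assms in auto)
  ultimately show "x \<oplus>\<^bsub>G\<^esub> y = (\<Oplus>\<^bsub>G\<^esub>j\<in>?S. component G A x j \<oplus>\<^bsub>G\<^esub> component G A y j)" by simp
qed

end

lemma module_abelian_group: "module R X \<Longrightarrow> abelian_group X"
  by (simp add: module_def)

lemma component_hom:
  assumes X: "module R X" "grading X Xg" and Y: "module R Y" "grading Y Yg"
    and f: "f \<in> graded_hom R X Xg Y Yg" and x: "x \<in> carrier X"
  shows "component Y Yg (f x) j = f (component X Xg x j)"
proof -
  note aX = module_abelian_group[OF X(1)] and aY = module_abelian_group[OF Y(1)]
  have "component Y Yg (f x) = (\<lambda>j. f (component X Xg x j))"
  proof (rule component_eqI[OF aY Y(2)])
    let ?S = "{j. component X Xg x j \<noteq> \<zero>\<^bsub>X\<^esub>}"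
    show "finite ?S" by (rule component_finite[OF aX X(2) x])
    show "f (component X Xg x j) \<in> Yg j" for j by (rule graded_homD(2)[OF f component_in[OF aX X(2) x]])
    show "f (component X Xg x j) = \<zero>\<^bsub>Y\<^esub>" if "j \<notin> ?S" for j
      using that hom_zero[OF X(1) Y(1) graded_homD(1)[OF f]] by simp
    have "f x = f (\<Oplus>\<^bsub>X\<^esub>j\<in>?S. component X Xg x j)" using component_sum[OF aX X(2) x] by simp
    also have "\<dots> = (\<Oplus>\<^bsub>Y\<^esub>j\<in>?S. f (component X Xg x j))"
      by (rule hom_finsum[OF X(1) Y(1) graded_homD(1)[OF f]]) (use component_carrier[OF aX X(2) x] in auto)
    finally show "f x = (\<Oplus>\<^bsub>Y\<^esub>j\<in>?S. f (component X Xg x j))" .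
  qed
  then show ?thesis by simp
qed

text \<open>If \<open>y = f x\<close> has degree \<open>j\<close>, then \<open>y\<close> is also the image of the component of \<open>x\<close> of degree \<open>j\<close>.\<close>

lemma graded_hom_strict:
  assumes X: "module R X" "grading X Xg" and Y: "module R Y" "grading Y Yg"
    and f: "f \<in> graded_hom R X Xg Y Yg"
  shows "degree_strict X Xg Yg f"
  unfolding degree_strict_def
proof (intro allI subsetI)
  fix j y assume "y \<in> Yg j \<inter> f ` carrier X"
  then obtain x where x: "x \<in> carrier X" "y = f x" and y: "y \<in> Yg j" by blast
  have "f (component X Xg x j) = component Y Yg y j" using component_hom[OF X Y f x(1)] x(2) by simp
  also have "\<dots> = y" using component_homogeneous[OF module_abelian_group[OF Y(1)] Y(2) y] by simp
  finally show "y \<in> f ` Xg j"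
    using component_in[OF module_abelian_group[OF X(1)] X(2) x(1)] by (metis imageI)
qed

definition homogeneous_submodule ::
  "('a, 'm) ring_scheme \<Rightarrow> ('a, 'b, 'n) module_scheme \<Rightarrow> (int \<Rightarrow> 'b set) \<Rightarrow> 'b set \<Rightarrow> bool" where
  "homogeneous_submodule R X Xg N \<longleftrightarrow> submodule R N X \<and> (\<forall>x\<in>N. \<forall>j. component X Xg x j \<in> N)"

lemma homogeneous_kernel:
  assumes X: "module R X" "grading X Xg" and Y: "module R Y" "grading Y Yg"
    and f: "f \<in> graded_hom R X Xg Y Yg"
  shows "homogeneous_submodule R X Xg {x \<in> carrier X. f x = \<zero>\<^bsub>Y\<^esub>}"
  unfolding homogeneous_submodule_def
proof (intro conjI ballI allI)
  show "submodule R {x \<in> carrier X. f x = \<zero>\<^bsub>Y\<^esub>} X"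
    by (rule hom_kernel_submodule[OF X(1) Y(1) graded_homD(1)[OF f]])
  fix x j assume "x \<in> {x \<in> carrier X. f x = \<zero>\<^bsub>Y\<^esub>}"
  then have x: "x \<in> carrier X" "f x = \<zero>\<^bsub>Y\<^esub>" by auto
  note aX = module_abelian_group[OF X(1)] and aY = module_abelian_group[OF Y(1)]
  have "f (component X Xg x j) = component Y Yg \<zero>\<^bsub>Y\<^esub> j" using component_hom[OF X Y f x(1)] x(2) by simp
  also have "\<dots> = \<zero>\<^bsub>Y\<^esub>" using component_homogeneous[OF aY Y(2) grading_zero[OF aY Y(2)], of 0] by simp
  finally show "component X Xg x j \<in> {x \<in> carrier X. f x = \<zero>\<^bsub>Y\<^esub>}"
    using component_carrier[OF aX X(2) x(1)] by simp
qed

lemma homogeneous_image: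
  assumes X: "module R X" "grading X Xg" and Y: "module R Y" "grading Y Yg"
    and f: "f \<in> graded_hom R X Xg Y Yg"
  shows "homogeneous_submodule R Y Yg (f ` carrier X)"
  unfolding homogeneous_submodule_def
proof (intro conjI ballI allI)
  show "submodule R (f ` carrier X) Y"
    by (rule hom_image_submodule[OF X(1) Y(1) graded_homD(1)[OF f]])
  fix y j assume "y \<in> f ` carrier X"
  then obtain x where x: "x \<in> carrier X" "y = f x" by blast
  then show "component Y Yg y j \<in> f ` carrier X"
    using component_hom[OF X Y f x(1)] component_carrier[OF module_abelian_group[OF X(1)] X(2) x(1)] by simp
qed

lemma grading_submodule:
  assumes X: "module R X" "grading X Xg" and N: "homogeneous_submodule R X Xg N"
  shows "grading (X\<lparr>carrier := N\<rparr>) (\<lambda>j. Xg j \<inter> N)"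
proof -
  have Ns: "submodule R N X" using N by (simp add: homogeneous_submodule_def)
  note aX = module_abelian_group[OF X(1)]
  interpret X: module R X by (rule X(1))
  interpret N: module R "X\<lparr>carrier := N\<rparr>" by (rule module_submodule[OF Ns])
  have sg: "subgroup (Xg j \<inter> N) (add_monoid (X\<lparr>carrier := N\<rparr>))" for j
  proof (rule N.add.subgroupI)
    show "Xg j \<inter> N \<noteq> {}" using grading_zero[OF aX X(2)] submoduleD(3)[OF Ns] by blast
    show "\<ominus>\<^bsub>X\<lparr>carrier := N\<rparr>\<^esub> x \<in> Xg j \<inter> N" if "x \<in> Xg j \<inter> N" for x
    proof -
      have x: "x \<in> Xg j" "x \<in> N" using that by auto
      show ?thesis unfolding minus_submodule[OF Ns x(2)]
        using grading_minus[OF aX X(2) x(1)] submodule_minus_closed[OF Ns x(2)] by blast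
    qed
  qed (use grading_add[OF aX X(2)] submoduleD(2)[OF Ns] in auto)
  have eu: "\<exists>!f. (\<forall>j. f j \<in> Xg j \<inter> N) \<and> finite {j. f j \<noteq> \<zero>\<^bsub>X\<lparr>carrier := N\<rparr>\<^esub>} \<and>
        x = (\<Oplus>\<^bsub>X\<lparr>carrier := N\<rparr>\<^esub>j\<in>{j. f j \<noteq> \<zero>\<^bsub>X\<lparr>carrier := N\<rparr>\<^esub>}. f j)" (is "\<exists>!f. ?P f") if x: "x \<in> N" for x
  proof (rule ex1I[of _ "component X Xg x"])
    have xc: "x \<in> carrier X" by (rule submoduleD(1)[OF Ns x])
    have cN: "component X Xg x j \<in> N" for j using N x by (auto simp: homogeneous_submodule_def)
    show "?P (component X Xg x)"
    proof (intro conjI allI)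
      show "component X Xg x j \<in> Xg j \<inter> N" for j using component_in[OF aX X(2) xc] cN by blast
      show "finite {j. component X Xg x j \<noteq> \<zero>\<^bsub>X\<lparr>carrier := N\<rparr>\<^esub>}" using component_finite[OF aX X(2) xc] by simp
      have "(\<Oplus>\<^bsub>X\<lparr>carrier := N\<rparr>\<^esub>j\<in>{j. component X Xg x j \<noteq> \<zero>\<^bsub>X\<^esub>}. component X Xg x j)
          = (\<Oplus>\<^bsub>X\<^esub>j\<in>{j. component X Xg x j \<noteq> \<zero>\<^bsub>X\<^esub>}. component X Xg x j)"
        by (rule finsum_submodule[OF Ns]) (use cN in blast)
      then show "x = (\<Oplus>\<^bsub>X\<lparr>carrier := N\<rparr>\<^esub>j\<in>{j. component X Xg x j \<noteq> \<zero>\<^bsub>X\<lparr>carrier := N\<rparr>\<^esub>}. component X Xg x j)"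
        using component_sum[OF aX X(2) xc] by simp
    qed
    fix f assume f: "?P f"
    have "(\<Oplus>\<^bsub>X\<lparr>carrier := N\<rparr>\<^esub>j\<in>{j. f j \<noteq> \<zero>\<^bsub>X\<^esub>}. f j) = (\<Oplus>\<^bsub>X\<^esub>j\<in>{j. f j \<noteq> \<zero>\<^bsub>X\<^esub>}. f j)"
      by (rule finsum_submodule[OF Ns]) (use f in blast)
    then have "x = (\<Oplus>\<^bsub>X\<^esub>j\<in>{j. f j \<noteq> \<zero>\<^bsub>X\<^esub>}. f j)" using f by simp
    then show "f = component X Xg x"
      by (intro component_eqI[OF aX X(2), of f "{j. f j \<noteq> \<zero>\<^bsub>X\<^esub>}", symmetric]) (use f in auto)
  qed
  show ?thesis unfolding grading_def using sg eu by simp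
qed

text \<open>The grading of a quotient by a homogeneous submodule.\<close>

lemma grading_surj:
  assumes X: "module R X" "grading X Xg" and Y: "module R Y" and p: "p \<in> module_hom R X Y"
    and surj: "p ` carrier X = carrier Y"
    and ker: "homogeneous_submodule R X Xg {x \<in> carrier X. p x = \<zero>\<^bsub>Y\<^esub>}"
  shows "grading Y (\<lambda>j. p ` Xg j)"
proof -
  note aX = module_abelian_group[OF X(1)]
  interpret X: module R X by (rule X(1))
  interpret Y: module R Y by (rule Y)
  have sg: "subgroup (p ` Xg j) (add_monoid Y)" for j
  proof (rule Y.add.subgroupI)
    show "p ` Xg j \<subseteq> carrier Y" using hom_closed[OF p] grading_carrier[OF aX X(2)] by auto
    show "p ` Xg j \<noteq> {}" using grading_zero[OF aX X(2)] by blast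
    show "\<ominus>\<^bsub>Y\<^esub> y \<in> p ` Xg j" if yj: "y \<in> p ` Xg j" for y
    proof -
      obtain x where x: "x \<in> Xg j" "y = p x" using yj by blast
      have "\<ominus>\<^bsub>Y\<^esub> y = p (\<ominus>\<^bsub>X\<^esub> x)" using hom_neg[OF X(1) Y p] x grading_carrier[OF aX X(2)] by simp
      then show ?thesis using grading_minus[OF aX X(2) x(1)] by simp
    qed
    show "y \<oplus>\<^bsub>Y\<^esub> y' \<in> p ` Xg j" if yj: "y \<in> p ` Xg j" "y' \<in> p ` Xg j" for y y'
    proof -
      obtain x x' where x: "x \<in> Xg j" "y = p x" "x' \<in> Xg j" "y' = p x'" using yj by blast
      have "y \<oplus>\<^bsub>Y\<^esub> y' = p (x \<oplus>\<^bsub>X\<^esub> x')" unfolding x(2,4)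
        by (rule module_hom_add[OF p, symmetric]) (rule grading_carrier[OF aX X(2)], rule x)+
      then show ?thesis using grading_add[OF aX X(2) x(1,3)] by simp
    qed
  qed
  have eu: "\<exists>!f. (\<forall>j. f j \<in> p ` Xg j) \<and> finite {j. f j \<noteq> \<zero>\<^bsub>Y\<^esub>} \<and> y = (\<Oplus>\<^bsub>Y\<^esub>j\<in>{j. f j \<noteq> \<zero>\<^bsub>Y\<^esub>}. f j)"
    (is "\<exists>!f. ?P f") if y: "y \<in> carrier Y" for y
  proof -
    obtain x where x: "x \<in> carrier X" "y = p x" using y surj by blast
    let ?c = "component X Xg x"
    let ?S = "{j. ?c j \<noteq> \<zero>\<^bsub>X\<^esub>}"
    have S: "finite ?S" by (rule component_finite[OF aX X(2) x(1)])
    have pc: "p (?c j) \<in> carrier Y" for j by (rule hom_closed[OF p component_carrier[OF aX X(2) x(1)]])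
    have pz: "p (?c j) = \<zero>\<^bsub>Y\<^esub>" if "j \<notin> ?S" for j using that hom_zero[OF X(1) Y p] by simp
    show ?thesis
    proof (rule ex1I[of _ "\<lambda>j. p (?c j)"])
      show "?P (\<lambda>j. p (?c j))"
      proof (intro conjI allI)
        show "p (?c j) \<in> p ` Xg j" for j using component_in[OF aX X(2) x(1)] by blast
        show "finite {j. p (?c j) \<noteq> \<zero>\<^bsub>Y\<^esub>}" by (rule finite_subset[OF _ S]) (use pz in blast)
        have "y = p (\<Oplus>\<^bsub>X\<^esub>j\<in>?S. ?c j)" using component_sum[OF aX X(2) x(1)] x(2) by simp
        also have "\<dots> = (\<Oplus>\<^bsub>Y\<^esub>j\<in>?S. p (?c j))"
          by (rule hom_finsum[OF X(1) Y p]) (use component_carrier[OF aX X(2) x(1)] in auto)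
        also have "\<dots> = (\<Oplus>\<^bsub>Y\<^esub>j\<in>{j. p (?c j) \<noteq> \<zero>\<^bsub>Y\<^esub>}. p (?c j))"
          by (rule finsum_support[OF module_abelian_group[OF Y] S pc pz, symmetric])
        finally show "y = (\<Oplus>\<^bsub>Y\<^esub>j\<in>{j. p (?c j) \<noteq> \<zero>\<^bsub>Y\<^esub>}. p (?c j))" .
      qed
      fix f assume f: "?P f"
      let ?T = "{j. f j \<noteq> \<zero>\<^bsub>Y\<^esub>}"
      have "\<exists>z. z \<in> Xg j \<and> p z = f j \<and> (f j = \<zero>\<^bsub>Y\<^esub> \<longrightarrow> z = \<zero>\<^bsub>X\<^esub>)" for j
      proof (cases "f j = \<zero>\<^bsub>Y\<^esub>")
        case True
        then show ?thesis using grading_zero[OF aX X(2)] hom_zero[OF X(1) Y p] by auto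
      next
        case False
        then show ?thesis using f by (metis imageE)
      qed
      then obtain z where z: "\<And>j. z j \<in> Xg j" "\<And>j. p (z j) = f j" "\<And>j. f j = \<zero>\<^bsub>Y\<^esub> \<Longrightarrow> z j = \<zero>\<^bsub>X\<^esub>"
        by metis
      have zc: "z j \<in> carrier X" for j using z(1) grading_carrier[OF aX X(2)] by blast
      have T: "finite ?T" using f by blast
      let ?x = "\<Oplus>\<^bsub>X\<^esub>j\<in>?T. z j"
      have xc: "?x \<in> carrier X" by (rule X.finsum_closed) (use zc in auto)
      have comp: "component X Xg ?x = z"
        by (rule component_eqI[OF aX X(2) z(1) T]) (use z(3) in auto)
      have "p ?x = (\<Oplus>\<^bsub>Y\<^esub>j\<in>?T. p (z j))" by (rule hom_finsum[OF X(1) Y p]) (use zc in auto)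
      also have "\<dots> = y" using f z(2) by simp
      finally have px: "p ?x = y" .
      let ?k = "x \<oplus>\<^bsub>X\<^esub> \<ominus>\<^bsub>X\<^esub> ?x"
      have k: "?k \<in> carrier X" using x(1) xc by simp
      have "p ?k = \<zero>\<^bsub>Y\<^esub>"
        using module_hom_add[OF p x(1), of "\<ominus>\<^bsub>X\<^esub> ?x"] hom_neg[OF X(1) Y p xc] px x(2) xc y by (simp add: Y.r_neg)
      then have "\<forall>j. component X Xg ?k j \<in> {x \<in> carrier X. p x = \<zero>\<^bsub>Y\<^esub>}"
        using ker k unfolding homogeneous_submodule_def by blast
      then have kz: "p (component X Xg ?k j) = \<zero>\<^bsub>Y\<^esub>" for j by blast
      have "x = ?k \<oplus>\<^bsub>X\<^esub> ?x" using x(1) xc by (simp add: X.a_assoc X.l_neg)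
      then have "?c = component X Xg (?k \<oplus>\<^bsub>X\<^esub> ?x)" by (rule arg_cong)
      then have "?c j = component X Xg ?k j \<oplus>\<^bsub>X\<^esub> z j" for j
        using fun_cong[OF component_add[OF aX X(2) k xc], of j] unfolding comp by simp
      then have "p (?c j) = p (component X Xg ?k j) \<oplus>\<^bsub>Y\<^esub> p (z j)" for j
        using module_hom_add[OF p component_carrier[OF aX X(2) k] zc] by simp
      then have "p (?c j) = f j" for j using kz z(2) hom_closed[OF p zc] by simp
      then show "f = (\<lambda>j. p (?c j))" by auto
    qed
  qed
  show ?thesis unfolding grading_def using sg eu by blast
qed

lemma (in degree_ring) degree_module_submodule:
  assumes X: "degree_module R Rg X Xg" and N: "submodule R N X"
  shows "degree_module R Rg (X\<lparr>carrier := N\<rparr>) (\<lambda>j. Xg j \<inter> N)"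
  using degree_moduleD[OF X] submoduleD[OF N] module_submodule[OF N] Rg_carrier
  by (auto simp: degree_module_def)

text \<open>The decomposition of a vector into homogeneous vectors is determined coordinatewise; it yields both
  the grading of \<open>R\<^sup>n\<close> and, for a homogeneous component, its coordinates.\<close>

lemma (in degree_ring) free_decomposition:
  assumes R: "grading R Rg" and g: "\<And>j. g j \<in> free_degree R Rg n a j"
    and T: "finite T" "\<And>j. j \<notin> T \<Longrightarrow> g j = \<zero>\<^bsub>free_module R n\<^esub>"
    and x: "x = (\<Oplus>\<^bsub>free_module R n\<^esub>j\<in>T. g j)"
  shows "component R Rg (x c) = (\<lambda>i. g (i + a c) c)"
proof (rule component_eqI[OF abelian_group_axioms R, of _ "(\<lambda>j. j - a c) ` T"])
  have gd: "\<And>j c. g j c \<in> Rg (j - a c)" and gc: "\<And>j. g j \<in> carrier (free_module R n)"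
    using g by (auto simp: free_degree_def)
  show "g (i + a c) c \<in> Rg i" for i using gd[of "i + a c" c] by simp
  show "finite ((\<lambda>j. j - a c) ` T)" using T by blast
  show "g (i + a c) c = \<zero>" if i: "i \<notin> (\<lambda>j. j - a c) ` T" for i
  proof -
    have "i + a c \<notin> T"
    proof
      assume "i + a c \<in> T"
      then have "(i + a c) - a c \<in> (\<lambda>j. j - a c) ` T" by (rule imageI)
      with i show False by simp
    qed
    then show ?thesis using T(2) by (simp add: free_module_simps)
  qed
  have "x c = (\<Oplus>j\<in>T. g j c)" unfolding x by (rule free_finsum) (use gc in auto)
  also have "\<dots> = (\<Oplus>j\<in>T. (\<lambda>i. g (i + a c) c) (j - a c))" by simp
  also have "\<dots> = (\<Oplus>i\<in>(\<lambda>j. j - a c) ` T. g (i + a c) c)"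
    by (rule finsum_reindex[symmetric]) (use gc free_carrier_in in \<open>auto simp: inj_on_def\<close>)
  finally show "x c = (\<Oplus>i\<in>(\<lambda>j. j - a c) ` T. g (i + a c) c)" .
qed

lemma (in degree_ring) grading_free:
  assumes R: "grading R Rg"
  shows "grading (free_module R n) (free_degree R Rg n a)"
proof -
  note aR = abelian_group_axioms
  interpret F: module R "free_module R n" by (rule free_module_module)
  have sg: "subgroup (free_degree R Rg n a j) (add_monoid (free_module R n))" for j
  proof (rule F.add.subgroupI)
    note fd = degree_moduleD[OF free_degree_module[of n a]]
    show "free_degree R Rg n a j \<subseteq> carrier (free_module R n)" using fd(2) by auto
    show "free_degree R Rg n a j \<noteq> {}" using fd(3) by blast
    show "\<ominus>\<^bsub>free_module R n\<^esub> x \<in> free_degree R Rg n a j" if "x \<in> free_degree R Rg n a j" for x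
      by (rule degree_neg[OF free_degree_module that])
    show "x \<oplus>\<^bsub>free_module R n\<^esub> y \<in> free_degree R Rg n a j"
      if "x \<in> free_degree R Rg n a j" "y \<in> free_degree R Rg n a j" for x y
      using fd(4)[OF that] by simp
  qed
  have shift: "(\<Oplus>j\<in>S. g (j - d)) = (\<Oplus>j\<in>(\<lambda>j. j - d) ` S. g j)" if "\<And>j. g j \<in> carrier R"
    for g :: "int \<Rightarrow> 'a" and d S
    by (rule finsum_reindex[symmetric]) (use that in \<open>auto simp: inj_on_def\<close>)
  have eu: "\<exists>!f. (\<forall>j. f j \<in> free_degree R Rg n a j) \<and> finite {j. f j \<noteq> \<zero>\<^bsub>free_module R n\<^esub>} \<and>
      x = (\<Oplus>\<^bsub>free_module R n\<^esub>j\<in>{j. f j \<noteq> \<zero>\<^bsub>free_module R n\<^esub>}. f j)" (is "\<exists>!f. ?P f")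
    if x: "x \<in> carrier (free_module R n)" for x
  proof -
    have xc: "x c \<in> carrier R" for c by (rule free_carrier_in[OF x])
    let ?f = "\<lambda>j c. component R Rg (x c) (j - a c)"
    have x0: "?f j c = \<zero>" if "c \<ge> n" for j c
      using component_homogeneous[OF aR R Rg_zero, of 0] that x by (simp add: free_carrier_iff)
    have fR: "component R Rg (x c) i \<in> carrier R" for c i by (rule component_carrier[OF aR R xc])
    have fc: "?f j \<in> carrier (free_module R n)" for j
      using fR x0 by (simp add: free_carrier_iff)
    let ?S = "\<Union>c<n. (\<lambda>i. i + a c) ` {i. component R Rg (x c) i \<noteq> \<zero>}"
    have S: "finite ?S" using component_finite[OF aR R xc] by auto
    have fS: "?f j = \<zero>\<^bsub>free_module R n\<^esub>" if "j \<notin> ?S" for j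
    proof
      fix c
      show "?f j c = \<zero>\<^bsub>free_module R n\<^esub> c"
      proof (cases "c < n")
        case True
        have "j = (j - a c) + a c" by simp
        then have "component R Rg (x c) (j - a c) = \<zero>" using that True by blast
        then show ?thesis by (simp add: free_module_simps)
      qed (use x0 in \<open>simp add: free_module_simps\<close>)
    qed
    have sum: "x = (\<Oplus>\<^bsub>free_module R n\<^esub>j\<in>?S. ?f j)"
    proof
      fix c
      have "(\<Oplus>\<^bsub>free_module R n\<^esub>j\<in>?S. ?f j) c = (\<Oplus>j\<in>?S. ?f j c)"
        by (rule free_finsum) (use fc in auto)
      also have "\<dots> = (\<Oplus>i\<in>(\<lambda>j. j - a c) ` ?S. component R Rg (x c) i)"
        by (rule shift[OF fR])
      also have "\<dots> = x c"
      proof (rule component_sum'[OF aR R xc, symmetric])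
        show "finite ((\<lambda>j. j - a c) ` ?S)" using S by blast
        fix i assume i: "i \<notin> (\<lambda>j. j - a c) ` ?S"
        have "i + a c \<notin> ?S"
        proof
          assume "i + a c \<in> ?S"
          then have "(i + a c) - a c \<in> (\<lambda>j. j - a c) ` ?S" by (rule imageI)
          with i show False by simp
        qed
        from fun_cong[OF fS[OF this], of c] show "component R Rg (x c) i = \<zero>" by (simp add: free_module_simps)
      qed
      finally show "x c = (\<Oplus>\<^bsub>free_module R n\<^esub>j\<in>?S. ?f j) c" by simp
    qed
    show ?thesis
    proof (rule ex1I[of _ ?f])
      show "?P ?f"
      proof (intro conjI allI)
        show "?f j \<in> free_degree R Rg n a j" for j
          using fc component_in[OF aR R xc] by (simp add: free_degree_def)
        show "finite {j. ?f j \<noteq> \<zero>\<^bsub>free_module R n\<^esub>}" by (rule finite_subset[OF _ S]) (use fS in blast)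
        show "x = (\<Oplus>\<^bsub>free_module R n\<^esub>j\<in>{j. ?f j \<noteq> \<zero>\<^bsub>free_module R n\<^esub>}. ?f j)"
          using sum finsum_support[OF module_abelian_group[OF F.module_axioms] S, of ?f] fc fS by auto
      qed
      fix g assume g: "?P g"
      have "component R Rg (x c) = (\<lambda>i. g (i + a c) c)" for c
        by (rule free_decomposition[OF R, of g n a "{j. g j \<noteq> \<zero>\<^bsub>free_module R n\<^esub>}"]) (use g in auto)
      then show "g = ?f" by (auto simp: fun_eq_iff)
    qed
  qed
  show ?thesis unfolding grading_def using sg eu by blast
qed

section \<open>Existence of minimal resolutions\<close>

text \<open>Induction on \<open>n\<close>: the last coordinates of the elements of \<open>K\<close> form an ideal, and the elements with
  last coordinate \<open>0\<close> form a submodule of \<open>R\<^sup>n\<close>. Finite generation is expressed without spans, as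
  membership in all submodules that contain \<open>S\<close>.\<close>

lemma noetherian_free_submodule:
  fixes R (structure)
  assumes "noetherian_ring R" "cring R" "submodule R K (free_module R n)"
  shows "\<exists>S. finite S \<and> S \<subseteq> K \<and> (\<forall>L. submodule R L (free_module R n) \<longrightarrow> S \<subseteq> L \<longrightarrow> K \<subseteq> L)"
  using assms(3)
proof (induction n arbitrary: K)
  case 0
  interpret cring R by fact
  have "x \<in> L" if "submodule R L (free_module R 0)" "x \<in> K" for x L
  proof -
    have "x = \<zero>\<^bsub>free_module R 0\<^esub>"
      using submoduleD(1)[OF 0 that(2)] by (auto simp: free_carrier_iff free_module_simps)
    then show ?thesis using submoduleD(3)[OF that(1)] by simp
  qed
  then show ?case by (intro exI[of _ "{}"]) auto
next
  case (Suc n)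
  interpret noetherian_ring R by fact
  interpret cring R by fact
  let ?F = "free_module R (Suc n)" and ?E = "free_module R n"
  interpret F: module R ?F by (rule free_module_module)
  interpret E: module R ?E by (rule free_module_module)
  have EF: "f \<in> carrier ?E \<longleftrightarrow> f \<in> carrier ?F \<and> f n = \<zero>" for f
  proof
    assume "f \<in> carrier ?F \<and> f n = \<zero>"
    moreover have "c = n \<or> Suc n \<le> c" if "n \<le> c" for c using that by linarith
    ultimately show "f \<in> carrier ?E" unfolding free_carrier_iff by (metis less_SucI)
  qed (auto simp: free_carrier_iff less_Suc_eq)
  have restrict: "submodule R (L \<inter> carrier ?E) ?E" if "submodule R L ?F" for L
    using E.module_axioms submoduleD[OF that] submoduleD[OF submodule_carrier[OF E.module_axioms]]
    by (auto simp: submodule_def free_module_simps)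
  have top_ideal: "ideal ((\<lambda>f. f n) ` L) R" if L: "submodule R L ?F" for L
  proof (rule idealI[OF ring_axioms])
    note Ld = submoduleD[OF L]
    have Ln: "f n \<in> carrier R" if "f \<in> L" for f using free_carrier_in[OF Ld(1)[OF that]] .
    show "subgroup ((\<lambda>f. f n) ` L) (add_monoid R)"
    proof (rule add.subgroupI)
      show "(\<lambda>f. f n) ` L \<subseteq> carrier R" using Ln by blast
      show "(\<lambda>f. f n) ` L \<noteq> {}" using Ld(3) by blast
      show "\<ominus> y \<in> (\<lambda>f. f n) ` L" if y: "y \<in> (\<lambda>f. f n) ` L" for y
      proof -
        obtain f where f: "f \<in> L" "y = f n" using y by blast
        have "((\<ominus> \<one>) \<odot>\<^bsub>?F\<^esub> f) n = \<ominus> y" using Ln[OF f(1)] f(2) by (simp add: free_module_simps l_minus)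
        moreover have "(\<ominus> \<one>) \<odot>\<^bsub>?F\<^esub> f \<in> L" by (rule Ld(4)) (use f in auto)
        ultimately show ?thesis by (metis imageI)
      qed
      show "y \<oplus> z \<in> (\<lambda>f. f n) ` L" if yz: "y \<in> (\<lambda>f. f n) ` L" "z \<in> (\<lambda>f. f n) ` L" for y z
      proof -
        obtain f g where fg: "f \<in> L" "y = f n" "g \<in> L" "z = g n" using yz by blast
        then have "(f \<oplus>\<^bsub>?F\<^esub> g) n = y \<oplus> z" by (simp add: free_module_simps)
        with Ld(2)[OF fg(1,3)] show ?thesis by (metis imageI)
      qed
    qed
    fix y r assume y: "y \<in> (\<lambda>f. f n) ` L" and r: "r \<in> carrier R"
    obtain f where f: "f \<in> L" "y = f n" using y by blast
    then have "(r \<odot>\<^bsub>?F\<^esub> f) n = r \<otimes> y" by (simp add: free_module_simps)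
    with Ld(4)[OF r f(1)] show "r \<otimes> y \<in> (\<lambda>f. f n) ` L" by (metis imageI)
    then show "y \<otimes> r \<in> (\<lambda>f. f n) ` L" using m_comm[OF r, of y] Ln[OF f(1)] f(2) by simp
  qed
  obtain S where S: "finite S" "S \<subseteq> K \<inter> carrier ?E"
    "\<And>L. submodule R L ?E \<Longrightarrow> S \<subseteq> L \<Longrightarrow> K \<inter> carrier ?E \<subseteq> L"
    using Suc.IH[OF restrict[OF Suc.prems]] by blast
  obtain A where A: "A \<subseteq> carrier R" "finite A" "(\<lambda>f. f n) ` K = Idl A"
    using finetely_gen[OF top_ideal[OF Suc.prems]] by blast
  have "\<forall>a\<in>A. \<exists>f. f \<in> K \<and> f n = a"
  proof
    fix a assume "a \<in> A"
    then have "a \<in> (\<lambda>f. f n) ` K" unfolding A(3) by (rule subsetD[OF genideal_self[OF A(1)]])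
    then show "\<exists>f. f \<in> K \<and> f n = a" by (elim imageE) (intro exI conjI, auto)
  qed
  from bchoice[OF this] obtain t where t: "\<And>a. a \<in> A \<Longrightarrow> t a \<in> K" "\<And>a. a \<in> A \<Longrightarrow> t a n = a" by blast
  show ?case
  proof (intro exI[of _ "S \<union> t ` A"] conjI allI impI subsetI)
    show "finite (S \<union> t ` A)" using S A by blast
    show "x \<in> S \<union> t ` A \<Longrightarrow> x \<in> K" for x using S t by blast
    fix L f assume L: "submodule R L ?F" and sub: "S \<union> t ` A \<subseteq> L" and f: "f \<in> K"
    have KL: "submodule R (K \<inter> L) ?F" by (rule submodule_Int[OF Suc.prems L])
    have "A \<subseteq> (\<lambda>f. f n) ` (K \<inter> L)"
    proof
      fix a assume a: "a \<in> A"
      then have "t a \<in> K \<inter> L" using t sub by blast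
      then show "a \<in> (\<lambda>f. f n) ` (K \<inter> L)" by (rule rev_image_eqI) (simp add: t(2)[OF a])
    qed
    then have "Idl A \<subseteq> (\<lambda>f. f n) ` (K \<inter> L)" by (rule genideal_minimal[OF top_ideal[OF KL]])
    then have "f n \<in> (\<lambda>f. f n) ` (K \<inter> L)" using imageI[OF f, of "\<lambda>f. f n"] unfolding A(3) by (rule subsetD)
    then obtain g where g: "g \<in> K" "g \<in> L" "f n = g n" by (elim imageE IntE)
    let ?d = "f \<oplus>\<^bsub>?F\<^esub> \<ominus>\<^bsub>?F\<^esub> g"
    have fF: "f \<in> carrier ?F" and gF: "g \<in> carrier ?F" using submoduleD(1)[OF Suc.prems] f g(1) by auto
    have dK: "?d \<in> K" by (rule submoduleD(2)[OF Suc.prems f submodule_minus_closed[OF Suc.prems g(1)]])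
    have fdg: "f = ?d \<oplus>\<^bsub>?F\<^esub> g" using fF gF by (simp add: F.a_assoc F.l_neg)
    have dF: "?d \<in> carrier ?F" using fF gF by simp
    have "f n = ?d n \<oplus> g n" using fun_cong[OF fdg, of n] by (simp only: free_module_simps)
    then have "?d n \<oplus> g n = \<zero> \<oplus> g n" using g(3) free_carrier_in[OF gF, of n] by simp
    then have "?d n = \<zero>" using free_carrier_in[OF gF, of n] free_carrier_in[OF dF, of n] by (simp only: add.r_cancel zero_closed)
    then have "?d \<in> K \<inter> carrier ?E" using EF dK dF by blast
    moreover have "K \<inter> carrier ?E \<subseteq> L \<inter> carrier ?E"
      by (rule S(3)[OF restrict[OF L]]) (use sub S(2) in blast)
    ultimately have "?d \<in> L" by blast
    then show "f \<in> L" using fdg submoduleD(2)[OF L _ g(2)] by metis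
  qed
qed

text \<open>The common generalisation of noetherian local rings and of standard graded algebras with their
  irrelevant ideals; the homogeneous elements outside \<open>\<mm>\<close> are units.\<close>

locale star_local = graded_residue +
  assumes noeth: "noetherian_ring R"
    and R_grading: "grading R Rg"
    and degree_0_unit: "x \<in> Rg 0 \<Longrightarrow> x \<notin> \<mm> \<Longrightarrow> x \<in> Units R"
begin

lemma component_0_max:
  assumes x: "x \<in> carrier R" and m: "component R Rg x 0 \<in> \<mm>"
  shows "x \<in> \<mm>"
proof -
  note aR = abelian_group_axioms
  have c: "component R Rg x j \<in> \<mm>" for j
    using degree_in_max component_in[OF aR R_grading x] m by (cases "j = 0") auto
  interpret m: ideal \<mm> R by (rule max_ideal)
  let ?S = "{j. component R Rg x j \<noteq> \<zero>}"
  have "(\<Oplus>j\<in>T. component R Rg x j) \<in> \<mm>" if "finite T" for T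
    using that
  proof (induction T)
    case (insert j T)
    then show ?case using c component_carrier[OF aR R_grading x] by (subst finsum_insert) (auto intro: m.a_closed)
  qed simp
  from this[OF component_finite[OF aR R_grading x]] show ?thesis
    using component_sum[OF aR R_grading x] by simp
qed

text \<open>A homogeneous relation with a coefficient outside \<open>\<mm>\<close> has, in the degree of the corresponding
  generator, a unit coefficient there, and expresses that generator by the other ones.\<close>

lemma irredundant_kernel:
  assumes X: "degree_module R Rg X Xg" "grading X Xg" and x: "\<And>c. c < n \<Longrightarrow> x c \<in> Xg (a c)"
    and irr: "\<And>b. b < n \<Longrightarrow> x b \<notin> module.span R X (x ` ({..<n} - {b}))"
    and r: "r \<in> carrier (free_module R n)" and z: "basis_map X x n r = \<zero>\<^bsub>X\<^esub>"
  shows "r \<in> ideal_smult R \<mm> (free_module R n)"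
proof -
  note Xm = degree_moduleD(1)[OF X(1)]
  interpret X: module R X by (rule Xm)
  interpret F: module R "free_module R n" by (rule free_module_module)
  note aF = module_abelian_group[OF F.module_axioms]
  note gF = grading_free[OF R_grading, of n a]
  have xc: "c < n \<Longrightarrow> x c \<in> carrier X" for c using x degree_moduleD(2)[OF X(1)] by blast
  have bg: "basis_map X x n \<in> graded_hom R (free_module R n) (free_degree R Rg n a) X Xg"
    by (rule basis_map_graded[OF X(1) x])
  have "r b \<in> \<mm>" if b: "b < n" for b
  proof (rule ccontr)
    assume rb: "r b \<notin> \<mm>"
    let ?y = "component (free_module R n) (free_degree R Rg n a) r (a b)"
    have yF: "?y \<in> carrier (free_module R n)" by (rule component_carrier[OF aF gF r])
    have yR: "?y c \<in> carrier R" for c by (rule free_carrier_in[OF yF])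
    have "basis_map X x n ?y = component X Xg \<zero>\<^bsub>X\<^esub> (a b)"
      using component_hom[OF F.module_axioms gF Xm X(2) bg r] z by simp
    also have "\<dots> = \<zero>\<^bsub>X\<^esub>"
      using component_homogeneous[OF X.abelian_group_axioms X(2) degree_moduleD(3)[OF X(1)], of 0] by simp
    finally have yz: "basis_map X x n ?y = \<zero>\<^bsub>X\<^esub>" .
    \<comment> \<open>the component of degree \<open>a b\<close> has the degree \<open>0\<close> part of \<open>r b\<close> as its coefficient at \<open>b\<close>\<close>
    have "component R Rg (r b) = (\<lambda>i. component (free_module R n) (free_degree R Rg n a) r (i + a b) b)"
      by (rule free_decomposition[OF R_grading component_in[OF aF gF r] component_finite[OF aF gF r] _
            component_sum[OF aF gF r]]) simp
    then have "?y b = component R Rg (r b) 0" by simp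
    then have yb: "?y b \<in> Rg 0" "?y b \<notin> \<mm>"
      using component_0_max[OF free_carrier_in[OF r]] rb component_in[OF abelian_group_axioms R_grading free_carrier_in[OF r]] by auto
    have u: "?y b \<in> Units R" by (rule degree_0_unit[OF yb])
    let ?T = "{..<n} - {b}"
    have Tn: "{..<n} = insert b ?T" using b by auto
    let ?sp = "X.span (x ` ?T)"
    have sp: "submodule R ?sp X" by (rule X.span_is_submodule) (use xc in auto)
    have rest: "(\<Oplus>\<^bsub>X\<^esub>c\<in>?T. ?y c \<odot>\<^bsub>X\<^esub> x c) \<in> ?sp"
    proof (rule submodule_finsum_closed[OF sp])
      have "x ` ?T \<subseteq> ?sp" by (rule X.in_own_span) (use xc in auto)
      then show "(\<lambda>c. ?y c \<odot>\<^bsub>X\<^esub> x c) \<in> ?T \<rightarrow> ?sp" using submoduleD(4)[OF sp yR] by blast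
    qed
    let ?s = "\<Oplus>\<^bsub>X\<^esub>c\<in>?T. ?y c \<odot>\<^bsub>X\<^esub> x c"
    have sc: "?s \<in> carrier X" by (rule submoduleD(1)[OF sp rest])
    have "basis_map X x n ?y = ?y b \<odot>\<^bsub>X\<^esub> x b \<oplus>\<^bsub>X\<^esub> ?s"
      unfolding basis_map_def
      by (subst Tn, rule X.finsum_insert) (use yR xc b in auto)
    then have eq: "?y b \<odot>\<^bsub>X\<^esub> x b = \<ominus>\<^bsub>X\<^esub> ?s"
      using yz X.minus_equality[of "?y b \<odot>\<^bsub>X\<^esub> x b" ?s] sc yR xc[OF b] by simp
    have "x b = (inv (?y b) \<otimes> ?y b) \<odot>\<^bsub>X\<^esub> x b" using u xc[OF b] by simp
    also have "\<dots> = inv (?y b) \<odot>\<^bsub>X\<^esub> (?y b \<odot>\<^bsub>X\<^esub> x b)"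
      using u yR xc[OF b] by (intro X.smult_assoc1) auto
    also have "\<dots> = inv (?y b) \<odot>\<^bsub>X\<^esub> \<ominus>\<^bsub>X\<^esub> ?s" unfolding eq ..
    also have "\<dots> \<in> ?sp" using u by (intro submoduleD(4)[OF sp] submodule_minus_closed[OF sp] rest) auto
    finally show False using irr[OF b] by blast
  qed
  then have "r c \<in> \<mm>" for c using r max_zero by (cases "c < n") (auto simp: free_carrier_iff)
  then show ?thesis using r by (simp add: ideal_smult_free[OF max_ideal])
qed

text \<open>A family of homogeneous generators of least length is irredundant, so that \<open>irredundant_kernel\<close>
  applies to it.\<close>

lemma minimal_cover:
  assumes X: "degree_module R Rg X Xg" "grading X Xg"
    and S: "finite S" "S \<subseteq> (\<Union>j. Xg j)" "module.span R X S = carrier X"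
  obtains n a p where "p \<in> graded_hom R (free_module R n) (free_degree R Rg n a) X Xg"
    "p ` carrier (free_module R n) = carrier X"
    "{r \<in> carrier (free_module R n). p r = \<zero>\<^bsub>X\<^esub>} \<subseteq> ideal_smult R \<mm> (free_module R n)"
proof -
  interpret X: module R X by (rule degree_moduleD(1)[OF X(1)])
  let ?P = "\<lambda>n::nat. \<exists>x a. (\<forall>c<n. x c \<in> Xg (a c)) \<and> X.span (x ` {..<n}) = carrier X"
  have "\<exists>n. ?P n"
  proof -
    obtain e where e: "bij_betw e {..<card S} S" using S(1) ex_bij_betw_nat_finite[of S] by (auto simp: atLeast0LessThan)
    have "\<forall>c<card S. \<exists>j. e c \<in> Xg j" using S(2) bij_betwE[OF e] by blast
    then obtain a where "\<forall>c<card S. e c \<in> Xg (a c)" by metis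
    moreover have "e ` {..<card S} = S" using e by (simp add: bij_betw_def)
    ultimately have "?P (card S)" using S(3) by (intro exI[of _ e] exI[of _ a] conjI) simp_all
    then show ?thesis by (rule exI)
  qed
  then have L: "?P (LEAST n. ?P n)" by (rule LeastI_ex)
  define n where "n = (LEAST n. ?P n)"
  obtain x a where x: "\<And>c. c < n \<Longrightarrow> x c \<in> Xg (a c)" and sp: "X.span (x ` {..<n}) = carrier X"
    using L unfolding n_def by blast
  have xc: "c < n \<Longrightarrow> x c \<in> carrier X" for c using x degree_moduleD(2)[OF X(1)] by blast
  have irr: "x b \<notin> X.span (x ` ({..<n} - {b}))" if b: "b < n" for b
  proof
    assume mem: "x b \<in> X.span (x ` ({..<n} - {b}))"
    let ?k = "\<lambda>c. if c < b then c else Suc c"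
    have k: "?k ` {..<n - 1} = {..<n} - {b}"
    proof (intro equalityI subsetI)
      fix c assume "c \<in> {..<n} - {b}"
      then have "c = ?k (if c < b then c else c - 1)" "(if c < b then c else c - 1) \<in> {..<n - 1}" using b by auto
      then show "c \<in> ?k ` {..<n - 1}" by (rule image_eqI)
    qed (use b in \<open>auto split: if_splits\<close>)
    have sub: "x ` ({..<n} - {b}) \<subseteq> carrier X" using xc by auto
    have "x ` {..<n} \<subseteq> X.span (x ` ({..<n} - {b}))" using mem X.in_own_span[OF sub] by blast
    then have "carrier X \<subseteq> X.span (x ` ({..<n} - {b}))"
      using X.span_is_subset[OF _ X.span_is_submodule[OF sub]] sp by blast
    then have "X.span (x ` ({..<n} - {b})) = carrier X" using X.span_is_subset2[OF sub] by blast
    then have "X.span ((\<lambda>c. x (?k c)) ` {..<n - 1}) = carrier X"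
      unfolding k[symmetric] image_image .
    moreover have "\<forall>c<n - 1. x (?k c) \<in> Xg (a (?k c))" using x b by auto
    ultimately have "?P (n - 1)" by (intro exI[of _ "\<lambda>c. x (?k c)"] exI[of _ "\<lambda>c. a (?k c)"]) blast
    then have "n \<le> n - 1" unfolding n_def by (rule Least_le)
    then show False using b by simp
  qed
  show thesis
  proof (rule that)
    show "basis_map X x n \<in> graded_hom R (free_module R n) (free_degree R Rg n a) X Xg"
      by (rule basis_map_graded[OF X(1) x])
    show "basis_map X x n ` carrier (free_module R n) = carrier X"
      using basis_map_image[OF X.module_axioms xc] sp by simp
    show "{r \<in> carrier (free_module R n). basis_map X x n r = \<zero>\<^bsub>X\<^esub>} \<subseteq> ideal_smult R \<mm> (free_module R n)"
    proof
      fix r assume "r \<in> {r \<in> carrier (free_module R n). basis_map X x n r = \<zero>\<^bsub>X\<^esub>}"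
      then have "r \<in> carrier (free_module R n)" "basis_map X x n r = \<zero>\<^bsub>X\<^esub>" by auto
      then show "r \<in> ideal_smult R \<mm> (free_module R n)" by (intro irredundant_kernel[where x = x and a = a, OF X]) (assumption | rule x irr)+
    qed
  qed
qed

text \<open>The same for a homogeneous submodule of a free module, which is generated by the components of
  finitely many generators.\<close>

lemma minimal_cover_submodule:
  assumes K: "homogeneous_submodule R (free_module R m) (free_degree R Rg m b) K"
  obtains n a p where
    "p \<in> graded_hom R (free_module R n) (free_degree R Rg n a) (free_module R m) (free_degree R Rg m b)"
    "p ` carrier (free_module R n) = K"
    "{r \<in> carrier (free_module R n). p r = \<zero>\<^bsub>free_module R m\<^esub>} \<subseteq> ideal_smult R \<mm> (free_module R n)"
proof -
  let ?F = "free_module R m" and ?Fg = "free_degree R Rg m b"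
  let ?X = "?F\<lparr>carrier := K\<rparr>" and ?Xg = "\<lambda>j. ?Fg j \<inter> K"
  interpret F: module R ?F by (rule free_module_module)
  have Ks: "submodule R K ?F" and Kc: "\<And>x j. x \<in> K \<Longrightarrow> component ?F ?Fg x j \<in> K"
    using K by (auto simp: homogeneous_submodule_def)
  note aF = F.abelian_group_axioms
  note gF = grading_free[OF R_grading, of m b]
  obtain S where S: "finite S" "S \<subseteq> K" "\<And>L. submodule R L ?F \<Longrightarrow> S \<subseteq> L \<Longrightarrow> K \<subseteq> L"
    using noetherian_free_submodule[OF noeth cring_axioms Ks] by blast
  have Sc: "x \<in> carrier ?F" if "x \<in> S" for x using S(2) submoduleD(1)[OF Ks] that by blast
  let ?supp = "\<lambda>x. {j. component ?F ?Fg x j \<noteq> \<zero>\<^bsub>?F\<^esub>}"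
  let ?T = "\<Union>x\<in>S. component ?F ?Fg x ` ?supp x"
  have T: "finite ?T" using S(1) component_finite[OF aF gF Sc] by blast
  have TK: "?T \<subseteq> K" using Kc S(2) by blast
  have Tg: "?T \<subseteq> (\<Union>j. ?Xg j)"
  proof
    fix y assume "y \<in> ?T"
    then obtain x j where x: "x \<in> S" "y = component ?F ?Fg x j" by blast
    then have "y \<in> ?Xg j" using Kc S(2) component_in[OF aF gF Sc[OF x(1)], of j] by auto
    then show "y \<in> (\<Union>j. ?Xg j)" by blast
  qed
  have TF: "?T \<subseteq> carrier ?F" using TK submoduleD(1)[OF Ks] by blast
  have sT: "submodule R (F.span ?T) ?F" by (rule F.span_is_submodule[OF TF])
  have "S \<subseteq> F.span ?T"
  proof
    fix x assume x: "x \<in> S"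
    have "(\<Oplus>\<^bsub>?F\<^esub>j\<in>?supp x. component ?F ?Fg x j) \<in> F.span ?T"
      by (rule submodule_finsum_closed[OF sT]) (use F.in_own_span[OF TF] x in blast)
    then show "x \<in> F.span ?T" using component_sum[OF aF gF Sc[OF x]] by simp
  qed
  from S(3)[OF sT this] have "F.span ?T = K" using F.span_is_subset[OF TK Ks] by blast
  then have span: "module.span R ?X ?T = carrier ?X" using F.span_li_not_depend(1)[OF TK Ks] by simp
  obtain n a p where p: "p \<in> graded_hom R (free_module R n) (free_degree R Rg n a) ?X ?Xg"
    "p ` carrier (free_module R n) = carrier ?X"
    "{r \<in> carrier (free_module R n). p r = \<zero>\<^bsub>?X\<^esub>} \<subseteq> ideal_smult R \<mm> (free_module R n)"
    by (rule minimal_cover[OF degree_module_submodule[OF free_degree_module Ks]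
          grading_submodule[OF F.module_axioms gF K] T Tg span]) (rule that, assumption+)
  show thesis
  proof (rule that)
    show "p \<in> graded_hom R (free_module R n) (free_degree R Rg n a) ?F ?Fg"
      using p(1) submoduleD(1)[OF Ks] by (auto simp: graded_hom_def module_hom_def image_subset_iff)
    show "p ` carrier (free_module R n) = K" using p(2) by simp
    show "{r \<in> carrier (free_module R n). p r = \<zero>\<^bsub>?F\<^esub>} \<subseteq> ideal_smult R \<mm> (free_module R n)"
      using p(3) by simp
  qed
qed

text \<open>Iterate \<open>minimal_cover\<close>: the kernel of each cover is a homogeneous submodule of \<open>\<mm>\<close> times a free
  module, and is covered in turn.\<close>

theorem minimal_resolution_exists:
  assumes X: "degree_module R Rg X Xg" "grading X Xg"
    and S: "finite S" "S \<subseteq> (\<Union>j. Xg j)" "module.span R X S = carrier X"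
  obtains n a F \<epsilon> where "\<And>i. obj F i = free_module R (n i)"
    "strict_resolution R Rg F (\<lambda>i. free_degree R Rg (n i) (a i)) \<epsilon> X Xg" "minimal_complex R \<mm> F"
proof -
  note Xm = degree_moduleD(1)[OF X(1)]
  obtain n0 a0 \<epsilon> where \<epsilon>: "\<epsilon> \<in> graded_hom R (free_module R n0) (free_degree R Rg n0 a0) X Xg"
    "\<epsilon> ` carrier (free_module R n0) = carrier X"
    "{r \<in> carrier (free_module R n0). \<epsilon> r = \<zero>\<^bsub>X\<^esub>} \<subseteq> ideal_smult R \<mm> (free_module R n0)"
    by (rule minimal_cover[OF X S]) (rule that, assumption+)
  \<comment> \<open>a stage consists of rank and degrees of the free module, the kernel to be covered next, and the map
    that leads to the previous stage, which is arbitrary at stage \<open>0\<close>\<close>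
  let ?P = "\<lambda>i :: nat. \<lambda>(n, a, K, d :: (nat \<Rightarrow> 'a) \<Rightarrow> nat \<Rightarrow> 'a).
    homogeneous_submodule R (free_module R n) (free_degree R Rg n a) K \<and>
    K \<subseteq> ideal_smult R \<mm> (free_module R n) \<and>
    (i = 0 \<longrightarrow> n = n0 \<and> a = a0 \<and> K = {r \<in> carrier (free_module R n0). \<epsilon> r = \<zero>\<^bsub>X\<^esub>})"
  let ?Q = "\<lambda>i :: nat. \<lambda>(n, a, K, d :: (nat \<Rightarrow> 'a) \<Rightarrow> nat \<Rightarrow> 'a) (n', a', K', d').
    d' \<in> graded_hom R (free_module R n') (free_degree R Rg n' a') (free_module R n) (free_degree R Rg n a) \<and>
    d' ` carrier (free_module R n') = K \<and>
    K' = {r \<in> carrier (free_module R n'). d' r = \<zero>\<^bsub>free_module R n\<^esub>}"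
  have "\<exists>f. \<forall>i. ?P i (f i) \<and> ?Q i (f i) (f (Suc i))"
  proof (rule dependent_nat_choice)
    show "\<exists>s. ?P 0 s"
      using homogeneous_kernel[OF free_module_module grading_free[OF R_grading] Xm X(2) \<epsilon>(1)] \<epsilon>(3)
      by (intro exI[of _ "(n0, a0, {r \<in> carrier (free_module R n0). \<epsilon> r = \<zero>\<^bsub>X\<^esub>}, undefined)"]) auto
  next
    fix s i assume s: "?P i s"
    obtain n a K d where snd: "s = (n, a, K, d)" by (cases s)
    have K: "homogeneous_submodule R (free_module R n) (free_degree R Rg n a) K" using s snd by simp
    obtain n' a' p where p: "p \<in> graded_hom R (free_module R n') (free_degree R Rg n' a') (free_module R n) (free_degree R Rg n a)"
      "p ` carrier (free_module R n') = K"
      "{r \<in> carrier (free_module R n'). p r = \<zero>\<^bsub>free_module R n\<^esub>} \<subseteq> ideal_smult R \<mm> (free_module R n')"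
      by (rule minimal_cover_submodule[OF K]) (rule that, assumption+)
    show "\<exists>s'. ?P (Suc i) s' \<and> ?Q i s s'"
      using p homogeneous_kernel[OF free_module_module grading_free[OF R_grading] free_module_module grading_free[OF R_grading] p(1)]
      unfolding snd
      by (intro exI[of _ "(n', a', {r \<in> carrier (free_module R n'). p r = \<zero>\<^bsub>free_module R n\<^esub>}, p)"]) auto
  qed
  then obtain f where f': "\<forall>i. ?P i (f i) \<and> ?Q i (f i) (f (Suc i))" by (rule exE)
  have f: "?P i (f i)" "?Q i (f i) (f (Suc i))" for i
    by (rule conjunct1[OF spec[OF f', of i]], rule conjunct2[OF spec[OF f', of i]])
  define n a K d where "n i = fst (f i)" and "a i = fst (snd (f i))" and "K i = fst (snd (snd (f i)))"
    and "d i = snd (snd (snd (f (Suc i))))" for i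
  have fi: "f i = (n i, a i, K i, snd (snd (snd (f i))))" for i by (simp add: n_def a_def K_def)
  have K: "K i \<subseteq> ideal_smult R \<mm> (free_module R (n i))" for i
    using f(1)[of i] by (subst (asm) fi) simp
  have K0: "n 0 = n0" "a 0 = a0" "K 0 = {r \<in> carrier (free_module R n0). \<epsilon> r = \<zero>\<^bsub>X\<^esub>}"
    using f(1)[of 0] by (subst (asm) fi, simp)+
  have d: "d i \<in> graded_hom R (free_module R (n (Suc i))) (free_degree R Rg (n (Suc i)) (a (Suc i)))
        (free_module R (n i)) (free_degree R Rg (n i) (a i))"
    "d i ` carrier (free_module R (n (Suc i))) = K i"
    "K (Suc i) = {r \<in> carrier (free_module R (n (Suc i))). d i r = \<zero>\<^bsub>free_module R (n i)\<^esub>}" for i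
    using f(2)[of i] by (subst (asm) (2) fi, subst (asm) fi, simp add: d_def)+
  define F where "F = \<lparr>obj = \<lambda>i. free_module R (n i), diff = d\<rparr>"
  have Fo: "obj F i = free_module R (n i)" and Fd: "diff F i = d i" for i by (simp_all add: F_def)
  have dd: "d i (d (Suc i) x) = \<zero>\<^bsub>free_module R (n i)\<^esub>" if "x \<in> carrier (free_module R (n (Suc (Suc i))))" for i x
  proof -
    have "d (Suc i) x \<in> K (Suc i)" using d(2)[of "Suc i"] that by blast
    then show ?thesis unfolding d(3) by simp
  qed
  have res: "resolution R F \<epsilon> X"
    unfolding resolution_def Fo Fd boundaries_def cycles.simps
    using free_module_module graded_homD(1)[OF d(1)] graded_homD(1)[OF \<epsilon>(1)] \<epsilon>(2) d(2,3) K0 by auto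
  have "strict_resolution R Rg F (\<lambda>i. free_degree R Rg (n i) (a i)) \<epsilon> X Xg"
    unfolding strict_resolution_def graded_complex_def Fo Fd
    using res X(1) free_degree_module d(1) dd \<epsilon>(1) K0(1,2)
      graded_hom_strict[OF free_module_module grading_free[OF R_grading] Xm X(2) \<epsilon>(1)]
      graded_hom_strict[OF free_module_module grading_free[OF R_grading] free_module_module grading_free[OF R_grading] d(1)]
    by simp
  moreover have "minimal_complex R \<mm> F"
    unfolding minimal_complex_def boundaries_def Fo Fd using d(2) K by simp
  ultimately show thesis using that Fo by blast
qed

end

section \<open>Hilbert's basis theorem for finitely generated algebras\<close>

text \<open>Ideals of a subring \<open>A\<close> of \<open>R\<close>, without making \<open>A\<close> a ring record of its own, so that adjoining one
  element after the other stays inside \<open>R\<close>.\<close>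

definition ideal_in :: "('a, 'm) ring_scheme \<Rightarrow> 'a set \<Rightarrow> 'a set \<Rightarrow> bool" where
  "ideal_in R A J \<longleftrightarrow> J \<subseteq> A \<and> \<zero>\<^bsub>R\<^esub> \<in> J \<and> (\<forall>x\<in>J. \<forall>y\<in>J. x \<oplus>\<^bsub>R\<^esub> y \<in> J) \<and>
     (\<forall>a\<in>A. \<forall>x\<in>J. a \<otimes>\<^bsub>R\<^esub> x \<in> J)"

definition noetherian_in :: "('a, 'm) ring_scheme \<Rightarrow> 'a set \<Rightarrow> bool" where
  "noetherian_in R A \<longleftrightarrow> (\<forall>J. ideal_in R A J \<longrightarrow>
     (\<exists>T. finite T \<and> T \<subseteq> J \<and> (\<forall>K. ideal_in R A K \<longrightarrow> T \<subseteq> K \<longrightarrow> J \<subseteq> K)))"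

text \<open>\<open>low A s n\<close> consists of the polynomial expressions in \<open>s\<close> of degree less than \<open>n\<close> over \<open>A\<close>.\<close>

primrec low :: "('a, 'm) ring_scheme \<Rightarrow> 'a set \<Rightarrow> 'a \<Rightarrow> nat \<Rightarrow> 'a set" where
  "low R A s 0 = {\<zero>\<^bsub>R\<^esub>}"
| "low R A s (Suc n) = {a \<otimes>\<^bsub>R\<^esub> (s [^]\<^bsub>R\<^esub> n) \<oplus>\<^bsub>R\<^esub> y | a y. a \<in> A \<and> y \<in> low R A s n}"

text \<open>The leading coefficients of the elements of \<open>J\<close> of degree \<open>n\<close>. Since \<open>s\<close> may be algebraic over \<open>A\<close>, an
  element of \<open>A[s]\<close> can have several of them.\<close>

definition leading :: "('a, 'm) ring_scheme \<Rightarrow> 'a set \<Rightarrow> 'a \<Rightarrow> nat \<Rightarrow> 'a set \<Rightarrow> 'a set" where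
  "leading R A s n J = {a \<in> A. \<exists>y\<in>low R A s n. a \<otimes>\<^bsub>R\<^esub> (s [^]\<^bsub>R\<^esub> n) \<oplus>\<^bsub>R\<^esub> y \<in> J}"

lemma ideal_inD:
  assumes "ideal_in R A J"
  shows "x \<in> J \<Longrightarrow> x \<in> A" "\<zero>\<^bsub>R\<^esub> \<in> J" "x \<in> J \<Longrightarrow> y \<in> J \<Longrightarrow> x \<oplus>\<^bsub>R\<^esub> y \<in> J"
    "a \<in> A \<Longrightarrow> x \<in> J \<Longrightarrow> a \<otimes>\<^bsub>R\<^esub> x \<in> J"
  using assms by (auto simp: ideal_in_def)

lemma noetherian_inD:
  assumes "noetherian_in R A" "ideal_in R A J"
  obtains T where "finite T" "T \<subseteq> J" "\<And>K. ideal_in R A K \<Longrightarrow> T \<subseteq> K \<Longrightarrow> J \<subseteq> K"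
proof -
  have "\<exists>T. finite T \<and> T \<subseteq> J \<and> (\<forall>K. ideal_in R A K \<longrightarrow> T \<subseteq> K \<longrightarrow> J \<subseteq> K)"
    using assms unfolding noetherian_in_def by (elim allE[of _ J] impE)
  then show thesis using that by (elim exE conjE) blast
qed

lemma low_SucI:
  "a \<in> A \<Longrightarrow> y \<in> low R A s n \<Longrightarrow> a \<otimes>\<^bsub>R\<^esub> (s [^]\<^bsub>R\<^esub> n) \<oplus>\<^bsub>R\<^esub> y \<in> low R A s (Suc n)"
  by auto

lemma leadingI:
  "a \<in> A \<Longrightarrow> y \<in> low R A s n \<Longrightarrow> a \<otimes>\<^bsub>R\<^esub> (s [^]\<^bsub>R\<^esub> n) \<oplus>\<^bsub>R\<^esub> y \<in> J \<Longrightarrow> a \<in> leading R A s n J"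
  by (auto simp: leading_def)

context cring
begin

context
  fixes A s
  assumes A: "subring A R" and s: "s \<in> carrier R"
begin

lemma A_carrier: "a \<in> A \<Longrightarrow> a \<in> carrier R"
  using subringE(1)[OF A] by blast

lemma low_carrier: "y \<in> low R A s n \<Longrightarrow> y \<in> carrier R"
  by (induction n arbitrary: y) (use A_carrier s in auto)

lemma low_zero: "\<zero> \<in> low R A s n"
proof (induction n)
  case (Suc n)
  have "\<zero> = \<zero> \<otimes> (s [^] n) \<oplus> \<zero>" using s by simp
  then show ?case using Suc subringE(2)[OF A] by (auto intro!: exI[of _ \<zero>])
qed simp

lemma low_add: "x \<in> low R A s n \<Longrightarrow> y \<in> low R A s n \<Longrightarrow> x \<oplus> y \<in> low R A s n"
proof (induction n arbitrary: x y)
  case (Suc n)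
  then obtain a b u v where *: "a \<in> A" "b \<in> A" "u \<in> low R A s n" "v \<in> low R A s n"
    "x = a \<otimes> (s [^] n) \<oplus> u" "y = b \<otimes> (s [^] n) \<oplus> v" by auto
  have "x \<oplus> y = (a \<oplus> b) \<otimes> (s [^] n) \<oplus> (u \<oplus> v)"
    unfolding * using *(1-4) A_carrier low_carrier s by (simp add: l_distr a_ac)
  then show ?case using low_SucI[OF subringE(7)[OF A *(1,2)] Suc.IH[OF *(3,4)]] by (simp only:)
qed simp

lemma low_smult: "c \<in> A \<Longrightarrow> x \<in> low R A s n \<Longrightarrow> c \<otimes> x \<in> low R A s n"
proof (induction n arbitrary: x)
  case (Suc n)
  then obtain a u where *: "a \<in> A" "u \<in> low R A s n" "x = a \<otimes> (s [^] n) \<oplus> u" by auto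
  have "c \<otimes> x = (c \<otimes> a) \<otimes> (s [^] n) \<oplus> c \<otimes> u"
    unfolding * using *(1,2) Suc.prems(1) A_carrier low_carrier s by (simp add: r_distr m_assoc)
  then show ?case
    using low_SucI[OF subringE(6)[OF A Suc.prems(1) *(1)] Suc.IH[OF Suc.prems(1) *(2)]] by (simp only:)
qed (use A_carrier in simp)

lemma low_neg:
  assumes "x \<in> low R A s n"
  shows "\<ominus> x \<in> low R A s n"
proof -
  have "(\<ominus> \<one>) \<otimes> x \<in> low R A s n" by (rule low_smult[OF subringE(5)[OF A subringE(3)[OF A]] assms])
  moreover have "(\<ominus> \<one>) \<otimes> x = \<ominus> x" using low_carrier[OF assms] by (simp add: l_minus)
  ultimately show ?thesis by (simp only:)
qed

lemma low_Suc: "x \<in> low R A s n \<Longrightarrow> x \<in> low R A s (Suc n)"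
proof -
  assume x: "x \<in> low R A s n"
  have "x = \<zero> \<otimes> (s [^] n) \<oplus> x" using s low_carrier[OF x] by simp
  then show ?thesis using low_SucI[OF subringE(2)[OF A] x] by (simp only:)
qed

lemma low_mono: "n \<le> m \<Longrightarrow> x \<in> low R A s n \<Longrightarrow> x \<in> low R A s m"
  by (induction rule: dec_induct) (auto intro: low_Suc simp del: low.simps)

lemma low_times: "x \<in> low R A s n \<Longrightarrow> s \<otimes> x \<in> low R A s (Suc n)"
proof (induction n arbitrary: x)
  case 0
  then show ?case using s low_zero[of "Suc 0"] by (simp del: low.simps(2))
next
  case (Suc n)
  then obtain a u where *: "a \<in> A" "u \<in> low R A s n" "x = a \<otimes> (s [^] n) \<oplus> u" by auto
  have "s \<otimes> x = a \<otimes> (s [^] Suc n) \<oplus> s \<otimes> u"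
    unfolding * using *(1,2) A_carrier low_carrier s by (simp add: r_distr m_ac)
  then show ?case using low_SucI[OF *(1) Suc.IH[OF *(2)]] by (simp only:)
qed

lemma low_mult:
  assumes "y \<in> low R A s m" "x \<in> low R A s n"
  shows "\<exists>k. x \<otimes> y \<in> low R A s k"
  using assms(2)
proof (induction n arbitrary: x)
  case 0
  then show ?case using low_carrier[OF assms(1)] low_zero by auto
next
  case (Suc n)
  then obtain a u where *: "a \<in> A" "u \<in> low R A s n" "x = a \<otimes> (s [^] n) \<oplus> u" by auto
  have "\<exists>k. (s [^] i) \<otimes> y \<in> low R A s k" for i :: nat
  proof (induction i)
    case 0
    then show ?case using low_carrier[OF assms(1)] assms(1) by auto
  next
    case (Suc i)
    then obtain k where k: "(s [^] i) \<otimes> y \<in> low R A s k" by blast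
    have "(s [^] Suc i) \<otimes> y = s \<otimes> ((s [^] i) \<otimes> y)" using s low_carrier[OF assms(1)] by (simp add: m_ac)
    then show ?case using low_times[OF k] by (intro exI[of _ "Suc k"]) (simp only:)
  qed
  then obtain k where k: "(s [^] n) \<otimes> y \<in> low R A s k" by blast
  obtain l where l: "u \<otimes> y \<in> low R A s l" using Suc.IH[OF *(2)] by blast
  have "x \<otimes> y = a \<otimes> ((s [^] n) \<otimes> y) \<oplus> u \<otimes> y"
    unfolding * using *(1,2) A_carrier low_carrier[OF assms(1)] low_carrier s by (simp add: l_distr m_assoc)
  moreover have "a \<otimes> ((s [^] n) \<otimes> y) \<in> low R A s (max k l)"
    by (rule low_mono[OF _ low_smult[OF *(1) k]]) simp
  moreover have "u \<otimes> y \<in> low R A s (max k l)" by (rule low_mono[OF _ l]) simp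
  ultimately show ?case using low_add by metis
qed

lemma generate_ring_low:
  assumes "x \<in> generate_ring R H" "H \<subseteq> A \<union> {s}"
  shows "\<exists>n. x \<in> low R A s n"
proof -
  have one: "a \<in> low R A s (Suc 0)" if "a \<in> A" for a
    using that A_carrier[OF that] by (auto intro!: exI[of _ a])
  show ?thesis using assms(1)
  proof induction
    case one
    show ?case using \<open>\<And>a. a \<in> A \<Longrightarrow> a \<in> low R A s (Suc 0)\<close> subringE(3)[OF A] by blast
  next
    case (incl h)
    have "s \<otimes> \<one> \<in> low R A s (Suc (Suc 0))" by (rule low_times[OF one[OF subringE(3)[OF A]]])
    then have "s \<in> low R A s (Suc (Suc 0))" using s by (simp del: low.simps)
    then show ?case using incl assms(2) one by blast
  next
    case (a_inv h)
    then show ?case using low_neg by blast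
  next
    case (eng_add x y)
    then obtain n m where nm: "x \<in> low R A s n" "y \<in> low R A s m" by blast
    have "x \<in> low R A s (max n m)" by (rule low_mono[OF _ nm(1)]) simp
    moreover have "y \<in> low R A s (max n m)" by (rule low_mono[OF _ nm(2)]) simp
    ultimately show ?case using low_add by blast
  next
    case (eng_mult x y)
    then show ?case using low_mult by blast
  qed
qed

text \<open>If \<open>I \<subseteq> J\<close> are ideals of \<open>B = A[s]\<close> with the same leading coefficients in all degrees, then \<open>I = J\<close> by
  induction on degrees. The leading coefficient ideals of \<open>J\<close> increase with the degree and become
  stationary at some \<open>N\<close>, so finitely many elements of \<open>J\<close>, with leading coefficients that generate these
  ideals in the degrees up to \<open>N\<close>, generate \<open>J\<close>.\<close>

lemma noetherian_adjoin:
  assumes noeth: "noetherian_in R A" and B: "subring B R" and AB: "A \<subseteq> B" and sB: "s \<in> B"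
    and low: "\<And>x. x \<in> B \<Longrightarrow> \<exists>n. x \<in> low R A s n"
  shows "noetherian_in R B"
  unfolding noetherian_in_def
proof (intro allI impI)
  fix J assume J: "ideal_in R B J"
  have Bc: "x \<in> carrier R" if "x \<in> B" for x using subringE(1)[OF B] that by blast
  have sn: "s [^] n \<in> carrier R" for n :: nat using s by simp
  have lead: "ideal_in R A (leading R A s n I)" if I: "ideal_in R B I" for n I
    unfolding ideal_in_def
  proof (intro conjI ballI)
    show "leading R A s n I \<subseteq> A" by (auto simp: leading_def)
    have "\<zero> \<otimes> (s [^] n) \<oplus> \<zero> \<in> I" using ideal_inD(2)[OF I] sn by simp
    then show "\<zero> \<in> leading R A s n I" using low_zero subringE(2)[OF A] by (auto simp: leading_def)
  next
    fix a b assume "a \<in> leading R A s n I" "b \<in> leading R A s n I"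
    then obtain u v where *: "a \<in> A" "b \<in> A" "u \<in> low R A s n" "v \<in> low R A s n"
      "a \<otimes> (s [^] n) \<oplus> u \<in> I" "b \<otimes> (s [^] n) \<oplus> v \<in> I" by (auto simp: leading_def)
    have "(a \<otimes> (s [^] n) \<oplus> u) \<oplus> (b \<otimes> (s [^] n) \<oplus> v) = (a \<oplus> b) \<otimes> (s [^] n) \<oplus> (u \<oplus> v)"
      using *(1-4) A_carrier low_carrier sn by (simp add: l_distr a_ac)
    then show "a \<oplus> b \<in> leading R A s n I"
      using ideal_inD(3)[OF I *(5,6)] by (intro leadingI[OF subringE(7)[OF A *(1,2)] low_add[OF *(3,4)]]) (simp only:)
  next
    fix c a assume c: "c \<in> A" and "a \<in> leading R A s n I"
    then obtain u where *: "a \<in> A" "u \<in> low R A s n" "a \<otimes> (s [^] n) \<oplus> u \<in> I" by (auto simp: leading_def)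
    have "c \<otimes> (a \<otimes> (s [^] n) \<oplus> u) = (c \<otimes> a) \<otimes> (s [^] n) \<oplus> c \<otimes> u"
      using *(1,2) c A_carrier low_carrier sn by (simp add: r_distr m_assoc)
    then show "c \<otimes> a \<in> leading R A s n I"
      using ideal_inD(4)[OF I subsetD[OF AB c] *(3)]
      by (intro leadingI[OF subringE(6)[OF A c *(1)] low_smult[OF c *(2)]]) (simp only:)
  qed
  have lead_Suc: "leading R A s n I \<subseteq> leading R A s (Suc n) I" if I: "ideal_in R B I" for n I
  proof
    fix a assume "a \<in> leading R A s n I"
    then obtain u where *: "a \<in> A" "u \<in> low R A s n" "a \<otimes> (s [^] n) \<oplus> u \<in> I" by (auto simp: leading_def)
    have "s \<otimes> (a \<otimes> (s [^] n) \<oplus> u) = a \<otimes> (s [^] Suc n) \<oplus> s \<otimes> u"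
      using *(1,2) A_carrier low_carrier s by (simp add: r_distr m_ac)
    then show "a \<in> leading R A s (Suc n) I"
      using ideal_inD(4)[OF I sB *(3)] by (intro leadingI[OF *(1) low_times[OF *(2)]]) (simp only:)
  qed
  have lead_mono: "leading R A s n I \<subseteq> leading R A s m I" if "ideal_in R B I" "n \<le> m" for n m I
    using that(2) by (induction rule: dec_induct) (use lead_Suc[OF that(1)] in auto)
  let ?U = "\<Union>n. leading R A s n J"
  have "ideal_in R A ?U"
    unfolding ideal_in_def
  proof (intro conjI ballI)
    show "?U \<subseteq> A" by (auto simp: leading_def)
    show "\<zero> \<in> ?U" using ideal_inD(2)[OF lead[OF J]] by blast
    show "x \<oplus> y \<in> ?U" if xy: "x \<in> ?U" "y \<in> ?U" for x y
    proof -
      obtain n m where nm: "x \<in> leading R A s n J" "y \<in> leading R A s m J" using xy by blast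
      have "x \<in> leading R A s (max n m) J" by (rule subsetD[OF lead_mono[OF J] nm(1)]) simp
      moreover have "y \<in> leading R A s (max n m) J" by (rule subsetD[OF lead_mono[OF J] nm(2)]) simp
      ultimately show ?thesis using ideal_inD(3)[OF lead[OF J]] by blast
    qed
    show "c \<otimes> x \<in> ?U" if "c \<in> A" "x \<in> ?U" for c x using that ideal_inD(4)[OF lead[OF J]] by blast
  qed
  then obtain T where T: "finite T" "T \<subseteq> ?U" "\<And>K. ideal_in R A K \<Longrightarrow> T \<subseteq> K \<Longrightarrow> ?U \<subseteq> K"
    by (rule noetherian_inD[OF noeth]) (rule that, assumption+)
  have "\<exists>N. T \<subseteq> leading R A s N J" using T(1,2)
  proof (induction T)
    case (insert t T)
    then obtain N where N: "T \<subseteq> leading R A s N J" by blast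
    obtain m where m: "t \<in> leading R A s m J" using insert.prems by blast
    have "insert t T \<subseteq> leading R A s (max N m) J"
      using subsetD[OF lead_mono[OF J, of m "max N m"] m] subset_trans[OF N lead_mono[OF J, of N "max N m"]] by simp
    then show ?case by blast
  qed simp
  then obtain N where "T \<subseteq> leading R A s N J" by blast
  from T(3)[OF lead[OF J] this] have N: "leading R A s n J \<subseteq> leading R A s N J" for n by blast
  have "\<exists>W. finite W \<and> W \<subseteq> J \<and> (\<forall>I. ideal_in R B I \<longrightarrow> W \<subseteq> I \<longrightarrow> leading R A s n J \<subseteq> leading R A s n I)" for n
  proof -
    obtain T where T: "finite T" "T \<subseteq> leading R A s n J"
      "\<And>K. ideal_in R A K \<Longrightarrow> T \<subseteq> K \<Longrightarrow> leading R A s n J \<subseteq> K"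
      by (rule noetherian_inD[OF noeth lead[OF J, of n]]) (rule that, assumption+)
    have "\<forall>t\<in>T. \<exists>y. y \<in> low R A s n \<and> t \<otimes> (s [^] n) \<oplus> y \<in> J" using T(2) by (auto simp: leading_def)
    from bchoice[OF this] obtain y where y: "\<And>t. t \<in> T \<Longrightarrow> y t \<in> low R A s n"
      "\<And>t. t \<in> T \<Longrightarrow> t \<otimes> (s [^] n) \<oplus> y t \<in> J" by blast
    let ?W = "(\<lambda>t. t \<otimes> (s [^] n) \<oplus> y t) ` T"
    have "leading R A s n J \<subseteq> leading R A s n I" if I: "ideal_in R B I" "?W \<subseteq> I" for I
    proof (rule T(3)[OF lead[OF I(1)]], rule subsetI)
      fix t assume t: "t \<in> T"
      have "t \<in> A" using subsetD[OF T(2) t] by (simp add: leading_def)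
      then show "t \<in> leading R A s n I" by (rule leadingI[OF _ y(1)[OF t] subsetD[OF I(2) imageI[OF t]]])
    qed
    then show ?thesis using T(1) y(2) by (intro exI[of _ ?W]) auto
  qed
  then have "\<forall>n. \<exists>W. finite W \<and> W \<subseteq> J \<and> (\<forall>I. ideal_in R B I \<longrightarrow> W \<subseteq> I \<longrightarrow> leading R A s n J \<subseteq> leading R A s n I)"
    by (rule allI)
  from choice[OF this] obtain W where W': "\<forall>n. finite (W n) \<and> W n \<subseteq> J \<and>
    (\<forall>I. ideal_in R B I \<longrightarrow> W n \<subseteq> I \<longrightarrow> leading R A s n J \<subseteq> leading R A s n I)" by (rule exE)
  have W: "finite (W n)" "W n \<subseteq> J"
    "ideal_in R B I \<Longrightarrow> W n \<subseteq> I \<Longrightarrow> leading R A s n J \<subseteq> leading R A s n I" for n I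
    using spec[OF W', of n] by blast+
  show "\<exists>T. finite T \<and> T \<subseteq> J \<and> (\<forall>K. ideal_in R B K \<longrightarrow> T \<subseteq> K \<longrightarrow> J \<subseteq> K)"
  proof (intro exI[of _ "\<Union>n\<le>N. W n"] conjI allI impI)
    show "finite (\<Union>n\<le>N. W n)" using W(1) by blast
    show "(\<Union>n\<le>N. W n) \<subseteq> J" using W(2) by blast
    fix K assume K: "ideal_in R B K" and WK: "(\<Union>n\<le>N. W n) \<subseteq> K"
    let ?I = "J \<inter> K"
    have I: "ideal_in R B ?I" using ideal_inD[OF J] ideal_inD[OF K] by (auto simp: ideal_in_def)
    have le: "leading R A s n J \<subseteq> leading R A s n ?I" if "n \<le> N" for n
      by (rule W(3)[OF I]) (use W(2) WK that in blast)
    have all: "leading R A s n J \<subseteq> leading R A s n ?I" for n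
    proof (cases "n \<le> N")
      case False
      then have "leading R A s N ?I \<subseteq> leading R A s n ?I" by (intro lead_mono[OF I]) simp
      then show ?thesis using N[of n] le[of N] by blast
    qed (rule le)
    have "x \<in> ?I" if "x \<in> J" "x \<in> low R A s n" for n x
      using that
    proof (induction n arbitrary: x)
      case 0
      then show ?case using ideal_inD(2)[OF I] by simp
    next
      case (Suc n)
      then obtain a u where *: "a \<in> A" "u \<in> low R A s n" "x = a \<otimes> (s [^] n) \<oplus> u" by auto
      then have "a \<in> leading R A s n ?I" using all[of n] Suc.prems(1) by (auto simp: leading_def)
      then obtain v where v: "v \<in> low R A s n" "a \<otimes> (s [^] n) \<oplus> v \<in> ?I" by (auto simp: leading_def)
      let ?z = "a \<otimes> (s [^] n) \<oplus> v" and ?d = "u \<oplus> \<ominus> v"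
      have c: "a \<in> carrier R" "u \<in> carrier R" "v \<in> carrier R"
        using A_carrier[OF *(1)] low_carrier[OF *(2)] low_carrier[OF v(1)] by auto
      have xz: "x = ?d \<oplus> ?z"
      proof -
        have "?d \<oplus> ?z = (a \<otimes> (s [^] n) \<oplus> u) \<oplus> (\<ominus> v \<oplus> v)" using c sn by (simp only: a_ac a_closed a_inv_closed m_closed)
        then show ?thesis using c sn *(3) by (simp add: l_neg)
      qed
      have "(\<ominus> \<one>) \<otimes> ?z \<in> J"
        by (rule ideal_inD(4)[OF J]) (use v(2) subringE(3,5)[OF B] in auto)
      then have nz: "\<ominus> ?z \<in> J" using c sn by (simp add: l_minus)
      have "x \<oplus> \<ominus> ?z = ?d \<oplus> (?z \<oplus> \<ominus> ?z)" unfolding xz using c sn by (simp only: a_assoc a_closed a_inv_closed m_closed)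
      also have "\<dots> = ?d" using c sn by (simp add: r_neg)
      finally have "?d \<in> J" using ideal_inD(3)[OF J Suc.prems(1) nz] by simp
      moreover have "?d \<in> low R A s n" by (rule low_add[OF *(2) low_neg[OF v(1)]])
      ultimately have "?d \<in> ?I" by (rule Suc.IH)
      then show ?case unfolding xz by (rule ideal_inD(3)[OF I _ v(2)])
    qed
    then show "J \<subseteq> K" using low ideal_inD(1)[OF J] by blast
  qed
qed

end

lemma noetherian_subfield:
  assumes "subfield K R"
  shows "noetherian_in R K"
  unfolding noetherian_in_def
proof (intro allI impI)
  fix J assume J: "ideal_in R K J"
  have Kc: "K \<subseteq> carrier R" by (rule subringE(1)[OF subfieldE(1)[OF assms]])
  show "\<exists>T. finite T \<and> T \<subseteq> J \<and> (\<forall>L. ideal_in R K L \<longrightarrow> T \<subseteq> L \<longrightarrow> J \<subseteq> L)"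
  proof (cases "J = {\<zero>}")
    case True
    then show ?thesis using ideal_inD(2) by (intro exI[of _ "{}"]) fastforce
  next
    case False
    then obtain u where u: "u \<in> J" "u \<noteq> \<zero>" using ideal_inD(2)[OF J] by blast
    have uK: "u \<in> K - {\<zero>}" using u ideal_inD(1)[OF J] by blast
    note inv = subfield_m_inv[OF assms uK]
    have "x \<in> L" if L: "ideal_in R K L" "u \<in> L" and x: "x \<in> J" for x L
    proof -
      have xK: "x \<in> K" using ideal_inD(1)[OF J x] .
      have "(x \<otimes> inv u) \<otimes> u \<in> L"
        by (rule ideal_inD(4)[OF L(1) _ L(2)]) (use subringE(6)[OF subfieldE(1)[OF assms]] xK inv in blast)
      moreover have "(x \<otimes> inv u) \<otimes> u = x"
        using inv xK uK Kc by (simp add: m_assoc subset_iff)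
      ultimately show ?thesis by simp
    qed
    then show ?thesis using u by (intro exI[of _ "{u}"]) auto
  qed
qed

lemma noetherian_generate_ring:
  assumes "subfield K R" "finite S" "S \<subseteq> carrier R"
  shows "noetherian_in R (generate_ring R (K \<union> S))"
  using assms(2,3)
proof (induction S)
  case empty
  note Ks = subfieldE(1)[OF assms(1)]
  have "generate_ring R K = K"
  proof
    show "generate_ring R K \<subseteq> K"
      by (rule generate_ring_min_subring1[OF subringE(1)[OF Ks] Ks]) simp
  qed (auto intro: generate_ring.incl)
  then show ?case using noetherian_subfield[OF assms(1)] by simp
next
  case (insert s S)
  have Kc: "K \<subseteq> carrier R" by (rule subringE(1)[OF subfieldE(1)[OF assms(1)]])
  let ?A = "generate_ring R (K \<union> S)" and ?B = "generate_ring R (K \<union> insert s S)"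
  have A: "subring ?A R" and B: "subring ?B R"
    using Kc insert.prems by (auto intro!: generate_ring_is_subring)
  have AB: "?A \<subseteq> ?B" by (rule mono_generate_ring) (use Kc insert.prems in auto)
  have sB: "s \<in> ?B" by (rule generate_ring.incl) simp
  have sub: "K \<union> insert s S \<subseteq> ?A \<union> {s}" using generate_ring.incl[of _ "K \<union> S" R] by auto
  show ?case
  proof (rule noetherian_adjoin[OF A _ _ B AB sB])
    show "s \<in> carrier R" using insert.prems by blast
    show "noetherian_in R ?A" using insert by blast
    show "\<exists>n. x \<in> low R ?A s n" if "x \<in> ?B" for x
      by (rule generate_ring_low[OF A _ that sub]) (use insert.prems in blast)
  qed
qed

lemma noetherian_in_carrier:
  assumes "noetherian_in R (carrier R)"
  shows "noetherian_ring R"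
proof (rule noetherian_ringI)
  fix I assume I: "ideal I R"
  have eq: "ideal_in R (carrier R) J" if "ideal J R" for J
  proof -
    interpret J: ideal J R by fact
    show ?thesis by (auto simp: ideal_in_def J.I_l_closed J.Icarr)
  qed
  obtain T where T: "finite T" "T \<subseteq> I" "\<And>K. ideal_in R (carrier R) K \<Longrightarrow> T \<subseteq> K \<Longrightarrow> I \<subseteq> K"
    by (rule noetherian_inD[OF assms eq[OF I]]) (rule that, assumption+)
  have Tc: "T \<subseteq> carrier R" using T(2) additive_subgroup.a_subset[of I R] I by (auto simp: ideal_def)
  have "I = Idl T"
    using genideal_minimal[OF I T(2)] T(3)[OF eq[OF genideal_ideal[OF Tc]] genideal_self[OF Tc]] by blast
  then show "\<exists>A\<subseteq>carrier R. finite A \<and> I = Idl A" using T(1) Tc by blast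
qed

end

section \<open>The trivial grading\<close>

text \<open>With this grading, ungraded statements are special cases of graded ones: all homomorphisms are
  graded and strict.\<close>

definition trivial_grading :: "('x, 'e) ring_scheme \<Rightarrow> int \<Rightarrow> 'x set" where
  "trivial_grading G j = (if j = 0 then carrier G else {\<zero>\<^bsub>G\<^esub>})"

lemma trivial_grading_simps [simp]:
  "trivial_grading G 0 = carrier G" "j \<noteq> 0 \<Longrightarrow> trivial_grading G j = {\<zero>\<^bsub>G\<^esub>}"
  by (simp_all add: trivial_grading_def)

lemma trivial_subgroup:
  assumes "abelian_group G"
  shows "subgroup (trivial_grading G j) (add_monoid G)"
proof -
  interpret abelian_group G by fact
  show ?thesis
    by (rule add.subgroupI) (auto simp: trivial_grading_def split: if_splits)
qed

lemma grading_trivial: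
  assumes "abelian_group G"
  shows "grading G (trivial_grading G)"
  unfolding grading_def
proof (intro conjI allI ballI trivial_subgroup[OF assms])
  interpret abelian_group G by fact
  fix x assume x: "x \<in> carrier G"
  let ?f = "\<lambda>j::int. if j = 0 then x else \<zero>\<^bsub>G\<^esub>"
  have sum: "(\<Oplus>\<^bsub>G\<^esub>j\<in>{j. f j \<noteq> \<zero>\<^bsub>G\<^esub>}. f j) = f 0" if f: "\<forall>j. f j \<in> trivial_grading G j" for f
  proof -
    have f0: "f 0 \<in> carrier G" "f j = \<zero>\<^bsub>G\<^esub>" if "j \<noteq> 0" for j
      using f that by (metis trivial_grading_simps(1), metis singletonD trivial_grading_simps(2))
    have fc: "f j \<in> carrier G" for j using f by (cases "j = 0") (auto simp: trivial_grading_def dest: spec[of _ j])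
    have "(\<Oplus>\<^bsub>G\<^esub>j\<in>{j. f j \<noteq> \<zero>\<^bsub>G\<^esub>}. f j) = (\<Oplus>\<^bsub>G\<^esub>j\<in>{0}. f j)"
      by (rule finsum_support[OF assms]) (use fc f0(2) in auto)
    also have "\<dots> = f 0" using fc[of 0] by simp
    finally show ?thesis .
  qed
  show "\<exists>!f. (\<forall>j. f j \<in> trivial_grading G j) \<and> finite {j. f j \<noteq> \<zero>\<^bsub>G\<^esub>} \<and>
      x = (\<Oplus>\<^bsub>G\<^esub>j\<in>{j. f j \<noteq> \<zero>\<^bsub>G\<^esub>}. f j)" (is "\<exists>!f. ?P f")
  proof (rule ex1I[of _ ?f])
    have t: "\<forall>j. ?f j \<in> trivial_grading G j" using x by auto
    have "finite {j. ?f j \<noteq> \<zero>\<^bsub>G\<^esub>}" by (rule finite_subset[of _ "{0}"]) auto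
    moreover have "x = (\<Oplus>\<^bsub>G\<^esub>j\<in>{j. ?f j \<noteq> \<zero>\<^bsub>G\<^esub>}. ?f j)" unfolding sum[OF t] by simp
    ultimately show "?P ?f" using t by blast
    fix g assume g: "?P g"
    then have "g 0 = x" using sum[of g] by simp
    moreover have "g j = \<zero>\<^bsub>G\<^esub>" if "j \<noteq> 0" for j
    proof -
      have "g j \<in> trivial_grading G j" using g by blast
      then show ?thesis using that by simp
    qed
    ultimately show "g = ?f" by (auto simp: fun_eq_iff)
  qed
qed

lemma degree_module_trivial:
  assumes "module R X"
  shows "degree_module R (trivial_grading R) X (trivial_grading X)"
proof -
  interpret X: module R X by fact
  show ?thesis unfolding degree_module_def
    by (auto simp: assms trivial_grading_def split: if_splits)
qed

lemma graded_hom_trivial: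
  assumes "module R X" "module R Y" "f \<in> module_hom R X Y"
  shows "f \<in> graded_hom R X (trivial_grading X) Y (trivial_grading Y)"
  by (rule graded_homI[OF assms(3)])
    (auto simp: trivial_grading_def hom_closed[OF assms(3)] hom_zero[OF assms] split: if_splits)

lemma degree_strict_trivial:
  assumes "module R X" "module R Y" "f \<in> module_hom R X Y"
  shows "degree_strict X (trivial_grading X) (trivial_grading Y) f"
  unfolding degree_strict_def
proof (intro allI)
  fix j
  show "trivial_grading Y j \<inter> f ` carrier X \<subseteq> f ` trivial_grading X j"
    using hom_zero[OF assms] by (cases "j = 0") auto
qed

lemma free_degree_trivial:
  assumes "cring R"
  shows "free_degree R (trivial_grading R) n (\<lambda>c. 0) = trivial_grading (free_module R n)"
proof -
  interpret cring R by fact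
  show ?thesis
  proof
    fix j
    show "free_degree R (trivial_grading R) n (\<lambda>c. 0) j = trivial_grading (free_module R n) j"
    proof (cases "j = 0")
      case True
      then show ?thesis by (auto simp: free_degree_def intro: free_carrier_in)
    next
      case False
      have "free_degree R (trivial_grading R) n (\<lambda>c. 0) j = {f \<in> carrier (free_module R n). \<forall>c. f c = \<zero>\<^bsub>R\<^esub>}"
        using False by (simp add: free_degree_def)
      also have "\<dots> = {\<lambda>c. \<zero>\<^bsub>R\<^esub>}" using free_zero_closed[of n] by (auto simp: fun_eq_iff)
      finally show ?thesis using False by (simp add: free_module_simps)
    qed
  qed
qed

lemma strict_resolution_trivial:
  assumes C: "resolution R C \<epsilon> M" and M: "module R M"
  shows "strict_resolution R (trivial_grading R) C (\<lambda>i. trivial_grading (obj C i)) \<epsilon> M (trivial_grading M)"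
proof -
  have m: "\<And>i. module R (obj C i)" and d: "\<And>i. diff C i \<in> module_hom R (obj C (Suc i)) (obj C i)"
    and e: "\<epsilon> \<in> module_hom R (obj C 0) M" using C by (auto simp: resolution_def)
  show ?thesis
    unfolding strict_resolution_def graded_complex_def
    using C degree_module_trivial[OF m] degree_module_trivial[OF M] graded_hom_trivial[OF m m d]
      graded_hom_trivial[OF m M e] degree_strict_trivial[OF m m d] degree_strict_trivial[OF m M e]
      resolution_exact(4)[OF C]
    by blast
qed

lemma graded_projective_trivial:
  assumes "cring R" "fg_projective R P"
  shows "graded_projective R (trivial_grading R) P (trivial_grading P)"
proof -
  interpret cring R by fact
  from assms(2) obtain n p q where P: "module R P" and p: "p \<in> module_hom R (free_module R n) P"
    and q: "q \<in> module_hom R P (free_module R n)" and pq: "\<forall>x\<in>carrier P. p (q x) = x"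
    unfolding fg_projective_def by blast
  show ?thesis
    unfolding graded_projective_def
    by (intro exI[of _ n] exI[of _ "\<lambda>c. 0"] bexI[of _ p] bexI[of _ q])
      (use pq graded_hom_trivial[OF free_module_module P p] graded_hom_trivial[OF P free_module_module q] in
        \<open>simp_all add: free_degree_trivial[OF assms(1)]\<close>)
qed

lemma degree_ring_trivial:
  assumes "cring R"
  shows "degree_ring R (trivial_grading R)"
proof -
  interpret cring R by fact
  show ?thesis
  proof (intro degree_ring.intro degree_ring_axioms.intro cring_axioms trivial_subgroup abelian_group_axioms)
    show "x \<otimes>\<^bsub>R\<^esub> y \<in> trivial_grading R (i + j)"
      if "x \<in> trivial_grading R i" "y \<in> trivial_grading R j" for x y i j
      using that by (auto simp: trivial_grading_def split: if_splits)
  qed simp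
qed

lemma graded_residue_trivial:
  assumes "cring R" "maximalideal \<mm> R"
  shows "graded_residue R (trivial_grading R) \<mm>"
proof -
  interpret degree_ring R "trivial_grading R" by (rule degree_ring_trivial[OF assms(1)])
  interpret m: maximalideal \<mm> R by fact
  show ?thesis
  proof (intro graded_residue.intro graded_residue_axioms.intro degree_ring_axioms assms(2))
    show "\<exists>s\<in>trivial_grading R 0. \<exists>q\<in>\<mm>. r = s \<oplus>\<^bsub>R\<^esub> q" if "r \<in> carrier R" for r
      by (rule bexI[of _ r], rule bexI[of _ "\<zero>\<^bsub>R\<^esub>"]) (use that m.zero_closed in auto)
  qed (use m.zero_closed in auto)
qed

section \<open>Local rings and standard graded algebras\<close>

text \<open>Zorn's lemma, for the proper ideals that contain \<open>x\<close>; chains of ideals of a noetherian ring contain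
  their union.\<close>

lemma (in noetherian_ring) nonunit_in_maximalideal:
  assumes "cring R" "x \<in> carrier R" "x \<notin> Units R"
  shows "\<exists>J. maximalideal J R \<and> x \<in> J"
proof -
  interpret cring R by fact
  let ?C = "{J. ideal J R \<and> \<one> \<notin> J \<and> x \<in> J}"
  have id: "ideal (PIdl x) R" by (rule cgenideal_ideal[OF assms(2)])
  have "\<one> \<notin> PIdl x"
  proof
    assume "\<one> \<in> PIdl x"
    then obtain r where "r \<in> carrier R" "\<one> = r \<otimes> x" by (auto simp: cgenideal_def)
    then have "x \<in> Units R" using assms(2) m_comm unfolding Units_def by force
    with assms(3) show False by blast
  qed
  then have ne: "?C \<noteq> {}" using id cgenideal_self[OF assms(2)] by blast
  have "\<exists>M\<in>?C. \<forall>X\<in>?C. M \<subseteq> X \<longrightarrow> X = M"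
  proof (rule subset_Zorn_nonempty[OF ne])
    fix \<C> assume c: "\<C> \<noteq> {}" "subset.chain ?C \<C>"
    then have "subset.chain {I. ideal I R} \<C>" by (auto simp: subset_chain_def)
    then have "\<Union>\<C> \<in> \<C>" by (rule ideal_chain_is_trivial[OF c(1)])
    then show "\<Union>\<C> \<in> ?C" using c(2) by (auto simp: subset_chain_def)
  qed
  then obtain M where M: "ideal M R" "\<one> \<notin> M" "x \<in> M" "\<And>X. ideal X R \<Longrightarrow> \<one> \<notin> X \<Longrightarrow> x \<in> X \<Longrightarrow> M \<subseteq> X \<Longrightarrow> X = M"
    by blast
  have "maximalideal M R"
  proof (rule maximalidealI[OF M(1)])
    show "carrier R \<noteq> M" using M(2) by auto
    show "J = M \<or> J = carrier R" if "ideal J R" "M \<subseteq> J" "J \<subseteq> carrier R" for J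
      using M(3) M(4)[OF that(1)] that ideal.one_imp_carrier[OF that(1)] by blast
  qed
  with M(3) show ?thesis by blast
qed

lemma noetherian_local_star_local:
  assumes "noetherian_local_ring R \<mm>"
  shows "star_local R (trivial_grading R) \<mm>"
proof -
  interpret noetherian_local_ring R \<mm> by fact
  show ?thesis
  proof (intro star_local.intro star_local_axioms.intro graded_residue_trivial cring_axioms maximal
      noetherian_ring_axioms grading_trivial abelian_group_axioms)
    show "x \<in> Units R" if "x \<in> trivial_grading R 0" "x \<notin> \<mm>" for x
      using that nonunit_in_maximalideal[OF cring_axioms, of x] unique_maximal by auto
  qed
qed

context standard_graded_algebra
begin

abbreviation "irr \<equiv> irrelevant_ideal R Rg"

lemma degree_ring: "degree_ring R Rg"
proof (intro degree_ring.intro degree_ring_axioms.intro cring_axioms mult_degree)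
  show "subgroup (Rg j) (add_monoid R)" for j using grading by (simp add: grading_def)
  show "\<one> \<in> Rg 0" by (rule subringE(3)[OF subfieldE(1)[OF degree_zero]])
qed

lemma noetherian: "noetherian_ring R"
proof -
  interpret degree_ring R Rg by (rule degree_ring)
  obtain S where S: "finite S" "S \<subseteq> Rg 1" "generate_ring R (Rg 0 \<union> S) = carrier R" using standard by blast
  have "S \<subseteq> carrier R" using S(2) Rg_carrier by blast
  from noetherian_generate_ring[OF degree_zero S(1) this] S(3) show ?thesis
    by (intro noetherian_in_carrier) simp
qed

lemma component_ring:
  assumes "x \<in> carrier R"
  shows "component R Rg x j \<in> Rg j" "component R Rg x j \<in> carrier R"
  by (rule component_in[OF abelian_group_axioms grading assms], rule component_carrier[OF abelian_group_axioms grading assms])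

lemma homogeneous_sum_closed:
  assumes x: "x \<in> carrier R" and N: "subgroup N (add_monoid R)" and c: "\<And>j. component R Rg x j \<in> N"
  shows "x \<in> N"
proof -
  have sub: "N \<subseteq> carrier R" using subgroup.subset[OF N] by simp
  have "(\<Oplus>j\<in>T. component R Rg x j) \<in> N" if "finite T" for T
    using that
  proof (induction T)
    case empty
    then show ?case using subgroup.one_closed[OF N] by simp
  next
    case (insert j T)
    then show ?case using c sub subgroup.m_closed[OF N] component_ring(2)[OF x] by (subst finsum_insert) auto
  qed
  from this[OF component_finite[OF abelian_group_axioms grading x]] show ?thesis
    using component_sum[OF abelian_group_axioms grading x] by simp
qed

lemma component_0_add:
  "x \<in> carrier R \<Longrightarrow> y \<in> carrier R \<Longrightarrow> component R Rg (x \<oplus> y) 0 = component R Rg x 0 \<oplus> component R Rg y 0"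
  using component_add[OF abelian_group_axioms grading, of x y] by simp

lemma component_0_homogeneous: "x \<in> Rg j \<Longrightarrow> component R Rg x 0 = (if j = 0 then x else \<zero>)"
  using component_homogeneous[OF abelian_group_axioms grading, of x j] by simp

text \<open>The elements without component of degree \<open>0\<close> form an ideal, because there are no components of
  negative degree.\<close>

lemma irrelevant_iff: "x \<in> irr \<longleftrightarrow> x \<in> carrier R \<and> component R Rg x 0 = \<zero>"
proof -
  interpret degree_ring R Rg by (rule degree_ring)
  let ?N = "{x \<in> carrier R. component R Rg x 0 = \<zero>}"
  have gens: "(\<Union>j\<in>{1..}. Rg j) \<subseteq> carrier R" using Rg_carrier by blast
  interpret irr: ideal irr R unfolding irrelevant_ideal_def by (rule genideal_ideal[OF gens])
  have Rirr: "Rg j \<subseteq> irr" if "j \<ge> 1" for j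
    unfolding irrelevant_ideal_def using genideal_self[OF gens] that by auto
  have sN: "subgroup ?N (add_monoid R)"
  proof (rule add.subgroupI)
    show "?N \<noteq> {}" using component_0_homogeneous[OF Rg_zero, of 0] by auto
    show "\<ominus> x \<in> ?N" if "x \<in> ?N" for x
    proof -
      have x: "x \<in> carrier R" "component R Rg x 0 = \<zero>" using that by auto
      have "component R Rg (x \<oplus> \<ominus> x) 0 = component R Rg (\<ominus> x) 0"
        using component_0_add[OF x(1), of "\<ominus> x"] x component_ring(2)[of "\<ominus> x"] by simp
      moreover have "component R Rg (x \<oplus> \<ominus> x) 0 = \<zero>"
        using component_0_homogeneous[OF Rg_zero, of 0] x(1) by (simp add: r_neg)
      ultimately show ?thesis using x(1) by simp
    qed
    show "x \<oplus> y \<in> ?N" if "x \<in> ?N" "y \<in> ?N" for x y using that component_0_add by auto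
  qed auto
  have mult: "r \<otimes> x \<in> ?N" if r: "r \<in> carrier R" and x: "x \<in> ?N" for r x
  proof -
    have xc: "x \<in> carrier R" using x by blast
    have h: "s \<otimes> z \<in> ?N" if s: "s \<in> Rg i" and z: "z \<in> Rg j" "j \<ge> 1" for s z i j
    proof (cases "i < 0")
      case True
      then show ?thesis using s z negative_degree Rg_carrier component_0_homogeneous[OF Rg_zero, of 0] by auto
    next
      case False
      then have "i + j \<noteq> 0" using z(2) by simp
      then show ?thesis using component_0_homogeneous[OF mult_degree[OF s z(1)]] Rg_carrier[OF mult_degree[OF s z(1)]] by simp
    qed
    have vim: "subgroup {s \<in> carrier R. s \<otimes> z \<in> ?N} (add_monoid R)" if z: "z \<in> carrier R" for z
    proof (rule add.subgroupI)
      show "{s \<in> carrier R. s \<otimes> z \<in> ?N} \<noteq> {}"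
        using z component_0_homogeneous[OF Rg_zero, of 0] by (auto intro!: exI[of _ \<zero>])
      show "\<ominus> s \<in> {s \<in> carrier R. s \<otimes> z \<in> ?N}" if "s \<in> {s \<in> carrier R. s \<otimes> z \<in> ?N}" for s
        using that z subgroup.m_inv_closed[OF sN, of "s \<otimes> z"] by (simp add: l_minus a_inv_def[symmetric])
      show "s \<oplus> q \<in> {s \<in> carrier R. s \<otimes> z \<in> ?N}"
        if "s \<in> {s \<in> carrier R. s \<otimes> z \<in> ?N}" "q \<in> {s \<in> carrier R. s \<otimes> z \<in> ?N}" for s q
        using that z subgroup.m_closed[OF sN, of "s \<otimes> z" "q \<otimes> z"] by (simp add: l_distr)
    qed auto
    have hr: "r \<otimes> z \<in> ?N" if z: "z \<in> Rg j" "j \<ge> 1" for z j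
    proof -
      have "r \<in> {s \<in> carrier R. s \<otimes> z \<in> ?N}"
        by (rule homogeneous_sum_closed[OF r vim[OF Rg_carrier[OF z(1)]]])
          (use h[OF component_ring(1)[OF r] z] component_ring(2)[OF r] in blast)
      then show ?thesis by blast
    qed
    have "r \<otimes> component R Rg x j \<in> ?N" for j
    proof (cases "j \<ge> 1")
      case True
      then show ?thesis by (rule hr[OF component_ring(1)[OF xc]])
    next
      case False
      then have "component R Rg x j = \<zero>"
        using x component_ring(1)[OF xc, of j] negative_degree[of j] by (cases "j = 0") auto
      then show ?thesis using r component_0_homogeneous[OF Rg_zero, of 0] by simp
    qed
    then have "component R Rg x j \<otimes> r \<in> ?N" for j
      using m_comm[OF r component_ring(2)[OF xc]] by simp
    then have "x \<in> {s \<in> carrier R. s \<otimes> r \<in> ?N}"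
      by (intro homogeneous_sum_closed[OF xc vim[OF r]]) (use component_ring(2)[OF xc] in blast)
    then show ?thesis using m_comm[OF r xc] by simp
  qed
  have "ideal ?N R"
  proof (rule idealI[OF ring_axioms sN])
    show "r \<otimes> x \<in> ?N" if "x \<in> ?N" "r \<in> carrier R" for x r by (rule mult[OF that(2,1)])
    show "x \<otimes> r \<in> ?N" if "x \<in> ?N" "r \<in> carrier R" for x r
      using mult[OF that(2,1)] m_comm[OF that(2), of x] that(1) by simp
  qed
  then have "irr \<subseteq> ?N" unfolding irrelevant_ideal_def
    by (rule genideal_minimal) (use Rg_carrier component_0_homogeneous in force)
  moreover have "x \<in> irr" if x: "x \<in> ?N" for x
  proof (rule homogeneous_sum_closed)
    show xc: "x \<in> carrier R" using x by blast
    show "subgroup irr (add_monoid R)" by (rule irr.a_subgroup)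
    show "component R Rg x j \<in> irr" for j
    proof (cases "j \<ge> 1")
      case True
      then show ?thesis using Rirr component_ring(1)[OF xc] by blast
    next
      case False
      then have "component R Rg x j = \<zero>"
        using x component_ring(1)[OF xc, of j] negative_degree[of j] by (cases "j = 0") auto
      then show ?thesis using irr.zero_closed by simp
    qed
  qed
  ultimately show ?thesis by blast
qed

lemma standard_star_local: "star_local R Rg irr"
proof -
  interpret degree_ring R Rg by (rule degree_ring)
  have gens: "(\<Union>j\<in>{1..}. Rg j) \<subseteq> carrier R" using Rg_carrier by blast
  have id: "ideal irr R" unfolding irrelevant_ideal_def by (rule genideal_ideal[OF gens])
  have one_zero: "\<one> \<noteq> \<zero>" using subfieldE(6)[OF degree_zero] by simp
  have one: "\<one> \<notin> irr" using component_0_homogeneous[OF one_degree] one_zero by (simp add: irrelevant_iff)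
  have split: "\<exists>q\<in>irr. x = component R Rg x 0 \<oplus> q" if x: "x \<in> carrier R" for x
  proof -
    let ?c = "component R Rg x 0"
    note c = component_ring[OF x, of 0]
    have "component R Rg (\<ominus> ?c) 0 = \<ominus> ?c" using component_0_homogeneous[OF Rg_neg[OF c(1)]] by simp
    then have "component R Rg (x \<oplus> \<ominus> ?c) 0 = \<zero>"
      using component_0_add[OF x, of "\<ominus> ?c"] c(2) by (simp add: r_neg)
    then have "x \<oplus> \<ominus> ?c \<in> irr" using x c(2) by (simp add: irrelevant_iff)
    moreover have "x = ?c \<oplus> (x \<oplus> \<ominus> ?c)" using x c(2) by (simp add: a_ac r_neg)
    ultimately show ?thesis by blast
  qed
  have unit: "x \<in> Units R" if x: "x \<in> Rg 0" "x \<noteq> \<zero>" for x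
  proof -
    have x': "x \<in> Rg 0 - {\<zero>}" using x by blast
    from subfield_m_inv[OF degree_zero x'] show ?thesis
      using Rg_carrier x unfolding Units_def by blast
  qed
  have max: "maximalideal irr R"
  proof (rule maximalidealI[OF id])
    show "carrier R \<noteq> irr" using one by auto
    fix J assume J: "ideal J R" "irr \<subseteq> J" "J \<subseteq> carrier R"
    interpret J: ideal J R by (rule J(1))
    show "J = irr \<or> J = carrier R"
    proof (cases "J \<subseteq> irr")
      case False
      then obtain x where x: "x \<in> J" "x \<notin> irr" by blast
      then have xc: "x \<in> carrier R" using J(3) by blast
      let ?c = "component R Rg x 0"
      note c = component_ring[OF xc, of 0]
      obtain q where q: "q \<in> irr" "x = ?c \<oplus> q" using split[OF xc] by blast
      have qJ: "q \<in> J" using q(1) J(2) by blast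
      have "x \<oplus> \<ominus> q \<in> J" using x(1) qJ by (simp add: J.a_closed J.a_inv_closed)
      moreover have "x \<oplus> \<ominus> q = ?c"
      proof -
        have "x \<oplus> \<ominus> q = (?c \<oplus> q) \<oplus> \<ominus> q" using q(2) by simp
        then show ?thesis using c(2) J.Icarr[OF qJ] by (simp add: a_assoc r_neg)
      qed
      ultimately have cJ: "?c \<in> J" by simp
      have "?c \<noteq> \<zero>" using x(2) xc by (simp add: irrelevant_iff)
      then have "?c \<in> Units R" by (rule unit[OF c(1)])
      then have "\<one> \<in> J" using J.I_l_closed[OF cJ, of "inv ?c"] by simp
      then show ?thesis using J.one_imp_carrier by blast
    qed (use J(2) in blast)
  qed
  show ?thesis
  proof (intro star_local.intro star_local_axioms.intro graded_residue.intro graded_residue_axioms.intro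
      degree_ring_axioms max noetherian grading)
    show "Rg j \<subseteq> irr" if "j \<noteq> 0" for j
      using that component_0_homogeneous Rg_carrier by (auto simp: irrelevant_iff)
    show "\<exists>s\<in>Rg 0. \<exists>q\<in>irr. r = s \<oplus> q" if "r \<in> carrier R" for r
      using split[OF that] component_ring(1)[OF that] by blast
    show "x \<in> Units R" if "x \<in> Rg 0" "x \<notin> irr" for x
      using that component_0_homogeneous[OF that(1)] Rg_carrier[OF that(1)] by (intro unit) (auto simp: irrelevant_iff)
  qed
qed

end

section \<open>Invariants read off from a minimal resolution\<close>

definition minimal_resolution ::
  "('a, 'm) ring_scheme \<Rightarrow> (int \<Rightarrow> 'a set) \<Rightarrow> 'a set \<Rightarrow> (nat \<Rightarrow> nat) \<Rightarrow> (nat \<Rightarrow> nat \<Rightarrow> int)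
     \<Rightarrow> ('a, nat \<Rightarrow> 'a) chain \<Rightarrow> ((nat \<Rightarrow> 'a) \<Rightarrow> 'b) \<Rightarrow> ('a, 'b, 'n) module_scheme \<Rightarrow> (int \<Rightarrow> 'b set) \<Rightarrow> bool" where
  "minimal_resolution R Rg \<mm> n a F \<epsilon> X Xg \<longleftrightarrow>
     (\<forall>i. obj F i = free_module R (n i)) \<and>
     strict_resolution R Rg F (\<lambda>i. free_degree R Rg (n i) (a i)) \<epsilon> X Xg \<and> minimal_complex R \<mm> F"

lemma free_component_eq:
  "obj F i = free_module R n \<Longrightarrow> free_component Rg F a i = free_degree R Rg n (a i)"
  by (auto simp: free_component_def free_degree_def fun_eq_iff)

lemma minimal_resolutionD:
  assumes "minimal_resolution R Rg \<mm> n a F \<epsilon> X Xg"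
  shows "obj F i = free_module R (n i)" "minimal_complex R \<mm> F" "free_resolution R F \<epsilon> X"
    "graded_free_resolution R Rg F a \<epsilon> X Xg" "resolution R F \<epsilon> X" "module R X"
    "strict_resolution R Rg F (\<lambda>i. free_degree R Rg (n i) (a i)) \<epsilon> X Xg"
proof -
  have o: "\<And>i. obj F i = free_module R (n i)" and m: "minimal_complex R \<mm> F"
    and s: "strict_resolution R Rg F (\<lambda>i. free_degree R Rg (n i) (a i)) \<epsilon> X Xg"
    using assms by (auto simp: minimal_resolution_def)
  show "obj F i = free_module R (n i)" by (rule o)
  show "minimal_complex R \<mm> F" by (rule m)
  show s': "strict_resolution R Rg F (\<lambda>i. free_degree R Rg (n i) (a i)) \<epsilon> X Xg" by (rule s)
  show "module R X" using s by (simp add: strict_resolution_def degree_module_def)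
  show r: "resolution R F \<epsilon> X" using s by (simp add: strict_resolution_def)
  show f: "free_resolution R F \<epsilon> X" using r o by (auto simp: free_resolution_def)
  have Fd: "\<And>i. diff F i \<in> graded_hom R (obj F (Suc i)) (free_degree R Rg (n (Suc i)) (a (Suc i)))
      (obj F i) (free_degree R Rg (n i) (a i))"
    and Fe: "\<epsilon> \<in> graded_hom R (obj F 0) (free_degree R Rg (n 0) (a 0)) X Xg"
    using s by (simp_all add: strict_resolution_def graded_complex_def)
  have "diff F i x \<in> free_degree R Rg (n i) (a i) j" if "x \<in> free_degree R Rg (n (Suc i)) (a (Suc i)) j" for i j x
    by (rule graded_homD(2)[OF Fd that])
  moreover have "\<epsilon> x \<in> Xg j" if "x \<in> free_degree R Rg (n 0) (a 0) j" for j x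
    by (rule graded_homD(2)[OF Fe that])
  ultimately show "graded_free_resolution R Rg F a \<epsilon> X Xg"
    unfolding graded_free_resolution_def using f free_component_eq[OF o] by auto
qed

lemma (in degree_ring) graded_free_resolution_strict:
  assumes R: "grading R Rg" and X: "degree_module R Rg X Xg" "grading X Xg"
    and F: "graded_free_resolution R Rg F a \<epsilon> X Xg"
  shows "strict_resolution R Rg F (free_component Rg F a) \<epsilon> X Xg"
    "graded_projective R Rg (obj F i) (free_component Rg F a i)"
proof -
  have r: "resolution R F \<epsilon> X" and "\<forall>i. \<exists>n. obj F i = free_module R n"
    using F by (auto simp: graded_free_resolution_def free_resolution_def)
  then obtain n where o: "\<And>i. obj F i = free_module R (n i)" by metis
  note fc = free_component_eq[OF o]
  note Xm = degree_moduleD(1)[OF X(1)]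
  have d: "diff F i \<in> graded_hom R (obj F (Suc i)) (free_component Rg F a (Suc i)) (obj F i) (free_component Rg F a i)" for i
    using F r by (auto simp: graded_free_resolution_def graded_hom_def resolution_def)
  have e: "\<epsilon> \<in> graded_hom R (obj F 0) (free_component Rg F a 0) X Xg"
    using F r by (auto simp: graded_free_resolution_def graded_hom_def resolution_def)
  have gF: "grading (obj F i) (free_component Rg F a i)" for i unfolding fc o by (rule grading_free[OF R])
  have mF: "module R (obj F i)" for i unfolding o by (rule free_module_module)
  have dF: "degree_module R Rg (obj F i) (free_component Rg F a i)" for i unfolding fc o by (rule free_degree_module)
  show "strict_resolution R Rg F (free_component Rg F a) \<epsilon> X Xg"
    unfolding strict_resolution_def graded_complex_def
    using r X(1) dF d e resolution_exact(4)[OF r] graded_hom_strict[OF mF gF Xm X(2) e] graded_hom_strict[OF mF gF mF gF d]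
    by blast
  show "graded_projective R Rg (obj F i) (free_component Rg F a i)" unfolding fc o by (rule free_projective)
qed

lemma (in degree_ring) minimal_resolution_projective:
  assumes "minimal_resolution R Rg \<mm> n a F \<epsilon> X Xg"
  shows "graded_projective R Rg (obj F i) (free_degree R Rg (n i) (a i))"
  unfolding minimal_resolutionD(1)[OF assms] by (rule free_projective)

lemma (in cring) fg_projective_free: "fg_projective R (free_module R n)"
  unfolding fg_projective_def
  by (intro conjI free_module_module exI[of _ n] bexI[of _ "\<lambda>x. x"]) (auto simp: module_hom_def)

lemma free_resolution_trivial:
  assumes R: "cring R" and X: "module R X" and F: "free_resolution R F \<epsilon> X"
  shows "strict_resolution R (trivial_grading R) F (\<lambda>i. trivial_grading (obj F i)) \<epsilon> X (trivial_grading X)"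
    "graded_projective R (trivial_grading R) (obj F i) (trivial_grading (obj F i))"
proof -
  show "strict_resolution R (trivial_grading R) F (\<lambda>i. trivial_grading (obj F i)) \<epsilon> X (trivial_grading X)"
    using F by (intro strict_resolution_trivial[OF _ X]) (simp add: free_resolution_def)
  show "graded_projective R (trivial_grading R) (obj F i) (trivial_grading (obj F i))"
    using F by (intro graded_projective_trivial[OF R]) (metis free_resolution_def cring.fg_projective_free[OF R])
qed

text \<open>The two resolutions are compared through the trivial grading, whether or not they are graded.\<close>

lemma linear_part_sup_iff:
  assumes R: "cring R" and I: "ideal I R" and X: "module R X"
    and F: "free_resolution R F \<epsilon> X" "minimal_complex R I F"
    and G: "free_resolution R G \<delta> X" "minimal_complex R I G"
  shows "linear_part_sup R I F = 0 \<longleftrightarrow> linear_part_exact R I G"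
proof -
  interpret degree_ring R "trivial_grading R" by (rule degree_ring_trivial[OF R])
  have Fr: "resolution R F \<epsilon> X" using F by (simp add: free_resolution_def)
  have "linear_part_sup R I F = 0 \<longleftrightarrow> linear_part_exact R I F"
    using Fr resolution_exact(4)[OF Fr] by (intro linear_part_sup_eq_0_iff[OF I _ _ _ F(2)]) (auto simp: resolution_def)
  also have "\<dots> \<longleftrightarrow> linear_part_exact R I G"
    using linear_part_exact_transfer[OF I free_resolution_trivial[OF R X F(1)] free_resolution_trivial[OF R X G(1)] F(2)]
      linear_part_exact_transfer[OF I free_resolution_trivial[OF R X G(1)] free_resolution_trivial[OF R X F(1)] G(2)]
    by blast
  finally show ?thesis .
qed

lemma koszul_module_iff:
  assumes R: "cring R" and I: "ideal \<mm> R" and F: "minimal_resolution R Rg \<mm> n a F \<epsilon> X Xg"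
  shows "koszul_module R \<mm> X \<longleftrightarrow> (nontrivial X \<longrightarrow> linear_part_exact R \<mm> F)"
proof -
  note FD = minimal_resolutionD[OF F]
  let ?P = "\<lambda>F. \<exists>\<epsilon>. free_resolution R F \<epsilon> X \<and> minimal_complex R \<mm> F"
  have "?P (SOME F. ?P F)" by (rule someI[of ?P F]) (use FD in blast)
  then obtain \<delta> where "free_resolution R (SOME F. ?P F) \<delta> X" "minimal_complex R \<mm> (SOME F. ?P F)" by blast
  from linear_part_sup_iff[OF R I FD(6) this FD(3,2)]
  show ?thesis by (auto simp: koszul_module_def linearity_defect_def)
qed

lemma graded_koszul_module_iff:
  assumes R: "cring R" and I: "ideal (irrelevant_ideal R Rg) R"
    and F: "minimal_resolution R Rg (irrelevant_ideal R Rg) n a F \<epsilon> X Xg"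
  shows "graded_koszul_module R Rg X Xg \<longleftrightarrow> (nontrivial X \<longrightarrow> linear_part_exact R (irrelevant_ideal R Rg) F)"
proof -
  note FD = minimal_resolutionD[OF F]
  let ?P = "\<lambda>F. \<exists>a \<epsilon>. graded_free_resolution R Rg F a \<epsilon> X Xg \<and> minimal_complex R (irrelevant_ideal R Rg) F"
  have "?P (SOME F. ?P F)" by (rule someI[of ?P F]) (use FD in blast)
  then obtain b \<delta> where "free_resolution R (SOME F. ?P F) \<delta> X" "minimal_complex R (irrelevant_ideal R Rg) (SOME F. ?P F)"
    unfolding graded_free_resolution_def by blast
  from linear_part_sup_iff[OF R I FD(6) this FD(3,2)]
  show ?thesis by (auto simp: graded_koszul_module_def graded_linearity_defect_def)
qed

lemma carrier_set_add:
  assumes "submodule R N X"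
  shows "carrier X <+>\<^bsub>X\<^esub> N = carrier X"
proof -
  interpret X: module R X using assms by (simp add: submodule_def)
  note N = submoduleD[OF assms]
  show ?thesis
  proof
    show "carrier X <+>\<^bsub>X\<^esub> N \<subseteq> carrier X" using N(1) by (auto simp: set_add_def')
    show "carrier X \<subseteq> carrier X <+>\<^bsub>X\<^esub> N"
    proof
      fix x assume x: "x \<in> carrier X"
      then have "x = x \<oplus>\<^bsub>X\<^esub> \<zero>\<^bsub>X\<^esub>" by simp
      then show "x \<in> carrier X <+>\<^bsub>X\<^esub> N" unfolding set_add_def' using x N(3) by blast
    qed
  qed
qed

text \<open>The ungraded Tor is the strand of degree \<open>0\<close> for the trivial grading, in which every basis vector
  has degree \<open>0\<close>.\<close>

lemma betti_eq_rank:
  assumes R: "cring R" and max: "maximalideal \<mm> R" and F: "minimal_resolution R Rg \<mm> n a F \<epsilon> X Xg"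
  shows "betti R \<mm> X s = n s"
proof -
  interpret graded_residue R "trivial_grading R" \<mm> by (rule graded_residue_trivial[OF R max])
  note FD = minimal_resolutionD[OF F]
  let ?P = "\<lambda>F. \<exists>\<epsilon>. free_resolution R F \<epsilon> X"
  let ?G = "SOME F. ?P F"
  have "?P ?G" by (rule someI[of ?P F]) (use FD in blast)
  then obtain \<delta> where G: "free_resolution R ?G \<delta> X" by blast
  note Gt = free_resolution_trivial[OF R FD(6) G]
  have Fs: "strict_resolution R (trivial_grading R) F (\<lambda>i. free_degree R (trivial_grading R) (n i) (\<lambda>c. 0)) \<epsilon> X (trivial_grading X)"
    using free_resolution_trivial(1)[OF R FD(6,3)] by (simp add: free_degree_trivial[OF R] FD(1))
  have Gm: "module R (obj ?G i)" for i using G by (simp add: free_resolution_def resolution_def)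
  have "residue_tor R \<mm> X s = homology (strand ?G (\<lambda>i. trivial_grading (obj ?G i)) 0) s"
    unfolding residue_tor_def residue_tensor_def strand_def
    using carrier_set_add[OF ideal_smult_submodule[OF Gm max_carrier]] by simp
  then show ?thesis
    using strand_homology_dim(1)[OF Fs FD(1,2) Gt, of 0 s] by (simp add: betti_def)
qed

context graded_residue
begin

lemma graded_tor_dim:
  assumes R: "grading R Rg" and irr: "\<mm> = irrelevant_ideal R Rg" and X: "grading X Xg"
    and F: "minimal_resolution R Rg \<mm> n a F \<epsilon> X Xg"
  shows "graded_betti R Rg X Xg s j = card {c. c < n s \<and> a s c = j}"
    and "nontrivial (graded_residue_tor R Rg X Xg s j) \<longleftrightarrow> (\<exists>c<n s. a s c = j)"
proof -
  note FD = minimal_resolutionD[OF F]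
  have Xd: "degree_module R Rg X Xg" using FD(7) by (simp add: strict_resolution_def)
  let ?P = "\<lambda>(F, a). \<exists>\<epsilon>. graded_free_resolution R Rg F a \<epsilon> X Xg"
  obtain G b where Gb: "(SOME p. ?P p) = (G, b)" by (cases "SOME p. ?P p")
  have "?P (SOME p. ?P p)" by (rule someI[of ?P "(F, a)"]) (use FD in blast)
  then obtain \<delta> where G: "graded_free_resolution R Rg G b \<delta> X Xg" unfolding Gb by blast
  have "graded_residue_tor R Rg X Xg s j = homology (strand G (free_component Rg G b) j) s"
    unfolding graded_residue_tor_def Gb by (simp add: residue_tensor_strand_def strand_def irr[symmetric] Let_def)
  then show "graded_betti R Rg X Xg s j = card {c. c < n s \<and> a s c = j}"
    "nontrivial (graded_residue_tor R Rg X Xg s j) \<longleftrightarrow> (\<exists>c<n s. a s c = j)"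
    using strand_homology_dim[OF FD(7,1,2) graded_free_resolution_strict[OF R Xd X G], of j s]
    by (simp_all add: graded_betti_def flip: irr)
qed

lemma regularity_eq:
  assumes R: "grading R Rg" and irr: "\<mm> = irrelevant_ideal R Rg" and X: "grading X Xg"
    and F: "minimal_resolution R Rg \<mm> n a F \<epsilon> X Xg"
  shows "regularity R Rg X Xg = Sup {ereal (real_of_int (j - int i)) | i j. \<exists>c<n i. a i c = j}"
  by (simp only: regularity_def graded_tor_dim(2)[OF assms])

end

definition last_nonzero :: "(nat \<Rightarrow> nat) \<Rightarrow> enat" where
  "last_nonzero n = Inf {enat k | k. \<forall>s>k. n s = 0}"

lemma last_nonzero_le_iff: "last_nonzero n \<le> enat k \<longleftrightarrow> (\<forall>s>k. n s = 0)"
proof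
  assume le: "last_nonzero n \<le> enat k"
  let ?S = "{enat k | k. \<forall>s>k. n s = 0}"
  have ne: "?S \<noteq> {}"
  proof
    assume "?S = {}"
    then have "last_nonzero n = \<infinity>" unfolding last_nonzero_def Inf_enat_def by (simp only: refl if_True)
    with le show False by simp
  qed
  then have "\<exists>x. x \<in> ?S" by (simp only: ex_in_conv not_False_eq_True)
  then have "(LEAST x. x \<in> ?S) \<in> ?S" by (rule LeastI_ex)
  then have "Inf ?S \<in> ?S" unfolding Inf_enat_def using ne by (simp only: if_False)
  then obtain m where "last_nonzero n = enat m" "\<forall>s>m. n s = 0" unfolding last_nonzero_def by blast
  with le show "\<forall>s>k. n s = 0" by simp
qed (auto simp: last_nonzero_def intro: Inf_lower)

lemma last_nonzero_sum:
  assumes "finite I" "I \<noteq> {}"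
  shows "last_nonzero (\<lambda>s. \<Sum>i\<in>I. n i s) = Max ((\<lambda>i. last_nonzero (n i)) ` I)"
proof -
  have "last_nonzero (\<lambda>s. \<Sum>i\<in>I. n i s) \<le> enat k \<longleftrightarrow> Max ((\<lambda>i. last_nonzero (n i)) ` I) \<le> enat k" for k
    using assms by (auto simp: last_nonzero_le_iff)
  then show ?thesis by (metis antisym enat.exhaust enat_ord_code(3) order_refl)
qed

text \<open>Used for regularities: \<open>S\<close> is the union of the translates \<open>T i + d i\<close>.\<close>

lemma Sup_shifted_union:
  fixes S :: "int set" and T :: "'i \<Rightarrow> int set"
  assumes I: "finite I" "I \<noteq> {}" and S: "\<And>x. x \<in> S \<longleftrightarrow> (\<exists>i\<in>I. x - d i \<in> T i)"
  shows "Sup ((\<lambda>x. ereal (real_of_int x)) ` S) =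
    Max ((\<lambda>i. Sup ((\<lambda>x. ereal (real_of_int x)) ` T i) + ereal (real_of_int (d i))) ` I)"
proof (rule antisym)
  let ?e = "\<lambda>x. ereal (real_of_int x)" and ?f = "\<lambda>i. Sup ((\<lambda>x. ereal (real_of_int x)) ` T i) + ereal (real_of_int (d i))"
  show "Sup (?e ` S) \<le> Max (?f ` I)"
  proof (rule Sup_least)
    fix y assume "y \<in> ?e ` S"
    then obtain x i where x: "y = ?e x" "i \<in> I" "x - d i \<in> T i" using S by blast
    have "?e x = ?e (x - d i) + ereal (real_of_int (d i))" by simp
    also have "\<dots> \<le> ?f i" by (rule add_right_mono[OF Sup_upper]) (use x in blast)
    also have "\<dots> \<le> Max (?f ` I)" by (rule Max_ge) (use I x in auto)
    finally show "y \<le> Max (?f ` I)" using x by simp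
  qed
  have "?f i \<le> Sup (?e ` S)" if i: "i \<in> I" for i
  proof -
    have "Sup (?e ` T i) \<le> Sup (?e ` S) - ereal (real_of_int (d i))"
    proof (rule Sup_least)
      fix y assume "y \<in> ?e ` T i"
      then obtain x where x: "y = ?e x" "x \<in> T i" by blast
      then have "(x + d i) - d i \<in> T i" by simp
      then have "x + d i \<in> S" using i unfolding S[of "x + d i"] by (rule rev_bexI[rotated])
      then have "?e (x + d i) \<le> Sup (?e ` S)" by (intro Sup_upper imageI)
      then show "y \<le> Sup (?e ` S) - ereal (real_of_int (d i))" unfolding x by (simp add: ereal_le_minus)
    qed
    then show ?thesis by (simp add: ereal_le_minus)
  qed
  then show "Max (?f ` I) \<le> Sup (?e ` S)" using I by simp
qed

text \<open>A projective resolution of length \<open>k\<close> forces the minimal resolution to vanish beyond \<open>k\<close>: the identity of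
  the minimal resolution is homotopic to a map that factors through the projective one, which
  is zero in degrees beyond \<open>k\<close>, and the terms \<open>ds + sd\<close> of the homotopy are zero modulo \<open>\<mm>\<close>.\<close>

lemma projective_dimension_eq:
  fixes X :: "('a, 'b, 'n) module_scheme" and R :: "('a, 'm) ring_scheme"
  assumes R: "cring R" and max: "maximalideal \<mm> R" and F: "minimal_resolution R Rg \<mm> n a F \<epsilon> X Xg"
  shows "projective_dimension R X = last_nonzero n"
proof -
  interpret graded_residue R "trivial_grading R" \<mm> by (rule graded_residue_trivial[OF R max])
  note FD = minimal_resolutionD[OF F]
  note Ft = free_resolution_trivial[OF R FD(6,3)]
  have "(\<exists>(P :: ('a, nat \<Rightarrow> 'a) chain) \<epsilon>. resolution R P \<epsilon> X \<and>
        (\<forall>i. fg_projective R (obj P i)) \<and> (\<forall>i>k. \<not> nontrivial (obj P i))) \<longleftrightarrow> (\<forall>s>k. n s = 0)" for k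
  proof
    assume "\<exists>(P :: ('a, nat \<Rightarrow> 'a) chain) \<epsilon>. resolution R P \<epsilon> X \<and>
        (\<forall>i. fg_projective R (obj P i)) \<and> (\<forall>i>k. \<not> nontrivial (obj P i))"
    then obtain P :: "('a, nat \<Rightarrow> 'a) chain" and \<delta> where P: "resolution R P \<delta> X"
      "\<And>i. fg_projective R (obj P i)" "\<And>i. i > k \<Longrightarrow> \<not> nontrivial (obj P i)" by blast
    show "\<forall>s>k. n s = 0"
    proof (intro allI impI)
      fix s assume "s > k"
      then obtain i where i: "s = Suc i" using not0_implies_Suc by (cases s) auto
      obtain \<phi> \<psi> h u where
        \<phi>: "\<And>i. \<phi> i \<in> graded_hom R (obj F i) (trivial_grading (obj F i)) (obj P i) (trivial_grading (obj P i))"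
        and \<psi>: "\<And>i. \<psi> i \<in> graded_hom R (obj P i) (trivial_grading (obj P i)) (obj F i) (trivial_grading (obj F i))"
        and h: "\<And>i. h i \<in> graded_hom R (obj F i) (trivial_grading (obj F i)) (obj F (Suc i)) (trivial_grading (obj F (Suc i)))"
        and hty: "\<And>i x. x \<in> carrier (obj F (Suc i)) \<Longrightarrow> x = \<psi> (Suc i) (\<phi> (Suc i) x) \<oplus>\<^bsub>obj F (Suc i)\<^esub>
          (diff F (Suc i) (h (Suc i) x) \<oplus>\<^bsub>obj F (Suc i)\<^esub> h i (diff F i x))"
        by (rule homotopy_equivalence[OF Ft strict_resolution_trivial[OF P(1) FD(6)] graded_projective_trivial[OF R P(2)]])
          (rule that, assumption+)
      have Fm: "module R (obj F i)" for i using FD(5) by (simp add: resolution_def)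
      have Pm: "module R (obj P i)" for i using P(1) by (simp add: resolution_def)
      have mF: "submodule R (ideal_smult R \<mm> (obj F i)) (obj F i)" for i by (rule ideal_smult_submodule[OF Fm max_carrier])
      have all: "x \<in> ideal_smult R \<mm> (obj F s)" if x: "x \<in> carrier (obj F s)" for x
      proof -
        have "\<phi> s x = \<zero>\<^bsub>obj P s\<^esub>"
          using graded_homD(3)[OF \<phi> x] P(3)[OF \<open>s > k\<close>] by (simp add: nontrivial_def)
        then have "\<psi> s (\<phi> s x) = \<zero>\<^bsub>obj F s\<^esub>" using hom_zero[OF Pm Fm graded_homD(1)[OF \<psi>]] by simp
        moreover have "diff F s (h s x) \<in> ideal_smult R \<mm> (obj F s)"
          by (rule minimal_complexD[OF FD(2) graded_homD(3)[OF h x]])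
        moreover have "h i (diff F i x) \<in> ideal_smult R \<mm> (obj F s)"
          unfolding i by (rule hom_ideal_smult[OF Fm Fm graded_homD(1)[OF h] max_carrier minimal_complexD[OF FD(2)]])
            (use x i in simp)
        ultimately have "\<psi> s (\<phi> s x) \<oplus>\<^bsub>obj F s\<^esub> (diff F s (h s x) \<oplus>\<^bsub>obj F s\<^esub> h i (diff F i x)) \<in> ideal_smult R \<mm> (obj F s)"
          using submoduleD(2,3)[OF mF] by metis
        then show ?thesis using hty[OF x[unfolded i]] unfolding i by simp
      qed
      show "n s = 0"
      proof (rule ccontr)
        assume "n s \<noteq> 0"
        then have "unit_vector R 0 \<in> carrier (obj F s)" unfolding FD(1) by (intro unit_vector_carrier) simp
        from all[OF this] have "unit_vector R 0 0 \<in> \<mm>" unfolding FD(1) ideal_smult_free[OF max_ideal] by blast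
        then show False using one_notin_max by (simp add: unit_vector_def)
      qed
    qed
  next
    assume z: "\<forall>s>k. n s = 0"
    have "\<not> nontrivial (free_module R 0)" by (auto simp: nontrivial_def free_carrier_iff free_module_simps)
    then have "\<forall>i>k. \<not> nontrivial (obj F i)" using z by (simp add: FD(1))
    moreover have "\<forall>i. fg_projective R (obj F i)" by (simp add: FD(1) fg_projective_free)
    ultimately show "\<exists>(P :: ('a, nat \<Rightarrow> 'a) chain) \<epsilon>. resolution R P \<epsilon> X \<and>
        (\<forall>i. fg_projective R (obj P i)) \<and> (\<forall>i>k. \<not> nontrivial (obj P i))"
      using FD(5) by blast
  qed
  then show ?thesis unfolding projective_dimension_def last_nonzero_def by simp
qed

section \<open>Cyclic modules\<close>

lemma (in cring) self_module_module: "module R (self_module R)"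
  by (rule module_criteria)
    (auto simp: self_module_def cring_axioms m_assoc l_distr r_distr a_assoc a_comm a_lcomm r_neg
      intro: bexI[of _ "\<ominus> _"])

lemma finsum_self_module: "finsum (self_module R) = finsum R"
  by (simp add: finsum_def finprod_def self_module_def fun_eq_iff)

lemma self_module_grading:
  "grading (self_module R) Rg = grading R Rg" "component (self_module R) Rg = component R Rg"
proof -
  have s: "subgroup A (add_monoid (self_module R)) = subgroup A (add_monoid R)" for A
    by (simp add: subgroup_def m_inv_def self_module_def)
  have z: "\<zero>\<^bsub>self_module R\<^esub> = \<zero>\<^bsub>R\<^esub>" "carrier (self_module R) = carrier R" by (simp_all add: self_module_def)
  show "grading (self_module R) Rg = grading R Rg" "component (self_module R) Rg = component R Rg"
    unfolding grading_def component_def[abs_def] finsum_self_module s unfolding z by (rule refl)+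
qed

lemma (in degree_ring) self_module_degree: "degree_module R Rg (self_module R) Rg"
  unfolding degree_module_def using self_module_module
  by (simp add: self_module_def Rg_zero Rg_add mult_degree Rg_carrier subset_iff)

context degree_ring
begin

context
  fixes M :: "('a, 'x, 'n) module_scheme" and Mg x d
  assumes R: "grading R Rg" and M: "degree_module R Rg M Mg" "grading M Mg" and x: "x \<in> Mg d"
begin

lemma multiplication_hom: "(\<lambda>r. r \<odot>\<^bsub>M\<^esub> x) \<in> module_hom R (self_module R) M"
proof -
  interpret M: module R M by (rule degree_moduleD(1)[OF M(1)])
  show ?thesis
    using degree_moduleD(2)[OF M(1) x] by (intro module_homI) (auto simp: self_module_def M.smult_l_distr M.smult_assoc1)
qed

lemma component_smult:
  assumes r: "r \<in> carrier R"
  shows "component M Mg (r \<odot>\<^bsub>M\<^esub> x) j = component R Rg r (j - d) \<odot>\<^bsub>M\<^esub> x"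
proof -
  interpret M: module R M by (rule degree_moduleD(1)[OF M(1)])
  note xc = degree_moduleD(2)[OF M(1) x]
  have aR: "abelian_group R" by (rule abelian_group_axioms)
  let ?S = "{i. component R Rg r i \<noteq> \<zero>}" and ?c = "component R Rg r"
  have cin: "?c i \<in> Rg i" "?c i \<in> carrier R" for i
    using component_in[OF aR R r] Rg_carrier by blast+
  have "component M Mg (r \<odot>\<^bsub>M\<^esub> x) = (\<lambda>j. ?c (j - d) \<odot>\<^bsub>M\<^esub> x)"
  proof (rule component_eqI[OF M.abelian_group_axioms M(2)])
    show "?c (j - d) \<odot>\<^bsub>M\<^esub> x \<in> Mg j" for j
      using degree_moduleD(5)[OF M(1) cin(1) x, of "j - d"] by simp
    show "finite ((\<lambda>i. i + d) ` ?S)" using component_finite[OF aR R r] by simp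
    show "?c (j - d) \<odot>\<^bsub>M\<^esub> x = \<zero>\<^bsub>M\<^esub>" if "j \<notin> (\<lambda>i. i + d) ` ?S" for j
    proof -
      have "?c (j - d) = \<zero>"
      proof (rule ccontr)
        assume "?c (j - d) \<noteq> \<zero>"
        then have "(j - d) + d \<in> (\<lambda>i. i + d) ` ?S" by blast
        with that show False by simp
      qed
      then show ?thesis using xc by simp
    qed
    have "r = finsum (self_module R) ?c ?S"
      using component_sum[OF aR R r] by (simp only: finsum_self_module)
    then have "r \<odot>\<^bsub>M\<^esub> x = finsum (self_module R) ?c ?S \<odot>\<^bsub>M\<^esub> x" by (rule arg_cong)
    also have "\<dots> = (\<Oplus>\<^bsub>M\<^esub>i\<in>?S. ?c i \<odot>\<^bsub>M\<^esub> x)"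
      by (rule hom_finsum[OF self_module_module M.module_axioms multiplication_hom])
        (simp add: self_module_def cin(2))
    also have "\<dots> = (\<Oplus>\<^bsub>M\<^esub>i\<in>?S. ?c ((i + d) - d) \<odot>\<^bsub>M\<^esub> x)" by simp
    also have "\<dots> = (\<Oplus>\<^bsub>M\<^esub>j\<in>(\<lambda>i. i + d) ` ?S. ?c (j - d) \<odot>\<^bsub>M\<^esub> x)"
      by (rule M.finsum_reindex[symmetric]) (use cin xc in \<open>auto simp: inj_on_def\<close>)
    finally show "r \<odot>\<^bsub>M\<^esub> x = (\<Oplus>\<^bsub>M\<^esub>j\<in>(\<lambda>i. i + d) ` ?S. ?c (j - d) \<odot>\<^bsub>M\<^esub> x)" .
  qed
  then show ?thesis by simp
qed

lemma colon_ideal_homogeneous: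
  assumes N: "homogeneous_submodule R M Mg N"
  shows "homogeneous_submodule R (self_module R) Rg (colon_ideal R M N x)"
proof -
  have Ns: "submodule R N M" and Nc: "\<And>y j. y \<in> N \<Longrightarrow> component M Mg y j \<in> N"
    using N by (auto simp: homogeneous_submodule_def)
  have eq: "colon_ideal R M N x = {r \<in> carrier (self_module R). r \<odot>\<^bsub>M\<^esub> x \<in> N}"
    by (simp add: colon_ideal_def self_module_def)
  have s: "submodule R (colon_ideal R M N x) (self_module R)"
    unfolding eq by (rule hom_vimage_submodule[OF self_module_module degree_moduleD(1)[OF M(1)] multiplication_hom Ns])
  have "component R Rg r j \<in> colon_ideal R M N x" if r: "r \<in> colon_ideal R M N x" for r j
  proof -
    have rR: "r \<in> carrier R" and "r \<odot>\<^bsub>M\<^esub> x \<in> N" using r by (auto simp: colon_ideal_def)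
    from Nc[OF this(2), of "j + d"] have "component R Rg r j \<odot>\<^bsub>M\<^esub> x \<in> N" by (simp add: component_smult[OF rR])
    then show ?thesis
      using Rg_carrier[OF component_in[OF abelian_group_axioms R rR]] by (simp add: colon_ideal_def)
  qed
  with s show ?thesis by (simp add: homogeneous_submodule_def self_module_grading)
qed

end

context
  fixes I
  assumes R: "grading R Rg" and I: "homogeneous_submodule R (self_module R) Rg I"
begin

lemma coset_self_module: "I +>\<^bsub>self_module R\<^esub> r = I +> r"
  by (simp add: a_r_coset_def r_coset_def self_module_def)

lemma
  shows cyclic_projection_hom: "(\<lambda>r. I +> r) \<in> module_hom R (self_module R) (cyclic_module R I)"
    and cyclic_carrier: "carrier (cyclic_module R I) = (\<lambda>r. I +> r) ` carrier R"
    and cyclic_module_module: "module R (cyclic_module R I)"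
    and cyclic_zero: "\<zero>\<^bsub>cyclic_module R I\<^esub> = I"
    and cyclic_zero_iff: "r \<in> carrier R \<Longrightarrow> I +> r = I \<longleftrightarrow> r \<in> I"
    and cyclic_ideal_carrier: "I \<subseteq> carrier R"
proof -
  have s: "submodule R I (self_module R)" using I by (simp add: homogeneous_submodule_def)
  show "(\<lambda>r. I +> r) \<in> module_hom R (self_module R) (cyclic_module R I)"
    using quotient_module_hom[OF s] by (simp add: coset_self_module)
  show "carrier (cyclic_module R I) = (\<lambda>r. I +> r) ` carrier R"
    using quotient_module_carrier[OF s] by (simp add: coset_self_module) (simp add: self_module_def)
  show "module R (cyclic_module R I)" by (rule quotient_module_module[OF s])
  show "\<zero>\<^bsub>cyclic_module R I\<^esub> = I" by (rule quotient_module_zero[OF s])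
  show "I +> r = I \<longleftrightarrow> r \<in> I" if "r \<in> carrier R" for r
    using coset_eq_self_iff[OF s, of r] that unfolding coset_self_module by (simp add: self_module_def)
  show "I \<subseteq> carrier R" using submoduleD(1)[OF s] by (auto simp: self_module_def)
qed

lemma cyclic_degree_module: "degree_module R Rg (cyclic_module R I) (cyclic_grading R Rg I)"
proof -
  note add = module_hom_add[OF cyclic_projection_hom, unfolded self_module_def, simplified, folded self_module_def]
    and smult = module_hom_smult[OF cyclic_projection_hom, unfolded self_module_def, simplified, folded self_module_def]
  interpret C: module R "cyclic_module R I" by (rule cyclic_module_module)
  have cc: "I +> r \<in> carrier (cyclic_module R I)" if "r \<in> carrier R" for r unfolding cyclic_carrier using that by blast
  show ?thesis unfolding degree_module_def
  proof (intro conjI allI ballI subsetI)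
    show "module R (cyclic_module R I)" by (rule cyclic_module_module)
    show "u \<in> carrier (cyclic_module R I)" if "u \<in> cyclic_grading R Rg I j" for u j
      using that cc Rg_carrier unfolding cyclic_grading_def by blast
    show "\<zero>\<^bsub>cyclic_module R I\<^esub> \<in> cyclic_grading R Rg I j" for j
    proof -
      have "I +> \<zero> = I" using cyclic_zero_iff[of \<zero>] I submoduleD(3)[of R I "self_module R"]
        by (simp add: homogeneous_submodule_def self_module_def)
      then show ?thesis unfolding cyclic_zero cyclic_grading_def using Rg_zero by (metis imageI)
    qed
    fix j u v assume "u \<in> cyclic_grading R Rg I j" "v \<in> cyclic_grading R Rg I j"
    then obtain r s where rs: "r \<in> Rg j" "s \<in> Rg j" "u = I +> r" "v = I +> s" unfolding cyclic_grading_def by blast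
    have "u \<oplus>\<^bsub>cyclic_module R I\<^esub> v = I +> (r \<oplus> s)"
      unfolding rs using add[OF Rg_carrier[OF rs(1)] Rg_carrier[OF rs(2)]] by simp
    then show "u \<oplus>\<^bsub>cyclic_module R I\<^esub> v \<in> cyclic_grading R Rg I j"
      unfolding cyclic_grading_def using Rg_add[OF rs(1,2)] by blast
  next
    fix i j r u assume r: "r \<in> Rg i" and "u \<in> cyclic_grading R Rg I j"
    then obtain s where s: "s \<in> Rg j" "u = I +> s" unfolding cyclic_grading_def by blast
    have "r \<odot>\<^bsub>cyclic_module R I\<^esub> u = I +> (r \<otimes> s)"
      unfolding s using smult[OF Rg_carrier[OF r] Rg_carrier[OF s(1)]] by simp
    then show "r \<odot>\<^bsub>cyclic_module R I\<^esub> u \<in> cyclic_grading R Rg I (i + j)"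
      unfolding cyclic_grading_def using mult_degree[OF r s(1)] by blast
  qed
qed

lemma cyclic_grading_grading: "grading (cyclic_module R I) (cyclic_grading R Rg I)"
proof -
  have ker: "{r \<in> carrier (self_module R). I +> r = \<zero>\<^bsub>cyclic_module R I\<^esub>} = I"
    using cyclic_zero_iff cyclic_ideal_carrier unfolding cyclic_zero by (auto simp: self_module_def)
  have surj: "(\<lambda>r. I +> r) ` carrier (self_module R) = carrier (cyclic_module R I)"
    unfolding cyclic_carrier by (simp add: self_module_def)
  have "grading (self_module R) Rg" using R by (simp only: self_module_grading(1))
  from grading_surj[OF self_module_module this cyclic_module_module cyclic_projection_hom surj]
  have "grading (cyclic_module R I) (\<lambda>j. (\<lambda>r. I +> r) ` Rg j)" using I unfolding ker by blast
  then show ?thesis by (simp add: cyclic_grading_def[abs_def])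
qed

lemma cyclic_projection:
  "(\<lambda>r. I +> r) \<in> graded_hom R (self_module R) Rg (cyclic_module R I) (cyclic_grading R Rg I)"
  "degree_strict (self_module R) Rg (cyclic_grading R Rg I) (\<lambda>r. I +> r)"
  using cyclic_projection_hom by (auto simp: graded_hom_def degree_strict_def cyclic_grading_def)

lemma cyclic_generated: "module.span R (cyclic_module R I) {I +> \<one>} = carrier (cyclic_module R I)"
proof -
  interpret C: module R "cyclic_module R I" by (rule cyclic_module_module)
  have c: "{I +> \<one>} \<subseteq> carrier (cyclic_module R I)" unfolding cyclic_carrier by blast
  have "I +> r \<in> C.span {I +> \<one>}" if r: "r \<in> carrier R" for r
  proof -
    have "I +> r = r \<odot>\<^bsub>cyclic_module R I\<^esub> (I +> \<one>)"
      using module_hom_smult[OF cyclic_projection_hom r, of \<one>] r by (simp add: self_module_def)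
    then show ?thesis using submoduleD(4)[OF C.span_is_submodule[OF c] r] C.in_own_span[OF c] by simp
  qed
  then show ?thesis using C.span_is_subset2[OF c] unfolding cyclic_carrier by blast
qed

lemma cyclic_nontrivial:
  assumes "\<one> \<notin> I"
  shows "nontrivial (cyclic_module R I)"
  using cyclic_zero_iff[of \<one>] assms unfolding nontrivial_def cyclic_zero cyclic_carrier by blast

end

end

lemma (in star_local) cyclic_minimal_resolution:
  assumes I: "homogeneous_submodule R (self_module R) Rg I"
  obtains n a F \<epsilon> where "minimal_resolution R Rg \<mm> n a F \<epsilon> (cyclic_module R I) (cyclic_grading R Rg I)"
proof -
  have f: "finite {I +> \<one>}" and g: "{I +> \<one>} \<subseteq> (\<Union>j. cyclic_grading R Rg I j)"
    using one_degree by (auto simp: cyclic_grading_def)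
  show thesis
  proof (rule minimal_resolution_exists[OF cyclic_degree_module[OF R_grading I] cyclic_grading_grading[OF R_grading I]
        f g cyclic_generated[OF R_grading I]])
    fix n a F \<epsilon>
    assume "\<And>i. obj F i = free_module R (n i)" "minimal_complex R \<mm> F"
      "strict_resolution R Rg F (\<lambda>i. free_degree R Rg (n i) (a i)) \<epsilon> (cyclic_module R I) (cyclic_grading R Rg I)"
    then show thesis by (intro that[of n a F \<epsilon>]) (simp add: minimal_resolution_def)
  qed
qed

section \<open>Resolving one extension\<close>

lemma free_degree_shift: "free_degree R Rg n (\<lambda>c. a c + d) j = free_degree R Rg n a (j - d)"
  by (simp add: free_degree_def algebra_simps)

lemma graded_hom_shift:
  "f \<in> graded_hom R X Xg Y Yg \<Longrightarrow> f \<in> graded_hom R X (\<lambda>j. Xg (j - d)) Y (\<lambda>j. Yg (j - d))"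
  by (auto simp: graded_hom_def)

text \<open>In the extension of \<open>R/I\<close> by \<open>P\<close>, the class of \<open>1\<close> sits in the degree \<open>d\<close> of the new generator, so the
  resolution of \<open>R/I\<close> enters with degrees shifted by \<open>d\<close>.\<close>

lemma strict_resolution_shift:
  fixes d :: int
  assumes C: "strict_resolution R Rg C Cg \<epsilon> X Xg"
  shows "strict_resolution R Rg C (\<lambda>i j. Cg i (j - d)) \<epsilon> X (\<lambda>j. Xg (j - d))"
proof -
  have dm: "degree_module R Rg Y (\<lambda>j. Yg (j - d))" if "degree_module R Rg Y Yg" for Y :: "('a, 'x, 'k) module_scheme" and Yg
    using that by (simp add: degree_module_def algebra_simps) (simp add: add_diff_eq[symmetric])
  have ds: "degree_strict Y (\<lambda>j. Yg (j - d)) (\<lambda>j. Zg (j - d)) f" if "degree_strict Y Yg Zg f"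
    for Y :: "('a, 'x, 'k) module_scheme" and Yg and Zg :: "int \<Rightarrow> 'y set" and f
    using that by (simp add: degree_strict_def)
  have c: "resolution R C \<epsilon> X" "\<And>i. degree_module R Rg (obj C i) (Cg i)"
    "\<And>i. diff C i \<in> graded_hom R (obj C (Suc i)) (Cg (Suc i)) (obj C i) (Cg i)"
    "\<forall>i. \<forall>x\<in>carrier (obj C (Suc (Suc i))). diff C i (diff C (Suc i) x) = \<zero>\<^bsub>obj C i\<^esub>"
    "degree_module R Rg X Xg" "\<epsilon> \<in> graded_hom R (obj C 0) (Cg 0) X Xg" "degree_strict (obj C 0) (Cg 0) Xg \<epsilon>"
    "\<And>i. degree_strict (obj C (Suc i)) (Cg (Suc i)) (Cg i) (diff C i)"
    using C by (simp_all add: strict_resolution_def graded_complex_def)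
  show ?thesis
    unfolding strict_resolution_def graded_complex_def
    by (intro conjI allI c(1) c(4) dm[OF c(2)] graded_hom_shift[OF c(3)] dm[OF c(5)] graded_hom_shift[OF c(6)]
        ds[OF c(7)] ds[OF c(8)])
qed

text \<open>The projection of \<open>N = P + Rx\<close> to \<open>N/P \<cong> R/(P : x)\<close>: the class of \<open>y\<close> is the set of all \<open>r\<close> with
  \<open>y \<in> P + rx\<close>, which is a coset of \<open>P : x\<close>.\<close>

definition quotient_projection ::
  "('a, 'm) ring_scheme \<Rightarrow> ('a, 'b, 'n) module_scheme \<Rightarrow> 'b set \<Rightarrow> 'b \<Rightarrow> 'b \<Rightarrow> 'a set" where
  "quotient_projection R M P x y = {r \<in> carrier R. \<exists>p\<in>P. y = p \<oplus>\<^bsub>M\<^esub> r \<odot>\<^bsub>M\<^esub> x}"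

context degree_ring
begin

context
  fixes M :: "('a, 'x, 'n) module_scheme" and Mg and N P :: "'x set" and x d and I
  assumes R: "grading R Rg" and M: "degree_module R Rg M Mg" "grading M Mg"
    and N: "homogeneous_submodule R M Mg N" and P: "homogeneous_submodule R M Mg P" and PN: "P \<subseteq> N"
    and x: "x \<in> Mg d" "x \<in> N" and gen: "\<And>y. y \<in> N \<Longrightarrow> \<exists>p\<in>P. \<exists>r\<in>carrier R. y = p \<oplus>\<^bsub>M\<^esub> r \<odot>\<^bsub>M\<^esub> x"
  defines "I \<equiv> colon_ideal R M P x"
begin

interpretation M: module R M by (rule degree_moduleD(1)[OF M(1)])

lemma Ns: "submodule R N M" and Ps: "submodule R P M"
  using N P by (auto simp: homogeneous_submodule_def)

lemmas colon_homogeneous = colon_ideal_homogeneous[OF R M x(1) P, folded I_def]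

lemma quotient_projection_eq:
  assumes p: "p \<in> P" and r: "r \<in> carrier R"
  shows "quotient_projection R M P x (p \<oplus>\<^bsub>M\<^esub> r \<odot>\<^bsub>M\<^esub> x) = I +> r"
proof -
  have xc: "x \<in> carrier M" by (rule degree_moduleD(2)[OF M(1) x(1)])
  have pc: "q \<in> carrier M" if "q \<in> P" for q by (rule submoduleD(1)[OF Ps that])
  have "(\<exists>q\<in>P. p \<oplus>\<^bsub>M\<^esub> r \<odot>\<^bsub>M\<^esub> x = q \<oplus>\<^bsub>M\<^esub> s \<odot>\<^bsub>M\<^esub> x) \<longleftrightarrow> s \<in> I +> r" if s: "s \<in> carrier R" for s
  proof
    assume "\<exists>q\<in>P. p \<oplus>\<^bsub>M\<^esub> r \<odot>\<^bsub>M\<^esub> x = q \<oplus>\<^bsub>M\<^esub> s \<odot>\<^bsub>M\<^esub> x"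
    then obtain q where q: "q \<in> P" "p \<oplus>\<^bsub>M\<^esub> r \<odot>\<^bsub>M\<^esub> x = q \<oplus>\<^bsub>M\<^esub> s \<odot>\<^bsub>M\<^esub> x" by blast
    have "(s \<ominus> r) \<odot>\<^bsub>M\<^esub> x = s \<odot>\<^bsub>M\<^esub> x \<ominus>\<^bsub>M\<^esub> r \<odot>\<^bsub>M\<^esub> x"
      using r s xc by (simp add: a_minus_def M.smult_l_distr M.smult_l_minus)
    also have "\<dots> = \<ominus>\<^bsub>M\<^esub> q \<oplus>\<^bsub>M\<^esub> (q \<oplus>\<^bsub>M\<^esub> s \<odot>\<^bsub>M\<^esub> x) \<ominus>\<^bsub>M\<^esub> r \<odot>\<^bsub>M\<^esub> x"
      using pc[OF q(1)] r s xc by (simp add: M.r_neg1 a_minus_def M.a_assoc)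
    also have "\<dots> = \<ominus>\<^bsub>M\<^esub> q \<oplus>\<^bsub>M\<^esub> p"
      unfolding q(2)[symmetric] using pc[OF q(1)] pc[OF p] r xc
      by (simp add: a_minus_def M.a_assoc M.r_neg)
    also have "\<dots> \<in> P" by (rule submoduleD(2)[OF Ps submodule_minus_closed[OF Ps q(1)] p])
    finally have "s \<ominus> r \<in> I" using r s by (simp add: I_def colon_ideal_def)
    moreover have "s = (s \<ominus> r) \<oplus> r" using r s by (simp add: a_minus_def a_assoc l_neg)
    ultimately show "s \<in> I +> r" by (auto simp: a_r_coset_def')
  next
    assume "s \<in> I +> r"
    then obtain b where b: "b \<in> carrier R" "b \<odot>\<^bsub>M\<^esub> x \<in> P" "s = b \<oplus> r"
      by (auto simp: a_r_coset_def' I_def colon_ideal_def)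
    have "p \<oplus>\<^bsub>M\<^esub> r \<odot>\<^bsub>M\<^esub> x = (p \<oplus>\<^bsub>M\<^esub> \<ominus>\<^bsub>M\<^esub> (b \<odot>\<^bsub>M\<^esub> x)) \<oplus>\<^bsub>M\<^esub> s \<odot>\<^bsub>M\<^esub> x"
      using b(1) r xc pc[OF p] unfolding b(3) by (simp add: M.smult_l_distr M.a_assoc M.r_neg1)
    moreover have "p \<oplus>\<^bsub>M\<^esub> \<ominus>\<^bsub>M\<^esub> (b \<odot>\<^bsub>M\<^esub> x) \<in> P"
      by (rule submoduleD(2)[OF Ps p submodule_minus_closed[OF Ps b(2)]])
    ultimately show "\<exists>q\<in>P. p \<oplus>\<^bsub>M\<^esub> r \<odot>\<^bsub>M\<^esub> x = q \<oplus>\<^bsub>M\<^esub> s \<odot>\<^bsub>M\<^esub> x" by blast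
  qed
  moreover have "I +> r \<subseteq> carrier R"
    using r cyclic_ideal_carrier[OF R colon_homogeneous] by (auto simp: a_r_coset_def')
  ultimately show ?thesis unfolding quotient_projection_def by blast
qed

lemma quotient_projection_hom: "quotient_projection R M P x \<in> module_hom R (M\<lparr>carrier := N\<rparr>) (cyclic_module R I)"
proof (rule module_homI)
  have xc: "x \<in> carrier M" by (rule degree_moduleD(2)[OF M(1) x(1)])
  note pc = submoduleD(1)[OF Ps] and proj = cyclic_projection_hom[OF R colon_homogeneous]
  fix y assume "y \<in> carrier (M\<lparr>carrier := N\<rparr>)"
  then have "y \<in> N" by simp
  then obtain p r where y: "p \<in> P" "r \<in> carrier R" "y = p \<oplus>\<^bsub>M\<^esub> r \<odot>\<^bsub>M\<^esub> x" using gen by blast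
  show "quotient_projection R M P x y \<in> carrier (cyclic_module R I)"
    unfolding y(3) quotient_projection_eq[OF y(1,2)] cyclic_carrier[OF R colon_homogeneous] using y(2) by blast
  show "quotient_projection R M P x (y \<oplus>\<^bsub>M\<lparr>carrier := N\<rparr>\<^esub> z) = quotient_projection R M P x y \<oplus>\<^bsub>cyclic_module R I\<^esub> quotient_projection R M P x z"
    if "z \<in> carrier (M\<lparr>carrier := N\<rparr>)" for z
  proof -
    have "z \<in> N" using that by simp
    then obtain q s where z: "q \<in> P" "s \<in> carrier R" "z = q \<oplus>\<^bsub>M\<^esub> s \<odot>\<^bsub>M\<^esub> x" using gen by blast
    have "y \<oplus>\<^bsub>M\<^esub> z = (p \<oplus>\<^bsub>M\<^esub> q) \<oplus>\<^bsub>M\<^esub> (r \<oplus> s) \<odot>\<^bsub>M\<^esub> x"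
      unfolding y(3) z(3) using y(2) z(2) pc[OF y(1)] pc[OF z(1)] xc by (simp add: M.smult_l_distr M.a_ac)
    then have "quotient_projection R M P x (y \<oplus>\<^bsub>M\<^esub> z) = I +> (r \<oplus> s)"
      using quotient_projection_eq[OF submoduleD(2)[OF Ps y(1) z(1)], of "r \<oplus> s"] y(2) z(2) by simp
    also have "\<dots> = (I +> r) \<oplus>\<^bsub>cyclic_module R I\<^esub> (I +> s)"
      using module_hom_add[OF proj, of r s] y(2) z(2) by (simp add: self_module_def)
    finally show ?thesis
      unfolding quotient_projection_eq[OF y(1,2), folded y(3)] quotient_projection_eq[OF z(1,2), folded z(3)] by simp
  qed
  show "quotient_projection R M P x (s \<odot>\<^bsub>M\<lparr>carrier := N\<rparr>\<^esub> y) = s \<odot>\<^bsub>cyclic_module R I\<^esub> quotient_projection R M P x y"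
    if s: "s \<in> carrier R" for s
  proof -
    have "s \<odot>\<^bsub>M\<^esub> y = s \<odot>\<^bsub>M\<^esub> p \<oplus>\<^bsub>M\<^esub> (s \<otimes> r) \<odot>\<^bsub>M\<^esub> x"
      unfolding y(3) using s y(2) pc[OF y(1)] xc by (simp add: M.smult_r_distr M.smult_assoc1)
    then have "quotient_projection R M P x (s \<odot>\<^bsub>M\<^esub> y) = I +> (s \<otimes> r)"
      using quotient_projection_eq[OF submoduleD(4)[OF Ps s y(1)], of "s \<otimes> r"] y(2) s by simp
    also have "\<dots> = s \<odot>\<^bsub>cyclic_module R I\<^esub> (I +> r)"
      using module_hom_smult[OF proj s, of r] y(2) by (simp add: self_module_def)
    finally show ?thesis unfolding quotient_projection_eq[OF y(1,2), folded y(3)] by simp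
  qed
qed

lemma quotient_projection_kernel:
  assumes "y \<in> N"
  shows "quotient_projection R M P x y = \<zero>\<^bsub>cyclic_module R I\<^esub> \<longleftrightarrow> y \<in> P"
proof -
  obtain p r where y: "p \<in> P" "r \<in> carrier R" "y = p \<oplus>\<^bsub>M\<^esub> r \<odot>\<^bsub>M\<^esub> x" using gen assms by blast
  have xc: "x \<in> carrier M" by (rule degree_moduleD(2)[OF M(1) x(1)])
  have "quotient_projection R M P x y = \<zero>\<^bsub>cyclic_module R I\<^esub> \<longleftrightarrow> r \<odot>\<^bsub>M\<^esub> x \<in> P"
    unfolding cyclic_zero[OF R colon_homogeneous] y(3) quotient_projection_eq[OF y(1,2)] cyclic_zero_iff[OF R colon_homogeneous y(2)]
    using y(2) by (simp add: I_def colon_ideal_def)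
  also have "\<dots> \<longleftrightarrow> y \<in> P"
  proof
    assume "r \<odot>\<^bsub>M\<^esub> x \<in> P"
    then show "y \<in> P" unfolding y(3) by (rule submoduleD(2)[OF Ps y(1)])
  next
    assume "y \<in> P"
    moreover have "r \<odot>\<^bsub>M\<^esub> x = \<ominus>\<^bsub>M\<^esub> p \<oplus>\<^bsub>M\<^esub> y" unfolding y(3) using submoduleD(1)[OF Ps y(1)] y(2) xc by (simp add: M.r_neg1)
    ultimately show "r \<odot>\<^bsub>M\<^esub> x \<in> P" using submoduleD(2)[OF Ps submodule_minus_closed[OF Ps y(1)]] by simp
  qed
  finally show ?thesis .
qed

text \<open>The map \<open>l\<close> lifts the augmentation of \<open>G\<close> first to \<open>R\<close> and then to \<open>N\<close> through \<open>r \<mapsto> rx\<close>. The composite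
  \<open>l d\<close> has values in \<open>P\<close> and vanishes on boundaries, so it lifts to a chain map \<open>\<phi>\<close> from the truncation of \<open>G\<close>
  in degrees \<open>\<ge> 1\<close> to \<open>F\<close>. The alternating sign in \<open>h\<^sub>i = (-1)\<^sup>i\<^sup>+\<^sup>1 \<phi>\<^sub>i\<close> turns the chain map into an
  anticommuting one, which makes the combined differential square to zero.\<close>

lemma extension_horseshoe:
  assumes F: "minimal_resolution R Rg \<mm> nF aF F eF (M\<lparr>carrier := P\<rparr>) (\<lambda>j. Mg j \<inter> P)"
    and G: "minimal_resolution R Rg \<mm> nG aG G eG (cyclic_module R I) (cyclic_grading R Rg I)"
  obtains l h where "horseshoe R Rg F G nF nG aF (\<lambda>i c. aG i c + d) eF eG (M\<lparr>carrier := N\<rparr>) (\<lambda>j. Mg j \<inter> N)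
    P (\<lambda>j. Mg j \<inter> P) (cyclic_module R I) (\<lambda>j. cyclic_grading R Rg I (j - d)) (quotient_projection R M P x) l h"
proof -
  note FD = minimal_resolutionD[OF F] and GD = minimal_resolutionD[OF G]
  note gp = minimal_resolution_projective[OF F]
  let ?Gg = "\<lambda>i. free_degree R Rg (nG i) (\<lambda>c. aG i c + d)"
  let ?Q = "cyclic_module R I" and ?Qg = "\<lambda>j. cyclic_grading R Rg I (j - d)"
  have Gs: "strict_resolution R Rg G ?Gg eG ?Q ?Qg"
    using strict_resolution_shift[OF GD(7), of d] unfolding free_degree_shift .
  have Gd: "\<And>i. diff G i \<in> graded_hom R (obj G (Suc i)) (?Gg (Suc i)) (obj G i) (?Gg i)"
    and eG: "eG \<in> graded_hom R (obj G 0) (?Gg 0) ?Q ?Qg"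
    using Gs by (simp_all add: strict_resolution_def graded_complex_def)
  have Gm: "\<And>i. module R (obj G i)" using GD(5) by (simp add: resolution_def)
  have Fm: "\<And>i. module R (obj F i)" using FD(5) by (simp add: resolution_def)
  have Nd: "degree_module R Rg (M\<lparr>carrier := N\<rparr>) (\<lambda>j. Mg j \<inter> N)" by (rule degree_module_submodule[OF M(1) Ns])
  have Pd: "degree_module R Rg (M\<lparr>carrier := P\<rparr>) (\<lambda>j. Mg j \<inter> P)" by (rule degree_module_submodule[OF M(1) Ps])
  note Nm = degree_moduleD(1)[OF Nd] and Pm = degree_moduleD(1)[OF Pd]
  have eG0: "eG \<in> graded_hom R (obj G 0) (free_degree R Rg (nG 0) (aG 0)) ?Q (cyclic_grading R Rg I)"
    using GD(7) by (simp add: strict_resolution_def)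
  have "eG ` carrier (obj G 0) \<subseteq> (\<lambda>r. I +> r) ` carrier (self_module R)"
  proof
    fix u assume "u \<in> eG ` carrier (obj G 0)"
    then have "u \<in> carrier ?Q" using graded_homD(3)[OF eG0] by blast
    then show "u \<in> (\<lambda>r. I +> r) ` carrier (self_module R)" unfolding cyclic_carrier[OF R colon_homogeneous] by (simp add: self_module_def)
  qed
  from projective_lift[OF minimal_resolution_projective[OF G] cyclic_degree_module[OF R colon_homogeneous] self_module_degree eG0
      cyclic_projection[OF R colon_homogeneous] this]
  obtain k where k: "k \<in> graded_hom R (obj G 0) (free_degree R Rg (nG 0) (aG 0)) (self_module R) Rg"
    and keq: "\<forall>z\<in>carrier (obj G 0). I +> k z = eG z" by blast
  let ?l = "\<lambda>z. k z \<odot>\<^bsub>M\<^esub> x"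
  have kR: "k z \<in> carrier R" if "z \<in> carrier (obj G 0)" for z
    using graded_homD(3)[OF k that] by (simp add: self_module_def)
  have lN: "?l z \<in> N" if "z \<in> carrier (obj G 0)" for z by (rule submoduleD(4)[OF Ns kR[OF that] x(2)])
  have l: "?l \<in> graded_hom R (obj G 0) (?Gg 0) (M\<lparr>carrier := N\<rparr>) (\<lambda>j. Mg j \<inter> N)"
  proof (rule graded_homI)
    have "?l \<in> module_hom R (obj G 0) M"
      by (rule hom_comp[OF graded_homD(1)[OF k] multiplication_hom[OF R M x(1)]])
    then show "?l \<in> module_hom R (obj G 0) (M\<lparr>carrier := N\<rparr>)" by (rule hom_restrict) (use lN in blast)
    fix j z assume z: "z \<in> ?Gg 0 j"
    then have "z \<in> free_degree R Rg (nG 0) (aG 0) (j - d)" unfolding free_degree_shift .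
    from degree_moduleD(5)[OF M(1) graded_homD(2)[OF k this] x(1)] have "?l z \<in> Mg j" by simp
    moreover have "z \<in> carrier (obj G 0)" using z by (simp add: free_degree_def GD(1))
    ultimately show "?l z \<in> Mg j \<inter> N" using lN by blast
  qed
  have \<pi>l: "quotient_projection R M P x (?l z) = eG z" if z: "z \<in> carrier (obj G 0)" for z
  proof -
    have "?l z = \<zero>\<^bsub>M\<^esub> \<oplus>\<^bsub>M\<^esub> ?l z" using submoduleD(1)[OF Ns lN[OF z]] by simp
    then have "quotient_projection R M P x (?l z) = quotient_projection R M P x (\<zero>\<^bsub>M\<^esub> \<oplus>\<^bsub>M\<^esub> ?l z)" by (rule arg_cong)
    also have "\<dots> = I +> k z" by (rule quotient_projection_eq[OF submoduleD(3)[OF Ps] kR[OF z]])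
    finally show ?thesis using keq z by simp
  qed
  let ?C = "\<lparr>obj = \<lambda>i. obj G (Suc i), diff = \<lambda>i. diff G (Suc i)\<rparr> :: ('a, nat \<Rightarrow> 'a) chain"
  let ?f = "\<lambda>z. ?l (diff G 0 z)"
  have C: "graded_complex R Rg ?C (\<lambda>i. ?Gg (Suc i))"
    using Gs by (auto simp: strict_resolution_def graded_complex_def)
  have Cp: "graded_projective R Rg (obj ?C i) (?Gg (Suc i))" for i by (simp add: GD(1) free_projective)
  have fP: "?f z \<in> P" if z: "z \<in> carrier (obj G 1)" for z
  proof -
    have dz: "diff G 0 z \<in> carrier (obj G 0)" using graded_homD(3)[OF Gd[of 0]] z by simp
    have "quotient_projection R M P x (?f z) = \<zero>\<^bsub>?Q\<^esub>" unfolding \<pi>l[OF dz] by (rule resolution_exact(3)[OF GD(5) z])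
    then show ?thesis unfolding quotient_projection_kernel[OF lN[OF dz]] .
  qed
  have f: "?f \<in> graded_hom R (obj ?C 0) (?Gg (Suc 0)) (M\<lparr>carrier := P\<rparr>) (\<lambda>j. Mg j \<inter> P)"
  proof (rule graded_homI)
    note c = graded_hom_comp[OF Gd[of 0] l]
    show "?f \<in> module_hom R (obj ?C 0) (M\<lparr>carrier := P\<rparr>)"
      using hom_restrict[OF graded_homD(1)[OF c], of P] fP by (simp add: image_subset_iff)
    fix j z assume z: "z \<in> ?Gg (Suc 0) j"
    then have "z \<in> carrier (obj G 1)" by (simp add: free_degree_def GD(1))
    with fP graded_homD(2)[OF c z] show "?f z \<in> Mg j \<inter> P" by blast
  qed
  have f0: "?f (diff ?C 0 z) = \<zero>\<^bsub>M\<lparr>carrier := P\<rparr>\<^esub>" if "z \<in> carrier (obj ?C 1)" for z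
    using resolution_exact(4)[OF GD(5), of z 0] that hom_zero[OF Gm Nm graded_homD(1)[OF l]] by simp
  have "\<exists>\<phi>. (\<forall>i. \<phi> i \<in> graded_hom R (obj ?C i) (?Gg (Suc i)) (obj F i) (free_degree R Rg (nF i) (aF i))) \<and>
    (\<forall>z\<in>carrier (obj ?C 0). eF (\<phi> 0 z) = ?f z) \<and>
    (\<forall>i. \<forall>z\<in>carrier (obj ?C (Suc i)). diff F i (\<phi> (Suc i) z) = \<phi> i (diff ?C i z))"
    by (rule chain_map_lift[OF C Cp _ f]) (rule FD(7), rule f0)
  then obtain \<phi> where \<phi>_all: "(\<forall>i. \<phi> i \<in> graded_hom R (obj ?C i) (?Gg (Suc i)) (obj F i) (free_degree R Rg (nF i) (aF i))) \<and>
    (\<forall>z\<in>carrier (obj ?C 0). eF (\<phi> 0 z) = ?f z) \<and>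
    (\<forall>i. \<forall>z\<in>carrier (obj ?C (Suc i)). diff F i (\<phi> (Suc i) z) = \<phi> i (diff ?C i z))" by (rule exE)
  have \<phi>: "\<And>i. \<phi> i \<in> graded_hom R (obj G (Suc i)) (?Gg (Suc i)) (obj F i) (free_degree R Rg (nF i) (aF i))"
    and \<phi>0: "\<And>z. z \<in> carrier (obj G (Suc 0)) \<Longrightarrow> eF (\<phi> 0 z) = ?f z"
    and \<phi>S: "\<And>i z. z \<in> carrier (obj G (Suc (Suc i))) \<Longrightarrow> diff F i (\<phi> (Suc i) z) = \<phi> i (diff G (Suc i) z)"
    using \<phi>_all by simp_all
  let ?h = "\<lambda>i z. if even i then \<ominus>\<^bsub>obj F i\<^esub> \<phi> i z else \<phi> i z"
  have Fdm: "degree_module R Rg (obj F i) (free_degree R Rg (nF i) (aF i))" for i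
    unfolding FD(1) by (rule free_degree_module)
  have Fd: "diff F i \<in> module_hom R (obj F (Suc i)) (obj F i)" for i using FD(5) by (simp add: resolution_def)
  have eF: "eF \<in> module_hom R (obj F 0) (M\<lparr>carrier := P\<rparr>)" using FD(5) by (simp add: resolution_def)
  have "horseshoe R Rg F G nF nG aF (\<lambda>i c. aG i c + d) eF eG (M\<lparr>carrier := N\<rparr>) (\<lambda>j. Mg j \<inter> N)
    P (\<lambda>j. Mg j \<inter> P) ?Q ?Qg (quotient_projection R M P x) ?l ?h"
  proof (rule horseshoe.intro[OF degree_ring_axioms horseshoe_axioms.intro])
    show "strict_resolution R Rg F (\<lambda>i. free_degree R Rg (nF i) (aF i)) eF (M\<lparr>carrier := N, carrier := P\<rparr>) (\<lambda>j. Mg j \<inter> P)"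
      using FD(7) by simp
    show "obj F i = free_module R (nF i)" "obj G i = free_module R (nG i)" for i by (rule FD(1) GD(1))+
    show "strict_resolution R Rg G ?Gg eG ?Q ?Qg" by (rule Gs)
    show "degree_module R Rg (M\<lparr>carrier := N\<rparr>) (\<lambda>j. Mg j \<inter> N)" by (rule Nd)
    show "submodule R P (M\<lparr>carrier := N\<rparr>)" by (rule submodule_submodule[OF Ns Ps PN])
    show "Mg j \<inter> P \<subseteq> Mg j \<inter> N" for j using PN by blast
    show "quotient_projection R M P x \<in> module_hom R (M\<lparr>carrier := N\<rparr>) ?Q" by (rule quotient_projection_hom)
    show "quotient_projection R M P x y = \<zero>\<^bsub>?Q\<^esub> \<longleftrightarrow> y \<in> P" if "y \<in> carrier (M\<lparr>carrier := N\<rparr>)" for y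
      by (rule quotient_projection_kernel) (use that in simp)
    show "?l \<in> graded_hom R (obj G 0) (?Gg 0) (M\<lparr>carrier := N\<rparr>) (\<lambda>j. Mg j \<inter> N)" by (rule l)
    show "quotient_projection R M P x (?l z) = eG z" if "z \<in> carrier (obj G 0)" for z by (rule \<pi>l[OF that])
    show "?h i \<in> graded_hom R (obj G (Suc i)) (?Gg (Suc i)) (obj F i) (free_degree R Rg (nF i) (aF i))" for i
      using \<phi> graded_hom_neg[OF Fdm \<phi>, of i] by (cases "even i") simp_all
    show "eF (?h 0 z) = \<ominus>\<^bsub>M\<lparr>carrier := N\<rparr>\<^esub> ?l (diff G 0 z)" if z: "z \<in> carrier (obj G 1)" for z
    proof -
      have z': "z \<in> carrier (obj G (Suc 0))" using z by simp
      have "eF (?h 0 z) = \<ominus>\<^bsub>M\<lparr>carrier := P\<rparr>\<^esub> ?f z"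
        using hom_neg[OF Fm Pm eF graded_homD(3)[OF \<phi> z']] \<phi>0[OF z'] by simp
      then show ?thesis using minus_submodule[OF Ps fP[OF z]] minus_submodule[OF Ns, of "?f z"] PN fP[OF z] by auto
    qed
    show "diff F i (?h (Suc i) z) = \<ominus>\<^bsub>obj F i\<^esub> ?h i (diff G (Suc i) z)" if z: "z \<in> carrier (obj G (Suc (Suc i)))" for i z
    proof -
      interpret Fi: module R "obj F i" by (rule Fm)
      have c: "\<phi> i (diff G (Suc i) z) \<in> carrier (obj F i)" by (rule graded_homD(3)[OF \<phi> graded_homD(3)[OF Gd z]])
      show ?thesis
        using hom_neg[OF Fm Fm Fd graded_homD(3)[OF \<phi> z]] \<phi>S[OF z] c by (cases "even i") simp_all
    qed
  qed
  then show thesis by (rule that)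
qed

end

end

text \<open>The hypothesis on \<open>\<mm>N \<inter> P\<close> starts the induction that makes the horseshoe resolution minimal.\<close>

lemma (in star_local) resolve_extension:
  fixes M :: "('a, 'x, 'n) module_scheme"
  assumes M: "degree_module R Rg M Mg" "grading M Mg"
    and N: "homogeneous_submodule R M Mg N" and P: "homogeneous_submodule R M Mg P" and PN: "P \<subseteq> N"
    and x: "x \<in> Mg d" "x \<in> N" and gen: "\<And>y. y \<in> N \<Longrightarrow> \<exists>p\<in>P. \<exists>r\<in>carrier R. y = p \<oplus>\<^bsub>M\<^esub> r \<odot>\<^bsub>M\<^esub> x"
    and IN: "ideal_smult R \<mm> (M\<lparr>carrier := N\<rparr>) \<inter> P \<subseteq> ideal_smult R \<mm> (M\<lparr>carrier := P\<rparr>)"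
    and F: "minimal_resolution R Rg \<mm> nF aF F eF (M\<lparr>carrier := P\<rparr>) (\<lambda>j. Mg j \<inter> P)" "linear_part_exact R \<mm> F"
    and G: "minimal_resolution R Rg \<mm> nG aG G eG (cyclic_module R (colon_ideal R M P x))
        (cyclic_grading R Rg (colon_ideal R M P x))" "linear_part_exact R \<mm> G"
  shows "\<exists>E \<epsilon>. minimal_resolution R Rg \<mm> (\<lambda>i. nF i + nG i) (\<lambda>i. join (nF i) (aF i) (\<lambda>c. aG i c + d)) E \<epsilon>
      (M\<lparr>carrier := N\<rparr>) (\<lambda>j. Mg j \<inter> N) \<and> linear_part_exact R \<mm> E"
proof -
  note FD = minimal_resolutionD[OF F(1)] and GD = minimal_resolutionD[OF G(1)]
  obtain l h where hs: "horseshoe R Rg F G nF nG aF (\<lambda>i c. aG i c + d) eF eG (M\<lparr>carrier := N\<rparr>) (\<lambda>j. Mg j \<inter> N)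
    P (\<lambda>j. Mg j \<inter> P) (cyclic_module R (colon_ideal R M P x))
    (\<lambda>j. cyclic_grading R Rg (colon_ideal R M P x) (j - d)) (quotient_projection R M P x) l h"
    by (rule extension_horseshoe[OF R_grading M N P PN x gen F(1) G(1)]) (assumption, rule that)
  interpret H: horseshoe R Rg F G nF nG aF "\<lambda>i c. aG i c + d" eF eG "M\<lparr>carrier := N\<rparr>" "\<lambda>j. Mg j \<inter> N"
    P "\<lambda>j. Mg j \<inter> P" "cyclic_module R (colon_ideal R M P x)"
    "\<lambda>j. cyclic_grading R Rg (colon_ideal R M P x) (j - d)" "quotient_projection R M P x" l h
    by (rule hs)
  let ?Eg = "\<lambda>i. free_degree R Rg (nF i + nG i) (H.total_degree i)"
  have IN': "ideal_smult R \<mm> (M\<lparr>carrier := N\<rparr>) \<inter> P \<subseteq> ideal_smult R \<mm> (M\<lparr>carrier := N, carrier := P\<rparr>)"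
    using IN by simp
  have deg: "H.total_degree i = join (nF i) (aF i) (\<lambda>c. aG i c + d)" for i by (simp add: H.total_degree_def)
  have gN: "grading (M\<lparr>carrier := N\<rparr>) (\<lambda>j. Mg j \<inter> N)"
    by (rule grading_submodule[OF degree_moduleD(1)[OF M(1)] M(2) N])
  have d: "diff H.total i \<in> graded_hom R (obj H.total (Suc i)) (?Eg (Suc i)) (obj H.total i) (?Eg i)" for i
    by (rule graded_homI[OF H.total_diff_hom H.total_diff_degree])
  have e: "H.augmentation \<in> graded_hom R (obj H.total 0) (?Eg 0) (M\<lparr>carrier := N\<rparr>) (\<lambda>j. Mg j \<inter> N)"
    by (rule graded_homI[OF H.augmentation_hom H.augmentation_degree])
  have ds: "degree_strict (obj H.total (Suc i)) (?Eg (Suc i)) (?Eg i) (diff H.total i)" for i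
    by (rule graded_hom_strict[OF _ _ _ _ d]) (simp_all add: free_module_module grading_free[OF R_grading])
  have es: "degree_strict (obj H.total 0) (?Eg 0) (\<lambda>j. Mg j \<inter> N) H.augmentation"
    by (rule graded_hom_strict[OF _ _ H.Nm gN e]) (simp_all add: free_module_module grading_free[OF R_grading])
  have dm: "degree_module R Rg (obj H.total i) (?Eg i)" for i by (simp add: free_degree_module)
  have dd: "diff H.total i (diff H.total (Suc i) z) = \<zero>\<^bsub>obj H.total i\<^esub>" if "z \<in> carrier (obj H.total (Suc (Suc i)))" for i z
    by (rule resolution_exact(4)[OF H.total_resolution that])
  have "strict_resolution R Rg H.total ?Eg H.augmentation (M\<lparr>carrier := N\<rparr>) (\<lambda>j. Mg j \<inter> N)"
    unfolding strict_resolution_def graded_complex_def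
    by (intro conjI allI ballI H.total_resolution dm d dd H.N e es ds)
  moreover have "minimal_complex R \<mm> H.total"
    by (rule H.total_minimal[OF max_ideal FD(2) GD(2) F(2) G(2) IN'])
  ultimately have "minimal_resolution R Rg \<mm> (\<lambda>i. nF i + nG i) H.total_degree H.total H.augmentation
      (M\<lparr>carrier := N\<rparr>) (\<lambda>j. Mg j \<inter> N)"
    by (simp add: minimal_resolution_def)
  moreover have "linear_part_exact R \<mm> H.total"
    by (rule H.total_linear_part_exact[OF max_ideal FD(2) GD(2) F(2) G(2) IN'])
  ultimately show ?thesis unfolding deg[abs_def] by blast
qed

lemma (in star_local) zero_module_resolution:
  assumes X: "degree_module R Rg X Xg" "grading X Xg" and z: "carrier X = {\<zero>\<^bsub>X\<^esub>}"
  shows "\<exists>F \<epsilon>. minimal_resolution R Rg \<mm> (\<lambda>i. 0) (\<lambda>i c. 0) F \<epsilon> X Xg \<and> linear_part_exact R \<mm> F"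
proof -
  interpret X: module R X by (rule degree_moduleD(1)[OF X(1)])
  let ?Z = "free_module R 0"
  let ?F = "\<lparr>obj = \<lambda>i. ?Z, diff = \<lambda>i x. x\<rparr> :: ('a, nat \<Rightarrow> 'a) chain" and ?e = "\<lambda>x :: nat \<Rightarrow> 'a. \<zero>\<^bsub>X\<^esub>"
  let ?Zg = "free_degree R Rg 0 (\<lambda>c. 0)"
  interpret Z: module R ?Z by (rule free_module_module)
  have c: "carrier ?Z = {\<zero>\<^bsub>?Z\<^esub>}" by (auto simp: free_carrier_iff free_module_simps)
  have d: "(\<lambda>x. x) \<in> graded_hom R ?Z ?Zg ?Z ?Zg" by (rule graded_hom_id)
  have e: "?e \<in> graded_hom R ?Z ?Zg X Xg"
    using zero_hom[OF X.module_axioms] degree_moduleD(3)[OF X(1)] by (auto simp: graded_hom_def)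
  note gZ = grading_free[OF R_grading, of 0 "\<lambda>c. 0"]
  have cy: "cycles ?F (Suc i) = boundaries ?F (Suc i)" for i by (auto simp: boundaries_def c)
  have r: "resolution R ?F ?e X"
    unfolding resolution_def using graded_homD(1)[OF d] graded_homD(1)[OF e] cy
    by (auto simp: boundaries_def c z Z.module_axioms)
  have s: "strict_resolution R Rg ?F (\<lambda>i. ?Zg) ?e X Xg"
    unfolding strict_resolution_def graded_complex_def
    using r X(1) free_degree_module d e c graded_hom_strict[OF Z.module_axioms gZ Z.module_axioms gZ d]
      graded_hom_strict[OF Z.module_axioms gZ X.module_axioms X(2) e]
    by simp
  have zero: "\<zero>\<^bsub>?Z\<^esub> \<in> ideal_smult R I ?Z" if "I \<subseteq> carrier R" for I
    by (rule submoduleD(3)[OF ideal_smult_submodule[OF Z.module_axioms that]])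
  have "minimal_complex R \<mm> ?F" using zero[OF max_carrier] by (simp add: minimal_complex_def boundaries_def c)
  moreover have "linear_part_exact R \<mm> ?F"
  proof -
    have pz: "\<zero>\<^bsub>?Z\<^esub> \<in> ideal_smult R (ideal_power R \<mm> p) ?Z" for p
      by (rule zero[OF ideal_power_subset[OF max_ideal]])
    have sub: "ideal_smult R (ideal_power R \<mm> p) ?Z \<subseteq> {\<zero>\<^bsub>?Z\<^esub>}" for p
      using submoduleD(1)[OF ideal_smult_submodule[OF Z.module_axioms ideal_power_subset[OF max_ideal]]] c by blast
    show ?thesis unfolding linear_part_exact_def
    proof (intro allI ballI impI)
      fix i p x assume "x \<in> ideal_smult R (ideal_power R \<mm> p) (obj ?F (Suc i))"
      then have "x = \<zero>\<^bsub>?Z\<^esub>" using sub[of p] by auto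
      then have x: "x = diff ?F (Suc i) \<zero>\<^bsub>?Z\<^esub> \<oplus>\<^bsub>obj ?F (Suc i)\<^esub> \<zero>\<^bsub>?Z\<^esub>" by simp
      show "\<exists>y\<in>ideal_smult R (ideal_power R \<mm> (p - 1)) (obj ?F (Suc (Suc i))).
          \<exists>b\<in>ideal_smult R (ideal_power R \<mm> (Suc p)) (obj ?F (Suc i)). x = diff ?F (Suc i) y \<oplus>\<^bsub>obj ?F (Suc i)\<^esub> b"
        by (rule bexI[of _ "\<zero>\<^bsub>?Z\<^esub>"], rule bexI[of _ "\<zero>\<^bsub>?Z\<^esub>"], rule x) (simp_all only: chain.simps pz)
    qed
  qed
  ultimately show ?thesis using s unfolding minimal_resolution_def by (intro exI[of _ ?F] exI[of _ ?e]) simp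
qed

lemma card_join:
  "card {c. c < n + k \<and> join n a b c = j} = card {c. c < n \<and> a c = j} + card {c. c < k \<and> b c = (j :: int)}"
proof -
  have "{c. c < n + k \<and> join n a b c = j} = {c. c < n \<and> a c = j} \<union> (\<lambda>c. c + n) ` {c. c < k \<and> b c = j}"
  proof (intro equalityI subsetI)
    fix c assume c: "c \<in> {c. c < n + k \<and> join n a b c = j}"
    show "c \<in> {c. c < n \<and> a c = j} \<union> (\<lambda>c. c + n) ` {c. c < k \<and> b c = j}"
    proof (cases "c < n")
      case False
      then have "c = (c - n) + n" "c - n \<in> {c. c < k \<and> b c = j}" using c by (auto simp: join_def)
      then show ?thesis by blast
    qed (use c in \<open>simp add: join_def\<close>)
  qed (auto simp: join_def)
  moreover have "card ((\<lambda>c. c + n) ` {c. c < k \<and> b c = j}) = card {c. c < k \<and> b c = j}"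
    by (rule card_image) (simp add: inj_on_def)
  moreover have "card ({c. c < n \<and> a c = j} \<union> (\<lambda>c. c + n) ` {c. c < k \<and> b c = j}) =
      card {c. c < n \<and> a c = j} + card ((\<lambda>c. c + n) ` {c. c < k \<and> b c = j})"
    by (rule card_Un_disjoint) auto
  ultimately show ?thesis by simp
qed

section \<open>Filtering by initial submodules\<close>

locale generated_module = star_local +
  fixes M :: "('a, 'x, 'y) module_scheme" and Mg and g :: "nat \<Rightarrow> 'x" and t and d
  assumes M: "degree_module R Rg M Mg" "grading M Mg"
    and gens: "minimal_generators R M g t" and deg: "\<And>i. i \<in> {1..t} \<Longrightarrow> g i \<in> Mg (d i)"
begin

interpretation M: module R M by (rule degree_moduleD(1)[OF M(1)])

lemma g_carrier: "i \<in> {1..t} \<Longrightarrow> g i \<in> carrier M"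
  by (rule degree_moduleD(2)[OF M(1) deg])



text \<open>Generators are numbered from \<open>1\<close>, basis vectors from \<open>0\<close>.\<close>

abbreviation "cover k \<equiv> basis_map M (\<lambda>c. g (Suc c)) k"

abbreviation "init i \<equiv> initial_submodule R M g i"

lemma shift_image: "(\<lambda>c. g (Suc c)) ` {..<k} = g ` {1..k}"
proof -
  have "Suc ` {..<k} = {1..k}" by (auto simp: image_Suc_lessThan)
  then show ?thesis by (metis image_image)
qed

lemma cover_hom: "k \<le> t \<Longrightarrow> cover k \<in> module_hom R (free_module R k) M"
  by (rule basis_map_hom[OF M.module_axioms]) (simp add: g_carrier)

lemma cover_graded: "k \<le> t \<Longrightarrow> cover k \<in> graded_hom R (free_module R k) (free_degree R Rg k (\<lambda>c. d (Suc c))) M Mg"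
  by (rule basis_map_graded[OF M(1)]) (simp add: deg)

lemma cover_image: "k \<le> t \<Longrightarrow> cover k ` carrier (free_module R k) = init k"
  unfolding initial_submodule_def shift_image[symmetric]
  by (rule basis_map_image[OF M.module_axioms]) (simp add: g_carrier)

lemma init_homogeneous: "k \<le> t \<Longrightarrow> homogeneous_submodule R M Mg (init k)"
  using homogeneous_image[OF free_module_module grading_free[OF R_grading] M.module_axioms M(2) cover_graded]
  by (simp add: cover_image)

lemma init_submodule: "k \<le> t \<Longrightarrow> submodule R (init k) M"
  using init_homogeneous by (simp add: homogeneous_submodule_def)

lemma gen_in_span: "A \<subseteq> {1..t} \<Longrightarrow> i \<in> A \<Longrightarrow> g i \<in> M.span (g ` A)"
  using M.in_own_span[of "g ` A"] g_carrier by blast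

lemma span_mono: "A \<subseteq> B \<Longrightarrow> B \<subseteq> {1..t} \<Longrightarrow> M.span (g ` A) \<subseteq> M.span (g ` B)"
  by (rule M.span_is_subset[OF _ M.span_is_submodule]) (use gen_in_span g_carrier in blast)+

lemma init_mono: "k \<le> l \<Longrightarrow> l \<le> t \<Longrightarrow> init k \<subseteq> init l"
  unfolding initial_submodule_def by (rule span_mono) auto

lemma init_all: "init t = carrier M"
  using gens by (simp add: initial_submodule_def minimal_generators_def)

lemma irredundant:
  assumes i: "i \<in> {1..t}"
  shows "g i \<notin> M.span (g ` ({1..t} - {i}))"
proof
  let ?A = "{1..t} - {i}"
  assume mem: "g i \<in> M.span (g ` ?A)"
  have c: "g ` ?A \<subseteq> carrier M" using g_carrier by blast
  have "g ` {1..t} \<subseteq> M.span (g ` ?A)"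
  proof
    fix y assume "y \<in> g ` {1..t}"
    then obtain l where l: "l \<in> {1..t}" "y = g l" by blast
    show "y \<in> M.span (g ` ?A)"
      using mem gen_in_span[of ?A l] l by (cases "l = i") auto
  qed
  then have "M.span (g ` {1..t}) \<subseteq> M.span (g ` ?A)" by (rule M.span_is_subset[OF _ M.span_is_submodule[OF c]])
  then have "M.span (g ` ?A) = carrier M"
    using gens M.span_is_subset2[OF c] by (simp add: minimal_generators_def)
  with gens i show False by (simp add: minimal_generators_def)
qed

lemma cover_extend:
  assumes k: "k \<le> l" "l \<le> t" and r: "r \<in> carrier (free_module R k)"
  shows "r \<in> carrier (free_module R l)" "cover l r = cover k r"
proof -
  show "r \<in> carrier (free_module R l)" using r k by (auto simp: free_carrier_iff) (metis not_le_imp_less zero_closed)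
  have "(\<Oplus>\<^bsub>M\<^esub>c\<in>{..<k}. r c \<odot>\<^bsub>M\<^esub> g (Suc c)) = (\<Oplus>\<^bsub>M\<^esub>c\<in>{..<l}. r c \<odot>\<^bsub>M\<^esub> g (Suc c))"
  proof (rule M.add.finprod_mono_neutral_cong_left)
    show "r c \<odot>\<^bsub>M\<^esub> g (Suc c) = \<zero>\<^bsub>M\<^esub>" if "c \<in> {..<l} - {..<k}" for c
      using that r k g_carrier[of "Suc c"] by (simp add: free_carrier_iff)
  qed (use k g_carrier free_carrier_in[OF r] in auto)
  then show "cover l r = cover k r" by (simp add: basis_map_def)
qed

lemma init_generated:
  assumes k: "Suc k \<le> t" and y: "y \<in> init (Suc k)"
  shows "\<exists>p\<in>init k. \<exists>r\<in>carrier R. y = p \<oplus>\<^bsub>M\<^esub> r \<odot>\<^bsub>M\<^esub> g (Suc k)"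
proof -
  obtain r where r: "r \<in> carrier (free_module R (Suc k))" "y = cover (Suc k) r" using y cover_image[OF k] by blast
  let ?r = "left_part R k r"
  have k': "k \<le> t" using k by simp
  have r': "?r \<in> carrier (free_module R k)" using hom_closed[OF left_part_hom[of k 1]] r(1) by simp
  have rc: "r c \<in> carrier R" for c by (rule free_carrier_in[OF r(1)])
  have "cover (Suc k) r = r k \<odot>\<^bsub>M\<^esub> g (Suc k) \<oplus>\<^bsub>M\<^esub> (\<Oplus>\<^bsub>M\<^esub>c\<in>{..<k}. r c \<odot>\<^bsub>M\<^esub> g (Suc c))"
    unfolding basis_map_def lessThan_Suc by (rule M.finsum_insert) (use k g_carrier rc in auto)
  also have "(\<Oplus>\<^bsub>M\<^esub>c\<in>{..<k}. r c \<odot>\<^bsub>M\<^esub> g (Suc c)) = cover k ?r"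
    unfolding basis_map_def by (rule M.finsum_cong') (use k g_carrier rc in \<open>auto simp: left_part_def\<close>)
  also have "r k \<odot>\<^bsub>M\<^esub> g (Suc k) \<oplus>\<^bsub>M\<^esub> cover k ?r = cover k ?r \<oplus>\<^bsub>M\<^esub> r k \<odot>\<^bsub>M\<^esub> g (Suc k)"
    by (rule M.a_comm) (use hom_closed[OF cover_hom[OF k'] r'] rc g_carrier[of "Suc k"] k in auto)
  finally have "y = cover k ?r \<oplus>\<^bsub>M\<^esub> r k \<odot>\<^bsub>M\<^esub> g (Suc k)" using r(2) by simp
  moreover have "cover k ?r \<in> init k" using cover_image[OF k'] r' by blast
  ultimately show ?thesis using rc by blast
qed

text \<open>Two expressions of the same element in terms of the generators agree modulo \<open>\<mm>\<close>, because the generators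
  are minimal.\<close>

lemma init_max_intersection:
  assumes k: "Suc k \<le> t"
  shows "ideal_smult R \<mm> (M\<lparr>carrier := init (Suc k)\<rparr>) \<inter> init k \<subseteq> ideal_smult R \<mm> (M\<lparr>carrier := init k\<rparr>)"
proof
  have k': "k \<le> t" using k by simp
  note fm = free_module_module
  have surj: "cover l \<in> module_hom R (free_module R l) (M\<lparr>carrier := init l\<rparr>)"
    "cover l ` carrier (free_module R l) = carrier (M\<lparr>carrier := init l\<rparr>)" if "l \<le> t" for l
    using hom_restrict[OF cover_hom[OF that], of "init l"] cover_image[OF that] by auto
  note im = hom_ideal_smult_surj[OF fm module_submodule[OF init_submodule] surj(1) max_carrier surj(2)]
  fix y assume y: "y \<in> ideal_smult R \<mm> (M\<lparr>carrier := init (Suc k)\<rparr>) \<inter> init k"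
  then obtain a where a: "a \<in> ideal_smult R \<mm> (free_module R (Suc k))" "y = cover (Suc k) a"
    using im[OF k k k] by blast
  obtain b where b: "b \<in> carrier (free_module R k)" "y = cover k b" using y cover_image[OF k'] by blast
  have a': "a \<in> carrier (free_module R (Suc k))" "\<And>c. a c \<in> \<mm>" using a(1) unfolding ideal_smult_free[OF max_ideal] by auto
  note at = cover_extend[OF k order_refl a'(1)] and bt = cover_extend[OF k' order_refl b(1)]
  interpret T: module R "free_module R t" by (rule fm)
  have "cover t (b \<ominus>\<^bsub>free_module R t\<^esub> a) = cover t b \<ominus>\<^bsub>M\<^esub> cover t a"
    by (rule hom_minus[OF fm M.module_axioms cover_hom[OF order_refl] bt(1) at(1)])
  also have "\<dots> = \<zero>\<^bsub>M\<^esub>"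
    unfolding at(2) bt(2) a(2)[symmetric] b(2)[symmetric]
    using b(2) hom_closed[OF cover_hom[OF k'] b(1)] by (simp add: a_minus_def M.r_neg)
  finally have z: "cover t (b \<ominus>\<^bsub>free_module R t\<^esub> a) = \<zero>\<^bsub>M\<^esub>" .
  have irr: "g (Suc c) \<notin> M.span ((\<lambda>c. g (Suc c)) ` ({..<t} - {c}))" if c: "c < t" for c
  proof -
    have "Suc ` ({..<t} - {c}) = {1..t} - {Suc c}"
    proof (intro equalityI subsetI)
      fix i assume "i \<in> {1..t} - {Suc c}"
      then have "i = Suc (i - 1)" "i - 1 \<in> {..<t} - {c}" by auto
      then show "i \<in> Suc ` ({..<t} - {c})" by blast
    qed auto
    then have "(\<lambda>c. g (Suc c)) ` ({..<t} - {c}) = g ` ({1..t} - {Suc c})" by (metis image_image)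
    then show ?thesis using irredundant[of "Suc c"] c by simp
  qed
  have "b \<ominus>\<^bsub>free_module R t\<^esub> a \<in> ideal_smult R \<mm> (free_module R t)"
    by (rule irredundant_kernel[OF M, of t "\<lambda>c. g (Suc c)" "\<lambda>c. d (Suc c)"])
      (use deg irr z at(1) bt(1) in auto)
  moreover have "a \<in> ideal_smult R \<mm> (free_module R t)"
    unfolding ideal_smult_free[OF max_ideal] using at(1) a'(2) by blast
  ultimately have "(b \<ominus>\<^bsub>free_module R t\<^esub> a) \<oplus>\<^bsub>free_module R t\<^esub> a \<in> ideal_smult R \<mm> (free_module R t)"
    by (rule submoduleD(2)[OF ideal_smult_submodule[OF fm max_carrier]])
  moreover have "(b \<ominus>\<^bsub>free_module R t\<^esub> a) \<oplus>\<^bsub>free_module R t\<^esub> a = b"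
    using at(1) bt(1) by (simp add: a_minus_def T.a_assoc T.l_neg)
  ultimately have "b \<in> ideal_smult R \<mm> (free_module R k)"
    using b(1) unfolding ideal_smult_free[OF max_ideal] by simp
  then show "y \<in> ideal_smult R \<mm> (M\<lparr>carrier := init k\<rparr>)"
    unfolding b(2) using im[OF k' k' k'] by blast
qed

lemma quotient_ideal_homogeneous:
  assumes "i \<in> {1..t}"
  shows "homogeneous_submodule R (self_module R) Rg (quotient_ideal R M g i)"
  unfolding quotient_ideal_def
  by (rule colon_ideal_homogeneous[OF R_grading M deg[OF assms] init_homogeneous]) (use assms in auto)

lemma quotient_ideal_proper:
  assumes i: "i \<in> {1..t}"
  shows "\<one> \<notin> quotient_ideal R M g i"
proof
  assume "\<one> \<in> quotient_ideal R M g i"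
  then have "g i \<in> init (i - 1)" using g_carrier[OF i] by (simp add: quotient_ideal_def colon_ideal_def)
  moreover have "init (i - 1) \<subseteq> M.span (g ` ({1..t} - {i}))"
    unfolding initial_submodule_def by (rule span_mono) (use i in auto)
  ultimately show False using irredundant[OF i] by blast
qed

lemma init_zero: "init 0 = {\<zero>\<^bsub>M\<^esub>}"
proof -
  have "init 0 = cover 0 ` carrier (free_module R 0)" by (rule cover_image[symmetric]) simp
  also have "carrier (free_module R 0) = {\<lambda>c. \<zero>}" by (auto simp: free_carrier_iff)
  finally show ?thesis by (simp add: basis_map_def)
qed

text \<open>Every step \<open>M\<^sub>k \<subseteq> M\<^sub>k\<^sub>+\<^sub>1\<close> adds the basis of the resolution of \<open>R/I\<^sub>k\<^sub>+\<^sub>1\<close>, with degrees shifted by that of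
  the new generator.\<close>

lemma initial_submodule_resolution:
  assumes G: "\<And>i. i \<in> {1..t} \<Longrightarrow> minimal_resolution R Rg \<mm> (nG i) (aG i) (G i) (eG i)
        (cyclic_module R (quotient_ideal R M g i)) (cyclic_grading R Rg (quotient_ideal R M g i))"
    and exG: "\<And>i. i \<in> {1..t} \<Longrightarrow> linear_part_exact R \<mm> (G i)"
  shows "k \<le> t \<Longrightarrow> \<exists>n a F \<epsilon>.
    minimal_resolution R Rg \<mm> n a F \<epsilon> (M\<lparr>carrier := init k\<rparr>) (\<lambda>j. Mg j \<inter> init k) \<and> linear_part_exact R \<mm> F \<and>
    (\<forall>s. n s = (\<Sum>i=1..k. nG i s)) \<and>
    (\<forall>s j. card {c. c < n s \<and> a s c = j} = (\<Sum>i=1..k. card {c. c < nG i s \<and> aG i s c = j - d i}))"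
proof (induction k)
  case 0
  have c: "carrier (M\<lparr>carrier := init 0\<rparr>) = {\<zero>\<^bsub>M\<lparr>carrier := init 0\<rparr>\<^esub>}" using init_zero by simp
  from zero_module_resolution[OF degree_module_submodule[OF M(1) init_submodule[OF 0]]
      grading_submodule[OF M.module_axioms M(2) init_homogeneous[OF 0]] c]
  obtain F \<epsilon> where "minimal_resolution R Rg \<mm> (\<lambda>i. 0) (\<lambda>i c. 0) F \<epsilon> (M\<lparr>carrier := init 0\<rparr>) (\<lambda>j. Mg j \<inter> init 0)"
    "linear_part_exact R \<mm> F" by blast
  then show ?case by (intro exI[of _ "\<lambda>i. 0"] exI[of _ "\<lambda>i c. 0"] exI[of _ F] exI[of _ \<epsilon>]) simp
next
  case (Suc k)
  have k: "Suc k \<in> {1..t}" "k \<le> t" using Suc.prems by auto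
  obtain n a F \<epsilon> where F: "minimal_resolution R Rg \<mm> n a F \<epsilon> (M\<lparr>carrier := init k\<rparr>) (\<lambda>j. Mg j \<inter> init k)"
    "linear_part_exact R \<mm> F" and n: "\<And>s. n s = (\<Sum>i=1..k. nG i s)"
    and a: "\<And>s j. card {c. c < n s \<and> a s c = j} = (\<Sum>i=1..k. card {c. c < nG i s \<and> aG i s c = j - d i})"
    using Suc.IH[OF k(2)] by blast
  have I: "quotient_ideal R M g (Suc k) = colon_ideal R M (init k) (g (Suc k))" by (simp add: quotient_ideal_def)
  have gi: "g (Suc k) \<in> init (Suc k)" unfolding initial_submodule_def by (rule gen_in_span) (use k in auto)
  let ?n = "\<lambda>i. n i + nG (Suc k) i" and ?a = "\<lambda>i. join (n i) (a i) (\<lambda>c. aG (Suc k) i c + d (Suc k))"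
  have "\<exists>E \<delta>. minimal_resolution R Rg \<mm> ?n ?a E \<delta> (M\<lparr>carrier := init (Suc k)\<rparr>) (\<lambda>j. Mg j \<inter> init (Suc k)) \<and>
      linear_part_exact R \<mm> E"
    by (rule resolve_extension[OF M init_homogeneous[OF Suc.prems] init_homogeneous[OF k(2)] init_mono[OF _ Suc.prems]
          deg[OF k(1)] gi init_generated[OF Suc.prems] init_max_intersection[OF Suc.prems] F
          G[OF k(1), unfolded I] exG[OF k(1)]]) simp_all
  then obtain E \<delta> where E: "minimal_resolution R Rg \<mm> ?n ?a E \<delta> (M\<lparr>carrier := init (Suc k)\<rparr>) (\<lambda>j. Mg j \<inter> init (Suc k))"
    "linear_part_exact R \<mm> E" by blast
  have "?n s = (\<Sum>i=1..Suc k. nG i s)" for s using n by simp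
  moreover have "card {c. c < ?n s \<and> ?a s c = j} = (\<Sum>i=1..Suc k. card {c. c < nG i s \<and> aG i s c = j - d i})" for s j
  proof -
    have "{c. c < nG (Suc k) s \<and> aG (Suc k) s c + d (Suc k) = j} = {c. c < nG (Suc k) s \<and> aG (Suc k) s c = j - d (Suc k)}"
      by auto
    then show ?thesis unfolding card_join a by simp
  qed
  ultimately show ?case using E by (intro exI[of _ ?n] exI[of _ ?a] exI[of _ E] exI[of _ \<delta>]) blast
qed

text \<open>Linearity defects of zero modules are \<open>0\<close> by convention. The quotients \<open>R/I\<^sub>i\<close> are nonzero, so that
  their being Koszul does make the linear parts of their resolutions acyclic.\<close>

lemma quotient_nontrivial: "i \<in> {1..t} \<Longrightarrow> nontrivial (cyclic_module R (quotient_ideal R M g i))"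
  by (rule cyclic_nontrivial[OF R_grading quotient_ideal_homogeneous quotient_ideal_proper])

end

section \<open>Modules with linear quotients\<close>

text \<open>That the \<open>R/I\<^sub>i\<close> are Koszul is expressed by their minimal resolutions; in this form, the hypotheses of
  the local and of the graded case coincide.\<close>

locale linear_quotient_module = generated_module +
  assumes nonzero: "carrier M \<noteq> {\<zero>\<^bsub>M\<^esub>}"
    and koszul: "\<And>i n a F \<epsilon>. i \<in> {1..t} \<Longrightarrow> minimal_resolution R Rg \<mm> n a F \<epsilon>
        (cyclic_module R (quotient_ideal R M g i)) (cyclic_grading R Rg (quotient_ideal R M g i)) \<Longrightarrow>
        linear_part_exact R \<mm> F"
begin

abbreviation "Q i \<equiv> cyclic_module R (quotient_ideal R M g i)"
abbreviation "Qg i \<equiv> cyclic_grading R Rg (quotient_ideal R M g i)"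

lemma gens_nonempty: "{1..t} \<noteq> {}"
  using nonzero init_all init_zero by (cases t) auto

lemma quotient_resolutions:
  "\<exists>nG aG G eG. \<forall>i. i \<in> {1..t} \<longrightarrow> minimal_resolution R Rg \<mm> (nG i) (aG i) (G i) (eG i) (Q i) (Qg i)"
proof -
  have "\<forall>i. \<exists>n a F \<epsilon>. i \<in> {1..t} \<longrightarrow> minimal_resolution R Rg \<mm> n a F \<epsilon> (Q i) (Qg i)"
  proof
    fix i show "\<exists>n a F \<epsilon>. i \<in> {1..t} \<longrightarrow> minimal_resolution R Rg \<mm> n a F \<epsilon> (Q i) (Qg i)"
    proof (cases "i \<in> {1..t}")
      case True
      obtain n a F \<epsilon> where "minimal_resolution R Rg \<mm> n a F \<epsilon> (Q i) (Qg i)"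
        by (rule cyclic_minimal_resolution[OF quotient_ideal_homogeneous[OF True]])
      then show ?thesis by blast
    qed blast
  qed
  then show ?thesis unfolding choice_iff .
qed

lemma init_resolution:
  assumes "k \<le> t"
  obtains n a F \<epsilon> where
    "minimal_resolution R Rg \<mm> n a F \<epsilon> (M\<lparr>carrier := init k\<rparr>) (\<lambda>j. Mg j \<inter> init k)" "linear_part_exact R \<mm> F"
proof -
  obtain nG aG G eG where "\<forall>i. i \<in> {1..t} \<longrightarrow> minimal_resolution R Rg \<mm> (nG i) (aG i) (G i) (eG i) (Q i) (Qg i)"
    using quotient_resolutions by (elim exE)
  note G = this[rule_format]
  from initial_submodule_resolution[OF G koszul[OF _ G] assms] show thesis using that by blast
qed

lemma module_resolution:
  assumes G: "\<And>i. i \<in> {1..t} \<Longrightarrow> minimal_resolution R Rg \<mm> (nG i) (aG i) (G i) (eG i) (Q i) (Qg i)"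
  obtains n a F \<epsilon> where "minimal_resolution R Rg \<mm> n a F \<epsilon> M Mg" "linear_part_exact R \<mm> F"
    "\<And>s. n s = (\<Sum>i=1..t. nG i s)"
    "\<And>s j. card {c. c < n s \<and> a s c = j} = (\<Sum>i=1..t. card {c. c < nG i s \<and> aG i s c = j - d i})"
proof -
  have "M\<lparr>carrier := init t\<rparr> = M" "(\<lambda>j. Mg j \<inter> init t) = Mg"
    using degree_moduleD(2)[OF M(1)] by (auto simp: init_all)
  with initial_submodule_resolution[OF G koszul[OF _ G] order_refl]
  obtain n a F \<epsilon> where "minimal_resolution R Rg \<mm> n a F \<epsilon> M Mg" "linear_part_exact R \<mm> F"
    "\<forall>s. n s = (\<Sum>i=1..t. nG i s)"
    "\<forall>s j. card {c. c < n s \<and> a s c = j} = (\<Sum>i=1..t. card {c. c < nG i s \<and> aG i s c = j - d i})"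
    by auto
  then show thesis by (intro that[of n a F \<epsilon>]) (assumption | erule spec | simp)+
qed

lemma betti_sum: "betti R \<mm> M s = (\<Sum>i=1..t. betti R \<mm> (Q i) s)"
proof -
  obtain nG aG G eG where "\<forall>i. i \<in> {1..t} \<longrightarrow> minimal_resolution R Rg \<mm> (nG i) (aG i) (G i) (eG i) (Q i) (Qg i)"
    using quotient_resolutions by (elim exE)
  note G = this[rule_format]
  obtain n a F \<epsilon> where F: "minimal_resolution R Rg \<mm> n a F \<epsilon> M Mg" and n: "\<And>s. n s = (\<Sum>i=1..t. nG i s)"
    by (rule module_resolution[OF G]) (assumption, rule that, assumption+)
  show ?thesis unfolding betti_eq_rank[OF is_cring maximal F] n
    by (rule sum.cong) (simp_all add: betti_eq_rank[OF is_cring maximal G])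
qed

lemma projective_dimension_max: "projective_dimension R M = Max ((\<lambda>i. projective_dimension R (Q i)) ` {1..t})"
proof -
  obtain nG aG G eG where "\<forall>i. i \<in> {1..t} \<longrightarrow> minimal_resolution R Rg \<mm> (nG i) (aG i) (G i) (eG i) (Q i) (Qg i)"
    using quotient_resolutions by (elim exE)
  note G = this[rule_format]
  obtain n a F \<epsilon> where F: "minimal_resolution R Rg \<mm> n a F \<epsilon> M Mg" and n: "\<And>s. n s = (\<Sum>i=1..t. nG i s)"
    by (rule module_resolution[OF G]) (assumption, rule that, assumption+)
  have "projective_dimension R M = last_nonzero (\<lambda>s. \<Sum>i=1..t. nG i s)"
    unfolding projective_dimension_eq[OF is_cring maximal F] n[abs_def] ..
  also have "\<dots> = Max ((\<lambda>i. last_nonzero (nG i)) ` {1..t})"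
    by (rule last_nonzero_sum[OF _ gens_nonempty]) simp
  also have "(\<lambda>i. last_nonzero (nG i)) ` {1..t} = (\<lambda>i. projective_dimension R (Q i)) ` {1..t}"
    by (rule image_cong) (simp_all add: projective_dimension_eq[OF is_cring maximal G])
  finally show ?thesis .
qed

lemma graded_betti_sum:
  assumes irr: "\<mm> = irrelevant_ideal R Rg"
  shows "graded_betti R Rg M Mg s j = (\<Sum>i=1..t. graded_betti R Rg (Q i) (Qg i) s (j - d i))"
proof -
  obtain nG aG G eG where "\<forall>i. i \<in> {1..t} \<longrightarrow> minimal_resolution R Rg \<mm> (nG i) (aG i) (G i) (eG i) (Q i) (Qg i)"
    using quotient_resolutions by (elim exE)
  note G = this[rule_format]
  obtain n a F \<epsilon> where F: "minimal_resolution R Rg \<mm> n a F \<epsilon> M Mg"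
    and a: "\<And>s j. card {c. c < n s \<and> a s c = j} = (\<Sum>i=1..t. card {c. c < nG i s \<and> aG i s c = j - d i})"
    by (rule module_resolution[OF G]) (assumption, rule that, assumption+)
  show ?thesis unfolding graded_tor_dim(1)[OF R_grading irr M(2) F] a
    by (rule sum.cong) (simp_all add: graded_tor_dim(1)[OF R_grading irr
          cyclic_grading_grading[OF R_grading quotient_ideal_homogeneous] G])
qed

lemma regularity_max:
  assumes irr: "\<mm> = irrelevant_ideal R Rg"
  shows "regularity R Rg M Mg = Max ((\<lambda>i. regularity R Rg (Q i) (Qg i) + ereal (real_of_int (d i))) ` {1..t})"
proof -
  obtain nG aG G eG where "\<forall>i. i \<in> {1..t} \<longrightarrow> minimal_resolution R Rg \<mm> (nG i) (aG i) (G i) (eG i) (Q i) (Qg i)"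
    using quotient_resolutions by (elim exE)
  note G = this[rule_format]
  obtain n a F \<epsilon> where F: "minimal_resolution R Rg \<mm> n a F \<epsilon> M Mg"
    and a: "\<And>s j. card {c. c < n s \<and> a s c = j} = (\<Sum>i=1..t. card {c. c < nG i s \<and> aG i s c = j - d i})"
    by (rule module_resolution[OF G]) (assumption, rule that, assumption+)
  have ex: "(\<exists>c<m. b c = (j :: int)) \<longleftrightarrow> card {c. c < m \<and> b c = j} \<noteq> 0" for m :: nat and b j
  proof -
    have "finite {c. c < m \<and> b c = j}" by simp
    then show ?thesis by (simp add: card_eq_0_iff)
  qed
  let ?S = "\<lambda>n a. {j - int s | s j. \<exists>c<n s. a s c = j}"
  have set: "{ereal (real_of_int (j - int s)) | s j. \<exists>c<n s. a s c = j} = (\<lambda>x. ereal (real_of_int x)) ` ?S n a"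
    for n and a :: "nat \<Rightarrow> nat \<Rightarrow> int" by blast
  have "x \<in> ?S n a \<longleftrightarrow> (\<exists>i\<in>{1..t}. x - d i \<in> ?S (nG i) (aG i))" for x
  proof -
    have "x \<in> ?S n a \<longleftrightarrow> (\<exists>s. \<exists>c<n s. a s c = x + int s)" by (auto simp: algebra_simps)
    also have "\<dots> \<longleftrightarrow> (\<exists>s. \<exists>i\<in>{1..t}. \<exists>c<nG i s. aG i s c = x + int s - d i)"
      unfolding ex a by simp
    also have "\<dots> \<longleftrightarrow> (\<exists>i\<in>{1..t}. x - d i \<in> ?S (nG i) (aG i))" by (force simp: algebra_simps)
    finally show ?thesis .
  qed
  from Sup_shifted_union[OF _ gens_nonempty this]
  have "Sup ((\<lambda>x. ereal (real_of_int x)) ` ?S n a) =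
      Max ((\<lambda>i. Sup ((\<lambda>x. ereal (real_of_int x)) ` ?S (nG i) (aG i)) + ereal (real_of_int (d i))) ` {1..t})" by simp
  moreover have "(\<lambda>i. Sup ((\<lambda>x. ereal (real_of_int x)) ` ?S (nG i) (aG i)) + ereal (real_of_int (d i))) ` {1..t} =
      (\<lambda>i. regularity R Rg (Q i) (Qg i) + ereal (real_of_int (d i))) ` {1..t}"
    by (rule image_cong) (simp_all only: set regularity_eq[OF R_grading irr
          cyclic_grading_grading[OF R_grading quotient_ideal_homogeneous] G])
  ultimately show ?thesis unfolding regularity_eq[OF R_grading irr M(2) F] set by simp
qed

end

theorem proposition5p11:
  fixes R :: "('a, 'm) ring_scheme"
    and M :: "('a, 'b, 'n) module_scheme"
    and \<mm> :: "'a set"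
    and Rg :: "int \<Rightarrow> 'a set"
    and Mg :: "int \<Rightarrow> 'b set"
    and g :: "nat \<Rightarrow> 'b"
    and t :: nat
    and d :: "nat \<Rightarrow> int"
  assumes "module R M" and "carrier M \<noteq> {\<zero>\<^bsub>M\<^esub>}"
  shows
    "(noetherian_local_ring R \<mm> \<and> linear_quotients R \<mm> M g t \<longrightarrow>
        (\<forall>i\<in>{1..t}. koszul_module R \<mm> (M\<lparr>carrier := initial_submodule R M g i\<rparr>)) \<and>
        koszul_module R \<mm> M \<and>
        (\<forall>s. betti R \<mm> M s =
           (\<Sum>i=1..t. betti R \<mm> (cyclic_module R (quotient_ideal R M g i)) s)) \<and>
        projective_dimension R M =
          Max ((\<lambda>i. projective_dimension R (cyclic_module R (quotient_ideal R M g i))) ` {1..t}))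
     \<and>
     (standard_graded_algebra R Rg \<and> graded_module R Rg M Mg \<and>
      graded_linear_quotients R Rg M g t \<and> (\<forall>i\<in>{1..t}. g i \<in> Mg (d i)) \<longrightarrow>
        (\<forall>i\<in>{1..t}. graded_koszul_module R Rg (M\<lparr>carrier := initial_submodule R M g i\<rparr>)
            (\<lambda>j. Mg j \<inter> initial_submodule R M g i)) \<and>
        graded_koszul_module R Rg M Mg \<and>
        (\<forall>s. betti R (irrelevant_ideal R Rg) M s =
           (\<Sum>i=1..t. betti R (irrelevant_ideal R Rg)
              (cyclic_module R (quotient_ideal R M g i)) s)) \<and>
        projective_dimension R M =
          Max ((\<lambda>i. projective_dimension R (cyclic_module R (quotient_ideal R M g i))) ` {1..t}) \<and>
        (\<forall>s. \<forall>j\<ge>0. graded_betti R Rg M Mg s j =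
           (\<Sum>i=1..t. graded_betti R Rg (cyclic_module R (quotient_ideal R M g i))
              (cyclic_grading R Rg (quotient_ideal R M g i)) s (j - d i))) \<and>
        regularity R Rg M Mg =
          Max ((\<lambda>i. regularity R Rg (cyclic_module R (quotient_ideal R M g i))
                 (cyclic_grading R Rg (quotient_ideal R M g i)) + ereal (real_of_int (d i)))
             ` {1..t}))"
proof -
  let ?I = "\<lambda>i. initial_submodule R M g i" and ?Q = "\<lambda>i. cyclic_module R (quotient_ideal R M g i)"
  interpret M: module R M by (rule assms(1))
  note R = M.is_cring
  show ?thesis
  proof (intro conjI[of "_ \<longrightarrow> _" "_ \<longrightarrow> _"] impI)
    assume hyp: "noetherian_local_ring R \<mm> \<and> linear_quotients R \<mm> M g t"
    \<comment> \<open>the local case is graded trivially, with all generators in degree \<open>0\<close>\<close>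
    let ?Rg = "trivial_grading R" and ?Mg = "trivial_grading M"
    interpret S: star_local R ?Rg \<mm> by (rule noetherian_local_star_local) (use hyp in blast)
    interpret S: generated_module R ?Rg \<mm> M ?Mg g t "\<lambda>i. 0"
    proof
      show "minimal_generators R M g t" using hyp by (simp add: linear_quotients_def)
      then show "g i \<in> ?Mg 0" if "i \<in> {1..t}" for i using that by (auto simp: minimal_generators_def)
    qed (rule degree_module_trivial[OF assms(1)] grading_trivial[OF M.abelian_group_axioms])+
    interpret L: linear_quotient_module R ?Rg \<mm> M ?Mg g t "\<lambda>i. 0"
    proof
      fix i n a F \<epsilon> assume i: "i \<in> {1..t}"
        and F: "minimal_resolution R ?Rg \<mm> n a F \<epsilon> (?Q i) (cyclic_grading R ?Rg (quotient_ideal R M g i))"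
      have "koszul_module R \<mm> (?Q i)" using hyp i by (simp add: linear_quotients_def)
      then show "linear_part_exact R \<mm> F"
        using koszul_module_iff[OF R S.max_ideal F] S.quotient_nontrivial[OF i] by simp
    qed (rule assms(2))
    have "koszul_module R \<mm> (M\<lparr>carrier := ?I i\<rparr>)" if i: "i \<in> {1..t}" for i
    proof -
      obtain n a F \<epsilon> where F: "minimal_resolution R ?Rg \<mm> n a F \<epsilon> (M\<lparr>carrier := ?I i\<rparr>) (\<lambda>j. ?Mg j \<inter> ?I i)"
        "linear_part_exact R \<mm> F"
        by (rule L.init_resolution[of i]) (use i in auto)
      then show ?thesis using koszul_module_iff[OF R S.max_ideal F(1)] by simp
    qed
    moreover have "koszul_module R \<mm> (M\<lparr>carrier := ?I t\<rparr>)"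
      by (rule calculation) (use L.gens_nonempty in simp)
    moreover have "M\<lparr>carrier := ?I t\<rparr> = M" using S.init_all by simp
    moreover note L.betti_sum L.projective_dimension_max
    ultimately show "(\<forall>i\<in>{1..t}. koszul_module R \<mm> (M\<lparr>carrier := ?I i\<rparr>)) \<and> koszul_module R \<mm> M \<and>
        (\<forall>s. betti R \<mm> M s = (\<Sum>i=1..t. betti R \<mm> (?Q i) s)) \<and>
        projective_dimension R M = Max ((\<lambda>i. projective_dimension R (?Q i)) ` {1..t})"
      by auto
  next
    let ?m = "irrelevant_ideal R Rg" and ?Qg = "\<lambda>i. cyclic_grading R Rg (quotient_ideal R M g i)"
    assume hyp: "standard_graded_algebra R Rg \<and> graded_module R Rg M Mg \<and>
      graded_linear_quotients R Rg M g t \<and> (\<forall>i\<in>{1..t}. g i \<in> Mg (d i))"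
    interpret S: star_local R Rg ?m by (rule standard_graded_algebra.standard_star_local) (use hyp in blast)
    have Mg: "grading M Mg" and smult: "\<And>i j r x. r \<in> Rg i \<Longrightarrow> x \<in> Mg j \<Longrightarrow> r \<odot>\<^bsub>M\<^esub> x \<in> Mg (i + j)"
      using hyp by (auto simp: graded_module_def)
    note Mab = M.abelian_group_axioms
    interpret S: generated_module R Rg ?m M Mg g t d
    proof
      show "degree_module R Rg M Mg"
        unfolding degree_module_def
        using assms(1) smult grading_carrier[OF Mab Mg] grading_zero[OF Mab Mg] grading_add[OF Mab Mg] by blast
      show "minimal_generators R M g t" "\<And>i. i \<in> {1..t} \<Longrightarrow> g i \<in> Mg (d i)"
        using hyp by (auto simp: graded_linear_quotients_def)
    qed (rule Mg)
    interpret L: linear_quotient_module R Rg ?m M Mg g t d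
    proof
      fix i n a F \<epsilon> assume i: "i \<in> {1..t}" and F: "minimal_resolution R Rg ?m n a F \<epsilon> (?Q i) (?Qg i)"
      have "graded_koszul_module R Rg (?Q i) (?Qg i)" using hyp i by (simp add: graded_linear_quotients_def)
      then show "linear_part_exact R ?m F"
        using graded_koszul_module_iff[OF R S.max_ideal F] S.quotient_nontrivial[OF i] by simp
    qed (rule assms(2))
    have "graded_koszul_module R Rg (M\<lparr>carrier := ?I i\<rparr>) (\<lambda>j. Mg j \<inter> ?I i)" if i: "i \<in> {1..t}" for i
    proof -
      obtain n a F \<epsilon> where F: "minimal_resolution R Rg ?m n a F \<epsilon> (M\<lparr>carrier := ?I i\<rparr>) (\<lambda>j. Mg j \<inter> ?I i)"
        "linear_part_exact R ?m F"
        by (rule L.init_resolution[of i]) (use i in auto)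
      then show ?thesis using graded_koszul_module_iff[OF R S.max_ideal F(1)] by simp
    qed
    moreover have "graded_koszul_module R Rg (M\<lparr>carrier := ?I t\<rparr>) (\<lambda>j. Mg j \<inter> ?I t)"
      by (rule calculation) (use L.gens_nonempty in simp)
    moreover have "M\<lparr>carrier := ?I t\<rparr> = M" "(\<lambda>j. Mg j \<inter> ?I t) = Mg"
      using S.init_all degree_moduleD(2)[OF S.M(1)] by auto
    moreover note L.betti_sum L.projective_dimension_max L.graded_betti_sum[OF refl] L.regularity_max[OF refl]
    ultimately show "(\<forall>i\<in>{1..t}. graded_koszul_module R Rg (M\<lparr>carrier := ?I i\<rparr>) (\<lambda>j. Mg j \<inter> ?I i)) \<and>
        graded_koszul_module R Rg M Mg \<and>
        (\<forall>s. betti R ?m M s = (\<Sum>i=1..t. betti R ?m (?Q i) s)) \<and>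
        projective_dimension R M = Max ((\<lambda>i. projective_dimension R (?Q i)) ` {1..t}) \<and>
        (\<forall>s. \<forall>j\<ge>0. graded_betti R Rg M Mg s j = (\<Sum>i=1..t. graded_betti R Rg (?Q i) (?Qg i) s (j - d i))) \<and>
        regularity R Rg M Mg = Max ((\<lambda>i. regularity R Rg (?Q i) (?Qg i) + ereal (real_of_int (d i))) ` {1..t})"
      by auto
  qed
qed

end
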